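(* Let $K$ be a field, and let $\mathcal{P}=(\mathcal{P}(n))_{n\geq 1}$ be the operad of indexed WN posets. For all $n\geq 1$, let $\mathcal{P}'(n)$ be the subspace of $\mathcal{P}(n)$ generated by $\mathcal{WNP}_h^{Ind}(n)$, the set of elements of $\mathcal{WNP}^{Ind}(n)$ whose underlying WN poset is $h$-connected. Then $\mathcal{P}'=(\mathcal{P}'(n))_{n\geq 1}$ is a suboperad of $\mathcal{P}$, isomorphic to the operad of $B_\infty$-algebras.
   Context: A double poset is a triple $(P,\leq_1,\leq_2)$ where $P$ is a finite set and $\leq_1,\leq_2$ are two partial orders on $P$; a plane poset is a double poset $(P,\leq_h,\leq_r)$ (with $\leq_h=\leq_1$, $\leq_r=\leq_2$) such that for all $x\neq y$ in $P$, $x$ and $y$ are comparable for $\leq_h$ if and only if they are not comparable for $\leq_r$. Let $N_1$ and $N_2$ be the following plane posets on $\{a,b,c,d\}$ (listing all strict relations): $N_1$: $a<_h c$, $a<_h d$, $b<_h d$; $a<_r b$, $c<_r b$, $c<_r d$. $N_2$: $a<_h c$, $b<_h c$, $b<_h d$; $a<_r b$, $a<_r d$, $c<_r d$. A double poset is WN if it is plane and has no subposet (subset with restricted orders) isomorphic to $N_1$ or $N_2$. It is $h$-connected if it is nonempty and the Hasse graph of $(P,\leq_h)$ is connected. For a set $\mathcal{D}$, $\mathcal{WNP}^{\mathcal{D}}$ is the set of (isomorphism classes of) pairs $(P,d)$ with $P$ a WN poset and $d:P\to\mathcal{D}$ a map; $\bullet_d$ is the one-element poset decorated by $d$. $\mathcal{WNP}^{Ind}(n)$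 is the set of (isomorphism classes of) pairs $(P,d)$ with $P$ a WN poset of cardinality $n$ and $d:P\to\{1,\ldots,n\}$ a bijection. For $P\in\mathcal{WNP}^{\mathbb{N}}$, $P[k]$ is obtained from $P$ by adding $k$ to all decorations. $\mathcal{H}_{\mathcal{WNP}}^{\mathcal{D}}$ is the $K$-vector space with basis $\mathcal{WNP}^{\mathcal{D}}$, with two bilinear associative products whose unit is the empty poset: $P\rightsquigarrow Q$ is the disjoint union of $P$ and $Q$ (keeping decorations), with $P,Q$ as double subposets and, for all $x\in P$, $y\in Q$, $x\leq_r y$ and $x,y$ not $\leq_h$-comparable; and $P\star Q=\sum_{R\in\mathcal{WNP}^{\mathcal{D}}}n(P,Q;R)R$, where $n(P,Q;R)$ is the number of ideals $I$ of $R$ (subsets such that $x\in I$, $y\in R$, $x\leq_h y$ imply $y\in I$) with $R\setminus I\cong P$ and $I\cong Q$ as decorated double posets. A $2$-$As$ algebra is a $K$-vector space with two associative products sharing the same unit; $(\mathcal{H}_{\mathcal{WNP}}^{\mathcal{D}},\star,\rightsquigarrow)$ is freely generated, as a $2$-$As$ algebra, by the $\bullet_d$, $d\in\mathcal{D}$. The operad $\mathcal{P}$: $\mathcal{P}(n)$ is the $K$-vector space with basis $\mathcal{WNP}^{Ind}(n)$; for $Q\in\mathcal{WNP}^{Ind}(k)$ and $P_i\in\mathcal{WNP}^{Ind}(n_i)$, $Q\circ(P_1,\ldots,P_k)=\Xi(Q)$ where $\Xi:(\mathcal{H}_{\mathcal{WNP}}^{\{1,\ldots,k\}},\star,\rightsquigarrow)\to(\mathcal{H}_{\mathcal{WNP}}^{\mathbb{N}},\star,\rightsquigarrow)$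 is the unique morphism of $2$-$As$ algebras sending $\bullet_i$ to $P_i[n_1+\cdots+n_{i-1}]$ for all $i$; the symmetric group $\mathfrak{S}_n$ acts on $\mathcal{P}(n)$ by permutation of the indices. A $B_\infty$-algebra is a vector space $V$ with linear maps $[-;-]_{m,n}:V^{\otimes m}\otimes V^{\otimes n}\to V$ for all $m,n\geq 1$ such that, if $T(V)$ carries the deconcatenation coproduct $\Delta$ and $\star_V:T(V)\otimes T(V)\to T(V)$ is the unique coalgebra morphism having the empty word $1$ as unit and satisfying $\pi_V((x_1\otimes\cdots\otimes x_m)\star_V(y_1\otimes\cdots\otimes y_n))=[x_1,\ldots,x_m;y_1,\ldots,y_n]_{m,n}$ for all $m,n\geq 1$ (with $\pi_V:T(V)\to V$ the canonical projection), then $(T(V),\star_V,\Delta)$ is a Hopf algebra (in particular $\star_V$ is associative). *)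

theory Defs
  imports Complex_Main "HOL-Library.Poly_Mapping" "HOL-Library.FuncSet"
    "HOL-Combinatorics.Permutations"
begin

section \<open>Free vector spaces\<close>

text \<open>The vector space with basis \<^typ>\<open>'b\<close> is the type of finitely supported functions
  from \<^typ>\<open>'b\<close> to the field; \<open>bas b\<close> below is the basis vector given by \<open>b\<close>.\<close>

definition scal :: "'k::field \<Rightarrow> ('b \<Rightarrow>\<^sub>0 'k) \<Rightarrow> ('b \<Rightarrow>\<^sub>0 'k)" where
  "scal c v = Poly_Mapping.map ((*) c) v"

abbreviation bas :: "'b \<Rightarrow> ('b \<Rightarrow>\<^sub>0 'k::field)" where
  "bas b \<equiv> Poly_Mapping.single b 1"

definition lin_ext :: "('a \<Rightarrow> ('b \<Rightarrow>\<^sub>0 'k)) \<Rightarrow> ('a \<Rightarrow>\<^sub>0 'k::field) \<Rightarrow> ('b \<Rightarrow>\<^sub>0 'k)" where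
  "lin_ext f v = (\<Sum>a\<in>Poly_Mapping.keys v. scal (Poly_Mapping.lookup v a) (f a))"

definition lin_map :: "('a \<Rightarrow> 'b) \<Rightarrow> ('a \<Rightarrow>\<^sub>0 'k::field) \<Rightarrow> ('b \<Rightarrow>\<^sub>0 'k)" where
  "lin_map f = lin_ext (\<lambda>a. bas (f a))"

lemma lookup_scal: "Poly_Mapping.lookup (scal c v) a = c * Poly_Mapping.lookup v a"
  unfolding scal_def by (simp add: Poly_Mapping.map.rep_eq when_def)

lemma vector_space_scal: "vector_space (scal :: 'k::field \<Rightarrow> ('b \<Rightarrow>\<^sub>0 'k) \<Rightarrow> _)"
  by unfold_locales
    (auto intro!: poly_mapping_eqI simp: lookup_scal lookup_add algebra_simps)

lemma module_scal: "module (scal :: 'k::field \<Rightarrow> ('b \<Rightarrow>\<^sub>0 'k) \<Rightarrow> _)"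
  using vector_space_scal by (simp add: module_iff_vector_space)

definition linear_on ::
  "('k \<Rightarrow> 'a::plus \<Rightarrow> 'a) \<Rightarrow> ('k \<Rightarrow> 'b::plus \<Rightarrow> 'b) \<Rightarrow> 'a set \<Rightarrow> ('a \<Rightarrow> 'b) \<Rightarrow> bool" where
  "linear_on s1 s2 S f \<longleftrightarrow>
     (\<forall>x\<in>S. \<forall>y\<in>S. f (x + y) = f x + f y) \<and> (\<forall>c. \<forall>x\<in>S. f (s1 c x) = s2 c (f x))"

text \<open>The tensor algebra of the space with basis \<^typ>\<open>'b\<close> has basis \<^typ>\<open>'b list\<close>;
  \<open>tensor_list [v1, v2, v3]\<close> is the elementary tensor of \<open>v1, v2, v3\<close>.\<close>

fun tensor_list :: "('b \<Rightarrow>\<^sub>0 'k::field) list \<Rightarrow> ('b list \<Rightarrow>\<^sub>0 'k)" where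
  "tensor_list [] = bas []"
| "tensor_list (v # vs) = lin_ext (\<lambda>b. lin_map ((#) b) (tensor_list vs)) v"


section \<open>Symmetric operads\<close>

text \<open>Only the components of arity \<open>n \<ge> 1\<close> are considered. The composition
  \<open>opcomp P k n q p\<close> is \<open>q \<circ> (p 1, \<dots>, p k)\<close> with \<open>q\<close> of arity \<open>k\<close> and \<open>p i\<close> of arity \<open>n i\<close>.
  The symmetric groups act on the left: \<open>opact P n \<sigma> x\<close> replaces each input index \<open>i\<close> of \<open>x\<close>
  by \<open>\<sigma> i\<close>.\<close>

record ('k, 'a) operad =
  ocar :: "nat \<Rightarrow> 'a set"
  oscal :: "'k \<Rightarrow> 'a \<Rightarrow> 'a"
  ounit :: 'a
  opcomp :: "nat \<Rightarrow> (nat \<Rightarrow> nat) \<Rightarrow> 'a \<Rightarrow> (nat \<Rightarrow> 'a) \<Rightarrow> 'a"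
  opact :: "nat \<Rightarrow> (nat \<Rightarrow> nat) \<Rightarrow> 'a \<Rightarrow> 'a"

text \<open>In \<open>q \<circ> (p 1, \<dots>, p k)\<close>, the \<open>j\<close>-th input of \<open>p i\<close> becomes the input \<open>offset n i + j\<close>.\<close>

definition offset :: "(nat \<Rightarrow> nat) \<Rightarrow> nat \<Rightarrow> nat" where
  "offset n i = (\<Sum>l\<in>{1..<i}. n l)"

definition composable :: "(nat \<Rightarrow> 'a set) \<Rightarrow> nat \<Rightarrow> (nat \<Rightarrow> nat) \<Rightarrow> 'a \<Rightarrow> (nat \<Rightarrow> 'a) \<Rightarrow> bool" where
  "composable C k n q p \<longleftrightarrow>
     k \<ge> 1 \<and> q \<in> C k \<and> (\<forall>i\<in>{1..k}. n i \<ge> 1 \<and> p i \<in> C (n i))"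

definition operad_spaces :: "('k::field, 'a::ab_group_add) operad \<Rightarrow> bool" where
  "operad_spaces P \<longleftrightarrow>
     vector_space (oscal P) \<and> (\<forall>n\<ge>1. module.subspace (oscal P) (ocar P n))"

definition operad_composition :: "('k::field, 'a::ab_group_add) operad \<Rightarrow> bool" where
  "operad_composition P \<longleftrightarrow>
     (\<forall>k n q p. composable (ocar P) k n q p \<longrightarrow>
        opcomp P k n q p \<in> ocar P (\<Sum>i=1..k. n i) \<and>
        linear_on (oscal P) (oscal P) (ocar P k) (\<lambda>x. opcomp P k n x p) \<and>
        (\<forall>i\<in>{1..k}. linear_on (oscal P) (oscal P) (ocar P (n i))
                        (\<lambda>x. opcomp P k n q (p(i := x)))) \<and>
        (\<forall>n' p'. (\<forall>i\<in>{1..k}. n' i = n i \<and> p' i = p i) \<longrightarrow>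
                     opcomp P k n' q p' = opcomp P k n q p))"

definition operad_assoc :: "('k::field, 'a::ab_group_add) operad \<Rightarrow> bool" where
  "operad_assoc P \<longleftrightarrow>
     (\<forall>k n q p m r.
        composable (ocar P) k n q p \<and>
        (\<forall>l\<in>{1..(\<Sum>i=1..k. n i)}. m l \<ge> 1 \<and> r l \<in> ocar P (m l)) \<longrightarrow>
        opcomp P (\<Sum>i=1..k. n i) m (opcomp P k n q p) r =
        opcomp P k (\<lambda>i. \<Sum>j=1..n i. m (offset n i + j)) q
          (\<lambda>i. opcomp P (n i) (\<lambda>j. m (offset n i + j)) (p i) (\<lambda>j. r (offset n i + j))))"

definition operad_unit :: "('k::field, 'a::ab_group_add) operad \<Rightarrow> bool" where
  "operad_unit P \<longleftrightarrow>
     ounit P \<in> ocar P 1 \<and>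
     (\<forall>n p. n 1 \<ge> 1 \<and> p 1 \<in> ocar P (n 1) \<longrightarrow> opcomp P 1 n (ounit P) p = p 1) \<and>
     (\<forall>k q. k \<ge> 1 \<and> q \<in> ocar P k \<longrightarrow> opcomp P k (\<lambda>_. 1) q (\<lambda>_. ounit P) = q)"

definition operad_action :: "('k::field, 'a::ab_group_add) operad \<Rightarrow> bool" where
  "operad_action P \<longleftrightarrow>
     (\<forall>n\<ge>1.
        (\<forall>x\<in>ocar P n. opact P n id x = x) \<and>
        (\<forall>\<sigma>. \<sigma> permutes {1..n} \<longrightarrow>
           opact P n \<sigma> ` ocar P n \<subseteq> ocar P n \<and>
           linear_on (oscal P) (oscal P) (ocar P n) (opact P n \<sigma>) \<and>
           (\<forall>\<tau>. \<tau> permutes {1..n} \<longrightarrow>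
              (\<forall>x\<in>ocar P n. opact P n (\<sigma> \<circ> \<tau>) x = opact P n \<sigma> (opact P n \<tau> x)))))"

text \<open>In the two equivariance axioms the permutation \<open>\<beta>\<close> is determined by the displayed values: it
  is the block permutation induced by \<open>\<sigma>\<close>, respectively the block sum of \<open>\<tau> 1, \<dots>, \<tau> k\<close>. For
  the first one, note that the input of \<open>q\<close> with index \<open>i\<close> has index \<open>\<sigma> i\<close> in
  \<open>opact P k \<sigma> q\<close>, so it receives \<open>p (\<sigma> i)\<close>.\<close>

definition operad_equivariant :: "('k::field, 'a::ab_group_add) operad \<Rightarrow> bool" where
  "operad_equivariant P \<longleftrightarrow>
     (\<forall>k n q p \<beta>.
        composable (ocar P) k n q p \<and> \<beta> permutes {1..(\<Sum>i=1..k. n i)} \<longrightarrow>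
        (\<forall>\<sigma>. \<sigma> permutes {1..k} \<and>
           (\<forall>i\<in>{1..k}. \<forall>j\<in>{1..n (\<sigma> i)}.
              \<beta> (offset (\<lambda>l. n (\<sigma> l)) i + j) = offset n (\<sigma> i) + j) \<longrightarrow>
           opcomp P k n (opact P k \<sigma> q) p =
           opact P (\<Sum>i=1..k. n i) \<beta> (opcomp P k (\<lambda>i. n (\<sigma> i)) q (\<lambda>i. p (\<sigma> i)))) \<and>
        (\<forall>\<tau>. (\<forall>i\<in>{1..k}. \<tau> i permutes {1..n i}) \<and>
           (\<forall>i\<in>{1..k}. \<forall>j\<in>{1..n i}. \<beta> (offset n i + j) = offset n i + \<tau> i j) \<longrightarrow>
           opcomp P k n q (\<lambda>i. opact P (n i) (\<tau> i) (p i)) =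
           opact P (\<Sum>i=1..k. n i) \<beta> (opcomp P k n q p)))"

definition is_operad :: "('k::field, 'a::ab_group_add) operad \<Rightarrow> bool" where
  "is_operad P \<longleftrightarrow>
     operad_spaces P \<and> operad_composition P \<and> operad_assoc P \<and> operad_unit P \<and>
     operad_action P \<and> operad_equivariant P"

definition is_suboperad :: "(nat \<Rightarrow> 'a set) \<Rightarrow> ('k::field, 'a::ab_group_add) operad \<Rightarrow> bool" where
  "is_suboperad S P \<longleftrightarrow>
     is_operad P \<and>
     (\<forall>n\<ge>1. module.subspace (oscal P) (S n) \<and> S n \<subseteq> ocar P n) \<and>
     ounit P \<in> S 1 \<and>
     (\<forall>k n q p. composable S k n q p \<longrightarrow> opcomp P k n q p \<in> S (\<Sum>i=1..k. n i)) \<and>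
     (\<forall>n\<ge>1. \<forall>\<sigma>. \<sigma> permutes {1..n} \<longrightarrow> opact P n \<sigma> ` S n \<subseteq> S n)"

definition restrict_operad :: "('k, 'a) operad \<Rightarrow> (nat \<Rightarrow> 'a set) \<Rightarrow> ('k, 'a) operad" where
  "restrict_operad P S = P\<lparr>ocar := S\<rparr>"

definition operad_isomorphism ::
  "(nat \<Rightarrow> 'a \<Rightarrow> 'b) \<Rightarrow> ('k::field, 'a::ab_group_add) operad \<Rightarrow> ('k, 'b::ab_group_add) operad \<Rightarrow> bool"
  where
  "operad_isomorphism \<phi> P Q \<longleftrightarrow>
     (\<forall>n\<ge>1. bij_betw (\<phi> n) (ocar P n) (ocar Q n) \<and>
             linear_on (oscal P) (oscal Q) (ocar P n) (\<phi> n) \<and>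
             (\<forall>\<sigma>. \<sigma> permutes {1..n} \<longrightarrow>
                (\<forall>x\<in>ocar P n. \<phi> n (opact P n \<sigma> x) = opact Q n \<sigma> (\<phi> n x)))) \<and>
     \<phi> 1 (ounit P) = ounit Q \<and>
     (\<forall>k n q p. composable (ocar P) k n q p \<longrightarrow>
        \<phi> (\<Sum>i=1..k. n i) (opcomp P k n q p) = opcomp Q k n (\<phi> k q) (\<lambda>i. \<phi> (n i) (p i)))"

definition operads_isomorphic ::
  "('k::field, 'a::ab_group_add) operad \<Rightarrow> ('k, 'b::ab_group_add) operad \<Rightarrow> bool" where
  "operads_isomorphic P Q \<longleftrightarrow> is_operad P \<and> is_operad Q \<and> (\<exists>\<phi>. operad_isomorphism \<phi> P Q)"


section \<open>Double posets, plane posets and WN posets\<close>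

record 'a dposet =
  verts :: "'a set"
  hle :: "'a rel"
  rle :: "'a rel"

record ('a, 'd) decposet = "'a dposet" +
  dec :: "'a \<Rightarrow> 'd"

definition double_poset :: "('a, 'm) dposet_scheme \<Rightarrow> bool" where
  "double_poset P \<longleftrightarrow>
     finite (verts P) \<and> partial_order_on (verts P) (hle P) \<and> partial_order_on (verts P) (rle P)"

definition plane_poset :: "('a, 'm) dposet_scheme \<Rightarrow> bool" where
  "plane_poset P \<longleftrightarrow> double_poset P \<and>
     (\<forall>x\<in>verts P. \<forall>y\<in>verts P. x \<noteq> y \<longrightarrow>
        ((x, y) \<in> hle P \<or> (y, x) \<in> hle P) = (\<not> ((x, y) \<in> rle P \<or> (y, x) \<in> rle P)))"

definition subposet :: "('a, 'm) dposet_scheme \<Rightarrow> 'a set \<Rightarrow> ('a, 'm) dposet_scheme" where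
  "subposet P S = P\<lparr>verts := S, hle := hle P \<inter> S \<times> S, rle := rle P \<inter> S \<times> S\<rparr>"

definition dposet_iso ::
  "('a \<Rightarrow> 'b) \<Rightarrow> ('a, 'm) dposet_scheme \<Rightarrow> ('b, 'n) dposet_scheme \<Rightarrow> bool" where
  "dposet_iso f P Q \<longleftrightarrow> bij_betw f (verts P) (verts Q) \<and>
     (\<forall>x\<in>verts P. \<forall>y\<in>verts P.
        ((x, y) \<in> hle P \<longleftrightarrow> (f x, f y) \<in> hle Q) \<and> ((x, y) \<in> rle P \<longleftrightarrow> (f x, f y) \<in> rle Q))"

definition has_subposet :: "('a, 'm) dposet_scheme \<Rightarrow> ('b, 'n) dposet_scheme \<Rightarrow> bool" where
  "has_subposet P N \<longleftrightarrow> (\<exists>S\<subseteq>verts P. \<exists>f. dposet_iso f (subposet P S) N)"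

text \<open>The elements \<open>a, b, c, d\<close> of the two forbidden posets are \<open>0, 1, 2, 3\<close>.\<close>

definition N1 :: "nat dposet" where
  "N1 = \<lparr>verts = {0, 1, 2, 3},
         hle = Id_on {0, 1, 2, 3} \<union> {(0, 2), (0, 3), (1, 3)},
         rle = Id_on {0, 1, 2, 3} \<union> {(0, 1), (2, 1), (2, 3)}\<rparr>"

definition N2 :: "nat dposet" where
  "N2 = \<lparr>verts = {0, 1, 2, 3},
         hle = Id_on {0, 1, 2, 3} \<union> {(0, 2), (1, 2), (1, 3)},
         rle = Id_on {0, 1, 2, 3} \<union> {(0, 1), (0, 3), (2, 3)}\<rparr>"

definition WN_poset :: "('a, 'm) dposet_scheme \<Rightarrow> bool" where
  "WN_poset P \<longleftrightarrow> plane_poset P \<and> \<not> has_subposet P N1 \<and> \<not> has_subposet P N2"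

definition hasse_edges :: "('a, 'm) dposet_scheme \<Rightarrow> 'a rel" where
  "hasse_edges P = {(x, y) \<in> hle P. x \<noteq> y \<and>
     \<not> (\<exists>z. z \<noteq> x \<and> z \<noteq> y \<and> (x, z) \<in> hle P \<and> (z, y) \<in> hle P)}"

definition h_connected :: "('a, 'm) dposet_scheme \<Rightarrow> bool" where
  "h_connected P \<longleftrightarrow> verts P \<noteq> {} \<and>
     (\<forall>x\<in>verts P. \<forall>y\<in>verts P. (x, y) \<in> (hasse_edges P \<union> (hasse_edges P)\<inverse>)\<^sup>*)"

definition h_ideal :: "('a, 'm) dposet_scheme \<Rightarrow> 'a set \<Rightarrow> bool" where
  "h_ideal P I \<longleftrightarrow> I \<subseteq> verts P \<and> (\<forall>x\<in>I. \<forall>y\<in>verts P. (x, y) \<in> hle P \<longrightarrow> y \<in> I)"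


section \<open>Isomorphism classes of decorated WN posets\<close>

definition decposet_isomorphic :: "('a, 'd) decposet \<Rightarrow> ('b, 'd) decposet \<Rightarrow> bool" where
  "decposet_isomorphic P Q \<longleftrightarrow>
     (\<exists>f. dposet_iso f P Q \<and> (\<forall>x\<in>verts P. dec Q (f x) = dec P x))"

lemma has_subposet_iff:
  "has_subposet P N \<longleftrightarrow>
     (\<exists>g. inj_on g (verts N) \<and> g ` verts N \<subseteq> verts P \<and>
        (\<forall>x\<in>verts N. \<forall>y\<in>verts N. ((g x, g y) \<in> hle P \<longleftrightarrow> (x, y) \<in> hle N) \<and>
           ((g x, g y) \<in> rle P \<longleftrightarrow> (x, y) \<in> rle N)))" (is "?L \<longleftrightarrow> ?R")
proof
  assume ?L
  then obtain S f where S: "S \<subseteq> verts P" and f: "dposet_iso f (subposet P S) N"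
    unfolding has_subposet_def by blast
  have b: "bij_betw f S (verts N)" and
    o: "\<And>x y. x \<in> S \<Longrightarrow> y \<in> S \<Longrightarrow> ((x, y) \<in> hle P \<longleftrightarrow> (f x, f y) \<in> hle N) \<and>
          ((x, y) \<in> rle P \<longleftrightarrow> (f x, f y) \<in> rle N)"
    using f by (auto simp: dposet_iso_def subposet_def)
  let ?g = "inv_into S f"
  have gS: "?g x \<in> S" "f (?g x) = x" if "x \<in> verts N" for x
    using that b by (auto simp: bij_betw_def inv_into_into f_inv_into_f)
  have "inj_on ?g (verts N)" by (metis gS(2) inj_onI)
  moreover have "?g ` verts N \<subseteq> verts P" using gS S by auto
  ultimately show ?R using gS o by (intro exI[of _ ?g]) (simp add: gS)
next
  assume ?R
  then obtain g where g: "inj_on g (verts N)" "g ` verts N \<subseteq> verts P"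
    and o: "\<And>x y. x \<in> verts N \<Longrightarrow> y \<in> verts N \<Longrightarrow> ((g x, g y) \<in> hle P \<longleftrightarrow> (x, y) \<in> hle N) \<and>
           ((g x, g y) \<in> rle P \<longleftrightarrow> (x, y) \<in> rle N)" by blast
  let ?f = "inv_into (verts N) g"
  have "dposet_iso ?f (subposet P (g ` verts N)) N"
    unfolding dposet_iso_def subposet_def
    using g(1) o by (auto simp: inj_on_imp_bij_betw bij_betw_inv_into)
  then show ?L unfolding has_subposet_def using g(2) by blast
qed

lemma has_subposet_subposet:
  assumes "has_subposet (subposet P S) N" "S \<subseteq> verts P"
  shows "has_subposet P N"
proof -
  from assms(1) obtain g where g: "inj_on g (verts N)" "g ` verts N \<subseteq> S"
    and o: "\<forall>x\<in>verts N. \<forall>y\<in>verts N.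
           ((g x, g y) \<in> hle (subposet P S) \<longleftrightarrow> (x, y) \<in> hle N) \<and>
           ((g x, g y) \<in> rle (subposet P S) \<longleftrightarrow> (x, y) \<in> rle N)"
    unfolding has_subposet_iff by (auto simp: subposet_def)
  have "g x \<in> S" if "x \<in> verts N" for x using g(2) that by blast
  with o have "\<forall>x\<in>verts N. \<forall>y\<in>verts N. ((g x, g y) \<in> hle P \<longleftrightarrow> (x, y) \<in> hle N) \<and>
           ((g x, g y) \<in> rle P \<longleftrightarrow> (x, y) \<in> rle N)"
    by (simp add: subposet_def)
  with g assms(2) show ?thesis unfolding has_subposet_iff by blast
qed

lemma partial_order_on_restrict:
  assumes "partial_order_on A r" "S \<subseteq> A"
  shows "partial_order_on S (r \<inter> S \<times> S)"
  using assms unfolding partial_order_on_def preorder_on_def refl_on_def trans_def antisym_def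
  by blast

lemma WN_poset_subposet:
  assumes "WN_poset P" "S \<subseteq> verts P"
  shows "WN_poset (subposet P S)"
proof -
  have "plane_poset (subposet P S)"
    using assms partial_order_on_restrict[of "verts P" _ S] finite_subset[of S "verts P"]
    unfolding WN_poset_def plane_poset_def double_poset_def subposet_def
    by (auto dest: subsetD)
  then show ?thesis using assms has_subposet_subposet unfolding WN_poset_def by blast
qed

lemma decposet_isomorphic_refl: "decposet_isomorphic P P"
  unfolding decposet_isomorphic_def dposet_iso_def
  by (rule exI[of _ id]) simp

lemma decposet_isomorphic_sym:
  assumes "decposet_isomorphic P Q" shows "decposet_isomorphic Q P"
proof -
  from assms obtain f where b: "bij_betw f (verts P) (verts Q)"
    and o: "\<forall>x\<in>verts P. \<forall>y\<in>verts P. ((x, y) \<in> hle P \<longleftrightarrow> (f x, f y) \<in> hle Q) \<and>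
          ((x, y) \<in> rle P \<longleftrightarrow> (f x, f y) \<in> rle Q)"
    and d: "\<forall>x\<in>verts P. dec Q (f x) = dec P x"
    unfolding decposet_isomorphic_def dposet_iso_def by blast
  let ?g = "inv_into (verts P) f"
  have g: "?g y \<in> verts P" "f (?g y) = y" if "y \<in> verts Q" for y
    using that b by (auto simp: bij_betw_def inv_into_into f_inv_into_f)
  have "bij_betw ?g (verts Q) (verts P)" using b by (rule bij_betw_inv_into)
  moreover have "((x, y) \<in> hle Q \<longleftrightarrow> (?g x, ?g y) \<in> hle P) \<and>
          ((x, y) \<in> rle Q \<longleftrightarrow> (?g x, ?g y) \<in> rle P)" if "x \<in> verts Q" "y \<in> verts Q" for x y
    using o g that by metis
  moreover have "dec P (?g y) = dec Q y" if "y \<in> verts Q" for y using d g that by metis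
  ultimately show ?thesis unfolding decposet_isomorphic_def dposet_iso_def by blast
qed

lemma decposet_isomorphic_trans:
  assumes "decposet_isomorphic P Q" "decposet_isomorphic Q R"
  shows "decposet_isomorphic P R"
proof -
  from assms(1) obtain f where f: "dposet_iso f P Q" "\<forall>x\<in>verts P. dec Q (f x) = dec P x"
    unfolding decposet_isomorphic_def by blast
  from assms(2) obtain g where g: "dposet_iso g Q R" "\<forall>x\<in>verts Q. dec R (g x) = dec Q x"
    unfolding decposet_isomorphic_def by blast
  have m: "f x \<in> verts Q" if "x \<in> verts P" for x
    using f(1) that by (auto simp: dposet_iso_def bij_betw_def)
  have "dposet_iso (g \<circ> f) P R"
    using f(1) g(1) m unfolding dposet_iso_def by (auto intro: bij_betw_trans)
  moreover have "\<forall>x\<in>verts P. dec R ((g \<circ> f) x) = dec P x" using f(2) g(2) m by simp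
  ultimately show ?thesis unfolding decposet_isomorphic_def by blast
qed

definition empty_decposet :: "(nat, 'd) decposet" where
  "empty_decposet = \<lparr>verts = {}, hle = {}, rle = {}, dec = (\<lambda>_. undefined)\<rparr>"

definition point_decposet :: "'d \<Rightarrow> (nat, 'd) decposet" where
  "point_decposet d = \<lparr>verts = {0}, hle = {(0, 0)}, rle = {(0, 0)}, dec = (\<lambda>_. d)\<rparr>"

definition map_dec_decposet :: "('d \<Rightarrow> 'e) \<Rightarrow> ('a, 'd) decposet \<Rightarrow> ('a, 'e) decposet" where
  "map_dec_decposet f P = \<lparr>verts = verts P, hle = hle P, rle = rle P, dec = f \<circ> dec P\<rparr>"

text \<open>In the disjoint union, \<open>x\<close> in \<open>P\<close> is renamed to \<open>2 x\<close> and \<open>y\<close> in \<open>Q\<close> to \<open>2 y + 1\<close>.\<close>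

definition sum_decposet :: "(nat, 'd) decposet \<Rightarrow> (nat, 'd) decposet \<Rightarrow> (nat, 'd) decposet" where
  "sum_decposet P Q =
     (let l = (\<lambda>x. 2 * x); r = (\<lambda>y. 2 * y + 1)
      in \<lparr>verts = l ` verts P \<union> r ` verts Q,
          hle = map_prod l l ` hle P \<union> map_prod r r ` hle Q,
          rle = map_prod l l ` rle P \<union> map_prod r r ` rle Q \<union> (l ` verts P) \<times> (r ` verts Q),
          dec = (\<lambda>z. if even z then dec P (z div 2) else dec Q (z div 2))\<rparr>)"

lemma WN_poset_small:
  assumes "plane_poset P" "card (verts P) < 4"
  shows "WN_poset P"
proof -
  have "\<not> has_subposet P N" if "card (verts N) = 4" for N :: "nat dposet"
  proof
    assume "has_subposet P N"
    then obtain g where "inj_on g (verts N)" "g ` verts N \<subseteq> verts P"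
      unfolding has_subposet_iff by blast
    then have "card (verts N) \<le> card (verts P)"
      using assms(1) card_inj_on_le by (auto simp: plane_poset_def double_poset_def)
    with that assms(2) show False by simp
  qed
  then show ?thesis using assms(1) by (simp add: WN_poset_def N1_def N2_def)
qed

lemma WN_empty_decposet: "WN_poset empty_decposet"
  by (rule WN_poset_small) (auto simp: empty_decposet_def plane_poset_def double_poset_def)

lemma WN_point_decposet: "WN_poset (point_decposet d)"
  by (rule WN_poset_small)
    (auto simp: point_decposet_def plane_poset_def double_poset_def partial_order_on_def
      preorder_on_def refl_on_def trans_def antisym_def)

lemma WN_map_dec_decposet:
  assumes "WN_poset P" shows "WN_poset (map_dec_decposet f P)"
  using assms unfolding WN_poset_def has_subposet_iff plane_poset_def double_poset_def
  by (simp add: map_dec_decposet_def)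

lemma sum_decposet_simps:
  fixes P Q :: "(nat, 'd) decposet" defines "R \<equiv> sum_decposet P Q"
  shows "verts R = (\<lambda>x. 2 * x) ` verts P \<union> (\<lambda>y. 2 * y + 1) ` verts Q"
    and "z \<in> verts R \<longleftrightarrow> (if even z then z div 2 \<in> verts P else z div 2 \<in> verts Q)"
    and "(x, y) \<in> hle R \<longleftrightarrow> (if even x then even y \<and> (x div 2, y div 2) \<in> hle P
           else odd y \<and> (x div 2, y div 2) \<in> hle Q)"
    and "(x, y) \<in> rle R \<longleftrightarrow> (if even x
           then if even y then (x div 2, y div 2) \<in> rle P
                else x div 2 \<in> verts P \<and> y div 2 \<in> verts Q
           else odd y \<and> (x div 2, y div 2) \<in> rle Q)"
    and "dec R z = (if even z then dec P (z div 2) else dec Q (z div 2))"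
proof -
  have ev: "x \<in> (\<lambda>x. 2 * x) ` A \<longleftrightarrow> even x \<and> x div 2 \<in> A" for x :: nat and A
    by (auto elim: evenE)
  have od: "x \<in> (\<lambda>x. 2 * x + 1) ` A \<longleftrightarrow> odd x \<and> x div 2 \<in> A" for x :: nat and A
    by (auto elim: oddE)
  have ev2: "(x, y) \<in> map_prod (\<lambda>x. 2 * x) (\<lambda>x. 2 * x) ` B \<longleftrightarrow>
      even x \<and> even y \<and> (x div 2, y div 2) \<in> B" for x y :: nat and B
    by (auto elim!: evenE intro: rev_image_eqI)
  have od2: "(x, y) \<in> map_prod (\<lambda>x. 2 * x + 1) (\<lambda>x. 2 * x + 1) ` B \<longleftrightarrow>
      odd x \<and> odd y \<and> (x div 2, y div 2) \<in> B" for x y :: nat and B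
    by (auto elim!: oddE intro: rev_image_eqI)
  show "verts R = (\<lambda>x. 2 * x) ` verts P \<union> (\<lambda>y. 2 * y + 1) ` verts Q"
    by (simp add: R_def sum_decposet_def Let_def)
  show "z \<in> verts R \<longleftrightarrow> (if even z then z div 2 \<in> verts P else z div 2 \<in> verts Q)"
    unfolding R_def sum_decposet_def Let_def dposet.simps Un_iff ev od by auto
  show "(x, y) \<in> hle R \<longleftrightarrow> (if even x then even y \<and> (x div 2, y div 2) \<in> hle P
           else odd y \<and> (x div 2, y div 2) \<in> hle Q)"
    unfolding R_def sum_decposet_def Let_def dposet.simps Un_iff ev2 od2 by auto
  show "(x, y) \<in> rle R \<longleftrightarrow> (if even x
           then if even y then (x div 2, y div 2) \<in> rle P
                else x div 2 \<in> verts P \<and> y div 2 \<in> verts Q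
           else odd y \<and> (x div 2, y div 2) \<in> rle Q)"
    unfolding R_def sum_decposet_def Let_def dposet.simps Un_iff ev2 od2 mem_Sigma_iff ev od
    by auto
  show "dec R z = (if even z then dec P (z div 2) else dec Q (z div 2))"
    by (simp add: R_def sum_decposet_def Let_def)
qed

lemma div2_eq: "x div 2 = y div 2 \<Longrightarrow> even x = even y \<Longrightarrow> x = (y::nat)"
  by (metis div_mult_mod_eq parity_cases)

lemma has_subposet_sum:
  fixes P Q :: "(nat, 'd) decposet"
  assumes N: "has_subposet (sum_decposet P Q) N"
    and conn: "\<And>e :: 'b \<Rightarrow> bool. (\<And>x y. x \<in> verts N \<Longrightarrow> y \<in> verts N \<Longrightarrow> (x, y) \<in> hle N \<Longrightarrow> e x = e y) \<Longrightarrow>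
          (\<forall>x\<in>verts N. e x) \<or> (\<forall>x\<in>verts N. \<not> e x)"
  shows "has_subposet P N \<or> has_subposet Q (N :: ('b, 'n) dposet_scheme)"
proof -
  let ?R = "sum_decposet P Q"
  from N obtain g where g: "inj_on g (verts N)" "g ` verts N \<subseteq> verts ?R"
    and o: "\<And>x y. x \<in> verts N \<Longrightarrow> y \<in> verts N \<Longrightarrow> ((g x, g y) \<in> hle ?R \<longleftrightarrow> (x, y) \<in> hle N) \<and>
           ((g x, g y) \<in> rle ?R \<longleftrightarrow> (x, y) \<in> rle N)"
    unfolding has_subposet_iff by blast
  have gR: "g x \<in> verts ?R" if "x \<in> verts N" for x using g(2) that by blast
  have "(\<forall>x\<in>verts N. even (g x)) \<or> (\<forall>x\<in>verts N. \<not> even (g x))"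
  proof (rule conn)
    fix x y assume "x \<in> verts N" "y \<in> verts N" "(x, y) \<in> hle N"
    then have "(g x, g y) \<in> hle ?R" using o by blast
    then show "even (g x) = even (g y)" by (auto simp: sum_decposet_simps split: if_splits)
  qed
  then show ?thesis
  proof
    assume e: "\<forall>x\<in>verts N. even (g x)"
    have "inj_on (\<lambda>x. g x div 2) (verts N)"
      by (rule inj_onI) (metis e div2_eq g(1) inj_onD)
    moreover have "(\<lambda>x. g x div 2) ` verts N \<subseteq> verts P"
      using gR e by (auto simp: sum_decposet_simps(2))
    ultimately have "has_subposet P N"
      unfolding has_subposet_iff using o e
      by (intro exI[of _ "\<lambda>x. g x div 2"]) (simp add: sum_decposet_simps(2-))
    then show ?thesis ..
  next
    assume e: "\<forall>x\<in>verts N. \<not> even (g x)"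
    have "inj_on (\<lambda>x. g x div 2) (verts N)"
      by (rule inj_onI) (metis e div2_eq g(1) inj_onD)
    moreover have "(\<lambda>x. g x div 2) ` verts N \<subseteq> verts Q"
      using gR e by (auto simp: sum_decposet_simps(2))
    ultimately have "has_subposet Q N"
      unfolding has_subposet_iff using o e
      by (intro exI[of _ "\<lambda>x. g x div 2"]) (simp add: sum_decposet_simps(2-))
    then show ?thesis ..
  qed
qed

lemma plane_sum_decposet:
  assumes "plane_poset P" "plane_poset Q"
  shows "plane_poset (sum_decposet P Q)"
proof -
  let ?R = "sum_decposet P Q"
  have P: "hle P \<subseteq> verts P \<times> verts P" "rle P \<subseteq> verts P \<times> verts P" "trans (hle P)" "trans (rle P)"
      "antisym (hle P)" "antisym (rle P)" "refl_on (verts P) (hle P)" "refl_on (verts P) (rle P)"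
    and Q: "hle Q \<subseteq> verts Q \<times> verts Q" "rle Q \<subseteq> verts Q \<times> verts Q" "trans (hle Q)" "trans (rle Q)"
      "antisym (hle Q)" "antisym (rle Q)" "refl_on (verts Q) (hle Q)" "refl_on (verts Q) (rle Q)"
    using assms by (auto simp: plane_poset_def double_poset_def partial_order_on_def preorder_on_def)
  have fin: "finite (verts ?R)"
    using assms by (simp add: sum_decposet_simps(1) plane_poset_def double_poset_def)
  have "hle ?R \<subseteq> verts ?R \<times> verts ?R"
    using P(1) Q(1) by (auto simp: sum_decposet_simps(2-) split: if_splits)
  moreover have "rle ?R \<subseteq> verts ?R \<times> verts ?R"
    using P(2) Q(2) by (auto simp: sum_decposet_simps(2-) split: if_splits)
  moreover have "refl_on (verts ?R) (hle ?R)" "refl_on (verts ?R) (rle ?R)"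
    using P(7,8) Q(7,8) by (auto simp: refl_on_def sum_decposet_simps(2-) split: if_splits)
  moreover have "trans (hle ?R)"
    by (rule transI) (use P(3) Q(3) in \<open>auto simp: sum_decposet_simps(2-) split: if_splits dest: transD\<close>)
  moreover have "trans (rle ?R)"
    by (rule transI)
      (use P(2,4) Q(2,4) in \<open>auto simp: sum_decposet_simps(2-) split: if_splits dest: transD\<close>)
  moreover have "antisym (hle ?R)"
    by (rule antisymI)
      (use P(5) Q(5) in \<open>auto simp: sum_decposet_simps(2-) split: if_splits dest: antisymD intro: div2_eq\<close>)
  moreover have "antisym (rle ?R)"
    by (rule antisymI)
      (use P(6) Q(6) in \<open>auto simp: sum_decposet_simps(2-) split: if_splits dest: antisymD intro: div2_eq\<close>)
  moreover have "((x, y) \<in> hle ?R \<or> (y, x) \<in> hle ?R) = (\<not> ((x, y) \<in> rle ?R \<or> (y, x) \<in> rle ?R))"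
    if "x \<in> verts ?R" "y \<in> verts ?R" "x \<noteq> y" for x y
  proof -
    have cP: "((a, b) \<in> hle P \<or> (b, a) \<in> hle P) = (\<not> ((a, b) \<in> rle P \<or> (b, a) \<in> rle P))"
      if "a \<in> verts P" "b \<in> verts P" "a \<noteq> b" for a b
      using assms(1) that by (simp add: plane_poset_def)
    have cQ: "((a, b) \<in> hle Q \<or> (b, a) \<in> hle Q) = (\<not> ((a, b) \<in> rle Q \<or> (b, a) \<in> rle Q))"
      if "a \<in> verts Q" "b \<in> verts Q" "a \<noteq> b" for a b
      using assms(2) that by (simp add: plane_poset_def)
    have ne: "x div 2 \<noteq> y div 2" if "even x = even y" using \<open>x \<noteq> y\<close> div2_eq that by blast
    show ?thesis
      using that(1,2) ne cP[of "x div 2" "y div 2"] cQ[of "x div 2" "y div 2"]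
      by (cases "even x"; cases "even y") (simp_all add: sum_decposet_simps(2-))
  qed
  ultimately show ?thesis
    using fin by (simp add: plane_poset_def double_poset_def partial_order_on_def preorder_on_def)
qed

lemma WN_sum_decposet:
  assumes "WN_poset P" "WN_poset Q"
  shows "WN_poset (sum_decposet P Q)"
proof -
  have "\<not> has_subposet (sum_decposet P Q) N1"
  proof
    assume "has_subposet (sum_decposet P Q) N1"
    then have "has_subposet P N1 \<or> has_subposet Q N1"
    proof (rule has_subposet_sum)
      fix e :: "nat \<Rightarrow> bool"
      assume "\<And>x y. x \<in> verts N1 \<Longrightarrow> y \<in> verts N1 \<Longrightarrow> (x, y) \<in> hle N1 \<Longrightarrow> e x = e y"
      from this[of 0 2] this[of 0 3] this[of 1 3]
      show "(\<forall>x\<in>verts N1. e x) \<or> (\<forall>x\<in>verts N1. \<not> e x)" by (auto simp: N1_def)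
    qed
    then show False using assms by (auto simp: WN_poset_def)
  qed
  moreover have "\<not> has_subposet (sum_decposet P Q) N2"
  proof
    assume "has_subposet (sum_decposet P Q) N2"
    then have "has_subposet P N2 \<or> has_subposet Q N2"
    proof (rule has_subposet_sum)
      fix e :: "nat \<Rightarrow> bool"
      assume "\<And>x y. x \<in> verts N2 \<Longrightarrow> y \<in> verts N2 \<Longrightarrow> (x, y) \<in> hle N2 \<Longrightarrow> e x = e y"
      from this[of 0 2] this[of 1 2] this[of 1 3]
      show "(\<forall>x\<in>verts N2. e x) \<or> (\<forall>x\<in>verts N2. \<not> e x)" by (auto simp: N2_def)
    qed
    then show False using assms by (auto simp: WN_poset_def)
  qed
  ultimately show ?thesis using plane_sum_decposet assms by (auto simp: WN_poset_def)
qed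

lemma sum_decposet_cong:
  assumes "decposet_isomorphic P P'" "decposet_isomorphic Q Q'"
  shows "decposet_isomorphic (sum_decposet P Q) (sum_decposet P' Q')"
proof -
  let ?R = "sum_decposet P Q" and ?R' = "sum_decposet P' Q'"
  from assms(1) obtain f where bf: "bij_betw f (verts P) (verts P')"
    and f: "\<And>x y. x \<in> verts P \<Longrightarrow> y \<in> verts P \<Longrightarrow> ((x, y) \<in> hle P \<longleftrightarrow> (f x, f y) \<in> hle P') \<and>
          ((x, y) \<in> rle P \<longleftrightarrow> (f x, f y) \<in> rle P')"
    and df: "\<And>x. x \<in> verts P \<Longrightarrow> dec P' (f x) = dec P x"
    unfolding decposet_isomorphic_def dposet_iso_def by blast
  from assms(2) obtain g where bg: "bij_betw g (verts Q) (verts Q')"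
    and g: "\<And>x y. x \<in> verts Q \<Longrightarrow> y \<in> verts Q \<Longrightarrow> ((x, y) \<in> hle Q \<longleftrightarrow> (g x, g y) \<in> hle Q') \<and>
          ((x, y) \<in> rle Q \<longleftrightarrow> (g x, g y) \<in> rle Q')"
    and dg: "\<And>x. x \<in> verts Q \<Longrightarrow> dec Q' (g x) = dec Q x"
    unfolding decposet_isomorphic_def dposet_iso_def by blast
  define h where "h z = (if even z then 2 * f (z div 2) else 2 * g (z div 2) + 1)" for z
  have h: "even (h z) = even z" "even z \<Longrightarrow> h z div 2 = f (z div 2)"
    "odd z \<Longrightarrow> h z div 2 = g (z div 2)" for z by (auto simp: h_def)
  have mf: "f x \<in> verts P'" if "x \<in> verts P" for x using bf that by (auto simp: bij_betw_def)
  have mg: "g x \<in> verts Q'" if "x \<in> verts Q" for x using bg that by (auto simp: bij_betw_def)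
  have "bij_betw h (verts ?R) (verts ?R')"
  proof (rule bij_betw_imageI)
    show "inj_on h (verts ?R)"
    proof (rule inj_onI)
      fix x y assume xy: "x \<in> verts ?R" "y \<in> verts ?R" "h x = h y"
      then have e: "even x = even y" by (metis h(1))
      have "x div 2 = y div 2"
      proof (cases "even x")
        case True
        then show ?thesis using xy e h(2) bf
          by (metis (no_types, lifting) bij_betw_def inj_on_def sum_decposet_simps(2))
      next
        case False
        then show ?thesis using xy e h(3) bg
          by (metis (no_types, lifting) bij_betw_def inj_on_def sum_decposet_simps(2))
      qed
      then show "x = y" using e div2_eq by blast
    qed
    show "h ` verts ?R = verts ?R'"
    proof
      show "h ` verts ?R \<subseteq> verts ?R'"
        by (auto simp: sum_decposet_simps(2) h mf mg split: if_splits)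
      show "verts ?R' \<subseteq> h ` verts ?R"
      proof
        fix z assume z: "z \<in> verts ?R'"
        show "z \<in> h ` verts ?R"
        proof (cases "even z")
          case True
          then have "z div 2 \<in> f ` verts P"
            using z bf by (simp add: sum_decposet_simps(2) bij_betw_def)
          then obtain x where x: "x \<in> verts P" "f x = z div 2" by force
          then have "h (2 * x) = z" "2 * x \<in> verts ?R"
            using True by (auto simp: h_def sum_decposet_simps(2))
          then show ?thesis by blast
        next
          case False
          then have "z div 2 \<in> g ` verts Q"
            using z bg by (simp add: sum_decposet_simps(2) bij_betw_def)
          then obtain x where x: "x \<in> verts Q" "g x = z div 2" by force
          then have "h (2 * x + 1) = z" "2 * x + 1 \<in> verts ?R"
            using False by (auto simp: h_def sum_decposet_simps(2))
          then show ?thesis by blast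
        qed
      qed
    qed
  qed
  moreover have "((x, y) \<in> hle ?R \<longleftrightarrow> (h x, h y) \<in> hle ?R') \<and> ((x, y) \<in> rle ?R \<longleftrightarrow> (h x, h y) \<in> rle ?R')"
    if "x \<in> verts ?R" "y \<in> verts ?R" for x y
    using that f[of "x div 2" "y div 2"] g[of "x div 2" "y div 2"]
    by (cases "even x"; cases "even y") (auto simp: sum_decposet_simps(2-) h mf mg)
  moreover have "dec ?R' (h x) = dec ?R x" if "x \<in> verts ?R" for x
    using that df dg by (cases "even x") (auto simp: sum_decposet_simps(2-) h)
  ultimately show ?thesis unfolding decposet_isomorphic_def dposet_iso_def by blast
qed

text \<open>Every finite decorated poset is isomorphic to one whose elements are natural numbers, so the
  following type is the set of isomorphism classes of WN posets decorated by \<^typ>\<open>'d\<close>.\<close>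

definition wnp_rel :: "(nat, 'd) decposet \<Rightarrow> (nat, 'd) decposet \<Rightarrow> bool" where
  "wnp_rel P Q \<longleftrightarrow> WN_poset P \<and> WN_poset Q \<and> decposet_isomorphic P Q"

quotient_type 'd wnp = "(nat, 'd) decposet" / partial: wnp_rel
proof (rule part_equivpI)
  show "\<exists>x :: (nat, 'd) decposet. wnp_rel x x"
    using WN_empty_decposet decposet_isomorphic_refl unfolding wnp_rel_def by blast
  show "symp (wnp_rel :: (nat, 'd) decposet \<Rightarrow> _)"
    by (rule sympI) (auto simp: wnp_rel_def intro: decposet_isomorphic_sym)
  show "transp (wnp_rel :: (nat, 'd) decposet \<Rightarrow> _)"
    by (rule transpI) (auto simp: wnp_rel_def intro: decposet_isomorphic_trans)
qed

lift_definition wnp_empty :: "'d wnp" is empty_decposet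
  by (simp add: wnp_rel_def WN_empty_decposet decposet_isomorphic_refl)

lift_definition wnp_point :: "'d \<Rightarrow> 'd wnp" is point_decposet
  by (simp add: wnp_rel_def WN_point_decposet decposet_isomorphic_refl)

lift_definition wnp_map_dec :: "('d \<Rightarrow> 'e) \<Rightarrow> 'd wnp \<Rightarrow> 'e wnp" is map_dec_decposet
  unfolding wnp_rel_def
  by (auto simp: WN_map_dec_decposet decposet_isomorphic_def dposet_iso_def)
    (auto simp: map_dec_decposet_def)

lift_definition wnp_sum :: "'d wnp \<Rightarrow> 'd wnp \<Rightarrow> 'd wnp" is sum_decposet
  by (simp add: wnp_rel_def WN_sum_decposet sum_decposet_cong)

definition wnp_over :: "'d set \<Rightarrow> 'd wnp set" where
  "wnp_over D = {abs_wnp P | P. WN_poset P \<and> dec P ` verts P \<subseteq> D}"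

definition wnp_ind :: "nat \<Rightarrow> nat wnp set" where
  "wnp_ind n = {abs_wnp P | P. WN_poset P \<and> card (verts P) = n \<and> bij_betw (dec P) (verts P) {1..n}}"

definition wnp_h_ind :: "nat \<Rightarrow> nat wnp set" where
  "wnp_h_ind n = {abs_wnp P | P. WN_poset P \<and> card (verts P) = n \<and>
     bij_betw (dec P) (verts P) {1..n} \<and> h_connected P}"


section \<open>The 2-As algebra of decorated WN posets\<close>

text \<open>The count does not depend on the chosen representative of the class \<open>R\<close>.\<close>

definition ideal_count :: "'d wnp \<Rightarrow> 'd wnp \<Rightarrow> 'd wnp \<Rightarrow> nat" where
  "ideal_count P Q R =
     card {I. h_ideal (rep_wnp R) I \<and>
              abs_wnp (subposet (rep_wnp R) (verts (rep_wnp R) - I)) = P \<and>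
              abs_wnp (subposet (rep_wnp R) I) = Q}"

lemma WN_rep_wnp: "WN_poset (rep_wnp X)"
  using Quotient_rep_reflp[OF Quotient_wnp, of X] by (simp add: wnp_rel_def)

lemma abs_rep_wnp: "abs_wnp (rep_wnp X) = X"
  by (rule Quotient_abs_rep[OF Quotient_wnp])

lemma abs_wnp_eqI: "WN_poset P \<Longrightarrow> WN_poset Q \<Longrightarrow> decposet_isomorphic P Q \<Longrightarrow> abs_wnp P = abs_wnp Q"
  using Quotient_rel[OF Quotient_wnp, of P Q] by (simp add: wnp_rel_def decposet_isomorphic_refl)

lemma rep_abs_wnp: "WN_poset P \<Longrightarrow> decposet_isomorphic P (rep_wnp (abs_wnp P))"
  using Quotient_rel[OF Quotient_wnp, of P "rep_wnp (abs_wnp P)"] abs_rep_wnp WN_rep_wnp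
  by (metis decposet_isomorphic_refl wnp_rel_def)

lemma decposet_isomorphic_card:
  assumes "decposet_isomorphic P Q"
  shows "card (verts Q) = card (verts P)" "dec Q ` verts Q = dec P ` verts P"
proof -
  from assms obtain f where f: "bij_betw f (verts P) (verts Q)" "\<forall>x\<in>verts P. dec Q (f x) = dec P x"
    unfolding decposet_isomorphic_def dposet_iso_def by blast
  show "card (verts Q) = card (verts P)" using bij_betw_same_card[OF f(1)] by simp
  have "verts Q = f ` verts P" using f(1) by (simp add: bij_betw_def)
  then show "dec Q ` verts Q = dec P ` verts P" using f(2) by (auto simp: image_image)
qed

lemma finite_wnp_bounded:
  assumes "finite D"
  shows "finite {R :: 'd wnp. card (verts (rep_wnp R)) = N \<and> dec (rep_wnp R) ` verts (rep_wnp R) \<subseteq> D}"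
proof -
  let ?B = "{..<N} \<times> {..<N}"
  let ?mk = "\<lambda>(h, r, d). abs_wnp \<lparr>verts = {..<N}, hle = h, rle = r, dec = d\<rparr>"
  have fin: "finite (Pow ?B \<times> Pow ?B \<times> ({..<N} \<rightarrow>\<^sub>E D))"
    using assms by (simp add: finite_PiE)
  have "{R :: 'd wnp. card (verts (rep_wnp R)) = N \<and> dec (rep_wnp R) ` verts (rep_wnp R) \<subseteq> D}
      \<subseteq> ?mk ` (Pow ?B \<times> Pow ?B \<times> ({..<N} \<rightarrow>\<^sub>E D))"
  proof
    fix R :: "'d wnp"
    assume R: "R \<in> {R. card (verts (rep_wnp R)) = N \<and> dec (rep_wnp R) ` verts (rep_wnp R) \<subseteq> D}"
    let ?P = "rep_wnp R"
    have WP: "WN_poset ?P" by (rule WN_rep_wnp)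
    then have "finite (verts ?P)" by (simp add: WN_poset_def plane_poset_def double_poset_def)
    then obtain g where g: "bij_betw g {..<N} (verts ?P)"
      using R bij_betw_iff_card[of "{..<N}" "verts ?P"] by auto
    define h where "h = {(x, y) \<in> ?B. (g x, g y) \<in> hle ?P}"
    define r where "r = {(x, y) \<in> ?B. (g x, g y) \<in> rle ?P}"
    define d where "d = restrict (dec ?P \<circ> g) {..<N}"
    define Q where "Q = \<lparr>verts = {..<N}, hle = h, rle = r, dec = d\<rparr>"
    have gm: "g x \<in> verts ?P" if "x < N" for x using g that by (auto simp: bij_betw_def)
    have gi: "g x = g y \<longleftrightarrow> x = y" if "x < N" "y < N" for x y
      using g that by (auto simp: bij_betw_def inj_on_def)
    have iso: "decposet_isomorphic Q ?P"
      unfolding decposet_isomorphic_def dposet_iso_def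
      by (rule exI[of _ g]) (auto simp: Q_def h_def r_def d_def g)
    have po: "partial_order_on {..<N} {(x, y) \<in> ?B. (g x, g y) \<in> \<rho>}"
      if "partial_order_on (verts ?P) \<rho>" for \<rho>
    proof -
      have \<rho>: "refl_on (verts ?P) \<rho>" "trans \<rho>" "antisym \<rho>"
        using partial_order_onD[OF that] by auto
      have "refl_on {..<N} {(x, y) \<in> ?B. (g x, g y) \<in> \<rho>}"
        using gm refl_onD[OF \<rho>(1)] by (auto simp: refl_on_def)
      moreover have "trans {(x, y) \<in> ?B. (g x, g y) \<in> \<rho>}"
        by (rule transI) (auto intro: transD[OF \<rho>(2)])
      moreover have "antisym {(x, y) \<in> ?B. (g x, g y) \<in> \<rho>}"
      proof (rule antisymI)
        fix x y
        assume "(x, y) \<in> {(x, y) \<in> ?B. (g x, g y) \<in> \<rho>}" "(y, x) \<in> {(x, y) \<in> ?B. (g x, g y) \<in> \<rho>}"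
        then have "x < N" "y < N" "g x = g y" using antisymD[OF \<rho>(3)] by auto
        then show "x = y" using gi by blast
      qed
      ultimately show ?thesis unfolding partial_order_on_def preorder_on_def by blast
    qed
    have "partial_order_on {..<N} h" "partial_order_on {..<N} r"
      using WP po unfolding h_def r_def WN_poset_def plane_poset_def double_poset_def by blast+
    then have "double_poset Q" by (simp add: Q_def double_poset_def)
    moreover have "((x, y) \<in> h \<or> (y, x) \<in> h) = (\<not> ((x, y) \<in> r \<or> (y, x) \<in> r))"
      if "x < N" "y < N" "x \<noteq> y" for x y
    proof -
      have "((g x, g y) \<in> hle ?P \<or> (g y, g x) \<in> hle ?P) =
          (\<not> ((g x, g y) \<in> rle ?P \<or> (g y, g x) \<in> rle ?P))"
        using WP gm gi that by (simp add: WN_poset_def plane_poset_def)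
      then show ?thesis using that by (simp add: h_def r_def)
    qed
    ultimately have "plane_poset Q" by (simp add: plane_poset_def Q_def)
    moreover have "has_subposet ?P M" if "has_subposet Q M" for M :: "nat dposet"
    proof -
      from that obtain k where k: "inj_on k (verts M)" "k ` verts M \<subseteq> {..<N}"
        and o: "\<forall>x\<in>verts M. \<forall>y\<in>verts M. ((k x, k y) \<in> h \<longleftrightarrow> (x, y) \<in> hle M) \<and>
           ((k x, k y) \<in> r \<longleftrightarrow> (x, y) \<in> rle M)"
        unfolding has_subposet_iff Q_def by auto
      have km: "k x < N" if "x \<in> verts M" for x using k(2) that by blast
      have "inj_on (g \<circ> k) (verts M)"
        using k g by (metis bij_betw_def comp_inj_on inj_on_subset)
      moreover have "(g \<circ> k) ` verts M \<subseteq> verts ?P" using km gm by auto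
      ultimately show ?thesis
        unfolding has_subposet_iff using o km
        by (intro exI[of _ "g \<circ> k"]) (simp add: h_def r_def)
    qed
    ultimately have "WN_poset Q" using WP by (auto simp: WN_poset_def)
    then have "abs_wnp Q = R" using abs_wnp_eqI[OF _ WP iso] abs_rep_wnp by metis
    moreover have "d \<in> {..<N} \<rightarrow>\<^sub>E D"
      using R gm by (auto simp: d_def)
    moreover have "h \<subseteq> ?B" "r \<subseteq> ?B" by (auto simp: h_def r_def)
    ultimately show "R \<in> ?mk ` (Pow ?B \<times> Pow ?B \<times> ({..<N} \<rightarrow>\<^sub>E D))"
      by (intro image_eqI[of _ _ "(h, r, d)"]) (auto simp: Q_def)
  qed
  then show ?thesis using fin finite_surj by blast
qed

lemma finite_ideal_count: "finite {R. ideal_count P Q R \<noteq> 0}"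
proof -
  let ?D = "dec (rep_wnp P) ` verts (rep_wnp P) \<union> dec (rep_wnp Q) ` verts (rep_wnp Q)"
  let ?N = "card (verts (rep_wnp P)) + card (verts (rep_wnp Q))"
  have fv: "finite (verts (rep_wnp X))" for X :: "'a wnp"
    using WN_rep_wnp[of X] by (simp add: WN_poset_def plane_poset_def double_poset_def)
  have "{R. ideal_count P Q R \<noteq> 0} \<subseteq>
    {R. card (verts (rep_wnp R)) = ?N \<and> dec (rep_wnp R) ` verts (rep_wnp R) \<subseteq> ?D}"
  proof
    fix R assume "R \<in> {R. ideal_count P Q R \<noteq> 0}"
    then obtain I where I: "h_ideal (rep_wnp R) I"
        "abs_wnp (subposet (rep_wnp R) (verts (rep_wnp R) - I)) = P"
        "abs_wnp (subposet (rep_wnp R) I) = Q"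
      by (auto simp: ideal_count_def card_eq_0_iff)
    let ?V = "verts (rep_wnp R)"
    have IV: "I \<subseteq> ?V" using I(1) by (simp add: h_ideal_def)
    have s: "verts (subposet X S) = S" "dec (subposet X S) = dec X" for X :: "(nat, 'a) decposet" and S
      by (simp_all add: subposet_def)
    have "decposet_isomorphic (subposet (rep_wnp R) (?V - I)) (rep_wnp P)"
      using rep_abs_wnp[OF WN_poset_subposet[OF WN_rep_wnp]] I(2) by (metis Diff_subset)
    from decposet_isomorphic_card[OF this]
    have 1: "card (verts (rep_wnp P)) = card (?V - I)"
      "dec (rep_wnp P) ` verts (rep_wnp P) = dec (rep_wnp R) ` (?V - I)" by (simp_all add: s)
    have "decposet_isomorphic (subposet (rep_wnp R) I) (rep_wnp Q)"
      using rep_abs_wnp[OF WN_poset_subposet[OF WN_rep_wnp]] I(3) IV by metis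
    from decposet_isomorphic_card[OF this]
    have 2: "card (verts (rep_wnp Q)) = card I"
      "dec (rep_wnp Q) ` verts (rep_wnp Q) = dec (rep_wnp R) ` I" by (simp_all add: s)
    have "card ?V = card (?V - I) + card I"
      using IV fv[of R] by (metis card_Diff_subset card_mono finite_subset le_add_diff_inverse2)
    with 1 2 show "R \<in> {R. card (verts (rep_wnp R)) = ?N \<and> dec (rep_wnp R) ` verts (rep_wnp R) \<subseteq> ?D}"
      by auto
  qed
  then show ?thesis
    by (rule finite_subset) (rule finite_wnp_bounded, simp add: fv)
qed

lift_definition wnp_star :: "'d wnp \<Rightarrow> 'd wnp \<Rightarrow> ('d wnp \<Rightarrow>\<^sub>0 'k::field)"
  is "\<lambda>P Q R. of_nat (ideal_count P Q R)"
proof -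
  fix P Q :: "'d wnp"
  show "finite {R. (of_nat (ideal_count P Q R) :: 'k) \<noteq> 0}"
    by (rule finite_subset[OF _ finite_ideal_count[of P Q]]) (metis (mono_tags) mem_Collect_eq of_nat_0 subsetI)
qed

definition hstar :: "('d wnp \<Rightarrow>\<^sub>0 'k::field) \<Rightarrow> ('d wnp \<Rightarrow>\<^sub>0 'k) \<Rightarrow> ('d wnp \<Rightarrow>\<^sub>0 'k)" where
  "hstar x y = lin_ext (\<lambda>P. lin_ext (\<lambda>Q. wnp_star P Q) y) x"

definition hsum :: "('d wnp \<Rightarrow>\<^sub>0 'k::field) \<Rightarrow> ('d wnp \<Rightarrow>\<^sub>0 'k) \<Rightarrow> ('d wnp \<Rightarrow>\<^sub>0 'k)" where
  "hsum x y = lin_ext (\<lambda>P. lin_ext (\<lambda>Q. bas (wnp_sum P Q)) y) x"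

definition WNP_space :: "'d set \<Rightarrow> ('d wnp \<Rightarrow>\<^sub>0 'k::field) set" where
  "WNP_space D = module.span scal (bas ` wnp_over D)"

definition two_as_morphism ::
  "'d set \<Rightarrow> 'e set \<Rightarrow> (('d wnp \<Rightarrow>\<^sub>0 'k::field) \<Rightarrow> ('e wnp \<Rightarrow>\<^sub>0 'k)) \<Rightarrow> bool" where
  "two_as_morphism D E \<Xi> \<longleftrightarrow>
     \<Xi> ` WNP_space D \<subseteq> WNP_space E \<and>
     linear_on scal scal (WNP_space D) \<Xi> \<and>
     \<Xi> (bas wnp_empty) = bas wnp_empty \<and>
     (\<forall>x\<in>WNP_space D. \<forall>y\<in>WNP_space D.
        \<Xi> (hstar x y) = hstar (\<Xi> x) (\<Xi> y) \<and> \<Xi> (hsum x y) = hsum (\<Xi> x) (\<Xi> y))"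


section \<open>The operad of indexed WN posets and the h-connected part\<close>

text \<open>The list \<open>Ps\<close> is \<open>[P 1, \<dots>, P k]\<close>, where \<open>P i\<close> has cardinality \<open>n i\<close>. The morphism is made
  extensional outside its domain, which makes it unique as a function of the ambient type.\<close>

definition wnp_comp_morphism ::
  "nat \<Rightarrow> (nat \<Rightarrow> nat) \<Rightarrow> nat wnp list \<Rightarrow> (nat wnp \<Rightarrow>\<^sub>0 'k::field) \<Rightarrow> (nat wnp \<Rightarrow>\<^sub>0 'k)" where
  "wnp_comp_morphism k n Ps =
     (THE \<Xi>. \<Xi> \<in> extensional (WNP_space {1..k}) \<and> two_as_morphism {1..k} UNIV \<Xi> \<and>
        (\<forall>i\<in>{1..k}. \<Xi> (bas (wnp_point i)) = bas (wnp_map_dec (\<lambda>j. j + offset n i) (Ps ! (i - 1)))))"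

definition WNP_operad :: "('k::field, nat wnp \<Rightarrow>\<^sub>0 'k) operad" where
  "WNP_operad =
     \<lparr>ocar = (\<lambda>n. module.span scal (bas ` wnp_ind n)),
      oscal = scal,
      ounit = bas (wnp_point 1),
      opcomp = (\<lambda>k n q p. lin_ext (\<lambda>Q. lin_ext (\<lambda>Ps. wnp_comp_morphism k n Ps (bas Q))
                  (tensor_list (map p [1..<Suc k]))) q),
      opact = (\<lambda>n \<sigma>. lin_map (wnp_map_dec \<sigma>))\<rparr>"

definition WNP_h :: "nat \<Rightarrow> (nat wnp \<Rightarrow>\<^sub>0 'k::field) set" where
  "WNP_h n = module.span scal (bas ` wnp_h_ind n)"


section \<open>B-infinity algebras\<close>

text \<open>Let \<open>V\<close> be the space with basis \<^typ>\<open>'b\<close>. A family of brackets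
  \<open>[-;-]\<^bsub>m,n\<^esub>\<close> with \<open>m, n \<ge> 1\<close> is given by its values \<open>br u v\<close> on nonempty words of basis elements,
  and a bilinear product on \<open>T(V)\<close> by its values \<open>s u v\<close> on words.\<close>

definition tensor2 :: "('a \<Rightarrow>\<^sub>0 'k::field) \<Rightarrow> ('b \<Rightarrow>\<^sub>0 'k) \<Rightarrow> ('a \<times> 'b \<Rightarrow>\<^sub>0 'k)" where
  "tensor2 x y = lin_ext (\<lambda>a. lin_map (Pair a) y) x"

definition deconcatenation :: "('b list \<Rightarrow>\<^sub>0 'k::field) \<Rightarrow> ('b list \<times> 'b list \<Rightarrow>\<^sub>0 'k)" where
  "deconcatenation = lin_ext (\<lambda>w. \<Sum>i\<le>length w. bas (take i w, drop i w))"

definition word_counit :: "'b list \<Rightarrow> 'k::field" where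
  "word_counit w = (if w = [] then 1 else 0)"

definition tensor_counit :: "('b list \<Rightarrow>\<^sub>0 'k::field) \<Rightarrow> 'k" where
  "tensor_counit x = Poly_Mapping.lookup x []"

definition tensor_proj :: "('b list \<Rightarrow>\<^sub>0 'k::field) \<Rightarrow> ('b \<Rightarrow>\<^sub>0 'k)" where
  "tensor_proj = lin_ext (\<lambda>w. case w of [b] \<Rightarrow> bas b | _ \<Rightarrow> 0)"

text \<open>\<open>s\<close> is a morphism of coalgebras from \<open>T(V) \<otimes> T(V)\<close> to \<open>T(V)\<close>.\<close>

definition coalgebra_product :: "('b list \<Rightarrow> 'b list \<Rightarrow> ('b list \<Rightarrow>\<^sub>0 'k::field)) \<Rightarrow> bool" where
  "coalgebra_product s \<longleftrightarrow>
     (\<forall>u v. deconcatenation (s u v) =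
        (\<Sum>i\<le>length u. \<Sum>j\<le>length v.
           tensor2 (s (take i u) (take j v)) (s (drop i u) (drop j v)))) \<and>
     (\<forall>u v. tensor_counit (s u v) = word_counit u * word_counit v)"

definition binf_star ::
  "('b list \<Rightarrow> 'b list \<Rightarrow> ('b \<Rightarrow>\<^sub>0 'k::field)) \<Rightarrow> 'b list \<Rightarrow> 'b list \<Rightarrow> ('b list \<Rightarrow>\<^sub>0 'k)" where
  "binf_star br =
     (THE s. coalgebra_product s \<and> (\<forall>w. s [] w = bas w \<and> s w [] = bas w) \<and>
        (\<forall>u v. u \<noteq> [] \<and> v \<noteq> [] \<longrightarrow> tensor_proj (s u v) = br u v))"

text \<open>For a subspace \<open>J\<close> of \<open>V\<close>, the kernel of the canonical map from \<open>T(V)\<close> to \<open>T(V/J)\<close>.\<close>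

definition tensor_ideal :: "('b \<Rightarrow>\<^sub>0 'k::field) set \<Rightarrow> ('b list \<Rightarrow>\<^sub>0 'k) set" where
  "tensor_ideal J = module.span scal {lin_map (\<lambda>b. u @ [b] @ v) x | u v x. x \<in> J}"

text \<open>The brackets of \<open>V\<close> induce brackets on \<open>V/J\<close> that make \<open>V/J\<close> a B-infinity algebra, i.e., the
  bialgebra axioms and the existence of an antipode hold in \<open>T(V/J)\<close>, the quotient of \<open>T(V)\<close> by
  \<open>tensor_ideal J\<close>. The unit, the counit, and the compatibility of the
  product with the coproduct are part of the definition of \<^const>\<open>binf_star\<close>. For \<open>J = {0}\<close> this
  says that \<open>V\<close> itself is a B-infinity algebra.\<close>

definition binf_quotient ::
  "('b list \<Rightarrow> 'b list \<Rightarrow> ('b \<Rightarrow>\<^sub>0 'k::field)) \<Rightarrow> ('b \<Rightarrow>\<^sub>0 'k) set \<Rightarrow> bool" where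
  "binf_quotient br J \<longleftrightarrow>
     module.subspace scal J \<and>
     (\<forall>x\<in>J. \<forall>u v w. w \<noteq> [] \<longrightarrow>
        lin_ext (\<lambda>b. br (u @ [b] @ v) w) x \<in> J \<and> lin_ext (\<lambda>b. br w (u @ [b] @ v)) x \<in> J) \<and>
     (\<forall>u v w. lin_ext (\<lambda>z. binf_star br z w) (binf_star br u v)
              - lin_ext (\<lambda>z. binf_star br u z) (binf_star br v w) \<in> tensor_ideal J) \<and>
     (\<exists>A :: 'b list \<Rightarrow> ('b list \<Rightarrow>\<^sub>0 'k).
        lin_ext A ` tensor_ideal J \<subseteq> tensor_ideal J \<and>
        (\<forall>w. (\<Sum>i\<le>length w. lin_ext (\<lambda>z. binf_star br z (drop i w)) (A (take i w)))
               - scal (word_counit w) (bas []) \<in> tensor_ideal J \<and>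
             (\<Sum>i\<le>length w. lin_ext (\<lambda>z. binf_star br (take i w) z) (A (drop i w)))
               - scal (word_counit w) (bas []) \<in> tensor_ideal J))"


section \<open>The operad of B-infinity algebras\<close>

text \<open>Bracket monomials in generators \<^typ>\<open>'x\<close>: \<open>Br s ss t ts\<close> stands for
  \<open>[s, ss; t, ts]\<close>, the head and tail arguments making both groups nonempty.\<close>

datatype 'x bterm = Gen 'x | Br "'x bterm" "'x bterm list" "'x bterm" "'x bterm list"

definition term_bracket :: "'x bterm list \<Rightarrow> 'x bterm list \<Rightarrow> ('x bterm \<Rightarrow>\<^sub>0 'k::field)" where
  "term_bracket u v =
     (case (u, v) of (s # ss, t # ts) \<Rightarrow> bas (Br s ss t ts) | _ \<Rightarrow> 0)"

text \<open>The free B-infinity algebra is the largest quotient of the space of bracket monomials that is a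
  B-infinity algebra.\<close>

definition binf_relations :: "('x bterm \<Rightarrow>\<^sub>0 'k::field) set" where
  "binf_relations = \<Inter> {J. binf_quotient term_bracket J}"

lemma subspace_binf_relations:
  "module.subspace scal (binf_relations :: ('x bterm \<Rightarrow>\<^sub>0 'k::field) set)"
proof -
  interpret module "scal :: 'k \<Rightarrow> ('x bterm \<Rightarrow>\<^sub>0 'k) \<Rightarrow> _" by (rule module_scal)
  show ?thesis unfolding binf_relations_def
    by (rule subspace_Inter) (auto simp: binf_quotient_def)
qed

lemma binf_relations_closed:
  fixes x y :: "'x bterm \<Rightarrow>\<^sub>0 'k::field"
  shows "0 \<in> (binf_relations :: ('x bterm \<Rightarrow>\<^sub>0 'k) set)"
    and "x \<in> binf_relations \<Longrightarrow> y \<in> binf_relations \<Longrightarrow> x + y \<in> binf_relations"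
    and "x \<in> binf_relations \<Longrightarrow> scal c x \<in> binf_relations"
    and "x \<in> binf_relations \<Longrightarrow> - x \<in> binf_relations"
proof -
  interpret module "scal :: 'k \<Rightarrow> ('x bterm \<Rightarrow>\<^sub>0 'k) \<Rightarrow> _" by (rule module_scal)
  note s = subspace_binf_relations[where ?'x = 'x and ?'k = 'k]
  show "0 \<in> (binf_relations :: ('x bterm \<Rightarrow>\<^sub>0 'k) set)" by (rule subspace_0[OF s])
  show "x \<in> binf_relations \<Longrightarrow> y \<in> binf_relations \<Longrightarrow> x + y \<in> binf_relations"
    by (rule subspace_add[OF s])
  show "x \<in> binf_relations \<Longrightarrow> scal c x \<in> binf_relations" by (rule subspace_scale[OF s])
  show "x \<in> binf_relations \<Longrightarrow> - x \<in> binf_relations" by (rule subspace_neg[OF s])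
qed

definition binf_eq :: "('x bterm \<Rightarrow>\<^sub>0 'k::field) \<Rightarrow> ('x bterm \<Rightarrow>\<^sub>0 'k) \<Rightarrow> bool" where
  "binf_eq x y \<longleftrightarrow> x - y \<in> binf_relations"

lemma equivp_binf_eq: "equivp (binf_eq :: ('x bterm \<Rightarrow>\<^sub>0 'k::field) \<Rightarrow> _)"
proof (rule equivpI)
  show "reflp (binf_eq :: ('x bterm \<Rightarrow>\<^sub>0 'k::field) \<Rightarrow> _)"
    by (rule reflpI) (simp add: binf_eq_def binf_relations_closed)
  show "symp (binf_eq :: ('x bterm \<Rightarrow>\<^sub>0 'k::field) \<Rightarrow> _)"
    by (rule sympI) (metis binf_eq_def binf_relations_closed(4) minus_diff_eq)
  show "transp (binf_eq :: ('x bterm \<Rightarrow>\<^sub>0 'k::field) \<Rightarrow> _)"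
  proof (rule transpI)
    fix x y z :: "'x bterm \<Rightarrow>\<^sub>0 'k"
    assume "binf_eq x y" "binf_eq y z"
    then have "(x - y) + (y - z) \<in> binf_relations"
      unfolding binf_eq_def by (rule binf_relations_closed)
    then show "binf_eq x z" by (simp add: binf_eq_def)
  qed
qed

quotient_type (overloaded) ('x, 'k) free_binf = "'x bterm \<Rightarrow>\<^sub>0 'k::field" / binf_eq
  by (rule equivp_binf_eq)

instantiation free_binf :: (type, field) ab_group_add
begin

lift_definition zero_free_binf :: "('a, 'b) free_binf" is 0 .

lift_definition plus_free_binf :: "('a, 'b) free_binf \<Rightarrow> ('a, 'b) free_binf \<Rightarrow> ('a, 'b) free_binf"
  is "(+)"
proof -
  fix a b c d :: "'a bterm \<Rightarrow>\<^sub>0 'b"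
  assume "binf_eq a b" "binf_eq c d"
  then have "(a - b) + (c - d) \<in> binf_relations"
    unfolding binf_eq_def by (rule binf_relations_closed)
  then show "binf_eq (a + c) (b + d)" unfolding binf_eq_def by (simp add: algebra_simps)
qed

lift_definition uminus_free_binf :: "('a, 'b) free_binf \<Rightarrow> ('a, 'b) free_binf" is uminus
proof -
  fix a b :: "'a bterm \<Rightarrow>\<^sub>0 'b"
  assume "binf_eq a b"
  then have "- (a - b) \<in> binf_relations"
    unfolding binf_eq_def by (rule binf_relations_closed)
  then show "binf_eq (- a) (- b)" unfolding binf_eq_def by (simp add: algebra_simps)
qed

lift_definition minus_free_binf :: "('a, 'b) free_binf \<Rightarrow> ('a, 'b) free_binf \<Rightarrow> ('a, 'b) free_binf"
  is "(-)"
proof -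
  fix a b c d :: "'a bterm \<Rightarrow>\<^sub>0 'b"
  assume "binf_eq a b" "binf_eq c d"
  then have "(a - b) + - (c - d) \<in> binf_relations"
    unfolding binf_eq_def by (intro binf_relations_closed)
  then show "binf_eq (a - c) (b - d)" unfolding binf_eq_def by (simp add: algebra_simps)
qed

instance
  by standard (transfer; simp add: binf_eq_def binf_relations_closed(1) algebra_simps)+

end

lift_definition binf_scal :: "'k::field \<Rightarrow> ('x, 'k) free_binf \<Rightarrow> ('x, 'k) free_binf" is scal
proof -
  fix c :: 'k and x y :: "'x bterm \<Rightarrow>\<^sub>0 'k"
  interpret module "scal :: 'k \<Rightarrow> ('x bterm \<Rightarrow>\<^sub>0 'k) \<Rightarrow> _" by (rule module_scal)
  assume "binf_eq x y"
  then show "binf_eq (scal c x) (scal c y)"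
    unfolding binf_eq_def using binf_relations_closed(3) scale_right_diff_distrib by metis
qed

fun bterm_gens :: "'x bterm \<Rightarrow> 'x list" where
  "bterm_gens (Gen i) = [i]"
| "bterm_gens (Br s ss t ts) = concat (map bterm_gens (s # ss)) @ concat (map bterm_gens (t # ts))"

fun bterm_subst :: "('x \<Rightarrow> ('y bterm \<Rightarrow>\<^sub>0 'k::field)) \<Rightarrow> 'x bterm \<Rightarrow> ('y bterm \<Rightarrow>\<^sub>0 'k)" where
  "bterm_subst p (Gen i) = p i"
| "bterm_subst p (Br s ss t ts) =
     lin_ext (\<lambda>u. lin_ext (\<lambda>v. term_bracket u v) (tensor_list (map (bterm_subst p) (t # ts))))
       (tensor_list (map (bterm_subst p) (s # ss)))"

text \<open>The arity \<open>n\<close> component is the multilinear part in the generators \<open>1, \<dots>, n\<close> of the free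
  B-infinity algebra, and composition is substitution, with the inputs of \<open>p i\<close> shifted by
  \<open>offset n i\<close>. The relations are stable under substitution, hence the choice of
  the representatives does not matter.\<close>

definition B_infinity_operad :: "('k::field, (nat, 'k) free_binf) operad" where
  "B_infinity_operad =
     \<lparr>ocar = (\<lambda>n. module.span binf_scal
         {abs_free_binf (bas t) | t. distinct (bterm_gens t) \<and> set (bterm_gens t) = {1..n}}),
      oscal = binf_scal,
      ounit = abs_free_binf (bas (Gen 1)),
      opcomp = (\<lambda>k n q p. abs_free_binf (lin_ext
         (bterm_subst (\<lambda>i. lin_map (map_bterm (\<lambda>j. j + offset n i)) (rep_free_binf (p i))))
         (rep_free_binf q))),
      opact = (\<lambda>n \<sigma> x. abs_free_binf (lin_map (map_bterm \<sigma>) (rep_free_binf x)))\<rparr>"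

end

theory Submission
  imports Defs "HOL-Library.Multiset"
begin

text \<open>
  The horizontal concatenation of WN posets and the vertical one, in which the first poset is placed
  \<open>h\<close>-below the second, are exchanged by the exchange of the two orders. Two decompositions of a
  poset by the same concatenation are nested (\<open>wnp_sum_equidivisible\<close>), so the posets form a free monoid for each of them; the
  irreducible elements of the horizontal one are the connected posets (\<open>h_connected_iff\<close>). The
  exclusion of \<open>N\<^sub>1\<close> and \<open>N\<^sub>2\<close> means that the comparability graph of \<open>\<le>\<^sub>h\<close> has no induced path on
  four vertices, hence a WN poset with at least two elements decomposes for one of the two
  concatenations (\<open>irreducible_point\<close>).

  The product \<open>P \<star> Q\<close> is the vertical concatenation of \<open>P\<close> and \<open>Q\<close>, with coefficient \<open>1\<close>, plus posets
  with the same decorations and fewer \<open>h\<close>-relations. So \<open>\<star>\<close> is a triangular deformation of the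
  vertical concatenation, and the posets with horizontal concatenation and \<open>\<star>\<close> form the free
  \<open>2\<close>-\<open>As\<close> algebra on the points over any field: a morphism is defined by recursion along the
  triangularity (locale \<open>two_as_mod\<close>) and it is unique as the points generate
  (\<open>wnp_generated\<close>). The target is allowed to satisfy the axioms only modulo a subspace. The composition of
  the operad of WN posets is substitution, i.e., such a morphism, and the operad axioms follow from
  the uniqueness of morphisms.

  As a space, the posets are the tensor algebra of the span of the connected ones, and \<open>\<star>\<close> is
  compatible with deconcatenation, because an ideal of a horizontal concatenation is a pair of ideals.
  Hence the connected posets form a \<open>B\<^sub>\<infinity>\<close> algebra, whose brackets are the connected parts of
  products of words (\<open>hstar_hprod\<close>). Evaluating bracket monomials in it is surjective: values of
  words are stable under both products and contain the points. Its kernel is the space of relations of the free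
  \<open>B\<^sub>\<infinity>\<close> algebra (\<open>binf_relations_eq\<close>): it satisfies the axioms of such a space since the values do, and
  it is the least one by freeness, because brackets are polynomials in the two products, so that a morphism
  of \<open>2\<close>-\<open>As\<close> algebras from the posets to the tensor algebra modulo any space of relations inverts the evaluation.

  So evaluation identifies the multilinear part of the free \<open>B\<^sub>\<infinity>\<close> algebra with the span of
  the connected indexed posets. Both compositions are substitutions and correspond to each other;
  in particular, substituting connected posets into a connected poset gives a combination of connected
  posets.
\<close>

section \<open>Linear extensions\<close>

interpretation pm: vector_space "scal :: 'k::field \<Rightarrow> ('b \<Rightarrow>\<^sub>0 'k) \<Rightarrow> _"
  by (rule vector_space_scal)

abbreviation lin :: "(('a \<Rightarrow>\<^sub>0 'k::field) \<Rightarrow> ('b \<Rightarrow>\<^sub>0 'k)) \<Rightarrow> bool" where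
  "lin \<equiv> linear_on scal scal UNIV"

abbreviation lk :: "('b \<Rightarrow>\<^sub>0 'k::zero) \<Rightarrow> 'b \<Rightarrow> 'k" where
  "lk \<equiv> Poly_Mapping.lookup"

lemma linI:
  assumes "\<And>x y. f (x + y) = f x + f y" "\<And>c x. f (scal c x) = scal c (f x)"
  shows "lin f"
  using assms by (simp add: linear_on_def)

lemma lin_plus: "lin f \<Longrightarrow> f (x + y) = f x + f y"
  and lin_scale: "lin f \<Longrightarrow> f (scal c x) = scal c (f x)"
  by (simp_all add: linear_on_def)

lemma lin_hom: "lin f \<Longrightarrow> module_hom scal scal f"
  by unfold_locales (simp_all add: lin_plus lin_scale)

lemma lin_zero: "lin f \<Longrightarrow> f 0 = 0"
  and lin_minus: "lin f \<Longrightarrow> f (x - y) = f x - f y"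
  and lin_setsum: "lin f \<Longrightarrow> f (sum h A) = (\<Sum>a\<in>A. f (h a))"
  using module_hom.zero[OF lin_hom] module_hom.diff[OF lin_hom] module_hom.sum[OF lin_hom] by blast+

lemma lookup_bas: "lk (bas a) b = (if a = b then 1 else (0::'k::field))"
  by (simp add: lookup_single when_def)

lemma lookup_lin_ext:
  "lk (lin_ext f v) b = (\<Sum>a\<in>Poly_Mapping.keys v. lk v a * lk (f a) b)"
  by (simp add: lin_ext_def lookup_sum lookup_scal)

lemma lookup_lin_ext_superset:
  assumes "finite A" "Poly_Mapping.keys v \<subseteq> A"
  shows "lk (lin_ext f v) b = (\<Sum>a\<in>A. lk v a * lk (f a) b)"
  unfolding lookup_lin_ext using assms
  by (intro sum.mono_neutral_left) (auto simp: in_keys_iff)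

lemma lin_lin_ext:
  fixes f :: "'a \<Rightarrow> ('b \<Rightarrow>\<^sub>0 'k::field)"
  shows "lin (lin_ext f)"
proof (rule linI)
  fix x y :: "'a \<Rightarrow>\<^sub>0 'k"
  let ?A = "Poly_Mapping.keys x \<union> Poly_Mapping.keys y"
  show "lin_ext f (x + y) = lin_ext f x + lin_ext f y"
    by (rule poly_mapping_eqI)
      (simp add: lookup_add lookup_lin_ext_superset[of ?A] Poly_Mapping.keys_add
        distrib_right sum.distrib)
next
  fix c :: 'k and x :: "'a \<Rightarrow>\<^sub>0 'k"
  have "Poly_Mapping.keys (scal c x) \<subseteq> Poly_Mapping.keys x"
    by (auto simp: in_keys_iff lookup_scal)
  then show "lin_ext f (scal c x) = scal c (lin_ext f x)"
    by (intro poly_mapping_eqI)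
      (simp add: lookup_scal lookup_lin_ext_superset[of "Poly_Mapping.keys x"]
        sum_distrib_left mult.assoc)
qed

lemma lin_ext_bas [simp]: "lin_ext f (bas a :: 'a \<Rightarrow>\<^sub>0 'k::field) = f a"
  by (rule poly_mapping_eqI) (simp add: lookup_lin_ext)

lemma lin_map_bas [simp]: "lin_map f (bas a :: 'a \<Rightarrow>\<^sub>0 'k::field) = bas (f a)"
  by (simp add: lin_map_def)

lemma bas_expand: "x = (\<Sum>a\<in>Poly_Mapping.keys x. scal (lk x a) (bas a))"
  by (rule poly_mapping_eqI)
    (auto simp: lookup_sum lookup_scal lookup_bas if_distrib in_keys_iff cong: if_cong)

lemma lin_ext_basis: "lin_ext bas x = x"
  using bas_expand[of x] by (simp add: lin_ext_def)

text \<open>A linear map takes values in a subspace as soon as it does so on the basis vectors in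
  the support of the argument; linear extensions are compared by applying this to differences.\<close>

lemma lin_in_subspace:
  assumes "lin f" "pm.subspace S" "\<And>a. a \<in> Poly_Mapping.keys x \<Longrightarrow> f (bas a) \<in> S"
  shows "f x \<in> S"
proof -
  have "f x = (\<Sum>a\<in>Poly_Mapping.keys x. scal (lk x a) (f (bas a)))"
    by (subst bas_expand[of x]) (simp add: lin_setsum[OF assms(1)] lin_scale[OF assms(1)])
  also have "\<dots> \<in> S"
    using assms by (intro pm.subspace_sum pm.subspace_scale) auto
  finally show ?thesis .
qed

lemma lin_ext_in_subspace:
  assumes "pm.subspace S" "\<And>a. a \<in> Poly_Mapping.keys x \<Longrightarrow> f a \<in> S"
  shows "lin_ext f x \<in> S"
  by (rule lin_in_subspace[OF lin_lin_ext assms(1)]) (simp add: assms(2))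

lemma subspace_zero_only: "pm.subspace {0}"
  by (simp add: pm.subspace_def)

lemma lin_add_fun: "lin f \<Longrightarrow> lin g \<Longrightarrow> lin (\<lambda>x. f x + g x)"
  by (rule linI) (simp_all add: lin_plus lin_scale pm.scale_right_distrib)

lemma lin_diff_fun: "lin f \<Longrightarrow> lin g \<Longrightarrow> lin (\<lambda>x. f x - g x)"
  by (rule linI) (simp_all add: lin_plus lin_scale pm.scale_right_diff_distrib)

lemma lin_sum_fun: "(\<And>a. a \<in> A \<Longrightarrow> lin (f a)) \<Longrightarrow> lin (\<lambda>x. \<Sum>a\<in>A. f a x)"
  by (rule linI) (simp_all add: lin_plus lin_scale sum.distrib pm.scale_sum_right)

lemma lin_scal_fun: "lin f \<Longrightarrow> lin (\<lambda>x. scal c (f x))"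
  by (rule linI) (simp_all add: lin_plus lin_scale pm.scale_right_distrib mult.commute)

lemma lin_zero_fun: "lin (\<lambda>x. 0)"
  by (rule linI) simp_all

lemma lin_id: "lin (\<lambda>x. x)"
  by (rule linI) simp_all

lemma lin_compose: "lin f \<Longrightarrow> lin g \<Longrightarrow> lin (\<lambda>x. f (g x))"
  by (rule linI) (simp_all add: lin_plus lin_scale)

lemma lin_lin_map: "lin (lin_map f)"
  by (simp add: lin_map_def lin_lin_ext)

lemma lin_ext_fun: "(\<And>a. lin (\<lambda>x. f x a)) \<Longrightarrow> lin (\<lambda>x. lin_ext (f x) v)"
  unfolding lin_ext_def by (intro lin_sum_fun lin_scal_fun) auto

lemma lin_lin_ext_arg: "lin g \<Longrightarrow> lin (\<lambda>x. lin_ext f (g x))"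
  and lin_lin_map_arg: "lin g \<Longrightarrow> lin (\<lambda>x. lin_map h (g x))"
  by (auto intro: lin_compose lin_lin_ext lin_lin_map)

named_theorems lin_intros

lemmas [lin_intros] = lin_add_fun lin_diff_fun lin_sum_fun lin_scal_fun lin_zero_fun lin_id
  lin_ext_fun lin_lin_ext_arg lin_lin_map_arg lin_lin_ext lin_lin_map

lemma lin_eqI:
  assumes "lin f" "lin g" "\<And>a. a \<in> Poly_Mapping.keys x \<Longrightarrow> f (bas a) = g (bas a)"
  shows "f x = g x"
proof -
  have "f x - g x \<in> {0}"
    by (rule lin_in_subspace[where f = "\<lambda>x. f x - g x"])
      (auto intro: lin_intros assms subspace_zero_only simp: assms(3))
  then show ?thesis by simp
qed

lemma lin_ext_eqI: "lin f \<Longrightarrow> (\<And>a. f (bas a) = h a) \<Longrightarrow> f x = lin_ext h x"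
  by (rule lin_eqI) (auto intro: lin_intros)

lemma lin_ext_cong:
  "(\<And>a. a \<in> Poly_Mapping.keys x \<Longrightarrow> f a = g a) \<Longrightarrow> lin_ext f x = lin_ext g x"
  by (simp add: lin_ext_def)

lemma lin_ext_lin: "lin f \<Longrightarrow> f (lin_ext g x) = lin_ext (\<lambda>a. f (g a)) x"
  by (rule lin_ext_eqI) (auto intro: lin_compose lin_lin_ext)

lemma lin_ext_lin_map: "lin_ext f (lin_map g x) = lin_ext (\<lambda>a. f (g a)) x"
  by (rule lin_ext_eqI) (auto intro: lin_intros)

lemma lin_map_lin_map: "lin_map f (lin_map g x) = lin_map (\<lambda>a. f (g a)) x"
  by (rule lin_eqI[where f = "\<lambda>x. lin_map f (lin_map g x)"]) (auto intro: lin_intros)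

lemma lin_map_cong:
  "(\<And>a. a \<in> Poly_Mapping.keys x \<Longrightarrow> f a = g a) \<Longrightarrow> lin_map f x = lin_map g x"
  unfolding lin_map_def by (rule lin_ext_cong) simp

lemma keys_lin_map: "Poly_Mapping.keys (lin_map f x) \<subseteq> f ` Poly_Mapping.keys x"
proof
  fix b assume "b \<in> Poly_Mapping.keys (lin_map f x)"
  then have "(\<Sum>a\<in>Poly_Mapping.keys x. lk x a * lk (bas (f a)) b) \<noteq> 0"
    by (simp add: in_keys_iff lin_map_def lookup_lin_ext)
  then obtain a where "a \<in> Poly_Mapping.keys x" "lk x a * lk (bas (f a)) b \<noteq> 0"
    by (meson sum.neutral)
  then show "b \<in> f ` Poly_Mapping.keys x" by (auto simp: lookup_bas split: if_splits)
qed

lemma lookup_lin_map_inj: "inj f \<Longrightarrow> lk (lin_map f x) (f a) = lk x a"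
  by (auto simp: lin_map_def lookup_lin_ext lookup_bas inj_eq if_distrib in_keys_iff cong: if_cong)

lemma span_bas_eq: "pm.span (bas ` B) = {x :: 'b \<Rightarrow>\<^sub>0 'k::field. Poly_Mapping.keys x \<subseteq> B}"
proof -
  have s: "pm.subspace {x :: 'b \<Rightarrow>\<^sub>0 'k. Poly_Mapping.keys x \<subseteq> B}"
    by (auto simp: pm.subspace_def in_keys_iff subset_iff lookup_add lookup_scal) (metis add.right_neutral)
  show ?thesis
  proof (intro equalityI subsetI)
    fix x :: "'b \<Rightarrow>\<^sub>0 'k" assume "x \<in> pm.span (bas ` B)"
    moreover have "bas ` B \<subseteq> {x :: 'b \<Rightarrow>\<^sub>0 'k. Poly_Mapping.keys x \<subseteq> B}"
      by (auto simp: in_keys_iff lookup_bas split: if_splits)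
    ultimately show "x \<in> {x. Poly_Mapping.keys x \<subseteq> B}"
      using pm.span_minimal[OF _ s] by blast
  next
    fix x :: "'b \<Rightarrow>\<^sub>0 'k" assume x: "x \<in> {x. Poly_Mapping.keys x \<subseteq> B}"
    show "x \<in> pm.span (bas ` B)"
      by (rule lin_in_subspace[OF lin_id pm.subspace_span]) (use x in \<open>auto intro: pm.span_base\<close>)
  qed
qed

definition bilinear :: "(('a \<Rightarrow>\<^sub>0 'k::field) \<Rightarrow> ('b \<Rightarrow>\<^sub>0 'k) \<Rightarrow> ('c \<Rightarrow>\<^sub>0 'k)) \<Rightarrow> bool" where
  "bilinear m \<longleftrightarrow> (\<forall>y. lin (\<lambda>x. m x y)) \<and> (\<forall>x. lin (m x))"

lemma bilinearD: "bilinear m \<Longrightarrow> lin (\<lambda>x. m x y)" "bilinear m \<Longrightarrow> lin (m x)"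
  by (auto simp: bilinear_def)

lemma bilinear_lin_ext: "bilinear (\<lambda>x y. lin_ext (\<lambda>a. lin_ext (f a) y) x)"
  unfolding bilinear_def by (auto intro!: lin_intros)

lemma bilinear_arg: 
  "bilinear m \<Longrightarrow> lin f \<Longrightarrow> lin (\<lambda>x. m (f x) y)"
  "bilinear m \<Longrightarrow> lin f \<Longrightarrow> lin (\<lambda>x. m y (f x))"
  using lin_compose[OF bilinearD(1)] lin_compose[OF bilinearD(2)] by blast+

lemma bilinear_in_subspace:
  assumes "bilinear m" "pm.subspace S"
    "\<And>a b. a \<in> Poly_Mapping.keys x \<Longrightarrow> b \<in> Poly_Mapping.keys y \<Longrightarrow> m (bas a) (bas b) \<in> S"
  shows "m x y \<in> S"
  by (rule lin_in_subspace[OF bilinearD(1)[OF assms(1)] assms(2)],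
      rule lin_in_subspace[OF bilinearD(2)[OF assms(1)] assms(2)]) (rule assms(3))

text \<open>Composition of operations and substitution into monomials are given by values on tuples of basis vectors.
  This evaluates their multilinear extensions at tuples of vectors.\<close>

lemma lin_ext_tensor_list:
  fixes G :: "('b \<Rightarrow>\<^sub>0 'k::field) list \<Rightarrow> ('c \<Rightarrow>\<^sub>0 'k)"
  assumes "\<And>xs ys. length xs + length ys + 1 = length vs \<Longrightarrow> lin (\<lambda>v. G (xs @ v # ys))"
  shows "lin_ext (\<lambda>bs. G (map bas bs)) (tensor_list vs) = G vs"
  using assms
proof (induction vs arbitrary: G)
  case (Cons v vs)
  have "lin_ext (\<lambda>bs. G (map bas bs)) (tensor_list (v # vs)) =
      lin_ext (\<lambda>b. lin_ext (\<lambda>bs. G (bas b # map bas bs)) (tensor_list vs)) v"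
    by (simp add: lin_ext_lin[OF lin_lin_ext] lin_ext_lin_map)
  also have "\<dots> = lin_ext (\<lambda>b. G (bas b # vs)) v"
  proof (rule lin_ext_cong)
    fix b
    show "lin_ext (\<lambda>bs. G (bas b # map bas bs)) (tensor_list vs) = G (bas b # vs)"
      using Cons.prems[of "bas b # xs" ys for xs ys] by (intro Cons.IH) auto
  qed
  also have "\<dots> = G (v # vs)"
    using Cons.prems[of "[]" vs] by (intro lin_ext_eqI[symmetric]) auto
  finally show ?case .
qed simp

section \<open>The two concatenations of WN posets\<close>

lemma plane_posetD:
  assumes "plane_poset X"
  shows "finite (verts X)" "hle X \<subseteq> verts X \<times> verts X" "rle X \<subseteq> verts X \<times> verts X"
    "trans (hle X)" "trans (rle X)" "antisym (hle X)" "antisym (rle X)"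
    "x \<in> verts X \<Longrightarrow> (x, x) \<in> hle X" "x \<in> verts X \<Longrightarrow> (x, x) \<in> rle X"
    "x \<in> verts X \<Longrightarrow> y \<in> verts X \<Longrightarrow> x \<noteq> y \<Longrightarrow>
       ((x, y) \<in> hle X \<or> (y, x) \<in> hle X) \<longleftrightarrow> \<not> ((x, y) \<in> rle X \<or> (y, x) \<in> rle X)"
  using assms
  unfolding plane_poset_def double_poset_def partial_order_on_def preorder_on_def refl_on_def
  by auto

lemma WN_plane: "WN_poset X \<Longrightarrow> plane_poset X"
  by (simp add: WN_poset_def)

lemmas WN_D = plane_posetD[OF WN_plane]

lemma WN_r_not_h:
  assumes "WN_poset X" "(x, y) \<in> rle X" "x \<noteq> y"
  shows "(x, y) \<notin> hle X" "(y, x) \<notin> hle X"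
  using WN_D(10)[OF assms(1), of x y] WN_D(3)[OF assms(1)] assms by auto

lemma subposet_simps [simp]:
  "verts (subposet X S) = S" "hle (subposet X S) = hle X \<inter> S \<times> S"
  "rle (subposet X S) = rle X \<inter> S \<times> S" "dec (subposet Y S) = dec Y"
  by (simp_all add: subposet_def)

lemma subposet_subposet: "T \<subseteq> S \<Longrightarrow> subposet (subposet X S) T = subposet X T"
  by (simp add: subposet_def Int_assoc Times_Int_Times Int_absorb1)

lemma subposet_verts: "WN_poset X \<Longrightarrow> subposet X (verts X) = X"
  using WN_D(2,3)[of X] by (simp add: subposet_def Int_absorb2)

lemma wnp_rel_refl: "WN_poset X \<Longrightarrow> wnp_rel X X"
  by (simp add: wnp_rel_def decposet_isomorphic_refl)

lemma wnp_cases: obtains X where "WN_poset X" "P = abs_wnp X"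
  by (metis WN_rep_wnp abs_rep_wnp)

lemma abs_wnp_eq_iff:
  "WN_poset X \<Longrightarrow> WN_poset Y \<Longrightarrow> abs_wnp X = abs_wnp Y \<longleftrightarrow> decposet_isomorphic X Y"
  by (metis Quotient_wnp Quotient_rel wnp_rel_def decposet_isomorphic_refl)

lemma decposet_isomorphicE:
  assumes "decposet_isomorphic X Y"
  obtains f where "bij_betw f (verts X) (verts Y)"
    "\<And>x y. x \<in> verts X \<Longrightarrow> y \<in> verts X \<Longrightarrow> (f x, f y) \<in> hle Y \<longleftrightarrow> (x, y) \<in> hle X"
    "\<And>x y. x \<in> verts X \<Longrightarrow> y \<in> verts X \<Longrightarrow> (f x, f y) \<in> rle Y \<longleftrightarrow> (x, y) \<in> rle X"
    "\<And>x. x \<in> verts X \<Longrightarrow> dec Y (f x) = dec X x"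
  using assms unfolding decposet_isomorphic_def dposet_iso_def by metis

lemma decposet_isomorphicI:
  assumes "bij_betw f (verts X) (verts Y)"
    "\<And>x y. x \<in> verts X \<Longrightarrow> y \<in> verts X \<Longrightarrow> (f x, f y) \<in> hle Y \<longleftrightarrow> (x, y) \<in> hle X"
    "\<And>x y. x \<in> verts X \<Longrightarrow> y \<in> verts X \<Longrightarrow> (f x, f y) \<in> rle Y \<longleftrightarrow> (x, y) \<in> rle X"
    "\<And>x. x \<in> verts X \<Longrightarrow> dec Y (f x) = dec X x"
  shows "decposet_isomorphic X Y"
  using assms unfolding decposet_isomorphic_def dposet_iso_def by blast

lift_definition wnp_mdec :: "'d wnp \<Rightarrow> 'd multiset"
  is "\<lambda>X. image_mset (dec X) (mset_set (verts X))"
proof -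
  fix X Y :: "(nat, 'd) decposet" assume "wnp_rel X Y"
  then have W: "WN_poset X" and iso: "decposet_isomorphic X Y" by (auto simp: wnp_rel_def)
  from iso obtain f where f: "bij_betw f (verts X) (verts Y)"
    "\<And>x. x \<in> verts X \<Longrightarrow> dec Y (f x) = dec X x" by (rule decposet_isomorphicE) blast
  have "image_mset (dec Y) (mset_set (verts Y)) =
      image_mset (dec Y) (image_mset f (mset_set (verts X)))"
    using f(1) by (simp add: bij_betw_def image_mset_mset_set)
  also have "\<dots> = image_mset (dec X) (mset_set (verts X))"
    using WN_D(1)[OF W] f(2) by (auto simp: multiset.map_comp intro!: image_mset_cong)
  finally show "image_mset (dec X) (mset_set (verts X)) = image_mset (dec Y) (mset_set (verts Y))"
    by simp
qed

text \<open>Posets with given decorations are compared by their number of \<open>h\<close>-relations: it measures how far a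
  summand of a product is from the leading one.\<close>

lift_definition wnp_hrel :: "'d wnp \<Rightarrow> nat" is "\<lambda>X. card (hle X)"
proof -
  fix X Y :: "(nat, 'd) decposet" assume "wnp_rel X Y"
  then have W: "WN_poset X" "WN_poset Y" and iso: "decposet_isomorphic X Y"
    by (auto simp: wnp_rel_def)
  from iso obtain f where f: "bij_betw f (verts X) (verts Y)"
    "\<And>x y. x \<in> verts X \<Longrightarrow> y \<in> verts X \<Longrightarrow> (f x, f y) \<in> hle Y \<longleftrightarrow> (x, y) \<in> hle X"
    by (rule decposet_isomorphicE) blast
  note s = WN_D(2)[OF W(1)] WN_D(2)[OF W(2)]
  have "inj_on (map_prod f f) (hle X)"
    by (rule inj_on_subset[OF _ s(1)]) (use f(1) in \<open>auto simp: bij_betw_def map_prod_inj_on\<close>)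
  moreover have "map_prod f f ` hle X = hle Y"
  proof (intro equalityI subsetI)
    fix p assume "p \<in> map_prod f f ` hle X" then show "p \<in> hle Y" using f(2) s(1) by auto
  next
    fix p assume p: "p \<in> hle Y"
    then have "p \<in> f ` verts X \<times> f ` verts X"
      using s(2) bij_betw_imp_surj_on[OF f(1)] by blast
    then obtain a b where ab: "p = (f a, f b)" "a \<in> verts X" "b \<in> verts X" by blast
    then have "(a, b) \<in> hle X" using p f(2) by simp
    then show "p \<in> map_prod f f ` hle X" using ab by force
  qed
  ultimately show "card (hle X) = card (hle Y)" by (metis card_image)
qed

definition swap_decposet :: "('a, 'd) decposet \<Rightarrow> ('a, 'd) decposet" where
  "swap_decposet X = X\<lparr>hle := rle X, rle := hle X\<rparr>"

lemma swap_decposet_simps [simp]: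
  "verts (swap_decposet X) = verts X" "hle (swap_decposet X) = rle X"
  "rle (swap_decposet X) = hle X" "dec (swap_decposet X) = dec X"
  "swap_decposet (swap_decposet X) = X"
  "subposet (swap_decposet X) S = swap_decposet (subposet X S)"
  by (simp_all add: swap_decposet_def subposet_def)

text \<open>The exchange of the two orders turns \<open>N\<^sub>1\<close> into \<open>N\<^sub>2\<close> and conversely if \<open>b\<close> and \<open>c\<close> are
  exchanged as well; hence it preserves WN posets.\<close>

definition swap_bc :: "nat \<Rightarrow> nat" where
  "swap_bc x = (if x = 1 then 2 else if x = 2 then 1 else x)"

lemma swap_bc_simps: "swap_bc 0 = 0" "swap_bc (Suc 0) = 2" "swap_bc 2 = 1" "swap_bc 3 = 3"
  by (simp_all add: swap_bc_def)

lemma N_swap_bc: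
  "\<forall>x\<in>{0, 1, 2, 3}. \<forall>y\<in>{0, 1, 2, 3}.
     ((swap_bc x, swap_bc y) \<in> rle N1 \<longleftrightarrow> (x, y) \<in> hle N2) \<and>
     ((swap_bc x, swap_bc y) \<in> hle N1 \<longleftrightarrow> (x, y) \<in> rle N2) \<and>
     ((swap_bc x, swap_bc y) \<in> rle N2 \<longleftrightarrow> (x, y) \<in> hle N1) \<and>
     ((swap_bc x, swap_bc y) \<in> hle N2 \<longleftrightarrow> (x, y) \<in> rle N1)"
  by (simp add: N1_def N2_def swap_bc_simps Id_on_iff)

lemma WN_swap_decposet:
  assumes "WN_poset X" shows "WN_poset (swap_decposet X)"
proof -
  have *: "has_subposet X M"
    if "has_subposet (swap_decposet X) N" "(N, M) \<in> {(N1, N2), (N2, N1)}" for N M :: "nat dposet"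
  proof -
    from that(1) obtain g where g: "inj_on g (verts N)" "g ` verts N \<subseteq> verts X"
      and o: "\<forall>x\<in>verts N. \<forall>y\<in>verts N. ((g x, g y) \<in> rle X \<longleftrightarrow> (x, y) \<in> hle N) \<and>
        ((g x, g y) \<in> hle X \<longleftrightarrow> (x, y) \<in> rle N)"
      unfolding has_subposet_iff by auto
    let ?t = swap_bc
    have v: "verts N = {0, 1, 2, 3}" "verts M = {0, 1, 2, 3}"
      using that(2) by (auto simp: N1_def N2_def)
    have t: "?t ` {0, 1, 2, 3} = {0, 1, 2, 3}" "inj_on ?t {0, 1, 2, 3}"
      by (auto simp: swap_bc_simps)
    have m: "((?t x, ?t y) \<in> rle N \<longleftrightarrow> (x, y) \<in> hle M) \<and> ((?t x, ?t y) \<in> hle N \<longleftrightarrow> (x, y) \<in> rle M)"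
      if "x \<in> {0, 1, 2, 3}" "y \<in> {0, 1, 2, 3}" for x y
      using N_swap_bc that \<open>(N, M) \<in> _\<close> by blast
    have "inj_on (g \<circ> ?t) (verts M)" "(g \<circ> ?t) ` verts M \<subseteq> verts X"
      using g t comp_inj_on[of ?t "verts M" g] unfolding v image_comp[symmetric] by auto
    moreover have "\<forall>x\<in>verts M. \<forall>y\<in>verts M. (((g \<circ> ?t) x, (g \<circ> ?t) y) \<in> hle X \<longleftrightarrow> (x, y) \<in> hle M) \<and>
        (((g \<circ> ?t) x, (g \<circ> ?t) y) \<in> rle X \<longleftrightarrow> (x, y) \<in> rle M)"
    proof (intro ballI)
      fix x y assume xy: "x \<in> verts M" "y \<in> verts M"
      then have "?t x \<in> verts N" "?t y \<in> verts N" using t(1) v by blast+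
      then show "(((g \<circ> ?t) x, (g \<circ> ?t) y) \<in> hle X \<longleftrightarrow> (x, y) \<in> hle M) \<and>
        (((g \<circ> ?t) x, (g \<circ> ?t) y) \<in> rle X \<longleftrightarrow> (x, y) \<in> rle M)"
        using o m[of x y] xy unfolding v comp_apply by blast
    qed
    ultimately show ?thesis unfolding has_subposet_iff by blast
  qed
  have "plane_poset (swap_decposet X)"
    using WN_plane[OF assms] by (auto simp: plane_poset_def double_poset_def)
  then show ?thesis using *[of N1 N2] *[of N2 N1] assms by (auto simp: WN_poset_def)
qed

lift_definition wnp_swap :: "'d wnp \<Rightarrow> 'd wnp" is swap_decposet
  unfolding wnp_rel_def
  by (auto simp: WN_swap_decposet elim!: decposet_isomorphicE intro!: decposet_isomorphicI)

lemma wnp_sum_abs: "WN_poset X \<Longrightarrow> WN_poset Y \<Longrightarrow>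
    wnp_sum (abs_wnp X) (abs_wnp Y) = abs_wnp (sum_decposet X Y)"
  and wnp_swap_abs: "WN_poset X \<Longrightarrow> wnp_swap (abs_wnp X) = abs_wnp (swap_decposet X)"
  and wnp_map_dec_abs: "WN_poset X \<Longrightarrow> wnp_map_dec f (abs_wnp X) = abs_wnp (map_dec_decposet f X)"
  and wnp_mdec_abs: "WN_poset X \<Longrightarrow>
    wnp_mdec (abs_wnp X) = image_mset (dec X) (mset_set (verts X))"
  and wnp_hrel_abs: "WN_poset X \<Longrightarrow> wnp_hrel (abs_wnp X) = card (hle X)"
  by (simp_all add: wnp_sum.abs_eq wnp_swap.abs_eq wnp_map_dec.abs_eq wnp_mdec.abs_eq
      wnp_hrel.abs_eq wnp_rel_refl)

lemma wnp_swap_swap [simp]: "wnp_swap (wnp_swap P) = P"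
  by (rule wnp_cases[of P]) (simp add: wnp_swap_abs WN_swap_decposet)

lemma wnp_mdec_swap [simp]: "wnp_mdec (wnp_swap P) = wnp_mdec P"
  by (rule wnp_cases[of P]) (simp add: wnp_swap_abs WN_swap_decposet wnp_mdec_abs)

text \<open>The vertical concatenation, in which all elements of \<open>P\<close> are \<open>h\<close>-below all elements of \<open>Q\<close>. The
  detour through the exchange of the two orders transfers to it all results on the horizontal one.\<close>

definition wnp_ser :: "'d wnp \<Rightarrow> 'd wnp \<Rightarrow> 'd wnp" where
  "wnp_ser P Q = wnp_swap (wnp_sum (wnp_swap P) (wnp_swap Q))"

lemma wnp_mdec_empty [simp]: "wnp_mdec wnp_empty = {#}"
  by transfer (simp add: empty_decposet_def)

lemma wnp_mdec_point [simp]: "wnp_mdec (wnp_point d) = {#d#}"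
  by transfer (simp add: point_decposet_def)

lemma abs_wnp_empty: "WN_poset X \<Longrightarrow> abs_wnp X = wnp_empty \<longleftrightarrow> verts X = {}"
proof -
  assume "WN_poset X"
  then have "abs_wnp X = wnp_empty \<longleftrightarrow> decposet_isomorphic X empty_decposet"
    by (simp add: abs_wnp_eq_iff[OF _ WN_empty_decposet] wnp_empty_def)
  also have "\<dots> \<longleftrightarrow> verts X = {}"
    by (auto simp: empty_decposet_def bij_betw_def elim!: decposet_isomorphicE
        intro!: decposet_isomorphicI[where f = id])
  finally show ?thesis .
qed

lemma wnp_mdec_eq_empty [simp]: "wnp_mdec P = {#} \<longleftrightarrow> P = wnp_empty"
  by (rule wnp_cases[of P])
    (simp add: wnp_mdec_abs abs_wnp_empty mset_set_empty_iff WN_D(1))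

lemma wnp_swap_empty [simp]: "wnp_swap P = wnp_empty \<longleftrightarrow> P = wnp_empty"
  by (metis wnp_mdec_eq_empty wnp_mdec_swap)

lemma wnp_mdec_sum [simp]: "wnp_mdec (wnp_sum P Q) = wnp_mdec P + wnp_mdec Q"
proof -
  obtain X Y where X: "WN_poset X" "P = abs_wnp X" and Y: "WN_poset Y" "Q = abs_wnp Y"
    by (metis wnp_cases)
  let ?l = "\<lambda>x::nat. 2 * x" and ?r = "\<lambda>y::nat. 2 * y + 1"
  have f: "finite (verts X)" "finite (verts Y)" using WN_D(1) X Y by auto
  have i: "inj_on ?l (verts X)" "inj_on ?r (verts Y)" by (auto simp: inj_on_def)
  have d: "?l ` verts X \<inter> ?r ` verts Y = {}" by (auto simp: disjoint_iff) presburger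
  have "mset_set (verts (sum_decposet X Y)) =
      image_mset ?l (mset_set (verts X)) + image_mset ?r (mset_set (verts Y))"
    unfolding sum_decposet_simps(1) using f i d
    by (simp add: mset_set_Union image_mset_mset_set)
  then show ?thesis
    using X Y by (simp add: wnp_sum_abs wnp_mdec_abs WN_sum_decposet multiset.map_comp
        sum_decposet_simps(5) comp_def)
qed

lemma wnp_mdec_ser [simp]: "wnp_mdec (wnp_ser P Q) = wnp_mdec P + wnp_mdec Q"
  by (simp add: wnp_ser_def)

lemma map_dec_decposet_simps [simp]:
  "verts (map_dec_decposet f X) = verts X" "hle (map_dec_decposet f X) = hle X"
  "rle (map_dec_decposet f X) = rle X" "dec (map_dec_decposet f X) = f \<circ> dec X"
  by (simp_all add: map_dec_decposet_def)

lemma wnp_mdec_map_dec [simp]: "wnp_mdec (wnp_map_dec f P) = image_mset f (wnp_mdec P)"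
  by (rule wnp_cases[of P])
    (simp add: wnp_mdec_abs wnp_map_dec_abs WN_map_dec_decposet multiset.map_comp)

text \<open>A decomposition of a WN poset as a horizontal concatenation is the same as a partition of its
  vertex set into two parts with \<open>A <\<^sub>r B\<close>.\<close>

definition r_split :: "('a, 'm) dposet_scheme \<Rightarrow> 'a set \<Rightarrow> 'a set \<Rightarrow> bool" where
  "r_split X A B \<longleftrightarrow> A \<union> B = verts X \<and> A \<inter> B = {} \<and> A \<times> B \<subseteq> rle X"

lemma wnp_sum_r_split:
  assumes W: "WN_poset X" and s: "r_split X A B"
  shows "wnp_sum (abs_wnp (subposet X A)) (abs_wnp (subposet X B)) = abs_wnp X"
proof -
  let ?Y = "sum_decposet (subposet X A) (subposet X B)"
  have V: "verts X = A \<union> B" "A \<inter> B = {}" and r: "\<And>a b. a \<in> A \<Longrightarrow> b \<in> B \<Longrightarrow> (a, b) \<in> rle X"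
    using s by (auto simp: r_split_def)
  have WA: "WN_poset (subposet X A)" "WN_poset (subposet X B)"
    using WN_poset_subposet[OF W] V by auto
  define f where "f z = (if z \<in> A then 2 * z else 2 * z + 1)" for z :: nat
  have f: "even (f z) \<longleftrightarrow> z \<in> A" "f z div 2 = z" for z by (auto simp: f_def)
  have "decposet_isomorphic X ?Y"
  proof (rule decposet_isomorphicI[where f = f])
    show "bij_betw f (verts X) (verts ?Y)"
    proof (rule bij_betw_imageI)
      show "inj_on f (verts X)" by (rule inj_onI) (metis f(2))
      show "f ` verts X = verts ?Y"
        using V unfolding sum_decposet_simps(1) subposet_simps
        by (auto simp: f_def image_Un intro: image_cong split: if_splits)
    qed
  next
    fix x y assume xy: "x \<in> verts X" "y \<in> verts X"
    then have AB: "x \<notin> A \<longleftrightarrow> x \<in> B" "y \<notin> A \<longleftrightarrow> y \<in> B" using V by auto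
    have rxy: "(x, y) \<in> rle X \<and> (x, y) \<notin> hle X \<and> (y, x) \<notin> hle X \<and> (y, x) \<notin> rle X"
      if "x \<in> A" "y \<in> B" for x y
    proof -
      have "(x, y) \<in> rle X" "x \<noteq> y" using r that V(2) by auto
      then show ?thesis using WN_r_not_h[OF W] antisymD[OF WN_D(7)[OF W]] by blast
    qed
    show "(f x, f y) \<in> hle ?Y \<longleftrightarrow> (x, y) \<in> hle X" "(f x, f y) \<in> rle ?Y \<longleftrightarrow> (x, y) \<in> rle X"
      using AB rxy[of x y] rxy[of y x] by (auto simp: sum_decposet_simps f)
  next
    fix x show "dec ?Y (f x) = dec X x" by (simp add: sum_decposet_simps f)
  qed
  then show ?thesis
    using W WA by (simp add: wnp_sum_abs WN_sum_decposet abs_wnp_eqI decposet_isomorphic_sym)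
qed

lemma wnp_sum_eq_abs:
  assumes W: "WN_poset X" and e: "abs_wnp X = wnp_sum P Q"
  obtains A B where "r_split X A B" "abs_wnp (subposet X A) = P" "abs_wnp (subposet X B) = Q"
proof -
  obtain Y Z where Y: "WN_poset Y" "P = abs_wnp Y" and Z: "WN_poset Z" "Q = abs_wnp Z"
    by (metis wnp_cases)
  have "decposet_isomorphic X (sum_decposet Y Z)"
    using e W Y Z by (simp add: wnp_sum_abs abs_wnp_eq_iff WN_sum_decposet)
  then obtain f where f: "bij_betw f (verts X) (verts (sum_decposet Y Z))"
    "\<And>x y. x \<in> verts X \<Longrightarrow> y \<in> verts X \<Longrightarrow> (f x, f y) \<in> hle (sum_decposet Y Z) \<longleftrightarrow> (x, y) \<in> hle X"
    "\<And>x y. x \<in> verts X \<Longrightarrow> y \<in> verts X \<Longrightarrow> (f x, f y) \<in> rle (sum_decposet Y Z) \<longleftrightarrow> (x, y) \<in> rle X"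
    "\<And>x. x \<in> verts X \<Longrightarrow> dec (sum_decposet Y Z) (f x) = dec X x"
    by (rule decposet_isomorphicE) blast
  define A where "A = {x \<in> verts X. even (f x)}"
  define B where "B = {x \<in> verts X. odd (f x)}"
  have fV: "f x \<in> verts (sum_decposet Y Z)" if "x \<in> verts X" for x
    using f(1) that by (auto simp: bij_betw_def)
  have pre: "\<exists>x\<in>verts X. f x = z" if "z \<in> verts (sum_decposet Y Z)" for z
    using f(1) that by (metis bij_betw_def imageE)
  have finj: "x = y" if "x \<in> verts X" "y \<in> verts X" "f x div 2 = f y div 2" "even (f x) = even (f y)"
    for x y using f(1) that div2_eq by (metis bij_betw_def inj_onD)
  have "r_split X A B"
    using fV by (auto simp: r_split_def A_def B_def f(3)[symmetric] sum_decposet_simps(2,4))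
  moreover have "decposet_isomorphic (subposet X A) Y"
  proof (rule decposet_isomorphicI[where f = "\<lambda>x. f x div 2"])
    have "\<exists>x\<in>A. f x div 2 = y" if "y \<in> verts Y" for y
      using pre[of "2 * y"] that by (force simp: sum_decposet_simps(2) A_def)
    then show "bij_betw (\<lambda>x. f x div 2) (verts (subposet X A)) (verts Y)"
      using fV finj by (auto simp: bij_betw_def inj_on_def A_def sum_decposet_simps(2) image_iff)
  qed (auto simp: A_def f(2-4)[symmetric] sum_decposet_simps(3-))
  moreover have "decposet_isomorphic (subposet X B) Z"
  proof (rule decposet_isomorphicI[where f = "\<lambda>x. f x div 2"])
    have "\<exists>x\<in>B. f x div 2 = y" if "y \<in> verts Z" for y
      using pre[of "2 * y + 1"] that by (force simp: sum_decposet_simps(2) B_def)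
    then show "bij_betw (\<lambda>x. f x div 2) (verts (subposet X B)) (verts Z)"
      using fV finj by (auto simp: bij_betw_def inj_on_def B_def sum_decposet_simps(2) image_iff)
  qed (auto simp: B_def f(2-4)[symmetric] sum_decposet_simps(3-))
  moreover have "WN_poset (subposet X A)" "WN_poset (subposet X B)"
    using WN_poset_subposet[OF W] by (auto simp: A_def B_def)
  ultimately show ?thesis using that Y Z abs_wnp_eqI by metis
qed

lemma wnp_sum_empty [simp]: "wnp_sum wnp_empty P = P" "wnp_sum P wnp_empty = P"
proof -
  obtain X where X: "WN_poset X" "P = abs_wnp X" by (rule wnp_cases)
  have "r_split X {} (verts X)" "r_split X (verts X) {}" by (auto simp: r_split_def)
  moreover have "abs_wnp (subposet X {}) = wnp_empty"
    using WN_poset_subposet[OF X(1)] by (simp add: abs_wnp_empty)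
  ultimately show "wnp_sum wnp_empty P = P" "wnp_sum P wnp_empty = P"
    using wnp_sum_r_split[OF X(1)] X subposet_verts by metis+
qed

lemma wnp_sum_assoc: "wnp_sum (wnp_sum P Q) R = wnp_sum P (wnp_sum Q R)"
proof -
  obtain X where X: "WN_poset X" "wnp_sum (wnp_sum P Q) R = abs_wnp X" by (rule wnp_cases)
  obtain AB C where 1: "r_split X AB C" "abs_wnp (subposet X AB) = wnp_sum P Q"
    "abs_wnp (subposet X C) = R" using wnp_sum_eq_abs[OF X(1)] X(2) by metis
  have V: "AB \<subseteq> verts X" using 1(1) by (auto simp: r_split_def)
  obtain A B where 2: "r_split (subposet X AB) A B" "abs_wnp (subposet (subposet X AB) A) = P"
    "abs_wnp (subposet (subposet X AB) B) = Q"
    using wnp_sum_eq_abs[OF WN_poset_subposet[OF X(1) V] 1(2)] by metis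
  have s: "A \<union> B = AB" "A \<inter> B = {}" "A \<times> B \<subseteq> rle X" "AB \<union> C = verts X" "AB \<inter> C = {}"
    "AB \<times> C \<subseteq> rle X" using 1(1) 2(1) by (auto simp: r_split_def)
  have "r_split X A (B \<union> C)" "r_split (subposet X (B \<union> C)) B C"
    using s unfolding r_split_def by auto
  then have "wnp_sum (abs_wnp (subposet X A)) (abs_wnp (subposet X (B \<union> C))) = abs_wnp X"
    "wnp_sum (abs_wnp (subposet (subposet X (B \<union> C)) B)) (abs_wnp (subposet (subposet X (B \<union> C)) C))
      = abs_wnp (subposet X (B \<union> C))"
    using wnp_sum_r_split[OF X(1)] wnp_sum_r_split[OF WN_poset_subposet[OF X(1)], of "B \<union> C" B C]
    s(1,4) by auto
  then show ?thesis using X(2) 1 2 s(1) by (simp add: subposet_subposet Un_upper1)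
      (metis Un_upper1 Un_upper2 subposet_subposet)
qed

text \<open>Two partitions \<open>A <\<^sub>r B\<close> and \<open>C <\<^sub>r D\<close> of the same poset are nested, because an element of
  \<open>A - C\<close> and one of \<open>C - A\<close> would precede each other. So the concatenation monoid is
  equidivisible, and being graded it is free on its irreducible elements.\<close>

lemma wnp_sum_equidivisible:
  assumes "wnp_sum A B = wnp_sum C D"
  shows "(\<exists>E. C = wnp_sum A E \<and> B = wnp_sum E D) \<or> (\<exists>E. A = wnp_sum C E \<and> D = wnp_sum E B)"
proof -
  obtain X where X: "WN_poset X" "wnp_sum A B = abs_wnp X" by (rule wnp_cases)
  obtain a b where 1: "r_split X a b" "abs_wnp (subposet X a) = A" "abs_wnp (subposet X b) = B"
    using wnp_sum_eq_abs[OF X(1)] X(2) by metis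
  obtain c d where 2: "r_split X c d" "abs_wnp (subposet X c) = C" "abs_wnp (subposet X d) = D"
    using wnp_sum_eq_abs[OF X(1)] X(2) assms by metis
  have nested: "\<exists>E. C' = wnp_sum A' E \<and> B' = wnp_sum E D'"
    if s: "r_split X a b" "r_split X c d" "a \<subseteq> c"
      and e: "abs_wnp (subposet X a) = A'" "abs_wnp (subposet X b) = B'"
        "abs_wnp (subposet X c) = C'" "abs_wnp (subposet X d) = D'" for a b c d A' B' C' D'
  proof -
    have V: "c \<subseteq> verts X" "b \<subseteq> verts X" using s by (auto simp: r_split_def)
    have d: "d \<subseteq> b" using s unfolding r_split_def by blast
    then have "r_split (subposet X c) a (c \<inter> b)" "r_split (subposet X b) (c \<inter> b) d"
      using s unfolding r_split_def by auto
    from wnp_sum_r_split[OF WN_poset_subposet[OF X(1) V(1)] this(1)]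
      wnp_sum_r_split[OF WN_poset_subposet[OF X(1) V(2)] this(2)]
    have "C' = wnp_sum A' (abs_wnp (subposet X (c \<inter> b)))"
      "B' = wnp_sum (abs_wnp (subposet X (c \<inter> b))) D'"
      using s e d by (simp_all add: subposet_subposet)
    then show ?thesis by blast
  qed
  have "a \<subseteq> c \<or> c \<subseteq> a"
  proof (rule ccontr)
    assume "\<not> ?thesis"
    then obtain x y where "x \<in> a" "x \<notin> c" "y \<in> c" "y \<notin> a" by blast
    then have "(x, y) \<in> rle X" "(y, x) \<in> rle X" "x \<noteq> y"
      using 1(1) 2(1) by (auto simp: r_split_def)
    then show False using antisymD[OF WN_D(7)[OF X(1)]] by blast
  qed
  then show ?thesis using nested[OF 1(1) 2(1) _ 1(2,3) 2(2,3)] nested[OF 2(1) 1(1) _ 2(2,3) 1(2,3)]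
    by blast
qed

definition wnp_size :: "'d wnp \<Rightarrow> nat" where
  "wnp_size P = size (wnp_mdec P)"

lemma wnp_size_simps [simp]:
  "wnp_size wnp_empty = 0" "wnp_size (wnp_point d) = 1"
  "wnp_size (wnp_sum P Q) = wnp_size P + wnp_size Q"
  "wnp_size (wnp_ser P Q) = wnp_size P + wnp_size Q"
  "wnp_size P = 0 \<longleftrightarrow> P = wnp_empty" "0 < wnp_size P \<longleftrightarrow> P \<noteq> wnp_empty"
  "wnp_size (wnp_swap P) = wnp_size P"
  by (simp_all add: wnp_size_def flip: nonempty_has_size)

definition sum_irreducible :: "'d wnp \<Rightarrow> bool" where
  "sum_irreducible P \<longleftrightarrow>
     P \<noteq> wnp_empty \<and> (\<forall>A B. P = wnp_sum A B \<longrightarrow> A = wnp_empty \<or> B = wnp_empty)"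

definition ser_irreducible :: "'d wnp \<Rightarrow> bool" where
  "ser_irreducible P \<longleftrightarrow> sum_irreducible (wnp_swap P)"

lemma wnp_sum_left_cancel:
  assumes "wnp_sum P Q = wnp_sum P R" shows "Q = R"
proof -
  have "Q' = R'" if "P = wnp_sum P E" "Q' = wnp_sum E R'" for E Q' R' :: "'a wnp"
  proof -
    have "wnp_size P = wnp_size P + wnp_size E" using that(1) by (metis wnp_size_simps(3))
    then have "E = wnp_empty" by simp
    then show ?thesis using that(2) by simp
  qed
  then show ?thesis using wnp_sum_equidivisible[OF assms] by metis
qed

lemma wnp_sum_irreducible_unique:
  assumes e: "wnp_sum C P = wnp_sum D Q" and C: "sum_irreducible C" and D: "sum_irreducible D"
  shows "C = D" "P = Q"
proof -
  from wnp_sum_equidivisible[OF e] show "C = D"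
  proof (elim disjE exE conjE)
    fix E assume "D = wnp_sum C E"
    then show ?thesis using C D by (metis sum_irreducible_def wnp_sum_empty(2))
  next
    fix E assume "C = wnp_sum D E"
    then show ?thesis using C D by (metis sum_irreducible_def wnp_sum_empty(2))
  qed
  then show "P = Q" using e wnp_sum_left_cancel by metis
qed

lemma wnp_sum_factor:
  "P \<noteq> wnp_empty \<Longrightarrow> \<exists>C Q. sum_irreducible C \<and> P = wnp_sum C Q"
proof (induction "wnp_size P" arbitrary: P rule: less_induct)
  case less
  show ?case
  proof (cases "sum_irreducible P")
    case True
    then show ?thesis by (metis wnp_sum_empty(2))
  next
    case False
    then obtain A B where AB: "P = wnp_sum A B" "A \<noteq> wnp_empty" "B \<noteq> wnp_empty"
      using less.prems by (auto simp: sum_irreducible_def)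
    then obtain C Q where "sum_irreducible C" "A = wnp_sum C Q"
      using less.hyps[of A] by auto
    then show ?thesis using AB wnp_sum_assoc by metis
  qed
qed

lemma sum_irreducible_point: "sum_irreducible (wnp_point d)"
proof -
  have "A = wnp_empty \<or> B = wnp_empty" if "wnp_point d = wnp_sum A B" for A B
  proof -
    have "wnp_size A + wnp_size B = 1" using that by (metis wnp_size_simps(2,3))
    then have "wnp_size A = 0 \<or> wnp_size B = 0" by linarith
    then show ?thesis by simp
  qed
  moreover have "wnp_point d \<noteq> wnp_empty" by (metis wnp_size_simps(1,2) zero_neq_one)
  ultimately show ?thesis by (simp add: sum_irreducible_def)
qed

section \<open>Connectedness and the structure of WN posets\<close>

definition h_comparable :: "('a, 'm) dposet_scheme \<Rightarrow> 'a \<Rightarrow> 'a \<Rightarrow> bool" where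
  "h_comparable X x y \<longleftrightarrow> (x, y) \<in> hle X \<or> (y, x) \<in> hle X"

text \<open>Disconnectedness in terms of the order, whose Hasse graph enters only in the definition of connectedness.\<close>

definition h_separated :: "('a, 'm) dposet_scheme \<Rightarrow> 'a set \<Rightarrow> bool" where
  "h_separated X A \<longleftrightarrow> A \<subseteq> verts X \<and> A \<noteq> {} \<and> A \<noteq> verts X \<and>
     (\<forall>a\<in>A. \<forall>b\<in>verts X - A. \<not> h_comparable X a b)"

text \<open>A minimal \<open>h\<close>-separated part \<open>A\<close> is an interval for the other order: if \<open>b\<close> outside of \<open>A\<close> were
  above some elements of \<open>A\<close> and below others, then these two parts of \<open>A\<close> would be separated from
  each other. Hence the complement consists of elements above \<open>A\<close> and elements below \<open>A\<close>, which gives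
  a horizontal splitting.\<close>

lemma h_separated_r_split:
  fixes X :: "('a, 'd) decposet"
  assumes W: "WN_poset X" and s: "\<exists>A. h_separated X A"
  shows "\<exists>A B. r_split X A B \<and> A \<noteq> {} \<and> B \<noteq> {}"
proof -
  obtain A where A: "h_separated X A" and min: "\<And>A'. h_separated X A' \<Longrightarrow> card A \<le> card A'"
    using s by (metis arg_min_natI arg_min_nat_le)
  define B where "B = verts X - A"
  have V: "A \<subseteq> verts X" "A \<noteq> {}" "B \<noteq> {}" and nc: "\<And>a b. a \<in> A \<Longrightarrow> b \<in> B \<Longrightarrow> \<not> h_comparable X a b"
    using A by (auto simp: h_separated_def B_def)
  have fin: "finite A" using V(1) WN_D(1)[OF W] finite_subset by blast
  have rc: "(a, b) \<in> rle X \<or> (b, a) \<in> rle X" if "a \<in> A" "b \<in> B" for a b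
    using WN_D(10)[OF W, of a b] nc[OF that] that V(1) by (auto simp: h_comparable_def B_def)
  have tr: "(x, y) \<in> rle X \<Longrightarrow> (y, z) \<in> rle X \<Longrightarrow> (x, z) \<in> rle X" for x y z
    using transD[OF WN_D(5)[OF W]] by blast
  have all: "(\<forall>a\<in>A. (a, b) \<in> rle X) \<or> (\<forall>a\<in>A. (b, a) \<in> rle X)" if b: "b \<in> B" for b
  proof (rule ccontr)
    assume n: "\<not> ?thesis"
    define A1 where "A1 = {a \<in> A. (a, b) \<in> rle X}"
    have A1: "A1 \<noteq> {}" "A1 \<subset> A" using n rc[OF _ b] by (auto simp: A1_def)
    have "\<not> h_comparable X x y" if "x \<in> A1" "y \<in> verts X - A1" for x y
    proof (cases "y \<in> A")
      case True
      then have "(x, b) \<in> rle X" "(b, y) \<in> rle X" "x \<noteq> y"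
        using that rc[OF _ b] by (auto simp: A1_def)
      then show ?thesis
        using tr WN_r_not_h[OF W, of x y] by (auto simp: h_comparable_def)
    next
      case False
      then show ?thesis using nc that by (auto simp: A1_def B_def)
    qed
    then have "h_separated X A1" using A1 V by (auto simp: h_separated_def)
    then show False using min psubset_card_mono[OF fin A1(2)] by fastforce
  qed
  \<comment> \<open>The elements above \<open>A\<close> form the right part, unless there are none; then \<open>A\<close> itself is the right part.\<close>
  define U where "U = {b \<in> B. \<forall>a\<in>A. (a, b) \<in> rle X}"
  show ?thesis
  proof (cases "U = {}")
    case True
    then have "r_split X B A" using all V by (auto simp: r_split_def B_def U_def)
    then show ?thesis using V by blast
  next
    case False
    obtain a where a: "a \<in> A" using V by blast
    have "r_split X ((B - U) \<union> A) U"
      unfolding r_split_def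
    proof (intro conjI)
      show "((B - U) \<union> A) \<times> U \<subseteq> rle X"
      proof clarify
        fix x u assume x: "x \<in> (B - U) \<union> A" "u \<in> U"
        then have "(a, u) \<in> rle X" using a by (auto simp: U_def)
        moreover have "(x, a) \<in> rle X" if "x \<notin> A" using all[of x] x that a by (auto simp: U_def)
        ultimately show "(x, u) \<in> rle X" using x tr by (auto simp: U_def)
      qed
    qed (use V in \<open>auto simp: U_def B_def\<close>)
    then show ?thesis using False V by blast
  qed
qed

lemma sum_irreducible_iff:
  assumes W: "WN_poset X"
  shows "sum_irreducible (abs_wnp X) \<longleftrightarrow> verts X \<noteq> {} \<and> \<not> (\<exists>A. h_separated X A)"
proof
  assume s: "sum_irreducible (abs_wnp X)"
  have "\<not> h_separated X A" for A
  proof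
    assume "h_separated X A"
    then obtain A B where AB: "r_split X A B" "A \<noteq> {}" "B \<noteq> {}"
      using h_separated_r_split[OF W] by blast
    then have "A \<subseteq> verts X" "B \<subseteq> verts X" by (auto simp: r_split_def)
    then show False
      using wnp_sum_r_split[OF W AB(1)] s AB abs_wnp_empty[OF WN_poset_subposet[OF W]]
      unfolding sum_irreducible_def by (metis subposet_simps(1))
  qed
  then show "verts X \<noteq> {} \<and> \<not> (\<exists>A. h_separated X A)"
    using s abs_wnp_empty[OF W] by (auto simp: sum_irreducible_def)
next
  assume s: "verts X \<noteq> {} \<and> \<not> (\<exists>A. h_separated X A)"
  have "A = wnp_empty \<or> B = wnp_empty" if "abs_wnp X = wnp_sum A B" for A B
  proof (rule ccontr)
    assume n: "\<not> ?thesis"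
    obtain a b where ab: "r_split X a b" "abs_wnp (subposet X a) = A" "abs_wnp (subposet X b) = B"
      using wnp_sum_eq_abs[OF W \<open>abs_wnp X = _\<close>] by blast
    have V: "a \<subseteq> verts X" "b \<subseteq> verts X" using ab(1) by (auto simp: r_split_def)
    then have "a \<noteq> {}" "b \<noteq> {}"
      using n ab(2,3) abs_wnp_empty[OF WN_poset_subposet[OF W]] by fastforce+
    moreover have "\<not> h_comparable X x y" if "x \<in> a" "y \<in> verts X - a" for x y
    proof -
      have "(x, y) \<in> rle X" "x \<noteq> y" using ab(1) that by (auto simp: r_split_def)
      then show ?thesis using WN_r_not_h[OF W] by (auto simp: h_comparable_def)
    qed
    ultimately have "h_separated X a" using V ab(1) by (auto simp: h_separated_def r_split_def)
    then show False using s by blast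
  qed
  then show "sum_irreducible (abs_wnp X)"
    using s abs_wnp_empty[OF W] by (auto simp: sum_irreducible_def)
qed

text \<open>Connectedness refers to the Hasse graph, separation to the order. A relation \<open>x <\<^sub>h y\<close> that is not an
  edge splits at an intermediate element into relations with smaller intervals.\<close>

lemma hle_hasse_path:
  assumes W: "WN_poset X" and "(x, y) \<in> hle X"
  shows "(x, y) \<in> (hasse_edges X)\<^sup>*"
  using assms(2)
proof (induction "card {z. (x, z) \<in> hle X \<and> (z, y) \<in> hle X}" arbitrary: x y rule: less_induct)
  case less
  let ?I = "\<lambda>x y. {z. (x, z) \<in> hle X \<and> (z, y) \<in> hle X}"
  note tr = transD[OF WN_D(4)[OF W]] and as = antisymD[OF WN_D(6)[OF W]]
  have V: "hle X \<subseteq> verts X \<times> verts X" using WN_D(2)[OF W] .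
  have fin: "finite (?I x y)" for x y
    by (rule finite_subset[OF _ WN_D(1)[OF W]]) (use V in auto)
  show ?case
  proof (cases "x = y \<or> (x, y) \<in> hasse_edges X")
    case False
    then obtain z where z: "z \<noteq> x" "z \<noteq> y" "(x, z) \<in> hle X" "(z, y) \<in> hle X"
      using less.prems by (auto simp: hasse_edges_def)
    have r: "(x, x) \<in> hle X" "(y, y) \<in> hle X" using less.prems V WN_D(8)[OF W] by auto
    have "?I x z \<subset> ?I x y" "?I z y \<subset> ?I x y"
      using z r less.prems by (auto intro: tr dest: as)
    then have "(x, z) \<in> (hasse_edges X)\<^sup>*" "(z, y) \<in> (hasse_edges X)\<^sup>*"
      using less.hyps z fin psubset_card_mono by meson+
    then show ?thesis by (rule rtrancl_trans)
  qed auto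
qed

lemma h_connected_iff:
  assumes W: "WN_poset X"
  shows "h_connected X \<longleftrightarrow> sum_irreducible (abs_wnp X)"
proof -
  let ?R = "(hasse_edges X \<union> (hasse_edges X)\<inverse>)\<^sup>*"
  have hR: "(x, y) \<in> ?R" if "h_comparable X x y" for x y
  proof -
    have "(x, y) \<in> hle X \<Longrightarrow> (x, y) \<in> ?R" for x y
      using hle_hasse_path[OF W] in_rtrancl_UnI by blast
    moreover have "sym ?R" by (simp add: sym_Un_converse sym_rtrancl)
    ultimately show ?thesis using that by (auto simp: h_comparable_def dest: symD)
  qed
  have "False" if c: "h_connected X" and A: "h_separated X A" for A
  proof -
    obtain a b where ab: "a \<in> A" "b \<in> verts X - A" using A by (auto simp: h_separated_def)
    have "(a, b) \<in> ?R" using c ab A by (auto simp: h_connected_def h_separated_def)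
    then have "b \<in> A"
    proof (induction rule: rtrancl_induct)
      case (step y z)
      then have "h_comparable X y z" by (auto simp: hasse_edges_def h_comparable_def)
      moreover have "z \<in> verts X" using step(2) WN_D(2)[OF W] by (auto simp: hasse_edges_def)
      ultimately show ?case using step(3) A by (auto simp: h_separated_def)
    qed (rule ab)
    then show False using ab by blast
  qed
  moreover have "\<exists>A. h_separated X A" if n: "\<not> h_connected X" "verts X \<noteq> {}"
  proof -
    obtain x y where xy: "x \<in> verts X" "y \<in> verts X" "(x, y) \<notin> ?R"
      using n by (auto simp: h_connected_def)
    have "h_separated X {z \<in> verts X. (x, z) \<in> ?R}"
      using xy hR by (auto simp: h_separated_def dest: rtrancl_trans)
    then show ?thesis by blast
  qed
  ultimately show ?thesis
    unfolding sum_irreducible_iff[OF W] by (auto simp: h_connected_def)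
qed

subsection \<open>Complement reducibility\<close>

definition separation :: "('a \<Rightarrow> 'a \<Rightarrow> bool) \<Rightarrow> 'a set \<Rightarrow> bool" where
  "separation E V \<longleftrightarrow> (\<exists>A\<subseteq>V. A \<noteq> {} \<and> A \<noteq> V \<and> (\<forall>a\<in>A. \<forall>b\<in>V - A. \<not> E a b))"

definition has_path4 :: "('a \<Rightarrow> 'a \<Rightarrow> bool) \<Rightarrow> 'a set \<Rightarrow> bool" where
  "has_path4 E V \<longleftrightarrow> (\<exists>a\<in>V. \<exists>b\<in>V. \<exists>c\<in>V. \<exists>d\<in>V. distinct [a, b, c, d] \<and>
     E a b \<and> E b c \<and> E c d \<and> \<not> E a c \<and> \<not> E a d \<and> \<not> E b d)"

lemma has_path4_complement:
  assumes "\<And>x y. E x y = E y x" "has_path4 (\<lambda>x y. \<not> E x y) V"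
  shows "has_path4 E V"
proof -
  from assms(2) obtain a b c d where "a \<in> V" "b \<in> V" "c \<in> V" "d \<in> V" "distinct [a, b, c, d]"
    "\<not> E a b" "\<not> E b c" "\<not> E c d" "E a c" "E a d" "E b d" by (auto simp: has_path4_def)
  then show ?thesis unfolding has_path4_def using assms(1)
    by (intro bexI[of _ c] bexI[of _ a] bexI[of _ d] bexI[of _ b]) auto
qed

text \<open>Adding a vertex \<open>v\<close> to a disconnected graph: if \<open>v\<close> is adjacent to both parts and not to all
  vertices, then some part contains both neighbours and non-neighbours of \<open>v\<close>. An edge between such
  vertices, extended by \<open>v\<close> and a neighbour in the other part, would be an induced path on four
  vertices; if there is no such edge, the non-neighbours in this part are separated.\<close>

lemma separation_insert:
  assumes sym: "\<And>x y. E x y = E y x" and no: "\<not> has_path4 E (insert v V)"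
    and v: "v \<notin> V" and s: "separation E V"
  shows "separation E (insert v V) \<or> separation (\<lambda>x y. \<not> E x y) (insert v V)"
proof (rule ccontr)
  assume "\<not> ?thesis"
  then have n1: "\<not> separation E (insert v V)" and n2: "\<not> separation (\<lambda>x y. \<not> E x y) (insert v V)"
    by auto
  from s obtain A where A: "A \<subseteq> V" "A \<noteq> {}" "A \<noteq> V" "\<forall>a\<in>A. \<forall>b\<in>V - A. \<not> E a b"
    by (auto simp: separation_def)
  have nb: "\<exists>x\<in>P. E v x" if "P = A \<or> P = V - A" for P
  proof (rule ccontr)
    assume nv: "\<not> ?thesis"
    have "\<not> E a b" if "a \<in> P" "b \<in> insert v V - P" for a b
    proof (cases "b = v")
      case True
      then show ?thesis using nv that sym[of a v] by blast
    next
      case False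
      then show ?thesis using that \<open>P = A \<or> P = V - A\<close> A(1,4) sym[of a b] by blast
    qed
    then have "P \<subseteq> insert v V \<and> P \<noteq> {} \<and> P \<noteq> insert v V \<and> (\<forall>a\<in>P. \<forall>b\<in>insert v V - P. \<not> E a b)"
      using that A(1-3) v by blast
    then show False using n1 unfolding separation_def by blast
  qed
  have "\<exists>w\<in>V. \<not> E v w"
  proof (rule ccontr)
    assume "\<not> ?thesis"
    then have "{v} \<subseteq> insert v V \<and> {v} \<noteq> {} \<and> {v} \<noteq> insert v V \<and>
        (\<forall>a\<in>{v}. \<forall>b\<in>insert v V - {v}. \<not> \<not> E a b)" using A v by auto
    then show False using n2 unfolding separation_def by blast
  qed
  then obtain w where w: "w \<in> V" "\<not> E v w" by blast
  define P where "P = (if w \<in> A then A else V - A)"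
  have P: "P = A \<or> P = V - A" "w \<in> P" "V - P = A \<or> V - P = V - A" "P \<subseteq> V"
    using w A(1) by (auto simp: P_def)
  have PQ: "\<not> E a b" "\<not> E b a" if "a \<in> P" "b \<in> V - P" for a b
    using A that sym by (auto simp: P_def split: if_splits)
  obtain z where z: "z \<in> V - P" "E v z" using nb[OF P(3)] by blast
  obtain x0 where x0: "x0 \<in> P" "E v x0" using nb[OF P(1)] by blast
  define M where "M = {y \<in> P. \<not> E v y}"
  have PM: "\<not> E x y" if "x \<in> P - M" "y \<in> M" for x y
  proof
    assume "E x y"
    then have "distinct [z, v, x, y] \<and> E z v \<and> E v x \<and> E x y \<and> \<not> E z x \<and> \<not> E z y \<and> \<not> E v y"
      using that z PQ sym v P(4) by (auto simp: M_def)
    moreover have "z \<in> insert v V" "v \<in> insert v V" "x \<in> insert v V" "y \<in> insert v V"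
      using z that P(4) by (auto simp: M_def)
    ultimately show False using no unfolding has_path4_def by blast
  qed
  have "\<not> E a b" if a: "a \<in> M" and b: "b \<in> insert v V - M" for a b
  proof -
    consider "b = v" | "b \<in> P - M" | "b \<in> V - P" using b by blast
    then show ?thesis
      using a PM[of b a] PQ(1)[of a b] sym[of a b] by cases (auto simp: M_def)
  qed
  moreover have "M \<subseteq> insert v V" "M \<noteq> {}" "M \<noteq> insert v V"
    using P w x0 v by (auto simp: M_def)
  ultimately show False using n1 unfolding separation_def by blast
qed

text \<open>The hypothesis is invariant under complementation, so adding the vertices one at a time, whichever of
  the graph and its complement is disconnected so far falls under the preceding lemma.\<close>

lemma complement_reducible:
  assumes "finite V" "card V \<ge> 2" and sym: "\<And>x y. E x y = E y x" and "\<not> has_path4 E V"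
  shows "separation E V \<or> separation (\<lambda>x y. \<not> E x y) V"
  using assms(1,2,4)
proof (induction V rule: finite_induct)
  case (insert v V)
  have no: "\<not> has_path4 E V" using insert.prems unfolding has_path4_def by blast
  have noc: "\<not> has_path4 (\<lambda>x y. \<not> E x y) (insert v V)"
    using has_path4_complement[of E] sym insert.prems by blast
  show ?case
  proof (cases "card V \<ge> 2")
    case True
    then have "separation E V \<or> separation (\<lambda>x y. \<not> E x y) V" using insert.IH no by blast
    then show ?thesis
      using separation_insert[of E v V] separation_insert[of "\<lambda>x y. \<not> E x y" v V] sym noc
        insert.prems insert.hyps(2) by auto
  next
    case False
    then have "card V = 1" using insert.prems insert.hyps by simp
    then obtain w where "V = {w}" by (rule card_1_singletonE)
    then have "separation E (insert v V) \<or> separation (\<lambda>x y. \<not> E x y) (insert v V)"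
      unfolding separation_def using insert.hyps(2)
      by (cases "E v w") (auto intro!: exI[of _ "{v}"])
    then show ?thesis .
  qed
qed simp

text \<open>On an induced path \<open>z <\<^sub>h v >\<^sub>h x <\<^sub>h y\<close> of the comparability graph, transitivity leaves only the
  two structures \<open>N\<^sub>2\<close> and \<open>N\<^sub>1\<close>, according to whether \<open>z\<close> or \<open>x\<close> comes first for \<open>\<le>\<^sub>r\<close>.\<close>

lemma has_subposet_NI:
  assumes W: "WN_poset X"
    and V: "z \<in> verts X" "v \<in> verts X" "x \<in> verts X" "y \<in> verts X" and d: "distinct [z, v, x, y]"
    and h: "(z, v) \<in> hle X" "(x, v) \<in> hle X" "(x, y) \<in> hle X"
    and n: "\<not> h_comparable X z x" "\<not> h_comparable X z y" "\<not> h_comparable X v y"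
  shows False
proof -
  note tr = transD[OF WN_D(5)[OF W]] and asr = antisymD[OF WN_D(7)[OF W]]
    and ash = antisymD[OF WN_D(6)[OF W]] and rf = WN_D(8)[OF W] WN_D(9)[OF W]
  have rc: "(a, b) \<in> rle X \<or> (b, a) \<in> rle X"
    if "\<not> h_comparable X a b" "a \<in> verts X" "b \<in> verts X" "a \<noteq> b" for a b
    using WN_D(10)[OF W, of a b] that by (auto simp: h_comparable_def)
  have hr: "(a, b) \<notin> rle X" "(b, a) \<notin> rle X" if "(a, b) \<in> hle X" "a \<noteq> b" for a b
    using WN_D(10)[OF W, of a b] WN_D(2)[OF W] that by auto
  have hs: "(b, a) \<notin> hle X" if "(a, b) \<in> hle X" "a \<noteq> b" for a b using ash that by blast
  have rs: "(b, a) \<notin> rle X" if "(a, b) \<in> rle X" "a \<noteq> b" for a b using asr that by blast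
  have D: "z \<noteq> v" "z \<noteq> x" "z \<noteq> y" "v \<noteq> x" "v \<noteq> y" "x \<noteq> y" using d by auto
  note facts = rf h n[unfolded h_comparable_def] hr[OF h(1) D(1)] hr[OF h(2) D(4)[symmetric]]
    hr[OF h(3) D(6)] hs[OF h(1) D(1)] hs[OF h(2) D(4)[symmetric]] hs[OF h(3) D(6)]
  have all4: "(\<forall>a\<in>{0, 1, 2, 3}. Q a) \<longleftrightarrow> Q 0 \<and> Q 1 \<and> Q 2 \<and> Q (3::nat)" for Q by auto
  \<comment> \<open>The direction of the relation between \<open>z\<close> and \<open>x\<close> propagates along the complementary path.\<close>
  consider "(z, x) \<in> rle X" | "(x, z) \<in> rle X" using rc[OF n(1) V(1,3) D(2)] by blast
  then show False
  proof cases
    case 1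
    then have 2: "(z, y) \<in> rle X" using rc[OF n(2) V(1,4) D(3)] tr hr[OF h(3) D(6)] by blast
    then have 3: "(v, y) \<in> rle X" using rc[OF n(3) V(2,4) D(5)] tr hr[OF h(1) D(1)] by blast
    let ?g = "\<lambda>i::nat. if i = 0 then z else if i = 1 then x else if i = 2 then v else y"
    have "has_subposet X N2"
      unfolding has_subposet_iff
    proof (intro exI[of _ ?g] conjI)
      show "inj_on ?g (verts N2)" using D by (auto simp: N2_def inj_on_def)
      show "?g ` verts N2 \<subseteq> verts X" using V by (auto simp: N2_def)
      show "\<forall>i\<in>verts N2. \<forall>j\<in>verts N2. ((?g i, ?g j) \<in> hle X \<longleftrightarrow> (i, j) \<in> hle N2) \<and>
          ((?g i, ?g j) \<in> rle X \<longleftrightarrow> (i, j) \<in> rle N2)"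
        using V facts 1 2 3 rs[OF 1 D(2)] rs[OF 2 D(3)] rs[OF 3 D(5)]
        by (simp add: N2_def Id_on_iff all4)
    qed
    then show False using W by (simp add: WN_poset_def)
  next
    case 2
    then have 3: "(y, z) \<in> rle X" using rc[OF n(2) V(1,4) D(3)] tr hr[OF h(3) D(6)] by blast
    then have 4: "(y, v) \<in> rle X" using rc[OF n(3) V(2,4) D(5)] tr hr[OF h(1) D(1)] by blast
    let ?g = "\<lambda>i::nat. if i = 0 then x else if i = 1 then z else if i = 2 then y else v"
    have "has_subposet X N1"
      unfolding has_subposet_iff
    proof (intro exI[of _ ?g] conjI)
      show "inj_on ?g (verts N1)" using D by (auto simp: N1_def inj_on_def)
      show "?g ` verts N1 \<subseteq> verts X" using V by (auto simp: N1_def)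
      show "\<forall>i\<in>verts N1. \<forall>j\<in>verts N1. ((?g i, ?g j) \<in> hle X \<longleftrightarrow> (i, j) \<in> hle N1) \<and>
          ((?g i, ?g j) \<in> rle X \<longleftrightarrow> (i, j) \<in> rle N1)"
        using V facts 2 3 4 rs[OF 2 D(2)[symmetric]] rs[OF 3 D(3)[symmetric]] rs[OF 4 D(5)[symmetric]]
        by (simp add: N1_def Id_on_iff all4)
    qed
    then show False using W by (simp add: WN_poset_def)
  qed
qed

lemma WN_no_path4:
  assumes W: "WN_poset X" shows "\<not> has_path4 (h_comparable X) (verts X)"
proof
  assume "has_path4 (h_comparable X) (verts X)"
  then obtain a b c d where V: "a \<in> verts X" "b \<in> verts X" "c \<in> verts X" "d \<in> verts X"
    and D: "distinct [a, b, c, d]" and E: "h_comparable X a b" "h_comparable X b c" "h_comparable X c d"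
    and n: "\<not> h_comparable X a c" "\<not> h_comparable X a d" "\<not> h_comparable X b d"
    unfolding has_path4_def by blast
  note tr = transD[OF WN_D(4)[OF W]]
  consider "(a, b) \<in> hle X" "(c, b) \<in> hle X" "(c, d) \<in> hle X"
    | "(b, a) \<in> hle X" "(b, c) \<in> hle X" "(d, c) \<in> hle X"
    using E n tr unfolding h_comparable_def by meson
  then show False
  proof cases
    case 1 then show False using has_subposet_NI[OF W V D] n by blast
  next
    case 2
    then show False using has_subposet_NI[OF W V(4,3,2,1)] D n by (auto simp: h_comparable_def)
  qed
qed

text \<open>Irreducibility for the horizontal concatenation means that the comparability graph of \<open>\<le>\<^sub>h\<close> is
  connected, for the vertical one that its complement is. For a graph without induced path on four vertices
  with at least two vertices these exclude each other.\<close>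

lemma irreducible_point:
  assumes "sum_irreducible P" "ser_irreducible P"
  obtains d where "P = wnp_point d"
proof -
  obtain X where X: "WN_poset X" "P = abs_wnp X" by (rule wnp_cases)
  note WS = WN_swap_decposet[OF X(1)]
  have 1: "verts X \<noteq> {}" "\<not> (\<exists>A. h_separated X A)"
    using assms(1) X by (simp_all add: sum_irreducible_iff)
  have 2: "\<not> (\<exists>A. h_separated (swap_decposet X) A)"
    using assms(2) X by (simp add: ser_irreducible_def wnp_swap_abs sum_irreducible_iff WS)
  have fin: "finite (verts X)" using WN_D(1) X by blast
  have "\<not> card (verts X) \<ge> 2"
  proof
    assume c: "card (verts X) \<ge> 2"
    have "\<not> separation (h_comparable X) (verts X)"
      using 1(2) unfolding separation_def h_separated_def by blast
    moreover have "\<not> separation (\<lambda>x y. \<not> h_comparable X x y) (verts X)"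
    proof
      assume "separation (\<lambda>x y. \<not> h_comparable X x y) (verts X)"
      then obtain A where A: "A \<subseteq> verts X" "A \<noteq> {}" "A \<noteq> verts X"
        "\<forall>a\<in>A. \<forall>b\<in>verts X - A. h_comparable X a b" unfolding separation_def by blast
      have "\<not> h_comparable (swap_decposet X) a b" if "a \<in> A" "b \<in> verts X - A" for a b
      proof -
        have "a \<noteq> b" "a \<in> verts X" "b \<in> verts X" "h_comparable X a b" using that A by auto
        then show ?thesis using WN_D(10)[OF X(1), of a b] by (auto simp: h_comparable_def)
      qed
      then have "h_separated (swap_decposet X) A" using A by (simp add: h_separated_def)
      then show False using 2 by blast
    qed
    ultimately show False
      using complement_reducible[OF fin c, of "h_comparable X"] WN_no_path4[OF X(1)]
      by (auto simp: h_comparable_def)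
  qed
  then have "card (verts X) = 1" using 1(1) fin card_gt_0_iff[of "verts X"] by linarith
  then obtain x where x: "verts X = {x}" by (rule card_1_singletonE)
  then have r: "hle X = {(x, x)}" "rle X = {(x, x)}" using WN_D(2,3,8,9)[OF X(1)] by auto
  have "decposet_isomorphic X (point_decposet (dec X x))"
    by (rule decposet_isomorphicI[where f = "\<lambda>_. 0"]) (auto simp: point_decposet_def x r bij_betw_def)
  then have "P = wnp_point (dec X x)"
    using X WN_point_decposet abs_wnp_eqI by (metis wnp_point.abs_eq)
  then show ?thesis by (rule that)
qed

text \<open>Each element of the lower part is comparable to each element of the upper part, so a separated set that
  meets one of them contains the other, and then both.\<close>

lemma ser_reducible_sum_irreducible:
  assumes "P \<noteq> wnp_empty" "Q \<noteq> wnp_empty"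
  shows "sum_irreducible (wnp_ser P Q)"
proof -
  obtain X where X: "WN_poset X" "wnp_sum (wnp_swap P) (wnp_swap Q) = abs_wnp X" by (rule wnp_cases)
  obtain A B where AB: "r_split X A B" "abs_wnp (subposet X A) = wnp_swap P"
    "abs_wnp (subposet X B) = wnp_swap Q" using wnp_sum_eq_abs[OF X(1)] X(2) by metis
  have V: "verts X = A \<union> B" using AB(1) by (auto simp: r_split_def)
  then have ne: "A \<noteq> {}" "B \<noteq> {}"
    using assms AB abs_wnp_empty[OF WN_poset_subposet[OF X(1)]]
    by (metis Un_upper1 subposet_simps(1) wnp_swap_empty)
      (metis AB(3) V X(1) WN_poset_subposet abs_wnp_empty assms(2) Un_upper2 subposet_simps(1) wnp_swap_empty)
  have cmp: "h_comparable (swap_decposet X) a b" if "a \<in> A" "b \<in> B" for a b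
    using AB(1) that by (auto simp: r_split_def h_comparable_def)
  have "\<not> h_separated (swap_decposet X) C" for C
  proof
    assume C: "h_separated (swap_decposet X) C"
    then have c: "C \<subseteq> A \<union> B" "C \<noteq> {}" "C \<noteq> A \<union> B"
      "\<And>x y. x \<in> C \<Longrightarrow> y \<in> A \<union> B \<Longrightarrow> y \<notin> C \<Longrightarrow> \<not> h_comparable (swap_decposet X) x y"
      using V by (auto simp: h_separated_def)
    have sym: "h_comparable (swap_decposet X) x y = h_comparable (swap_decposet X) y x" for x y
      by (auto simp: h_comparable_def)
    have "C = A \<union> B" using c cmp sym ne by blast
    then show False using c(3) by simp
  qed
  then show ?thesis
    unfolding wnp_ser_def X(2) wnp_swap_abs[OF X(1)] sum_irreducible_iff[OF WN_swap_decposet[OF X(1)]]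
    using V ne by simp
qed

section \<open>The product dual to cutting along ideals\<close>

text \<open>The coproduct that cuts a poset along its ideals, as a functional: \<open>cop_sum R F\<close> is the sum of
  \<open>F R\<^sub>1 R\<^sub>2\<close> over the terms \<open>R\<^sub>1 \<otimes> R\<^sub>2\<close> of the coproduct of \<open>R\<close>. In this form, coefficients of products
  and identities between them are handled without linear combinations in tensor powers.\<close>

definition cop_sum :: "'d wnp \<Rightarrow> ('d wnp \<Rightarrow> 'd wnp \<Rightarrow> 'a::comm_monoid_add) \<Rightarrow> 'a" where
  "cop_sum R F = (\<Sum>I | h_ideal (rep_wnp R) I.
     F (abs_wnp (subposet (rep_wnp R) (verts (rep_wnp R) - I))) (abs_wnp (subposet (rep_wnp R) I)))"

lemma finite_h_ideals: "WN_poset X \<Longrightarrow> finite {I. h_ideal X I}"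
  by (rule finite_subset[of _ "Pow (verts X)"]) (auto simp: h_ideal_def WN_D(1))

lemma abs_subposet_iso:
  assumes W: "WN_poset X" "WN_poset Y" and S: "S \<subseteq> verts X"
    and f: "bij_betw f (verts X) (verts Y)"
    "\<And>x y. x \<in> verts X \<Longrightarrow> y \<in> verts X \<Longrightarrow> (f x, f y) \<in> hle Y \<longleftrightarrow> (x, y) \<in> hle X"
    "\<And>x y. x \<in> verts X \<Longrightarrow> y \<in> verts X \<Longrightarrow> (f x, f y) \<in> rle Y \<longleftrightarrow> (x, y) \<in> rle X"
    "\<And>x. x \<in> verts X \<Longrightarrow> dec Y (f x) = dec X x"
  shows "abs_wnp (subposet Y (f ` S)) = abs_wnp (subposet X S)"
proof (rule abs_wnp_eqI[symmetric])
  have "f ` S \<subseteq> verts Y" using S f(1) by (auto simp: bij_betw_def)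
  then show "WN_poset (subposet X S)" "WN_poset (subposet Y (f ` S))"
    using W S by (auto intro: WN_poset_subposet)
  show "decposet_isomorphic (subposet X S) (subposet Y (f ` S))"
  proof (rule decposet_isomorphicI[where f = f])
    show "bij_betw f (verts (subposet X S)) (verts (subposet Y (f ` S)))"
      using f(1) S by (auto simp: bij_betw_def intro: inj_on_subset)
  qed (use S f in \<open>auto simp: subset_iff\<close>)
qed

lemma cop_sum_abs:
  assumes W: "WN_poset X"
  shows "cop_sum (abs_wnp X) F =
    (\<Sum>I | h_ideal X I. F (abs_wnp (subposet X (verts X - I))) (abs_wnp (subposet X I)))"
proof -
  let ?Y = "rep_wnp (abs_wnp X)"
  note WY = WN_rep_wnp[of "abs_wnp X"]
  from rep_abs_wnp[OF W] obtain f where f: "bij_betw f (verts X) (verts ?Y)"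
    "\<And>x y. x \<in> verts X \<Longrightarrow> y \<in> verts X \<Longrightarrow> (f x, f y) \<in> hle ?Y \<longleftrightarrow> (x, y) \<in> hle X"
    "\<And>x y. x \<in> verts X \<Longrightarrow> y \<in> verts X \<Longrightarrow> (f x, f y) \<in> rle ?Y \<longleftrightarrow> (x, y) \<in> rle X"
    "\<And>x. x \<in> verts X \<Longrightarrow> dec ?Y (f x) = dec X x"
    by (rule decposet_isomorphicE) blast
  note sub = abs_subposet_iso[OF W WY _ f]
  have fV: "f ` verts X = verts ?Y" and inj: "inj_on f (verts X)" using f(1) by (auto simp: bij_betw_def)
  have id: "h_ideal ?Y (f ` I) \<longleftrightarrow> h_ideal X I" if "I \<subseteq> verts X" for I
    using that f(2) inj unfolding h_ideal_def fV[symmetric]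
    by (auto simp: image_mono subset_iff inj_on_image_mem_iff[OF inj _ that])
  have "bij_betw ((`) f) {I. h_ideal X I} {I. h_ideal ?Y I}"
  proof (rule bij_betw_imageI)
    show "inj_on ((`) f) {I. h_ideal X I}"
      by (rule inj_on_subset[OF inj_on_image_Pow[OF inj]]) (auto simp: h_ideal_def)
    show "(`) f ` {I. h_ideal X I} = {I. h_ideal ?Y I}"
    proof (intro equalityI subsetI)
      fix J assume "J \<in> (`) f ` {I. h_ideal X I}"
      then obtain I where I: "J = f ` I" "h_ideal X I" by blast
      then have "I \<subseteq> verts X" by (simp add: h_ideal_def)
      then show "J \<in> {I. h_ideal ?Y I}" using id I by blast
    next
      fix J assume J: "J \<in> {I. h_ideal ?Y I}"
      then obtain I where "I \<subseteq> verts X" "J = f ` I"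
        unfolding h_ideal_def fV[symmetric] by (auto simp: subset_image_iff)
      then show "J \<in> (`) f ` {I. h_ideal X I}" using id J by auto
    qed
  qed
  from sum.reindex_bij_betw[OF this, symmetric] show ?thesis
    unfolding cop_sum_def
  proof (rule trans[OF _ sum.cong[OF refl]])
    fix I assume "I \<in> {I. h_ideal X I}"
    then have I: "I \<subseteq> verts X" by (auto simp: h_ideal_def)
    have "verts ?Y - f ` I = f ` (verts X - I)"
      using inj I by (simp add: fV[symmetric] inj_on_image_set_diff)
    then show "F (abs_wnp (subposet ?Y (verts ?Y - f ` I))) (abs_wnp (subposet ?Y (f ` I))) =
        F (abs_wnp (subposet X (verts X - I))) (abs_wnp (subposet X I))"
      using sub[of I] sub[of "verts X - I"] I by simp
  qed
qed

lemma cop_sum_sum: "cop_sum R (\<lambda>a b. \<Sum>s\<in>S. F s a b) = (\<Sum>s\<in>S. cop_sum R (F s))"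
  unfolding cop_sum_def by (rule sum.swap)

lemma cop_sum_times:
  fixes c :: "'a::comm_semiring_0"
  shows "c * cop_sum R F = cop_sum R (\<lambda>a b. c * F a b)" "cop_sum R F * c = cop_sum R (\<lambda>a b. F a b * c)"
  by (simp_all add: cop_sum_def sum_distrib_left sum_distrib_right)

lemma ser_r_split:
  assumes "WN_poset X"
  shows "abs_wnp X = wnp_ser P Q \<longleftrightarrow> (\<exists>A B. r_split (swap_decposet X) A B \<and>
    abs_wnp (subposet X A) = P \<and> abs_wnp (subposet X B) = Q)" (is "?L \<longleftrightarrow> ?R")
proof -
  note WS = WN_swap_decposet[OF assms]
  have sub: "WN_poset (subposet X S)" if "S \<subseteq> verts X" for S
    using WN_poset_subposet[OF assms that] .
  have sw: "wnp_swap (abs_wnp (subposet (swap_decposet X) S)) = abs_wnp (subposet X S)"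
    if "S \<subseteq> verts X" for S
    using sub[OF that] by (simp add: wnp_swap_abs WN_swap_decposet)
  have V: "A \<subseteq> verts X" "B \<subseteq> verts X" if "r_split (swap_decposet X) A B" for A B
    using that by (auto simp: r_split_def)
  have "?L \<longleftrightarrow> abs_wnp (swap_decposet X) = wnp_sum (wnp_swap P) (wnp_swap Q)"
    unfolding wnp_ser_def wnp_swap_abs[OF assms, symmetric] by (metis wnp_swap_swap)
  also have "\<dots> \<longleftrightarrow> ?R"
    using wnp_sum_eq_abs[OF WS] wnp_sum_r_split[OF WS] sw V by (metis wnp_swap_swap)
  finally show ?thesis .
qed

lemma size_abs: "WN_poset X \<Longrightarrow> wnp_size (abs_wnp X) = card (verts X)"
  by (simp add: wnp_size_def wnp_mdec_abs)

text \<open>If \<open>I\<close> is an ideal, then no element of \<open>I\<close> is below one of the complement, so the number of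
  relations is maximal, among all posets with these two parts, exactly for the vertical
  concatenation.\<close>

lemma card_hle_ideal:
  assumes W: "WN_poset X" and I: "h_ideal X I"
  shows "card (hle X) = card (hle (subposet X (verts X - I))) + card (hle (subposet X I)) +
    card (hle X \<inter> (verts X - I) \<times> I)"
proof -
  have f: "finite (hle X)"
    by (rule finite_subset[OF WN_D(2)[OF W]]) (simp add: WN_D(1)[OF W])
  have "hle X = (hle X \<inter> (verts X - I) \<times> (verts X - I)) \<union> (hle X \<inter> I \<times> I) \<union>
      (hle X \<inter> (verts X - I) \<times> I)"
    using WN_D(2)[OF W] I by (auto simp: h_ideal_def)
  then have "card (hle X) = card ((hle X \<inter> (verts X - I) \<times> (verts X - I)) \<union> (hle X \<inter> I \<times> I) \<union>
      (hle X \<inter> (verts X - I) \<times> I))" by simp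
  also have "\<dots> = card ((hle X \<inter> (verts X - I) \<times> (verts X - I)) \<union> (hle X \<inter> I \<times> I)) +
      card (hle X \<inter> (verts X - I) \<times> I)"
    using f by (intro card_Un_disjoint) auto
  also have "card ((hle X \<inter> (verts X - I) \<times> (verts X - I)) \<union> (hle X \<inter> I \<times> I)) =
      card (hle X \<inter> (verts X - I) \<times> (verts X - I)) + card (hle X \<inter> I \<times> I)"
    using f by (intro card_Un_disjoint) auto
  finally show ?thesis by simp
qed

lemma r_split_swap_ideal:
  assumes W: "WN_poset X" and s: "r_split (swap_decposet X) A B"
  shows "h_ideal X B" "verts X - B = A" "A \<times> B \<subseteq> hle X"
proof -
  show "A \<times> B \<subseteq> hle X" and V: "verts X - B = A" using s by (auto simp: r_split_def)
  then show "h_ideal X B"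
    using s antisymD[OF WN_D(6)[OF W]] by (fastforce simp: h_ideal_def r_split_def)
qed

lemma wnp_hrel_ser: "wnp_hrel (wnp_ser P Q) = wnp_hrel P + wnp_hrel Q + wnp_size P * wnp_size Q"
proof -
  obtain X where X: "WN_poset X" "wnp_ser P Q = abs_wnp X" by (rule wnp_cases)
  then obtain A B where AB: "r_split (swap_decposet X) A B" "abs_wnp (subposet X A) = P"
    "abs_wnp (subposet X B) = Q" using ser_r_split by metis
  note i = r_split_swap_ideal[OF X(1) AB(1)]
  have V: "A \<subseteq> verts X" "B \<subseteq> verts X" using AB(1) by (auto simp: r_split_def)
  have f: "finite A" "finite B" using V WN_D(1)[OF X(1)] finite_subset by auto
  have "hle X \<inter> (A \<times> B) = A \<times> B" using i(3) by auto
  then show ?thesis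
    using card_hle_ideal[OF X(1) i(1)] X AB(2,3) WN_poset_subposet[OF X(1) V(1)]
      WN_poset_subposet[OF X(1) V(2)] i(2) f
    by (auto simp: wnp_hrel_abs size_abs card_cartesian_product)
qed

text \<open>A necessary condition for \<open>R\<close> to have an ideal of class \<open>Q\<close> with complement of class \<open>P\<close>. It contains all that
  the inductions use about the terms of the coproduct.\<close>

definition ideal_cut :: "'d wnp \<Rightarrow> 'd wnp \<Rightarrow> 'd wnp \<Rightarrow> bool" where
  "ideal_cut R P Q \<longleftrightarrow> wnp_mdec R = wnp_mdec P + wnp_mdec Q \<and>
     (R = wnp_ser P Q \<or> wnp_hrel R < wnp_hrel (wnp_ser P Q))"

lemma ideal_cut_ideal:
  assumes W: "WN_poset X" and I: "h_ideal X I"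
  shows "ideal_cut (abs_wnp X) (abs_wnp (subposet X (verts X - I))) (abs_wnp (subposet X I))"
proof -
  let ?J = "verts X - I"
  have IV: "I \<subseteq> verts X" using I by (simp add: h_ideal_def)
  have f: "finite I" "finite ?J" using IV WN_D(1)[OF W] finite_subset by auto
  have WI: "WN_poset (subposet X I)" "WN_poset (subposet X ?J)"
    using WN_poset_subposet[OF W] IV by auto
  have "mset_set (verts X) = mset_set (?J \<union> I)" using IV by (simp add: Un_absorb2)
  also have "\<dots> = mset_set ?J + mset_set I" using f by (intro mset_set_Union) auto
  finally have "wnp_mdec (abs_wnp X) = wnp_mdec (abs_wnp (subposet X ?J)) + wnp_mdec (abs_wnp (subposet X I))"
    using W WI by (simp add: wnp_mdec_abs)
  moreover have "abs_wnp X = wnp_ser (abs_wnp (subposet X ?J)) (abs_wnp (subposet X I))"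
    if "?J \<times> I \<subseteq> hle X"
    unfolding ser_r_split[OF W] using that IV
    by (intro exI[of _ ?J] exI[of _ I]) (auto simp: r_split_def)
  moreover have "wnp_hrel (abs_wnp X) < wnp_hrel (wnp_ser (abs_wnp (subposet X ?J)) (abs_wnp (subposet X I)))"
    if "\<not> ?J \<times> I \<subseteq> hle X"
  proof -
    have "hle X \<inter> ?J \<times> I \<subset> ?J \<times> I" using that by auto
    then have "card (hle X \<inter> ?J \<times> I) < card ?J * card I"
      using psubset_card_mono[of "?J \<times> I"] f by (simp add: card_cartesian_product)
    then show ?thesis
      using card_hle_ideal[OF W I] W WI by (simp add: wnp_hrel_ser wnp_hrel_abs size_abs)
  qed
  ultimately show ?thesis unfolding ideal_cut_def by blast
qed

lemma cop_sum_cong: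
  assumes "\<And>a b. ideal_cut R a b \<Longrightarrow> F a b = G a b"
  shows "cop_sum R F = cop_sum R G"
  unfolding cop_sum_def
  by (rule sum.cong[OF refl], rule assms)
    (use ideal_cut_ideal[OF WN_rep_wnp[of R]] abs_rep_wnp[of R] in auto)

lemma cop_sum_zero: "(\<And>a b. ideal_cut R a b \<Longrightarrow> F a b = 0) \<Longrightarrow> cop_sum R F = 0"
  using cop_sum_cong[of R F "\<lambda>_ _. 0"] by (simp add: cop_sum_def)

text \<open>An ideal of a vertical concatenation is contained in the upper part or contains it, so the upper part is
  the only ideal of its cardinality, and the leading coefficient of a product is \<open>1\<close> in any characteristic.\<close>

lemma cop_sum_wnp_ser:
  assumes "\<And>a b. (a, b) \<noteq> (P, Q) \<Longrightarrow> F a b = 0"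
  shows "cop_sum (wnp_ser P Q) F = F P Q"
proof -
  obtain X where X: "WN_poset X" "wnp_ser P Q = abs_wnp X" by (rule wnp_cases)
  then obtain A B where AB: "r_split (swap_decposet X) A B" "abs_wnp (subposet X A) = P"
    "abs_wnp (subposet X B) = Q" using ser_r_split by metis
  note i = r_split_swap_ideal[OF X(1) AB(1)]
  have V: "B \<subseteq> verts X" using AB(1) by (auto simp: r_split_def)
  have z: "F (abs_wnp (subposet X (verts X - I))) (abs_wnp (subposet X I)) = 0"
    if I: "h_ideal X I" "I \<noteq> B" for I
  proof (rule assms, rule notI)
    assume e: "(abs_wnp (subposet X (verts X - I)), abs_wnp (subposet X I)) = (P, Q)"
    have IV: "I \<subseteq> verts X" using I by (simp add: h_ideal_def)
    have f: "finite I" "finite B" using IV V WN_D(1)[OF X(1)] finite_subset by auto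
    have "card I = card B"
      using e AB(3) size_abs[OF WN_poset_subposet[OF X(1) IV]] size_abs[OF WN_poset_subposet[OF X(1) V]]
      by simp
    moreover have "I \<subseteq> B \<or> B \<subseteq> I"
    proof (rule ccontr)
      assume "\<not> ?thesis"
      then obtain x y where xy: "x \<in> I" "x \<notin> B" "y \<in> B" "y \<notin> I" by blast
      then have "(x, y) \<in> hle X" using i(2,3) IV by blast
      then show False using xy I(1) V by (auto simp: h_ideal_def)
    qed
    ultimately show False using I(2) f card_subset_eq by metis
  qed
  have "cop_sum (wnp_ser P Q) F =
      (\<Sum>I\<in>{I. h_ideal X I}. if I = B then F P Q else 0)"
    unfolding X(2) cop_sum_abs[OF X(1)]
    using z i AB(2,3) by (intro sum.cong) auto
  also have "\<dots> = F P Q" using i(1) finite_h_ideals[OF X(1)] by simp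
  finally show ?thesis .
qed

text \<open>Both sides sum over the chains \<open>J \<subseteq> K\<close> of ideals: on the left \<open>J\<close> is cut off first, on the right \<open>K\<close>.\<close>

lemma cop_sum_coassoc:
  fixes F :: "'d wnp \<Rightarrow> 'd wnp \<Rightarrow> 'd wnp \<Rightarrow> 'b::comm_monoid_add"
  shows "cop_sum R (\<lambda>a c. cop_sum a (\<lambda>a1 a2. F a1 a2 c)) = cop_sum R (\<lambda>a b. cop_sum b (F a))"
proof -
  obtain X where X: "WN_poset X" "R = abs_wnp X" by (rule wnp_cases)
  let ?V = "verts X" and ?s = "\<lambda>S. abs_wnp (subposet X S)"
  have sub: "cop_sum (?s S) G = (\<Sum>J | h_ideal (subposet X S) J. G (?s (S - J)) (?s J))"
    if "S \<subseteq> ?V" for S and G :: "_ \<Rightarrow> _ \<Rightarrow> 'b"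
    unfolding cop_sum_abs[OF WN_poset_subposet[OF X(1) that]]
    by (intro sum.cong) (auto simp: subposet_subposet h_ideal_def)
  have fin: "finite {J. h_ideal (subposet X S) J}" if "S \<subseteq> ?V" for S
    using finite_h_ideals WN_poset_subposet[OF X(1) that] by blast
  have "cop_sum R (\<lambda>a c. cop_sum a (\<lambda>a1 a2. F a1 a2 c)) =
      (\<Sum>I | h_ideal X I. \<Sum>J | h_ideal (subposet X (?V - I)) J. F (?s (?V - I - J)) (?s J) (?s I))"
    unfolding X(2) cop_sum_abs[OF X(1)] by (intro sum.cong) (auto simp: sub)
  also have "\<dots> = (\<Sum>(I, J)\<in>(SIGMA I:{I. h_ideal X I}. {J. h_ideal (subposet X (?V - I)) J}).
      F (?s (?V - I - J)) (?s J) (?s I))"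
    by (rule sum.Sigma) (auto simp: finite_h_ideals X fin)
  also have "\<dots> = (\<Sum>(I, J)\<in>(SIGMA I:{I. h_ideal X I}. {J. h_ideal (subposet X I) J}).
      F (?s (?V - I)) (?s (I - J)) (?s J))"
  \<comment> \<open>An ideal \<open>J\<close> of the complement of \<open>I\<close> corresponds to the ideal \<open>I \<union> J\<close> that contains \<open>I\<close>.\<close>
  proof (rule sum.reindex_bij_witness[of _ "\<lambda>(K, L). (L, K - L)" "\<lambda>(I, J). (I \<union> J, I)"], goal_cases)
    case (1 p) then show ?case by (auto simp: h_ideal_def)
  next
    case (2 p) then show ?case by (fastforce simp: h_ideal_def)
  next
    case (3 p) then show ?case by (auto simp: h_ideal_def)
  next
    case (4 p) then show ?case by (fastforce simp: h_ideal_def)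
  next
    case (5 p)
    then obtain I J where p: "p = (I, J)" "h_ideal X I" "h_ideal (subposet X (?V - I)) J" by auto
    then have "?V - (I \<union> J) = ?V - I - J" "(I \<union> J) - I = J" by (auto simp: h_ideal_def)
    then show ?case using p by simp
  qed
  also have "\<dots> = (\<Sum>I | h_ideal X I. \<Sum>J | h_ideal (subposet X I) J. F (?s (?V - I)) (?s (I - J)) (?s J))"
    using fin by (intro sum.Sigma[symmetric] finite_h_ideals[OF X(1)]) (auto simp: h_ideal_def[of X])
  also have "\<dots> = cop_sum R (\<lambda>a b. cop_sum b (F a))"
    unfolding X(2) cop_sum_abs[OF X(1)] by (intro sum.cong) (auto simp: sub h_ideal_def)
  finally show ?thesis .
qed

lemma abs_subposet_empty: "WN_poset X \<Longrightarrow> S \<subseteq> verts X \<Longrightarrow> abs_wnp (subposet X S) = wnp_empty \<longleftrightarrow> S = {}"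
  using abs_wnp_empty[OF WN_poset_subposet] by simp

lemma cop_sum_empty_left: "cop_sum R (\<lambda>a b. if a = wnp_empty then F b else 0) = F R"
  and cop_sum_empty_right: "cop_sum R (\<lambda>a b. if b = wnp_empty then F a else 0) = F R"
proof -
  obtain X where X: "WN_poset X" "R = abs_wnp X" by (rule wnp_cases)
  have i: "h_ideal X {}" "h_ideal X (verts X)" by (auto simp: h_ideal_def)
  have "cop_sum R (\<lambda>a b. if a = wnp_empty then F b else 0) =
      (\<Sum>I\<in>{I. h_ideal X I}. if I = verts X then F R else 0)"
    unfolding X(2) cop_sum_abs[OF X(1)]
    by (intro sum.cong) (auto simp: abs_subposet_empty[OF X(1)] subposet_verts[OF X(1)] h_ideal_def)
  then show "cop_sum R (\<lambda>a b. if a = wnp_empty then F b else 0) = F R"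
    using i finite_h_ideals[OF X(1)] by simp
  have "cop_sum R (\<lambda>a b. if b = wnp_empty then F a else 0) =
      (\<Sum>I\<in>{I. h_ideal X I}. if I = {} then F R else 0)"
    unfolding X(2) cop_sum_abs[OF X(1)]
    by (intro sum.cong) (auto simp: abs_subposet_empty[OF X(1)] subposet_verts[OF X(1)] h_ideal_def)
  then show "cop_sum R (\<lambda>a b. if b = wnp_empty then F a else 0) = F R"
    using i finite_h_ideals[OF X(1)] by simp
qed

lemma cop_sum_wnp_empty: "cop_sum wnp_empty F = F wnp_empty wnp_empty"
proof -
  have "cop_sum wnp_empty F = cop_sum wnp_empty (\<lambda>a b. if a = wnp_empty then F wnp_empty b else 0)"
    by (rule cop_sum_cong) (auto simp: ideal_cut_def)
  then show ?thesis by (simp add: cop_sum_empty_left)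
qed

text \<open>The ideals of a horizontal concatenation are the pairs of ideals of the two parts.\<close>

lemma cop_sum_wnp_sum:
  "cop_sum (wnp_sum P Q) F =
     cop_sum P (\<lambda>a b. cop_sum Q (\<lambda>c d. F (wnp_sum a c) (wnp_sum b d)))"
proof -
  obtain X where X: "WN_poset X" "wnp_sum P Q = abs_wnp X" by (rule wnp_cases)
  then obtain A B where AB: "r_split X A B" "abs_wnp (subposet X A) = P"
    "abs_wnp (subposet X B) = Q" using wnp_sum_eq_abs by metis
  have V: "A \<union> B = verts X" "A \<inter> B = {}" using AB(1) by (auto simp: r_split_def)
  have WA: "WN_poset (subposet X A)" "WN_poset (subposet X B)"
    using WN_poset_subposet[OF X(1)] V by auto
  let ?s = "\<lambda>S. abs_wnp (subposet X S)"
  have nh: "(x, y) \<notin> hle X" "(y, x) \<notin> hle X" if "x \<in> A" "y \<in> B" for x y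
    using WN_r_not_h[OF X(1), of x y] AB(1) that by (auto simp: r_split_def)
  have s: "?s S = wnp_sum (?s (S \<inter> A)) (?s (S \<inter> B))" if "S \<subseteq> verts X" for S
  proof -
    have "r_split (subposet X S) (S \<inter> A) (S \<inter> B)"
      using AB(1) that by (auto simp: r_split_def)
    from wnp_sum_r_split[OF WN_poset_subposet[OF X(1) that] this] show ?thesis
      by (simp add: subposet_subposet)
  qed
  have "cop_sum (wnp_sum P Q) F = (\<Sum>I | h_ideal X I. F (?s (verts X - I)) (?s I))"
    unfolding X(2) by (rule cop_sum_abs[OF X(1)])
  also have "\<dots> = (\<Sum>(I, J)\<in>{I. h_ideal (subposet X A) I} \<times> {J. h_ideal (subposet X B) J}.
      F (wnp_sum (?s (A - I)) (?s (B - J))) (wnp_sum (?s I) (?s J)))"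
  proof (rule sum.reindex_bij_witness[of _ "\<lambda>(I, J). I \<union> J" "\<lambda>I. (I \<inter> A, I \<inter> B)"], goal_cases)
    case (1 I) then show ?case using V by (auto simp: h_ideal_def)
  next
    case (2 I) then show ?case using V(1)[symmetric] by (auto simp: h_ideal_def)
  next
    case (3 p) then show ?case using V by (auto simp: h_ideal_def)
  next
    case (4 p)
    then obtain I J where p: "p = (I, J)" "h_ideal (subposet X A) I" "h_ideal (subposet X B) J" by auto
    then have "h_ideal X (I \<union> J)"
      using V(1)[symmetric] nh unfolding h_ideal_def subposet_simps by blast
    then show ?case using p by simp
  next
    case (5 I)
    then have I: "I \<subseteq> verts X" by (simp add: h_ideal_def)
    have "(verts X - I) \<inter> A = A - I \<inter> A" "(verts X - I) \<inter> B = B - I \<inter> B" using V by auto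
    then show ?case using s[OF I] s[of "verts X - I"] by simp
  qed
  also have "\<dots> = (\<Sum>I | h_ideal (subposet X A) I. \<Sum>J | h_ideal (subposet X B) J.
      F (wnp_sum (?s (A - I)) (?s (B - J))) (wnp_sum (?s I) (?s J)))"
    by (simp add: sum.cartesian_product)
  also have "\<dots> = cop_sum P (\<lambda>a b. cop_sum Q (\<lambda>c d. F (wnp_sum a c) (wnp_sum b d)))"
    unfolding AB(2,3)[symmetric] cop_sum_abs[OF WA(1)] cop_sum_abs[OF WA(2)]
    by (intro sum.cong refl) (auto simp: subposet_subposet h_ideal_def)
  finally show ?thesis .
qed

lemma cop_sum_map_dec:
  "cop_sum (wnp_map_dec f R) F = cop_sum R (\<lambda>a b. F (wnp_map_dec f a) (wnp_map_dec f b))"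
proof -
  obtain X where X: "WN_poset X" "R = abs_wnp X" by (rule wnp_cases)
  have m: "wnp_map_dec f (abs_wnp (subposet X S)) = abs_wnp (subposet (map_dec_decposet f X) S)"
    if "S \<subseteq> verts X" for S
  proof -
    have "map_dec_decposet f (subposet X S) = subposet (map_dec_decposet f X) S"
      by (simp add: map_dec_decposet_def subposet_def)
    then show ?thesis using wnp_map_dec_abs[OF WN_poset_subposet[OF X(1) that], of f] by metis
  qed
  show ?thesis
    unfolding X(2) wnp_map_dec_abs[OF X(1)] cop_sum_abs[OF X(1)]
      cop_sum_abs[OF WN_map_dec_decposet[OF X(1)]]
    by (intro sum.cong) (auto simp: h_ideal_def m)
qed

lemma wnp_map_dec_sum: "wnp_map_dec f (wnp_sum P Q) = wnp_sum (wnp_map_dec f P) (wnp_map_dec f Q)"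
proof -
  obtain X Y where X: "WN_poset X" "P = abs_wnp X" and Y: "WN_poset Y" "Q = abs_wnp Y"
    by (metis wnp_cases)
  have "decposet_isomorphic (map_dec_decposet f (sum_decposet X Y))
      (sum_decposet (map_dec_decposet f X) (map_dec_decposet f Y))"
    by (rule decposet_isomorphicI[where f = id]) (auto simp: sum_decposet_simps(2-) id_def[symmetric]
        set_eq_iff bij_betw_def)
  then show ?thesis
    using X Y by (simp add: wnp_sum_abs wnp_map_dec_abs WN_sum_decposet WN_map_dec_decposet abs_wnp_eqI)
qed

lemma wnp_map_dec_point [simp]: "wnp_map_dec f (wnp_point d) = wnp_point (f d)"
proof -
  have "map_dec_decposet f (point_decposet d) = point_decposet (f d)"
    by (simp add: map_dec_decposet_def point_decposet_def comp_def)
  then show ?thesis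
    using wnp_map_dec_abs[OF WN_point_decposet, of f d] by (simp add: wnp_point_def)
qed

lemma wnp_map_dec_empty [simp]: "wnp_map_dec f wnp_empty = wnp_empty"
  by (metis wnp_mdec_eq_empty wnp_mdec_empty wnp_mdec_map_dec image_mset_empty)

lemma wnp_map_dec_cong:
  assumes "\<And>d. d \<in># wnp_mdec P \<Longrightarrow> f d = g d"
  shows "wnp_map_dec f P = wnp_map_dec g P"
proof -
  obtain X where X: "WN_poset X" "P = abs_wnp X" by (rule wnp_cases)
  have "decposet_isomorphic (map_dec_decposet f X) (map_dec_decposet g X)"
    using assms WN_D(1)[OF X(1)] unfolding X(2) wnp_mdec_abs[OF X(1)]
    by (intro decposet_isomorphicI[where f = id]) auto
  then show ?thesis
    using X by (simp add: wnp_map_dec_abs WN_map_dec_decposet abs_wnp_eqI)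
qed

lemma map_dec_decposet_comp:
  "map_dec_decposet f (map_dec_decposet g X) = map_dec_decposet (\<lambda>x. f (g x)) X"
  "map_dec_decposet (\<lambda>x. x) X = X"
  by (cases X, simp add: map_dec_decposet_def comp_def)+

lemma wnp_map_dec_comp: "wnp_map_dec f (wnp_map_dec g P) = wnp_map_dec (\<lambda>x. f (g x)) P"
  by (rule wnp_cases[of P])
    (simp add: wnp_map_dec_abs WN_map_dec_decposet map_dec_decposet_comp)

lemma wnp_map_dec_id [simp]: "wnp_map_dec (\<lambda>x. x) P = P"
  by (rule wnp_cases[of P]) (simp add: wnp_map_dec_abs map_dec_decposet_comp)

lemma wnp_map_dec_inj: "inj f \<Longrightarrow> inj (wnp_map_dec f)"
  by (rule inj_on_inverseI[where g = "wnp_map_dec (inv f)"]) (simp add: wnp_map_dec_comp)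

lemma wnp_map_dec_range:
  assumes "set_mset (wnp_mdec P) \<subseteq> range f"
  shows "P \<in> range (wnp_map_dec f)"
proof -
  have "P = wnp_map_dec (\<lambda>x. f (inv f x)) P"
    by (subst wnp_map_dec_id[symmetric], rule wnp_map_dec_cong)
      (use assms in \<open>auto simp: f_inv_into_f subset_iff\<close>)
  then show ?thesis by (metis wnp_map_dec_comp rangeI)
qed

lemma sum_irreducible_map_dec:
  assumes "sum_irreducible P" shows "sum_irreducible (wnp_map_dec f P)"
proof -
  obtain X where X: "WN_poset X" "P = abs_wnp X" by (rule wnp_cases)
  show ?thesis
    using assms
    by (simp add: X wnp_map_dec_abs sum_irreducible_iff WN_map_dec_decposet h_separated_def h_comparable_def)
qed

section \<open>The algebra of WN posets\<close>

lemma bilinear_hstar: "bilinear (hstar :: ('d wnp \<Rightarrow>\<^sub>0 'k::field) \<Rightarrow> _)"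
  and bilinear_hsum: "bilinear (hsum :: ('d wnp \<Rightarrow>\<^sub>0 'k::field) \<Rightarrow> _)"
  using bilinear_lin_ext[of wnp_star] bilinear_lin_ext[of "\<lambda>P Q. bas (wnp_sum P Q)"]
  by (simp_all add: hstar_def[abs_def] hsum_def[abs_def])

lemma hsum_bas [simp]: "hsum (bas P) (bas Q) = bas (wnp_sum P Q)"
  by (simp add: hsum_def)

lemma lookup_wnp_star:
  "lk (wnp_star P Q) R = cop_sum R (\<lambda>a b. lk (bas P) a * lk (bas Q) b :: 'k::field)"
proof -
  let ?X = "rep_wnp R"
  let ?S = "{I. h_ideal ?X I}"
  let ?p = "\<lambda>I. abs_wnp (subposet ?X (verts ?X - I)) = P \<and> abs_wnp (subposet ?X I) = Q"
  have "cop_sum R (\<lambda>a b. lk (bas P) a * lk (bas Q) b :: 'k) = (\<Sum>I\<in>?S. if ?p I then 1 else 0)"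
    unfolding cop_sum_def by (intro sum.cong) (auto simp: lookup_bas)
  also have "\<dots> = of_nat (card {I \<in> ?S. ?p I})"
    using finite_h_ideals[OF WN_rep_wnp[of R]] by (simp add: sum.If_cases Int_def)
  also have "\<dots> = lk (wnp_star P Q) R"
    by (simp add: wnp_star.rep_eq ideal_count_def)
  finally show ?thesis by simp
qed

text \<open>The product \<open>\<star>\<close> is the transpose of the coproduct given by ideals.\<close>

lemma lookup_hstar:
  fixes x y :: "'d wnp \<Rightarrow>\<^sub>0 'k::field"
  shows "lk (hstar x y) R = cop_sum R (\<lambda>a b. lk x a * lk y b)"
proof -
  let ?X = "Poly_Mapping.keys x" and ?Y = "Poly_Mapping.keys y"
  have e: "(\<Sum>P\<in>Poly_Mapping.keys x. lk x P * lk (bas P) a) = lk x a" for x :: "'d wnp \<Rightarrow>\<^sub>0 'k" and a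
    using lookup_lin_ext[of bas x a] by (simp add: lin_ext_basis)
  have "lk (hstar x y) R =
      (\<Sum>P\<in>?X. \<Sum>Q\<in>?Y. lk x P * (lk y Q * cop_sum R (\<lambda>a b. lk (bas P) a * lk (bas Q) b)))"
    by (simp add: hstar_def lookup_lin_ext lookup_wnp_star sum_distrib_left)
  also have "\<dots> = cop_sum R (\<lambda>a b. \<Sum>P\<in>?X. \<Sum>Q\<in>?Y. (lk x P * lk (bas P) a) * (lk y Q * lk (bas Q) b))"
    by (simp add: cop_sum_sum cop_sum_times mult.assoc mult.left_commute)
  also have "\<dots> = cop_sum R (\<lambda>a b. lk x a * lk y b)"
    by (simp only: sum_product[symmetric] e)
  finally show ?thesis .
qed

lemma hstar_assoc: "hstar (hstar x y) z = hstar x (hstar y z)"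
  by (rule poly_mapping_eqI)
    (simp add: lookup_hstar cop_sum_times cop_sum_coassoc mult.assoc)

lemma hstar_empty [simp]:
  "hstar (bas wnp_empty) x = (x :: 'd wnp \<Rightarrow>\<^sub>0 'k::field)" "hstar x (bas wnp_empty) = x"
proof -
  have "lk (hstar (bas wnp_empty) x) R = cop_sum R (\<lambda>a b. if a = wnp_empty then lk x b else 0)" for R
    unfolding lookup_hstar by (rule cop_sum_cong) (auto simp: lookup_bas)
  then show "hstar (bas wnp_empty) x = x" by (intro poly_mapping_eqI) (simp add: cop_sum_empty_left)
  have "lk (hstar x (bas wnp_empty)) R = cop_sum R (\<lambda>a b. if b = wnp_empty then lk x a else 0)" for R
    unfolding lookup_hstar by (rule cop_sum_cong) (auto simp: lookup_bas)
  then show "hstar x (bas wnp_empty) = x" by (intro poly_mapping_eqI) (simp add: cop_sum_empty_right)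
qed

lemma hsum_empty [simp]:
  "hsum (bas wnp_empty) x = (x :: 'd wnp \<Rightarrow>\<^sub>0 'k::field)" "hsum x (bas wnp_empty) = x"
  by (rule lin_eqI[OF bilinearD(2)[OF bilinear_hsum] lin_id], simp)
    (rule lin_eqI[OF bilinearD(1)[OF bilinear_hsum] lin_id], simp)

lemmas [lin_intros] = bilinear_arg[OF bilinear_hstar] bilinear_arg[OF bilinear_hsum]

lemma hsum_assoc: "hsum (hsum x y) z = hsum x (hsum y z)"
proof (rule lin_eqI[where x = x])
  fix a
  show "hsum (hsum (bas a) y) z = hsum (bas a) (hsum y z)"
  proof (rule lin_eqI[where x = y])
    fix b
    show "hsum (hsum (bas a) (bas b)) z = hsum (bas a) (hsum (bas b) z)"
      by (rule lin_eqI[where x = z]) (auto intro!: lin_intros simp: wnp_sum_assoc)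
  qed (intro lin_intros)+
qed (intro lin_intros)+

lemma keys_hstar:
  assumes "R \<in> Poly_Mapping.keys (hstar x y)"
  shows "\<exists>P\<in>Poly_Mapping.keys x. \<exists>Q\<in>Poly_Mapping.keys y. ideal_cut R P Q"
proof (rule ccontr)
  assume "\<not> ?thesis"
  then have "lk x a * lk y b = 0" if "ideal_cut R a b" for a b
    using that in_keys_iff mult_eq_0_iff by metis
  then have "cop_sum R (\<lambda>a b. lk x a * lk y b) = 0" by (rule cop_sum_zero)
  then show False using assms by (simp add: in_keys_iff lookup_hstar)
qed

lemma lookup_hstar_ser: "lk (hstar (bas P) (bas Q)) (wnp_ser P Q) = 1"
proof -
  have "lk (hstar (bas P) (bas Q)) (wnp_ser P Q) =
      cop_sum (wnp_ser P Q) (\<lambda>a b. if a = P \<and> b = Q then 1 else 0)"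
    unfolding lookup_hstar by (rule cop_sum_cong) (auto simp: lookup_bas)
  also have "\<dots> = 1" by (subst cop_sum_wnp_ser) auto
  finally show ?thesis .
qed

text \<open>The leading term of \<open>P \<star> Q\<close> is the vertical concatenation.\<close>

definition star_tail :: "'d wnp \<Rightarrow> 'd wnp \<Rightarrow> ('d wnp \<Rightarrow>\<^sub>0 'k::field)" where
  "star_tail P Q = hstar (bas P) (bas Q) - bas (wnp_ser P Q)"

lemma hstar_bas_ser: "hstar (bas P) (bas Q) = bas (wnp_ser P Q) + star_tail P Q"
  by (simp add: star_tail_def)

lemma keys_star_tail:
  assumes "R \<in> Poly_Mapping.keys (star_tail P Q :: 'd wnp \<Rightarrow>\<^sub>0 'k::field)"
  shows "wnp_mdec R = wnp_mdec P + wnp_mdec Q" "wnp_hrel R < wnp_hrel (wnp_ser P Q)"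
proof -
  have l: "lk (star_tail P Q) R = lk (hstar (bas P) (bas Q)) R - lk (bas (wnp_ser P Q)) R - (0 :: 'k)"
    by (simp add: star_tail_def lookup_minus)
  then have "R \<noteq> wnp_ser P Q" using assms by (auto simp: in_keys_iff lookup_hstar_ser lookup_bas)
  then have "R \<in> Poly_Mapping.keys (hstar (bas P) (bas Q) :: 'd wnp \<Rightarrow>\<^sub>0 'k)"
    using assms l by (auto simp: in_keys_iff lookup_bas)
  then have "ideal_cut R P Q" using keys_hstar by fastforce
  then show "wnp_mdec R = wnp_mdec P + wnp_mdec Q" "wnp_hrel R < wnp_hrel (wnp_ser P Q)"
    using \<open>R \<noteq> _\<close> by (auto simp: ideal_cut_def)
qed

subsection \<open>Relabelling\<close>

abbreviation relabel :: "('d \<Rightarrow> 'e) \<Rightarrow> ('d wnp \<Rightarrow>\<^sub>0 'k::field) \<Rightarrow> ('e wnp \<Rightarrow>\<^sub>0 'k)" where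
  "relabel f \<equiv> lin_map (wnp_map_dec f)"

lemma relabel_hsum: "relabel f (hsum x y) = hsum (relabel f x) (relabel f y)"
proof (rule lin_eqI[where x = x])
  fix a
  show "relabel f (hsum (bas a) y) = hsum (relabel f (bas a)) (relabel f y)"
    by (rule lin_eqI[where x = y]) (auto intro!: lin_intros simp: wnp_map_dec_sum)
qed (intro lin_intros)+

text \<open>For injective \<open>f\<close>, the posets with decorations in the range of \<open>f\<close> are relabelled in a unique way, and only
  such posets occur in a product of relabelled posets.\<close>

lemma relabel_hstar:
  assumes f: "inj f"
  shows "relabel f (hstar x y) = hstar (relabel f x) (relabel f y)"
proof (rule poly_mapping_eqI)
  fix R
  note inj = wnp_map_dec_inj[OF f]
  show "lk (relabel f (hstar x y)) R = lk (hstar (relabel f x) (relabel f y)) R"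
  proof (cases "R \<in> range (wnp_map_dec f)")
    case True
    then obtain S where "R = wnp_map_dec f S" by blast
    then show ?thesis
      by (simp add: lookup_lin_map_inj[OF inj] lookup_hstar cop_sum_map_dec)
  next
    case False
    have "lk (relabel f (hstar x y)) R = 0"
      using False keys_lin_map[of "wnp_map_dec f" "hstar x y"] by (auto simp: in_keys_iff)
    moreover have "lk (hstar (relabel f x) (relabel f y)) R = 0"
    proof (rule ccontr)
      assume "\<not> ?thesis"
      then have "R \<in> Poly_Mapping.keys (hstar (relabel f x) (relabel f y))"
        by (simp add: in_keys_iff)
      then obtain P Q where "P \<in> Poly_Mapping.keys (relabel f x)"
        "Q \<in> Poly_Mapping.keys (relabel f y)" "ideal_cut R P Q" using keys_hstar by blast
      then have "P \<in> range (wnp_map_dec f)" "Q \<in> range (wnp_map_dec f)"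
        "wnp_mdec R = wnp_mdec P + wnp_mdec Q"
        using keys_lin_map by (fastforce simp: ideal_cut_def)+
      then have "set_mset (wnp_mdec R) \<subseteq> range f" by auto
      then show False using False wnp_map_dec_range by blast
    qed
    ultimately show ?thesis by simp
  qed
qed

subsection \<open>Graded pieces\<close>

definition wnp_piece :: "'d multiset \<Rightarrow> ('d wnp \<Rightarrow>\<^sub>0 'k::field) set" where
  "wnp_piece M = {x. \<forall>P\<in>Poly_Mapping.keys x. wnp_mdec P = M}"

lemma wnp_piece_span: "wnp_piece M = pm.span (bas ` {P. wnp_mdec P = M})"
  by (auto simp: span_bas_eq wnp_piece_def)

lemma subspace_wnp_piece: "pm.subspace (wnp_piece M)"
  unfolding wnp_piece_span by (rule pm.subspace_span)

lemma bas_in_wnp_piece [simp]: "bas P \<in> wnp_piece M \<longleftrightarrow> wnp_mdec P = M"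
  by (simp add: wnp_piece_def)

lemma hsum_in_wnp_piece: "x \<in> wnp_piece M \<Longrightarrow> y \<in> wnp_piece N \<Longrightarrow> hsum x y \<in> wnp_piece (M + N)"
  by (rule bilinear_in_subspace[OF bilinear_hsum subspace_wnp_piece])
    (auto simp: wnp_piece_def)

lemma hstar_in_wnp_piece: "x \<in> wnp_piece M \<Longrightarrow> y \<in> wnp_piece N \<Longrightarrow> hstar x y \<in> wnp_piece (M + N)"
  using keys_hstar by (fastforce simp: wnp_piece_def ideal_cut_def)

lemma relabel_in_wnp_piece: "x \<in> wnp_piece M \<Longrightarrow> relabel f x \<in> wnp_piece (image_mset f M)"
  using keys_lin_map[of "wnp_map_dec f" x] by (fastforce simp: wnp_piece_def)

subsection \<open>Sums over the splittings of a word\<close>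

text \<open>The analogue of \<^const>\<open>cop_sum\<close> for deconcatenation. The recursion on the word makes its coassociativity
  an induction without manipulation of indices.\<close>

primrec split_sum :: "'a list \<Rightarrow> ('a list \<Rightarrow> 'a list \<Rightarrow> 'b::comm_monoid_add) \<Rightarrow> 'b" where
  "split_sum [] F = F [] []"
| "split_sum (x # u) F = F [] (x # u) + split_sum u (\<lambda>a b. F (x # a) b)"

lemma split_sum_eq: "split_sum u F = (\<Sum>i\<le>length u. F (take i u) (drop i u))"
  by (induction u arbitrary: F) (simp_all add: sum.atMost_Suc_shift del: sum.atMost_Suc)

lemma split_sum_add: "split_sum u (\<lambda>a b. F a b + G a b) = split_sum u F + split_sum u G"
  by (simp add: split_sum_eq sum.distrib)

lemma split_sum_coassoc:
  fixes F :: "'a list \<Rightarrow> 'a list \<Rightarrow> 'a list \<Rightarrow> 'b::comm_monoid_add"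
  shows "split_sum u (\<lambda>a b. split_sum a (\<lambda>a1 a2. F a1 a2 b)) = split_sum u (\<lambda>a b. split_sum b (F a))"
proof (induction u arbitrary: F)
  case (Cons x u)
  have "split_sum (x # u) (\<lambda>a b. split_sum a (\<lambda>a1 a2. F a1 a2 b)) =
      F [] [] (x # u) + (split_sum u (F [] \<circ> (#) x) +
        split_sum u (\<lambda>a b. split_sum a (\<lambda>a1 a2. F (x # a1) a2 b)))"
    by (simp only: split_sum.simps split_sum_add comp_def)
  also have "split_sum u (\<lambda>a b. split_sum a (\<lambda>a1 a2. F (x # a1) a2 b)) =
      split_sum u (\<lambda>a b. split_sum b (F (x # a)))"
    by (rule Cons.IH)
  also have "F [] [] (x # u) + (split_sum u (F [] \<circ> (#) x) + \<dots>) =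
      split_sum (x # u) (\<lambda>a b. split_sum b (F a))"
    by (simp only: split_sum.simps comp_def add.assoc)
  finally show ?case .
qed simp

lemma split_sum_cong:
  assumes "\<And>a b. u = a @ b \<Longrightarrow> F a b = G a b"
  shows "split_sum u F = split_sum u G"
  unfolding split_sum_eq by (rule sum.cong[OF refl], rule assms) simp

lemma split_sum_zero [simp]: "split_sum u (\<lambda>a b. 0) = 0"
  by (simp add: split_sum_eq)

lemma split_sum_swap:
  "split_sum u (\<lambda>a b. split_sum v (F a b)) = split_sum v (\<lambda>c d. split_sum u (\<lambda>a b. F a b c d))"
  unfolding split_sum_eq by (rule sum.swap)

lemma split_sum_times:
  fixes c :: "'a::comm_semiring_0"
  shows "c * split_sum u F = split_sum u (\<lambda>a b. c * F a b)" "split_sum u F * c = split_sum u (\<lambda>a b. F a b * c)"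
  by (simp_all add: split_sum_eq sum_distrib_left sum_distrib_right)

lemma split_sum_product:
  fixes F G :: "_ \<Rightarrow> _ \<Rightarrow> 'a::comm_semiring_0"
  shows "split_sum u F * split_sum v G = split_sum u (\<lambda>a b. split_sum v (\<lambda>c d. F a b * G c d))"
  by (simp only: split_sum_eq sum_product)

lemma lookup_split_sum: "lk (split_sum u F) w = split_sum u (\<lambda>a b. lk (F a b) w)"
  by (simp add: split_sum_eq lookup_sum)

lemma cop_sum_product:
  fixes F G :: "_ \<Rightarrow> _ \<Rightarrow> 'a::comm_semiring_0"
  shows "cop_sum R F * cop_sum S G = cop_sum R (\<lambda>a b. cop_sum S (\<lambda>c d. F a b * G c d))"
  by (simp only: cop_sum_def sum_product)

lemma cop_sum_split_sum:
  "cop_sum R (\<lambda>a b. split_sum u (F a b)) = split_sum u (\<lambda>c d. cop_sum R (\<lambda>a b. F a b c d))"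
  unfolding split_sum_eq by (rule cop_sum_sum)

lemma lin_split_sum: "lin f \<Longrightarrow> f (split_sum u F) = split_sum u (\<lambda>a b. f (F a b))"
  by (simp add: split_sum_eq lin_setsum)

lemma lin_split_sum_fun: "(\<And>a b. lin (\<lambda>x. F x a b)) \<Longrightarrow> lin (\<lambda>x. split_sum u (F x))"
  unfolding split_sum_eq by (intro lin_sum_fun)

subsection \<open>Words of connected posets\<close>

definition primitives :: "('d wnp \<Rightarrow>\<^sub>0 'k::field) set" where
  "primitives = {x. \<forall>P\<in>Poly_Mapping.keys x. sum_irreducible P}"

lemma subspace_primitives: "pm.subspace primitives"
proof -
  have "primitives = pm.span (bas ` {P. sum_irreducible P})"
    by (auto simp: span_bas_eq primitives_def)
  then show ?thesis by (metis pm.subspace_span)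
qed

lemma bas_in_primitives [simp]: "bas P \<in> primitives \<longleftrightarrow> sum_irreducible P"
  by (simp add: primitives_def)

lemma relabel_primitives: "x \<in> primitives \<Longrightarrow> relabel f x \<in> primitives"
  using keys_lin_map[of "wnp_map_dec f" x] by (fastforce simp: primitives_def intro: sum_irreducible_map_dec)

text \<open>The projection of words in connected posets to the words of length one.\<close>

definition proj_prim :: "('d wnp \<Rightarrow>\<^sub>0 'k::field) \<Rightarrow> ('d wnp \<Rightarrow>\<^sub>0 'k)" where
  "proj_prim = lin_ext (\<lambda>P. if sum_irreducible P then bas P else 0)"

lemma lin_proj_prim: "lin proj_prim"
  by (simp add: proj_prim_def lin_lin_ext)

lemma proj_prim_primitive: "proj_prim x \<in> primitives"
  unfolding proj_prim_def
  by (rule lin_ext_in_subspace[OF subspace_primitives])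
    (simp add: pm.subspace_0[OF subspace_primitives])

lemma proj_prim_id: "x \<in> primitives \<Longrightarrow> proj_prim x = x"
  by (rule lin_eqI[OF lin_proj_prim lin_id]) (auto simp: proj_prim_def primitives_def)

lemma lookup_proj_prim: "lk (proj_prim x) P = (if sum_irreducible P then lk x P else 0)"
proof -
  have "lk (proj_prim x) P =
      (\<Sum>a\<in>Poly_Mapping.keys x. if a = P then (if sum_irreducible P then lk x P else 0) else 0)"
    unfolding proj_prim_def lookup_lin_ext by (intro sum.cong) (auto simp: lookup_bas)
  then show ?thesis by (simp add: in_keys_iff)
qed

lemma lookup_hsum:
  "lk (hsum x y) R = (\<Sum>P\<in>Poly_Mapping.keys x. \<Sum>Q\<in>Poly_Mapping.keys y.
     if wnp_sum P Q = R then lk x P * lk y Q else 0)"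
  by (simp add: hsum_def lookup_lin_ext sum_distrib_left lookup_bas if_distrib cong: if_cong)

lemma lookup_hsum_primitive:
  assumes x: "x \<in> primitives"
  shows "sum_irreducible C \<Longrightarrow> lk (hsum x y) (wnp_sum C R) = lk x C * lk y R"
    and "lk (hsum x y) wnp_empty = 0"
proof -
  have irr: "sum_irreducible P" if "P \<in> Poly_Mapping.keys x" for P
    using x that by (simp add: primitives_def)
  show "lk (hsum x y) (wnp_sum C R) = lk x C * lk y R" if C: "sum_irreducible C"
  proof -
    have "lk (hsum x y) (wnp_sum C R) = (\<Sum>P\<in>Poly_Mapping.keys x. \<Sum>Q\<in>Poly_Mapping.keys y.
        if P = C \<and> Q = R then lk x P * lk y Q else 0)"
      unfolding lookup_hsum
      using wnp_sum_irreducible_unique[OF _ irr C] by (intro sum.cong refl if_cong) auto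
    also have "\<dots> = (\<Sum>P\<in>Poly_Mapping.keys x. if P = C then
        (\<Sum>Q\<in>Poly_Mapping.keys y. if Q = R then lk x C * lk y R else 0) else 0)"
      by (intro sum.cong refl) (auto intro: sum.cong)
    also have "\<dots> = lk x C * lk y R" by (simp add: in_keys_iff)
    finally show ?thesis .
  qed
  have "wnp_sum P Q \<noteq> wnp_empty" if "P \<in> Poly_Mapping.keys x" for P Q
    using irr[OF that] by (metis add_is_0 sum_irreducible_def wnp_size_simps(1,3,5))
  then show "lk (hsum x y) wnp_empty = 0" by (simp add: lookup_hsum)
qed

primrec hprod :: "('d wnp \<Rightarrow>\<^sub>0 'k::field) list \<Rightarrow> ('d wnp \<Rightarrow>\<^sub>0 'k)" where
  "hprod [] = bas wnp_empty"
| "hprod (x # xs) = hsum x (hprod xs)"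

lemma wnp_word_cases:
  obtains "P = wnp_empty" | C R where "sum_irreducible C" "P = wnp_sum C R"
  using wnp_sum_factor by blast

lemma lookup_hprod_empty: "set us \<subseteq> primitives \<Longrightarrow> lk (hprod us) wnp_empty = (if us = [] then 1 else 0)"
  by (cases us) (auto simp: lookup_bas lookup_hsum_primitive)

text \<open>Products of primitive elements are words; the transpose of concatenation on them is
  deconcatenation.\<close>

lemma lookup_hprod_sum:
  assumes "set us \<subseteq> primitives"
  shows "lk (hprod us) (wnp_sum a c) = split_sum us (\<lambda>u1 u2. lk (hprod u1) a * lk (hprod u2) c)"
  using assms
proof (induction us arbitrary: a)
  case Nil
  have "wnp_sum a c = wnp_empty \<longleftrightarrow> a = wnp_empty \<and> c = wnp_empty"
    by (metis add_is_0 wnp_size_simps(3,5))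
  then show ?case by (auto simp: lookup_bas)
next
  case (Cons x us)
  then have x: "x \<in> primitives" by simp
  show ?case
  proof (cases rule: wnp_word_cases[of a])
    case 1
    then show ?thesis by (simp add: lookup_bas lookup_hsum_primitive(2)[OF x])
  next
    case (2 C R)
    then have ne: "wnp_empty \<noteq> wnp_sum C R"
      by (metis add_is_0 sum_irreducible_def wnp_size_simps(1,3,5))
    have IH: "lk (hprod us) (wnp_sum R c) = split_sum us (\<lambda>u1 u2. lk (hprod u1) R * lk (hprod u2) c)"
      using Cons by simp
    show ?thesis
      unfolding 2(2) wnp_sum_assoc split_sum.simps hprod.simps lookup_hsum_primitive(1)[OF x 2(1)] IH
      using ne by (simp add: lookup_bas split_sum_times mult.assoc)
  qed
qed

text \<open>The compatibility of the product with deconcatenation expresses \<open>u \<star> v\<close> through the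
  connected parts of the products of the prefixes: this is the \<open>B\<^sub>\<infinity>\<close> structure on connected posets.\<close>

lemma hstar_hprod:
  assumes u: "set us \<subseteq> primitives" and v: "set vs \<subseteq> primitives"
  shows "hstar (hprod us) (hprod vs) =
    (if us = [] \<and> vs = [] then bas wnp_empty else 0) +
    split_sum us (\<lambda>u1 u2. split_sum vs (\<lambda>v1 v2.
      hsum (proj_prim (hstar (hprod u1) (hprod v1))) (hstar (hprod u2) (hprod v2))))"
    (is "?l = ?e + ?r")
proof (rule poly_mapping_eqI)
  fix R
  show "lk ?l R = lk (?e + ?r) R"
  proof (cases rule: wnp_word_cases[of R])
    case 1
    then show ?thesis
      using u v by (simp add: lookup_hstar cop_sum_wnp_empty lookup_add lookup_split_sum
        lookup_hsum_primitive(2)[OF proj_prim_primitive] lookup_hprod_empty lookup_bas)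
  next
    case (2 C S)
    have ne: "wnp_empty \<noteq> R" using 2 by (metis add_is_0 sum_irreducible_def wnp_size_simps(1,3,5))
    have "lk ?l R = cop_sum C (\<lambda>a b. cop_sum S (\<lambda>c d.
        split_sum us (\<lambda>u1 u2. split_sum vs (\<lambda>v1 v2.
          (lk (hprod u1) a * lk (hprod v1) b) * (lk (hprod u2) c * lk (hprod v2) d)))))"
      unfolding 2(2) lookup_hstar cop_sum_wnp_sum lookup_hprod_sum[OF u] lookup_hprod_sum[OF v]
      by (simp only: split_sum_product mult.assoc mult.left_commute)
    also have "\<dots> = split_sum us (\<lambda>u1 u2. split_sum vs (\<lambda>v1 v2.
          lk (hstar (hprod u1) (hprod v1)) C * lk (hstar (hprod u2) (hprod v2)) S))"
      by (simp only: cop_sum_split_sum lookup_hstar cop_sum_product)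
    also have "\<dots> = lk ?r R"
      unfolding 2(2)
      by (simp add: lookup_split_sum lookup_hsum_primitive(1)[OF proj_prim_primitive 2(1)]
          lookup_proj_prim 2(1))
    also have "\<dots> = lk (?e + ?r) R" using ne by (simp add: lookup_add lookup_bas)
    finally show ?thesis .
  qed
qed

section \<open>Freeness\<close>

lemma wnp_point_not_empty [simp]: "wnp_point d \<noteq> wnp_empty"
  by (metis wnp_size_simps(1,2) zero_neq_one)

lemma wnp_point_inject [simp]: "wnp_point d = wnp_point d' \<longleftrightarrow> d = d'"
proof
  assume "wnp_point d = wnp_point d'"
  then have "wnp_mdec (wnp_point d) = wnp_mdec (wnp_point d')" by simp
  then show "d = d'" by simp
qed simp

lemma wnp_sum_eq_empty [simp]: "wnp_sum P Q = wnp_empty \<longleftrightarrow> P = wnp_empty \<and> Q = wnp_empty"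
  by (metis add_is_0 wnp_size_simps(3,5))

lemma wnp_ser_eq_empty [simp]: "wnp_ser P Q = wnp_empty \<longleftrightarrow> P = wnp_empty \<and> Q = wnp_empty"
  by (metis add_is_0 wnp_size_simps(4,5))

lemma sum_irreducible_not_empty [simp]: "\<not> sum_irreducible wnp_empty"
  by (simp add: sum_irreducible_def)

lemma wnp_sum_not_irreducible:
  "P \<noteq> wnp_empty \<Longrightarrow> Q \<noteq> wnp_empty \<Longrightarrow> \<not> sum_irreducible (wnp_sum P Q)"
  by (auto simp: sum_irreducible_def)

lemma ser_irreducible_point: "ser_irreducible (wnp_point d)"
proof -
  have "swap_decposet (point_decposet d) = point_decposet d"
    by (simp add: swap_decposet_def point_decposet_def)
  then have "wnp_swap (wnp_point d) = wnp_point d"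
    using wnp_swap_abs[OF WN_point_decposet, of d] by (simp add: wnp_point_def)
  then show ?thesis by (simp add: ser_irreducible_def sum_irreducible_point)
qed

lemma ser_irreducible_not_empty: "ser_irreducible P \<Longrightarrow> P \<noteq> wnp_empty"
  by (auto simp: ser_irreducible_def sum_irreducible_def)

lemma wnp_ser_factor:
  assumes "P \<noteq> wnp_empty"
  obtains A B where "ser_irreducible A" "P = wnp_ser A B"
proof -
  obtain C Q where "sum_irreducible C" "wnp_swap P = wnp_sum C Q"
    using wnp_sum_factor[of "wnp_swap P"] assms by auto
  then have "ser_irreducible (wnp_swap C)" "P = wnp_ser (wnp_swap C) (wnp_swap Q)"
    by (simp_all add: ser_irreducible_def wnp_ser_def) (metis wnp_swap_swap)
  then show ?thesis by (rule that)
qed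

lemma wnp_ser_empty [simp]: "wnp_ser P wnp_empty = P"
proof -
  have "wnp_swap wnp_empty = (wnp_empty :: 'a wnp)" by simp
  then show ?thesis by (simp add: wnp_ser_def del: wnp_swap_empty)
qed

lemma wnp_ser_irreducible_unique:
  assumes "wnp_ser A B = wnp_ser C D" "ser_irreducible A" "ser_irreducible C"
  shows "A = C" "B = D"
proof -
  have "wnp_sum (wnp_swap A) (wnp_swap B) = wnp_sum (wnp_swap C) (wnp_swap D)"
    using assms(1) unfolding wnp_ser_def by (metis wnp_swap_swap)
  then have "wnp_swap A = wnp_swap C" "wnp_swap B = wnp_swap D"
    using wnp_sum_irreducible_unique assms(2,3) unfolding ser_irreducible_def by blast+
  then show "A = C" "B = D" by (metis wnp_swap_swap)+
qed

lemma wnp_point_not_ser: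
  assumes "A \<noteq> wnp_empty" "B \<noteq> wnp_empty" shows "wnp_ser A B \<noteq> wnp_point d"
proof
  assume "wnp_ser A B = wnp_point d"
  then have "wnp_size A + wnp_size B = 1" by (metis wnp_size_simps(2,4))
  moreover have "wnp_size A > 0" "wnp_size B > 0" using assms by simp_all
  ultimately show False by linarith
qed

text \<open>A WN poset is empty, a point, a horizontal concatenation with a connected first factor, or a
  vertical concatenation. In the last case the induction hypothesis also covers the posets with the
  same decorations and fewer \<open>h\<close>-relations, which are those of the tail of the product \<open>\<star>\<close>.\<close>

lemma wnp_induct [case_names empty point sum ser]:
  assumes "\<Phi> wnp_empty"
    and "\<And>d. \<Phi> (wnp_point d)"
    and "\<And>C R. sum_irreducible C \<Longrightarrow> R \<noteq> wnp_empty \<Longrightarrow> \<Phi> C \<Longrightarrow> \<Phi> R \<Longrightarrow> \<Phi> (wnp_sum C R)"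
    and "\<And>A B. ser_irreducible A \<Longrightarrow> B \<noteq> wnp_empty \<Longrightarrow> \<Phi> A \<Longrightarrow> \<Phi> B \<Longrightarrow>
      (\<And>R. wnp_mdec R = wnp_mdec A + wnp_mdec B \<Longrightarrow> wnp_hrel R < wnp_hrel (wnp_ser A B) \<Longrightarrow> \<Phi> R) \<Longrightarrow>
      \<Phi> (wnp_ser A B)"
  shows "\<Phi> P"
proof (induction P rule: wf_induct[OF wf_measures[of "[wnp_size, wnp_hrel]"]])
  case (1 P)
  then have IH: "\<And>R. wnp_size R < wnp_size P \<Longrightarrow> \<Phi> R"
    "\<And>R. wnp_size R = wnp_size P \<Longrightarrow> wnp_hrel R < wnp_hrel P \<Longrightarrow> \<Phi> R" by auto
  have pos: "0 < wnp_size R" if "R \<noteq> wnp_empty" for R :: "'a wnp" using that by simp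
  consider "P = wnp_empty" | "P \<noteq> wnp_empty" "\<not> sum_irreducible P"
    | "sum_irreducible P" "ser_irreducible P" | "sum_irreducible P" "\<not> ser_irreducible P" by blast
  then show ?case
  proof cases
    case 2
    then obtain C R where CR: "sum_irreducible C" "P = wnp_sum C R" using wnp_sum_factor by blast
    have "R \<noteq> wnp_empty" using 2 CR by auto
    moreover have "C \<noteq> wnp_empty" using CR(1) by auto
    ultimately show ?thesis using CR pos IH(1) assms(3) by simp
  next
    case 4
    then obtain A B where AB: "ser_irreducible A" "P = wnp_ser A B"
      using wnp_ser_factor[of P] by (auto simp: sum_irreducible_def)
    have "B \<noteq> wnp_empty" using 4 AB by auto
    moreover have "A \<noteq> wnp_empty" using AB(1) ser_irreducible_not_empty by blast
    moreover have "\<Phi> R" if "wnp_mdec R = wnp_mdec A + wnp_mdec B" "wnp_hrel R < wnp_hrel P" for R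
      using IH(2)[of R] that AB(2) by (simp add: wnp_size_def)
    ultimately show ?thesis using AB pos IH(1) assms(4) by simp
  qed (use assms(1,2) irreducible_point in auto)
qed

text \<open>The points generate, since a vertical concatenation is a product minus its tail, which is covered by
  induction. The grading serves to express properties that depend on the decorations.\<close>

lemma wnp_generated:
  fixes S :: "'d multiset \<Rightarrow> ('d wnp \<Rightarrow>\<^sub>0 'k::field) set"
  assumes sub: "\<And>M. pm.subspace (S M)"
    and empty: "bas wnp_empty \<in> S {#}"
    and point: "\<And>d. bas (wnp_point d) \<in> S {#d#}"
    and sum: "\<And>M N x y. x \<in> wnp_piece M \<Longrightarrow> y \<in> wnp_piece N \<Longrightarrow> x \<in> S M \<Longrightarrow> y \<in> S N \<Longrightarrow> hsum x y \<in> S (M + N)"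
    and star: "\<And>M N x y. x \<in> wnp_piece M \<Longrightarrow> y \<in> wnp_piece N \<Longrightarrow> x \<in> S M \<Longrightarrow> y \<in> S N \<Longrightarrow> hstar x y \<in> S (M + N)"
  shows "x \<in> wnp_piece M \<Longrightarrow> x \<in> S M"
proof -
  have b: "bas P \<in> S (wnp_mdec P)" for P
  proof (induction P rule: wnp_induct)
    case (sum C R)
    then show ?case using assms(4)[of "bas C" _ "bas R"] by simp
  next
    case (ser A B)
    have "hstar (bas A) (bas B) \<in> S (wnp_mdec A + wnp_mdec B)"
      using star[of "bas A" _ "bas B"] ser by simp
    moreover have "star_tail A B \<in> S (wnp_mdec A + wnp_mdec B)"
      by (rule lin_in_subspace[OF lin_id sub]) (use keys_star_tail ser.IH(3) in fastforce)
    ultimately have "hstar (bas A) (bas B) - star_tail A B \<in> S (wnp_mdec A + wnp_mdec B)"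
      by (rule pm.subspace_diff[OF sub])
    then show ?case by (simp add: hstar_bas_ser)
  qed (use empty point in auto)
  assume x: "x \<in> wnp_piece M"
  show ?thesis
    by (rule lin_in_subspace[OF lin_id sub]) (use b x in \<open>auto simp: wnp_piece_def\<close>)
qed

definition sum_head :: "'d wnp \<Rightarrow> 'd wnp \<times> 'd wnp" where
  "sum_head P = (SOME (C, R). sum_irreducible C \<and> P = wnp_sum C R)"

definition ser_head :: "'d wnp \<Rightarrow> 'd wnp \<times> 'd wnp" where
  "ser_head P = (SOME (A, B). ser_irreducible A \<and> P = wnp_ser A B)"

lemma sum_head_eq: "sum_irreducible C \<Longrightarrow> sum_head (wnp_sum C R) = (C, R)"
  unfolding sum_head_def
  by (rule some_equality) (auto dest: wnp_sum_irreducible_unique)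

lemma ser_head_eq: "ser_irreducible A \<Longrightarrow> ser_head (wnp_ser A B) = (A, B)"
  unfolding ser_head_def
  by (rule some_equality) (auto dest: wnp_ser_irreducible_unique)

lemma lin_ext_fundef_cong [fundef_cong]:
  "v = w \<Longrightarrow> (\<And>a. a \<in> Poly_Mapping.keys w \<Longrightarrow> f a = g a) \<Longrightarrow> lin_ext f v = lin_ext g w"
  by (hypsubst, rule lin_ext_cong)

text \<open>A presentation of a \<open>2\<close>-\<open>As\<close> algebra as a quotient by \<open>I\<close>. It is used with \<open>I = 0\<close> for the algebra of WN
  posets and with the ideal generated by relations for the tensor algebra.\<close>

locale two_as_mod =
  fixes c1 c2 :: "('b \<Rightarrow>\<^sub>0 'k::field) \<Rightarrow> ('b \<Rightarrow>\<^sub>0 'k) \<Rightarrow> ('b \<Rightarrow>\<^sub>0 'k)" and e :: "'b \<Rightarrow>\<^sub>0 'k"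
    and I :: "('b \<Rightarrow>\<^sub>0 'k) set"
  assumes sub: "pm.subspace I"
    and bil: "bilinear c1" "bilinear c2"
    and ideal: "\<And>x y. x \<in> I \<Longrightarrow> c1 x y \<in> I" "\<And>x y. y \<in> I \<Longrightarrow> c1 x y \<in> I"
      "\<And>x y. x \<in> I \<Longrightarrow> c2 x y \<in> I" "\<And>x y. y \<in> I \<Longrightarrow> c2 x y \<in> I"
    and assoc: "\<And>x y z. c1 (c1 x y) z - c1 x (c1 y z) \<in> I" "\<And>x y z. c2 (c2 x y) z - c2 x (c2 y z) \<in> I"
    and unit: "\<And>x. c1 e x - x \<in> I" "\<And>x. c1 x e - x \<in> I" "\<And>x. c2 e x - x \<in> I" "\<And>x. c2 x e - x \<in> I"
begin

definition eqv :: "('b \<Rightarrow>\<^sub>0 'k) \<Rightarrow> ('b \<Rightarrow>\<^sub>0 'k) \<Rightarrow> bool" (infix \<open>\<approx>\<close> 50) where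
  "x \<approx> y \<longleftrightarrow> x - y \<in> I"

lemma eqv_refl [simp]: "x \<approx> x"
  by (simp add: eqv_def pm.subspace_0[OF sub])

lemma eqv_sym: "x \<approx> y \<Longrightarrow> y \<approx> x"
  using pm.subspace_neg[OF sub] by (fastforce simp: eqv_def)

lemma eqv_trans [trans]: "x \<approx> y \<Longrightarrow> y \<approx> z \<Longrightarrow> x \<approx> z"
  using pm.subspace_add[OF sub, of "x - y" "y - z"] by (simp add: eqv_def)

lemma eqv_diff: "x \<approx> y \<Longrightarrow> x' \<approx> y' \<Longrightarrow> x - x' \<approx> y - y'"
  using pm.subspace_diff[OF sub, of "x - y" "x' - y'"] by (simp add: eqv_def algebra_simps)

lemma eqv_sum: "(\<And>s. s \<in> S \<Longrightarrow> f s \<approx> h s) \<Longrightarrow> sum f S \<approx> sum h S"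
  unfolding eqv_def sum_subtractf[symmetric] by (rule pm.subspace_sum[OF sub])

lemma eqv_mult: 
  assumes "x \<approx> x'" "y \<approx> y'" shows "c1 x y \<approx> c1 x' y'" "c2 x y \<approx> c2 x' y'"
proof -
  have *: "c x y \<approx> c x' y'" if "bilinear c" "\<And>x y. x \<in> I \<Longrightarrow> c x y \<in> I" "\<And>x y. y \<in> I \<Longrightarrow> c x y \<in> I" for c
  proof -
    have "c x y - c x' y' = c (x - x') y + c x' (y - y')"
      by (simp add: lin_minus[OF bilinearD(1)[OF that(1)]] lin_minus[OF bilinearD(2)[OF that(1)]])
    then show ?thesis
      using assms that(2,3) pm.subspace_add[OF sub] by (auto simp: eqv_def)
  qed
  show "c1 x y \<approx> c1 x' y'" by (rule *[OF bil(1) ideal(1,2)])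
  show "c2 x y \<approx> c2 x' y'" by (rule *[OF bil(2) ideal(3,4)])
qed

lemma eqv_lin:
  assumes "lin f" "lin h" "\<And>a. a \<in> Poly_Mapping.keys x \<Longrightarrow> f (bas a) \<approx> h (bas a)"
  shows "f x \<approx> h x"
  unfolding eqv_def
  by (rule lin_in_subspace[OF lin_diff_fun[OF assms(1,2)] sub]) (use assms(3) in \<open>simp add: eqv_def\<close>)

lemma eqv_assoc: "c1 (c1 x y) z \<approx> c1 x (c1 y z)" "c2 (c2 x y) z \<approx> c2 x (c2 y z)"
  and eqv_unit: "c1 e x \<approx> x" "c1 x e \<approx> x" "c2 e x \<approx> x" "c2 x e \<approx> x"
  using assoc unit by (simp_all add: eqv_def)

text \<open>The universal morphism. On a vertical concatenation it is forced by the leading term of \<open>\<star>\<close>.\<close>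

function xi :: "('d \<Rightarrow> ('b \<Rightarrow>\<^sub>0 'k)) \<Rightarrow> 'd wnp \<Rightarrow> ('b \<Rightarrow>\<^sub>0 'k)" where
  "xi g P =
     (if P = wnp_empty then e
      else if \<exists>d. P = wnp_point d then g (THE d. P = wnp_point d)
      else if sum_irreducible P then
        c2 (xi g (fst (ser_head P))) (xi g (snd (ser_head P)))
          - lin_ext (xi g) (star_tail (fst (ser_head P)) (snd (ser_head P)))
      else c1 (xi g (fst (sum_head P))) (xi g (snd (sum_head P))))"
  by pat_completeness auto

lemma ser_head_irreducible:
  assumes "sum_irreducible P" "\<nexists>d. P = wnp_point d"
  obtains A B where "ser_head P = (A, B)" "P = wnp_ser A B" "A \<noteq> wnp_empty" "B \<noteq> wnp_empty"
    "ser_irreducible A"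
proof -
  have "P \<noteq> wnp_empty" using assms(1) by auto
  then obtain A B where AB: "ser_irreducible A" "P = wnp_ser A B" by (rule wnp_ser_factor)
  have "B \<noteq> wnp_empty" using AB assms irreducible_point by (metis wnp_ser_empty)
  then show ?thesis using AB that ser_head_eq ser_irreducible_not_empty by blast
qed

lemma sum_head_reducible:
  assumes "\<not> sum_irreducible P" "P \<noteq> wnp_empty"
  obtains C R where "sum_head P = (C, R)" "P = wnp_sum C R" "C \<noteq> wnp_empty" "R \<noteq> wnp_empty"
proof -
  obtain C R where CR: "sum_irreducible C" "P = wnp_sum C R" using assms(2) wnp_sum_factor by blast
  then show ?thesis using that sum_head_eq assms(1) by (metis sum_irreducible_not_empty wnp_sum_empty(2))
qed

termination
proof (relation "measures [\<lambda>(g, P). wnp_size P, \<lambda>(g, P). wnp_hrel P]", goal_cases)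
  case (2 g P)
  then obtain A B where "ser_head P = (A, B)" "P = wnp_ser A B" "A \<noteq> wnp_empty" "B \<noteq> wnp_empty"
    by (auto elim: ser_head_irreducible)
  then show ?case by simp
next
  case (3 g P)
  then obtain A B where "ser_head P = (A, B)" "P = wnp_ser A B" "A \<noteq> wnp_empty" "B \<noteq> wnp_empty"
    by (auto elim: ser_head_irreducible)
  then show ?case by simp
next
  case (4 g P R)
  then obtain A B where AB: "ser_head P = (A, B)" "P = wnp_ser A B"
    by (auto elim: ser_head_irreducible)
  then have "R \<in> Poly_Mapping.keys (star_tail A B :: _ \<Rightarrow>\<^sub>0 'k)" using 4 by simp
  from keys_star_tail[OF this] show ?case using AB by (simp add: wnp_size_def)
next
  case (5 g P)
  then obtain C R where "sum_head P = (C, R)" "P = wnp_sum C R" "C \<noteq> wnp_empty" "R \<noteq> wnp_empty"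
    by (auto elim: sum_head_reducible)
  then show ?case by simp
next
  case (6 g P)
  then obtain C R where "sum_head P = (C, R)" "P = wnp_sum C R" "C \<noteq> wnp_empty" "R \<noteq> wnp_empty"
    by (auto elim: sum_head_reducible)
  then show ?case by simp
qed simp

declare xi.simps [simp del]

lemma xi_empty [simp]: "xi g wnp_empty = e"
  and xi_point [simp]: "xi g (wnp_point d) = g d"
  by (simp_all add: xi.simps)

lemma xi_sum_irreducible:
  assumes "sum_irreducible C" shows "xi g (wnp_sum C R) \<approx> c1 (xi g C) (xi g R)"
proof (cases "R = wnp_empty")
  case True
  then show ?thesis by (simp add: eqv_sym eqv_unit)
next
  case False
  have C: "C \<noteq> wnp_empty" using assms by auto
  then have "\<not> sum_irreducible (wnp_sum C R)" using False by (simp add: wnp_sum_not_irreducible)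
  moreover from this have "wnp_sum C R \<noteq> wnp_point d" for d using sum_irreducible_point by metis
  ultimately show ?thesis
    using C by (subst xi.simps) (simp add: sum_head_eq[OF assms])
qed

lemma xi_sum: "xi g (wnp_sum P Q) \<approx> c1 (xi g P) (xi g Q)"
proof (induction "wnp_size P" arbitrary: P rule: less_induct)
  case less
  show ?case
  proof (cases rule: wnp_word_cases[of P])
    case 1
    then show ?thesis by (simp add: eqv_sym eqv_unit)
  next
    case (2 C R)
    have "C \<noteq> wnp_empty" using 2(1) by auto
    then have "0 < wnp_size C" by simp
    then have IH: "xi g (wnp_sum R Q) \<approx> c1 (xi g R) (xi g Q)" using less 2(2) by simp
    have "xi g (wnp_sum P Q) \<approx> c1 (xi g C) (xi g (wnp_sum R Q))"
      unfolding 2(2) wnp_sum_assoc by (rule xi_sum_irreducible[OF 2(1)])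
    also have "\<dots> \<approx> c1 (xi g C) (c1 (xi g R) (xi g Q))" by (intro eqv_mult IH eqv_refl)
    also have "\<dots> \<approx> c1 (c1 (xi g C) (xi g R)) (xi g Q)" by (rule eqv_sym[OF eqv_assoc(1)])
    also have "\<dots> \<approx> c1 (xi g P) (xi g Q)"
      unfolding 2(2) by (intro eqv_mult eqv_sym[OF xi_sum_irreducible] eqv_refl 2(1))
    finally show ?thesis .
  qed
qed

abbreviation Xi :: "('d \<Rightarrow> ('b \<Rightarrow>\<^sub>0 'k)) \<Rightarrow> ('d wnp \<Rightarrow>\<^sub>0 'k) \<Rightarrow> ('b \<Rightarrow>\<^sub>0 'k)" where
  "Xi g \<equiv> lin_ext (xi g)"

lemmas [lin_intros] = bilinear_arg[OF bil(1)] bilinear_arg[OF bil(2)]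

lemma Xi_hsum: "Xi g (hsum x y) \<approx> c1 (Xi g x) (Xi g y)"
proof (rule eqv_lin[where x = x])
  fix a
  show "Xi g (hsum (bas a) y) \<approx> c1 (Xi g (bas a)) (Xi g y)"
    by (rule eqv_lin[where x = y]) (auto intro!: lin_intros simp: xi_sum)
qed (intro lin_intros)+

lemma xi_ser:
  assumes "ser_irreducible A" "B \<noteq> wnp_empty"
  shows "xi g (wnp_ser A B) = c2 (xi g A) (xi g B) - Xi g (star_tail A B)"
proof -
  have A: "A \<noteq> wnp_empty" using assms(1) ser_irreducible_not_empty by blast
  show ?thesis
    using A assms(2) ser_reducible_sum_irreducible[OF A assms(2)] wnp_point_not_ser[OF A assms(2)]
    by (subst xi.simps) (simp add: ser_head_eq[OF assms(1)])
qed

lemma Xi_hstar_irreducible: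
  assumes "ser_irreducible A"
  shows "Xi g (hstar (bas A) y) \<approx> c2 (xi g A) (Xi g y)"
proof (rule eqv_lin[where x = y])
  fix B
  show "Xi g (hstar (bas A) (bas B)) \<approx> c2 (xi g A) (Xi g (bas B))"
  proof (cases "B = wnp_empty")
    case True
    then show ?thesis by (simp add: eqv_sym eqv_unit)
  next
    case False
    then show ?thesis
      by (simp add: hstar_bas_ser lin_plus[OF lin_lin_ext] xi_ser[OF assms])
  qed
qed (intro lin_intros)+

text \<open>For \<open>A\<close> irreducible this holds by construction. In general \<open>A\<close> splits off from \<open>P = wnp_ser A B\<close> up to the tail of
  \<open>A \<star> B\<close>, and associativity on both sides reduces the claim to \<open>A\<close>, \<open>B\<close> and the posets of the tail.\<close>

lemma Xi_hstar_bas: "Xi g (hstar (bas P) y) \<approx> c2 (xi g P) (Xi g y)"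
proof (induction P arbitrary: y rule: wnp_induct)
  case empty
  then show ?case by (simp add: eqv_sym eqv_unit)
next
  case (point d)
  show ?case using Xi_hstar_irreducible[OF ser_irreducible_point[of d]] by simp
next
  case (sum C R)
  have "ser_irreducible (wnp_sum C R)"
  proof (rule ccontr)
    assume n: "\<not> ser_irreducible (wnp_sum C R)"
    obtain A B where AB: "ser_irreducible A" "wnp_sum C R = wnp_ser A B"
      using wnp_ser_factor[of "wnp_sum C R"] sum by auto
    have "B \<noteq> wnp_empty" using AB n by auto
    then have "sum_irreducible (wnp_sum C R)"
      using ser_reducible_sum_irreducible[of A B] AB ser_irreducible_not_empty by auto
    moreover have "C \<noteq> wnp_empty" using sum(1) by auto
    ultimately show False using wnp_sum_not_irreducible[of C R] sum(2) by blast
  qed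
  then show ?case by (rule Xi_hstar_irreducible)
next
  case (ser A B)
  have tail: "Xi g (hstar (star_tail A B) y) \<approx> c2 (Xi g (star_tail A B)) (Xi g y)"
  proof (rule eqv_lin[where x = "star_tail A B"])
    fix R assume "R \<in> Poly_Mapping.keys (star_tail A B :: 'a wnp \<Rightarrow>\<^sub>0 'k)"
    then show "Xi g (hstar (bas R) y) \<approx> c2 (Xi g (bas R)) (Xi g y)"
      using ser.IH(3) keys_star_tail by fastforce
  qed (intro lin_intros)+
  have "(bas (wnp_ser A B) :: _ \<Rightarrow>\<^sub>0 'k) = hstar (bas A) (bas B) - star_tail A B" by (simp add: hstar_bas_ser)
  then have "hstar (bas (wnp_ser A B)) y = hstar (bas A) (hstar (bas B) y) - hstar (star_tail A B) y"
    by (simp add: lin_minus[OF bilinearD(1)[OF bilinear_hstar]] hstar_assoc)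
  then have split: "Xi g (hstar (bas (wnp_ser A B)) y) =
      Xi g (hstar (bas A) (hstar (bas B) y)) - Xi g (hstar (star_tail A B) y)"
    by (simp add: lin_minus[OF lin_lin_ext])
  have "Xi g (hstar (bas (wnp_ser A B)) y) \<approx> c2 (xi g A) (Xi g (hstar (bas B) y)) - c2 (Xi g (star_tail A B)) (Xi g y)"
    unfolding split by (rule eqv_diff[OF Xi_hstar_irreducible[OF ser(1)] tail])
  also have "\<dots> \<approx> c2 (xi g A) (c2 (xi g B) (Xi g y)) - c2 (Xi g (star_tail A B)) (Xi g y)"
    by (rule eqv_diff[OF eqv_mult(2)[OF eqv_refl ser.IH(2)] eqv_refl])
  also have "\<dots> \<approx> c2 (c2 (xi g A) (xi g B)) (Xi g y) - c2 (Xi g (star_tail A B)) (Xi g y)"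
    by (rule eqv_diff[OF eqv_sym[OF eqv_assoc(2)] eqv_refl])
  also have "\<dots> = c2 (xi g (wnp_ser A B)) (Xi g y)"
    by (simp add: xi_ser[OF ser(1,2)] lin_minus[OF bilinearD(1)[OF bil(2)]])
  finally show ?case .
qed

lemma Xi_hstar: "Xi g (hstar x y) \<approx> c2 (Xi g x) (Xi g y)"
  by (rule eqv_lin[where x = x]) (auto intro!: lin_intros simp: Xi_hstar_bas)

end

section \<open>Substitution in WN posets and the operad of indexed WN posets\<close>

interpretation wnp_target: two_as_mod hsum hstar "bas wnp_empty" "{0} :: ('e wnp \<Rightarrow>\<^sub>0 'k::field) set"
proof
  show "pm.subspace ({0} :: ('e wnp \<Rightarrow>\<^sub>0 'k) set)" by (rule subspace_zero_only)
qed (simp_all add: bilinear_hsum bilinear_hstar lin_zero[OF bilinearD(1)[OF bilinear_hsum]]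
    lin_zero[OF bilinearD(2)[OF bilinear_hsum]] lin_zero[OF bilinearD(1)[OF bilinear_hstar]]
    lin_zero[OF bilinearD(2)[OF bilinear_hstar]] hsum_assoc hstar_assoc)

definition wnp_subst :: "('d \<Rightarrow> ('e wnp \<Rightarrow>\<^sub>0 'k::field)) \<Rightarrow> ('d wnp \<Rightarrow>\<^sub>0 'k) \<Rightarrow> ('e wnp \<Rightarrow>\<^sub>0 'k)" where
  "wnp_subst g = wnp_target.Xi g"

text \<open>Unlike \<^const>\<open>two_as_morphism\<close>, which restricts the decorations, this is about maps on the whole space; all
  compositions are restrictions of such maps.\<close>

definition two_as_hom :: "(('d wnp \<Rightarrow>\<^sub>0 'k::field) \<Rightarrow> ('e wnp \<Rightarrow>\<^sub>0 'k)) \<Rightarrow> bool" where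
  "two_as_hom f \<longleftrightarrow> lin f \<and> f (bas wnp_empty) = bas wnp_empty \<and>
     (\<forall>x y. f (hstar x y) = hstar (f x) (f y) \<and> f (hsum x y) = hsum (f x) (f y))"

lemma wnp_subst_hom: "two_as_hom (wnp_subst g)"
  using wnp_target.Xi_hsum[of g] wnp_target.Xi_hstar[of g]
  by (simp add: two_as_hom_def wnp_subst_def lin_lin_ext wnp_target.eqv_def)

lemma lin_wnp_subst: "lin (wnp_subst g)"
  and wnp_subst_empty [simp]: "wnp_subst g (bas wnp_empty) = bas wnp_empty"
  and wnp_subst_hstar: "wnp_subst g (hstar x y) = hstar (wnp_subst g x) (wnp_subst g y)"
  and wnp_subst_hsum: "wnp_subst g (hsum x y) = hsum (wnp_subst g x) (wnp_subst g y)"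
  using wnp_subst_hom[of g] by (simp_all add: two_as_hom_def)

lemma wnp_subst_point [simp]: "wnp_subst g (bas (wnp_point d)) = g d"
  by (simp add: wnp_subst_def)

lemma relabel_hom: "inj f \<Longrightarrow> two_as_hom (relabel f)"
  by (simp add: two_as_hom_def lin_lin_map relabel_hsum relabel_hstar)

lemma two_as_hom_compose: "two_as_hom f \<Longrightarrow> two_as_hom h \<Longrightarrow> two_as_hom (\<lambda>x. f (h x))"
  by (simp add: two_as_hom_def lin_compose)

lemma two_as_hom_id: "two_as_hom (\<lambda>x. x)"
  by (simp add: two_as_hom_def lin_id)

lemma subspace_keys: "pm.subspace {x :: 'b \<Rightarrow>\<^sub>0 'k::field. Poly_Mapping.keys x \<subseteq> B}"
  by (metis span_bas_eq pm.subspace_span)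

lemma WNP_space_eq: "WNP_space D = {x. \<forall>P\<in>Poly_Mapping.keys x. set_mset (wnp_mdec P) \<subseteq> D}"
proof -
  have "wnp_over D = {P. set_mset (wnp_mdec P) \<subseteq> D}"
  proof (intro equalityI subsetI)
    fix P assume "P \<in> wnp_over D"
    then show "P \<in> {P. set_mset (wnp_mdec P) \<subseteq> D}"
      by (auto simp: wnp_over_def wnp_mdec_abs WN_D(1))
  next
    fix P assume P: "P \<in> {P. set_mset (wnp_mdec P) \<subseteq> D}"
    obtain X where X: "WN_poset X" "P = abs_wnp X" by (rule wnp_cases)
    then have "dec X ` verts X \<subseteq> D" using P by (simp add: wnp_mdec_abs WN_D(1))
    then show "P \<in> wnp_over D" using X by (auto simp: wnp_over_def)
  qed
  then show ?thesis by (auto simp: WNP_space_def span_bas_eq)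
qed

lemma wnp_piece_space: "set_mset M \<subseteq> D \<Longrightarrow> wnp_piece M \<subseteq> WNP_space D"
  by (auto simp: WNP_space_eq wnp_piece_def)

lemma subspace_WNP_space: "pm.subspace (WNP_space D)"
  unfolding WNP_space_def by (rule pm.subspace_span)

lemma hstar_in_WNP_space: "x \<in> WNP_space D \<Longrightarrow> y \<in> WNP_space D \<Longrightarrow> hstar x y \<in> WNP_space D"
  unfolding WNP_space_eq using keys_hstar by (fastforce simp: ideal_cut_def)

lemma hsum_in_WNP_space: "x \<in> WNP_space D \<Longrightarrow> y \<in> WNP_space D \<Longrightarrow> hsum x y \<in> WNP_space D"
  by (rule bilinear_in_subspace[OF bilinear_hsum subspace_WNP_space]) (auto simp: WNP_space_eq)

lemma two_as_hom_morphism: "two_as_hom f \<Longrightarrow> two_as_morphism D UNIV f"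
  by (auto simp: two_as_morphism_def two_as_hom_def linear_on_def WNP_space_eq)

text \<open>The elements at which two morphisms agree form a subspace that is stable under both products.\<close>

lemma two_as_morphism_unique:
  assumes f: "two_as_morphism D E f" and h: "two_as_morphism D E h"
    and p: "\<And>d. d \<in> D \<Longrightarrow> f (bas (wnp_point d)) = h (bas (wnp_point d))"
    and x: "x \<in> WNP_space D"
  shows "f x = h x"
proof -
  let ?T = "{x \<in> WNP_space D. f x = h x}"
  have lf: "f (x + y) = f x + f y" "f (scal c x) = scal c (f x)"
    and lh: "h (x + y) = h x + h y" "h (scal c x) = scal c (h x)"
    if "x \<in> WNP_space D" "y \<in> WNP_space D" for x y c
    using f h that by (auto simp: two_as_morphism_def linear_on_def)
  have z: "0 \<in> WNP_space D" by (rule pm.subspace_0[OF subspace_WNP_space])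
  have T: "pm.subspace ?T"
  proof (rule pm.subspaceI)
    have "f (scal 0 0) = scal 0 (f 0)" "h (scal 0 0) = scal 0 (h 0)" using lf(2) lh(2) z by blast+
    then show "0 \<in> ?T" using z by simp
  next
    fix x y assume "x \<in> ?T" "y \<in> ?T"
    then show "x + y \<in> ?T" using lf(1) lh(1) pm.subspace_add[OF subspace_WNP_space] by auto
  next
    fix c x assume "x \<in> ?T"
    then show "scal c x \<in> ?T" using lf(2) lh(2) pm.subspace_scale[OF subspace_WNP_space] by auto
  qed
  define S where "S M = (if set_mset M \<subseteq> D then ?T else UNIV)" for M
  have gen: "x \<in> S M" if "x \<in> wnp_piece M" for x M
    using _ _ _ _ _ that
  proof (rule wnp_generated)
    show "pm.subspace (S M)" for M by (simp add: S_def T)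
    show "bas wnp_empty \<in> S {#}"
      using f h by (simp add: S_def two_as_morphism_def WNP_space_eq)
    show "bas (wnp_point d) \<in> S {#d#}" for d using p[of d] by (simp add: S_def WNP_space_eq)
  next
    fix M N x y assume "x \<in> S M" "y \<in> S N"
    then show "hsum x y \<in> S (M + N)"
      using f h hsum_in_WNP_space by (auto simp: S_def two_as_morphism_def)
  next
    fix M N x y assume "x \<in> S M" "y \<in> S N"
    then show "hstar x y \<in> S (M + N)"
      using f h hstar_in_WNP_space by (auto simp: S_def two_as_morphism_def)
  qed
  have "bas P \<in> ?T" if "P \<in> wnp_over D" for P
  proof -
    have "(bas P :: 'a wnp \<Rightarrow>\<^sub>0 'c) \<in> WNP_space D"
      unfolding WNP_space_def by (rule pm.span_base) (use that in blast)
    then have "set_mset (wnp_mdec P) \<subseteq> D" by (simp add: WNP_space_eq)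
    then show ?thesis using gen[of "bas P" "wnp_mdec P"] by (simp add: S_def)
  qed
  then have "WNP_space D \<subseteq> ?T"
    unfolding WNP_space_def by (intro pm.span_minimal) (use T in \<open>auto simp: WNP_space_def\<close>)
  then show ?thesis using x by blast
qed

lemma two_as_hom_unique:
  assumes "two_as_hom f" "two_as_hom h" "x \<in> wnp_piece M"
    "\<And>d. d \<in># M \<Longrightarrow> f (bas (wnp_point d)) = h (bas (wnp_point d))"
  shows "f x = h x"
  by (rule two_as_morphism_unique[OF two_as_hom_morphism[OF assms(1)] two_as_hom_morphism[OF assms(2)],
        of "set_mset M"]) (use assms(3,4) wnp_piece_space[of M "set_mset M"] in auto)

lemma two_as_hom_eqI:
  assumes "two_as_hom f" "two_as_hom h" "\<And>d. f (bas (wnp_point d)) = h (bas (wnp_point d))"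
  shows "f x = h x"
  by (rule two_as_morphism_unique[OF two_as_hom_morphism[OF assms(1)] two_as_hom_morphism[OF assms(2)], of UNIV])
    (use assms(3) in \<open>auto simp: WNP_space_eq\<close>)

lemma wnp_subst_relabel: "inj f \<Longrightarrow> wnp_subst g (relabel f x) = wnp_subst (\<lambda>i. g (f i)) x"
  by (rule two_as_hom_eqI) (auto intro: two_as_hom_compose wnp_subst_hom relabel_hom)

lemma relabel_wnp_subst: "inj f \<Longrightarrow> relabel f (wnp_subst g x) = wnp_subst (\<lambda>i. relabel f (g i)) x"
  by (rule two_as_hom_eqI) (auto intro: two_as_hom_compose wnp_subst_hom relabel_hom)

lemma wnp_subst_wnp_subst: "wnp_subst h (wnp_subst g x) = wnp_subst (\<lambda>i. wnp_subst h (g i)) x"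
  by (rule two_as_hom_eqI) (auto intro: two_as_hom_compose wnp_subst_hom)

lemma wnp_subst_id: "wnp_subst (\<lambda>i. bas (wnp_point i)) x = x"
  by (rule two_as_hom_eqI[OF wnp_subst_hom two_as_hom_id]) simp

lemma wnp_subst_cong:
  "x \<in> wnp_piece M \<Longrightarrow> (\<And>i. i \<in># M \<Longrightarrow> g i = h i) \<Longrightarrow> wnp_subst g x = wnp_subst h x"
  by (rule two_as_hom_unique[OF wnp_subst_hom wnp_subst_hom]) auto

lemma relabel_id [simp]: "relabel (\<lambda>i. i) x = x"
  by (rule lin_eqI[OF lin_lin_map lin_id]) simp

lemma relabel_cong:
  "x \<in> wnp_piece M \<Longrightarrow> (\<And>i. i \<in># M \<Longrightarrow> f i = h i) \<Longrightarrow> relabel f x = relabel h x"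
  by (rule lin_map_cong, rule wnp_map_dec_cong) (auto simp: wnp_piece_def)

lemma subspace_vimage: "lin f \<Longrightarrow> pm.subspace S \<Longrightarrow> pm.subspace {x. f x \<in> S}"
  by (auto simp: pm.subspace_def lin_zero lin_plus lin_scale)

lemma wnp_subst_piece:
  assumes "x \<in> wnp_piece M" "\<And>i. i \<in># M \<Longrightarrow> g i \<in> wnp_piece (N i)"
  shows "wnp_subst g x \<in> wnp_piece (\<Sum>i\<in>#M. N i)"
proof -
  define S where "S M = (if \<forall>i\<in>#M. g i \<in> wnp_piece (N i)
    then {x. wnp_subst g x \<in> wnp_piece (\<Sum>i\<in>#M. N i)} else UNIV)" for M
  have "x \<in> S M"
    using _ _ _ _ _ assms(1)
  proof (rule wnp_generated)
    show "pm.subspace (S M)" for M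
      by (auto simp: S_def intro!: subspace_vimage lin_wnp_subst subspace_wnp_piece)
    show "bas wnp_empty \<in> S {#}" "bas (wnp_point d) \<in> S {#d#}" for d
      by (auto simp: S_def)
  next
    fix M' N' x y assume "x \<in> S M'" "y \<in> S N'"
    then show "hsum x y \<in> S (M' + N')" "hstar x y \<in> S (M' + N')"
      using hsum_in_wnp_piece hstar_in_wnp_piece
      by (auto simp: S_def wnp_subst_hsum wnp_subst_hstar)
  qed
  then show ?thesis using assms(2) by (simp add: S_def)
qed

text \<open>An index that occurs exactly once in a product occurs in exactly one of the factors, and the other factor does
  not depend on its argument. The value \<open>g 0 i\<close> stands for the common value of all \<open>g v i\<close>.\<close>

lemma wnp_subst_multilinear:
  fixes g :: "('c \<Rightarrow>\<^sub>0 'k::field) \<Rightarrow> 'd \<Rightarrow> ('e wnp \<Rightarrow>\<^sub>0 'k)"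
  assumes x: "x \<in> wnp_piece M" and c: "count M i0 = 1"
    and g: "\<And>i v. i \<in># M \<Longrightarrow> i \<noteq> i0 \<Longrightarrow> g v i = g 0 i" "lin (\<lambda>v. g v i0)"
  shows "lin (\<lambda>v. wnp_subst (g v) x)"
proof -
  let ?C = "\<lambda>M. \<forall>i\<in>#M. i \<noteq> i0 \<longrightarrow> (\<forall>v. g v i = g 0 i)"
  define S where "S M = {x. ?C M \<longrightarrow> (count M i0 = 0 \<longrightarrow> (\<forall>v. wnp_subst (g v) x = wnp_subst (g 0) x)) \<and>
    (count M i0 = 1 \<longrightarrow> lin (\<lambda>v. wnp_subst (g v) x))}" for M
  have S0: "wnp_subst (g v) x = wnp_subst (g 0) x" if "x \<in> S M" "?C M" "count M i0 = 0" for M x v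
    using that unfolding S_def by blast
  have S1: "lin (\<lambda>v. wnp_subst (g v) x)" if "x \<in> S M" "?C M" "count M i0 = 1" for M x
    using that unfolding S_def by blast
  have prod: "m x y \<in> S (M + N)" if xy: "x \<in> S M" "y \<in> S N" and m: "bilinear m'"
    "\<And>v. wnp_subst (g v) (m x y) = m' (wnp_subst (g v) x) (wnp_subst (g v) y)" for M N x y m m'
    unfolding S_def
  proof (intro CollectI impI conjI allI)
    assume C: "?C (M + N)" and z: "count (M + N) i0 = 0"
    have "?C M" "?C N" using C by (blast intro: union_iff[THEN iffD2])+
    moreover have "count M i0 = 0" "count N i0 = 0" using z by simp_all
    ultimately show "wnp_subst (g v) (m x y) = wnp_subst (g 0) (m x y)" for v
      unfolding m(2) by (simp only: S0[OF xy(1), of v] S0[OF xy(2), of v])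
  next
    assume C: "?C (M + N)" and o: "count (M + N) i0 = 1"
    have CC: "?C M" "?C N" using C by (blast intro: union_iff[THEN iffD2])+
    have "count M i0 = 1 \<and> count N i0 = 0 \<or> count M i0 = 0 \<and> count N i0 = 1"
      using o by (simp add: add_is_1)
    then show "lin (\<lambda>v. wnp_subst (g v) (m x y))"
    proof (elim disjE conjE)
      assume o: "count M i0 = 1" "count N i0 = 0"
      have "(\<lambda>v. wnp_subst (g v) (m x y)) = (\<lambda>v. m' (wnp_subst (g v) x) (wnp_subst (g 0) y))"
        unfolding m(2) by (rule ext, rule arg_cong[of _ _ "m' _"], rule S0[OF xy(2) CC(2) o(2)])
      then show ?thesis
        using bilinear_arg(1)[OF m(1) S1[OF xy(1) CC(1) o(1)]] by simp
    next
      assume o: "count M i0 = 0" "count N i0 = 1"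
      have "(\<lambda>v. wnp_subst (g v) (m x y)) = (\<lambda>v. m' (wnp_subst (g 0) x) (wnp_subst (g v) y))"
        unfolding m(2) by (rule ext, rule arg_cong[of _ _ "\<lambda>z. m' z _"], rule S0[OF xy(1) CC(1) o(1)])
      then show ?thesis
        using bilinear_arg(2)[OF m(1) S1[OF xy(2) CC(2) o(2)]] by simp
    qed
  qed
  have "x \<in> S M"
    using _ _ _ _ _ x
  proof (rule wnp_generated)
    show "pm.subspace (S M)" for M
    proof (rule pm.subspaceI)
      show "0 \<in> S M" unfolding S_def by (simp only: mem_Collect_eq lin_zero[OF lin_wnp_subst] lin_zero_fun simp_thms)
    next
      fix x y assume xy: "x \<in> S M" "y \<in> S M"
      show "x + y \<in> S M"
        unfolding S_def
      proof (intro CollectI impI conjI allI)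
        assume "?C M" "count M i0 = 0"
        then show "wnp_subst (g v) (x + y) = wnp_subst (g 0) (x + y)" for v
          by (simp only: lin_plus[OF lin_wnp_subst] S0[OF xy(1), of v] S0[OF xy(2), of v])
      next
        assume a: "?C M" "count M i0 = 1"
        show "lin (\<lambda>v. wnp_subst (g v) (x + y))"
          unfolding lin_plus[OF lin_wnp_subst] by (rule lin_add_fun[OF S1[OF xy(1) a] S1[OF xy(2) a]])
      qed
    next
      fix c x assume x: "x \<in> S M"
      show "scal c x \<in> S M"
        unfolding S_def
      proof (intro CollectI impI conjI allI)
        assume "?C M" "count M i0 = 0"
        then show "wnp_subst (g v) (scal c x) = wnp_subst (g 0) (scal c x)" for v
          by (simp only: lin_scale[OF lin_wnp_subst] S0[OF x, of v])
      next
        assume a: "?C M" "count M i0 = 1"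
        show "lin (\<lambda>v. wnp_subst (g v) (scal c x))"
          unfolding lin_scale[OF lin_wnp_subst] by (rule lin_scal_fun[OF S1[OF x a]])
      qed
    qed
    show "bas wnp_empty \<in> S {#}" by (simp add: S_def)
    show "bas (wnp_point d) \<in> S {#d#}" for d
      unfolding S_def using g(2) by (cases "d = i0") simp_all
  next
    fix M N x y assume xy: "x \<in> S M" "y \<in> S N"
    show "hsum x y \<in> S (M + N)" 
      by (rule prod[where m = hsum and m' = hsum]) (simp_all add: xy bilinear_hsum wnp_subst_hsum)
    show "hstar x y \<in> S (M + N)" 
      by (rule prod[where m = hstar and m' = hstar]) (simp_all add: xy bilinear_hstar wnp_subst_hstar)
  qed
  moreover have "?C M" using g(1) by blast
  ultimately show ?thesis using c S1 by blast
qed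

subsection \<open>The composition of the operad\<close>

lemma image_mset_eq_mset_set:
  assumes A: "finite A" and B: "finite B"
  shows "image_mset f (mset_set A) = mset_set B \<longleftrightarrow> bij_betw f A B"
proof
  assume e: "image_mset f (mset_set A) = mset_set B"
  have "set_mset (image_mset f (mset_set A)) = B" "size (image_mset f (mset_set A)) = card B"
    unfolding e using B by simp_all
  then have "f ` A = B" "card A = card B" using A by simp_all
  then show "bij_betw f A B" using A eq_card_imp_inj_on[of A f] by (auto simp: bij_betw_def)
qed (auto simp: bij_betw_def image_mset_mset_set)

abbreviation labels :: "nat \<Rightarrow> nat multiset" where
  "labels n \<equiv> mset_set {1..n}"

lemma wnp_ind_eq: "wnp_ind n = {P. wnp_mdec P = labels n}"
proof (intro equalityI subsetI)
  fix P assume "P \<in> wnp_ind n"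
  then show "P \<in> {P. wnp_mdec P = labels n}"
    by (auto simp: wnp_ind_def wnp_mdec_abs image_mset_eq_mset_set WN_D(1))
next
  fix P assume P: "P \<in> {P. wnp_mdec P = labels n}"
  obtain X where X: "WN_poset X" "P = abs_wnp X" by (rule wnp_cases)
  then have b: "bij_betw (dec X) (verts X) {1..n}"
    using P by (simp add: wnp_mdec_abs image_mset_eq_mset_set WN_D(1))
  then show "P \<in> wnp_ind n" using X bij_betw_same_card[OF b] by (auto simp: wnp_ind_def)
qed

lemma wnp_h_ind_eq: "wnp_h_ind n = {P. wnp_mdec P = labels n \<and> sum_irreducible P}"
proof (intro equalityI subsetI)
  fix P assume "P \<in> wnp_h_ind n"
  then show "P \<in> {P. wnp_mdec P = labels n \<and> sum_irreducible P}"
    by (auto simp: wnp_h_ind_def wnp_mdec_abs image_mset_eq_mset_set WN_D(1) h_connected_iff)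
next
  fix P assume P: "P \<in> {P. wnp_mdec P = labels n \<and> sum_irreducible P}"
  then have "P \<in> wnp_ind n" by (simp add: wnp_ind_eq)
  then obtain X where X: "P = abs_wnp X" "WN_poset X" "card (verts X) = n"
    "bij_betw (dec X) (verts X) {1..n}" by (auto simp: wnp_ind_def)
  then have "h_connected X" using P h_connected_iff by auto
  then show "P \<in> wnp_h_ind n" using X by (auto simp: wnp_h_ind_def)
qed

lemma WNP_h_eq: "WNP_h n = wnp_piece (labels n) \<inter> primitives"
  by (auto simp: WNP_h_def span_bas_eq wnp_h_ind_eq wnp_piece_def primitives_def)

lemma WNP_operad_simps [simp]:
  "ocar WNP_operad n = wnp_piece (labels n)" "oscal WNP_operad = scal"
  "ounit WNP_operad = bas (wnp_point 1)" "opact WNP_operad n \<sigma> = relabel \<sigma>"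
  by (simp_all add: WNP_operad_def wnp_ind_eq wnp_piece_span)

abbreviation shift :: "nat \<Rightarrow> (nat wnp \<Rightarrow>\<^sub>0 'k::field) \<Rightarrow> (nat wnp \<Rightarrow>\<^sub>0 'k)" where
  "shift c \<equiv> relabel (\<lambda>j. j + c)"

text \<open>The morphism that defines the composition is characterised on the posets decorated by \<open>{1..k}\<close>; substitution
  satisfies the characterisation, and the indices outside of \<open>{1..k}\<close> have no influence there.\<close>

lemma wnp_comp_morphism_eq:
  fixes x :: "nat wnp \<Rightarrow>\<^sub>0 'k::field"
  assumes "x \<in> WNP_space {1..k}"
  shows "wnp_comp_morphism k n Ps x = wnp_subst (\<lambda>i. shift (offset n i) (bas (Ps ! (i - 1)))) x"
proof -
  let ?g = "\<lambda>i. shift (offset n i) (bas (Ps ! (i - 1))) :: nat wnp \<Rightarrow>\<^sub>0 'k"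
  let ?f = "restrict (wnp_subst ?g) (WNP_space {1..k})"
  have space: "(bas wnp_empty :: nat wnp \<Rightarrow>\<^sub>0 'k) \<in> WNP_space D"
    "d \<in> D \<Longrightarrow> (bas (wnp_point d) :: nat wnp \<Rightarrow>\<^sub>0 'k) \<in> WNP_space D"
    for D :: "nat set" and d by (simp_all add: WNP_space_eq)
  have "two_as_morphism {1..k} UNIV (wnp_subst ?g)" by (rule two_as_hom_morphism[OF wnp_subst_hom])
  then have m: "two_as_morphism {1..k} UNIV ?f"
    unfolding two_as_morphism_def linear_on_def
    by (simp add: space hstar_in_WNP_space hsum_in_WNP_space
        pm.subspace_add[OF subspace_WNP_space] pm.subspace_scale[OF subspace_WNP_space])
  have "wnp_comp_morphism k n Ps = ?f"
    unfolding wnp_comp_morphism_def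
  proof (rule the_equality)
    show "?f \<in> extensional (WNP_space {1..k}) \<and> two_as_morphism {1..k} UNIV ?f \<and>
        (\<forall>i\<in>{1..k}. ?f (bas (wnp_point i)) = bas (wnp_map_dec (\<lambda>j. j + offset n i) (Ps ! (i - 1))))"
      using m by (simp add: space)
  next
    fix h :: "(nat wnp \<Rightarrow>\<^sub>0 'k) \<Rightarrow> (nat wnp \<Rightarrow>\<^sub>0 'k)"
    assume h: "h \<in> extensional (WNP_space {1..k}) \<and> two_as_morphism {1..k} UNIV h \<and>
        (\<forall>i\<in>{1..k}. h (bas (wnp_point i)) = bas (wnp_map_dec (\<lambda>j. j + offset n i) (Ps ! (i - 1))))"
    show "h = ?f"
    proof (rule extensionalityI[of _ "WNP_space {1..k}"])
      show "h x = ?f x" if "x \<in> WNP_space {1..k}" for x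
        by (rule two_as_morphism_unique[OF _ m _ that]) (use h space in auto)
    qed (use h in auto)
  qed
  then show ?thesis using assms by simp
qed

lemma keys_tensor_list: "Poly_Mapping.keys (tensor_list vs) \<subseteq> {w. length w = length vs}"
proof (induction vs)
  case (Cons v vs)
  have "lin_map ((#) b) (tensor_list vs) \<in> {x. Poly_Mapping.keys x \<subseteq> {w. length w = length (v # vs)}}" for b
  proof (rule CollectI, rule subsetI)
    fix x assume "x \<in> Poly_Mapping.keys (lin_map ((#) b) (tensor_list vs))"
    then have "x \<in> (#) b ` Poly_Mapping.keys (tensor_list vs)" by (rule subsetD[OF keys_lin_map])
    then obtain w where "w \<in> Poly_Mapping.keys (tensor_list vs)" "x = b # w" by (rule imageE)
    then show "x \<in> {w. length w = length (v # vs)}" using Cons.IH by auto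
  qed
  then have "tensor_list (v # vs) \<in> {x. Poly_Mapping.keys x \<subseteq> {w. length w = length (v # vs)}}"
    unfolding tensor_list.simps by (rule lin_ext_in_subspace[OF subspace_keys])
  then show ?case by (rule CollectD)
qed simp

text \<open>Composition extends the morphism multilinearly from tuples of posets. Since each index occurs once in an indexed
  poset, substitution is multilinear too, so composition is substitution of vectors. In the lists, the
  argument with index \<open>i\<close> is at position \<open>i - 1\<close>.\<close>

lemma opcomp_WNP:
  assumes q: "q \<in> wnp_piece (labels k)"
  shows "opcomp WNP_operad k n q p = wnp_subst (\<lambda>i. shift (offset n i) (p i)) (q :: nat wnp \<Rightarrow>\<^sub>0 'k::field)"
proof -
  have "opcomp WNP_operad k n q p = lin_ext (\<lambda>Q. lin_ext (\<lambda>Ps. wnp_comp_morphism k n Ps (bas Q))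
      (tensor_list (map p [1..<Suc k]))) q"
    by (simp add: WNP_operad_def)
  also have "\<dots> = lin_ext (\<lambda>Q. wnp_subst (\<lambda>i. shift (offset n i) (p i)) (bas Q)) q"
  proof (rule lin_ext_cong)
    fix Q assume "Q \<in> Poly_Mapping.keys q"
    then have Q: "bas Q \<in> wnp_piece (labels k)" "bas Q \<in> WNP_space {1..k}"
      using q by (auto simp: wnp_piece_def WNP_space_eq)
    let ?ps = "map p [1..<Suc k]"
    define G where "G vs = wnp_subst (\<lambda>i. shift (offset n i) (vs ! (i - 1))) (bas Q)"
      for vs :: "(nat wnp \<Rightarrow>\<^sub>0 'k) list"
    have "lin_ext (\<lambda>Ps. wnp_comp_morphism k n Ps (bas Q)) (tensor_list ?ps) =
        lin_ext (\<lambda>Ps. G (map bas Ps)) (tensor_list ?ps)"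
    proof (rule lin_ext_cong)
      fix Ps assume "Ps \<in> Poly_Mapping.keys (tensor_list ?ps)"
      then have l: "length Ps = k" using keys_tensor_list[of ?ps] by auto
      have "wnp_subst (\<lambda>i. shift (offset n i) (bas (Ps ! (i - 1)))) (bas Q) =
          wnp_subst (\<lambda>i. shift (offset n i) (map bas Ps ! (i - 1))) (bas Q :: nat wnp \<Rightarrow>\<^sub>0 'k)"
        by (rule wnp_subst_cong[OF Q(1)]) (use l in auto)
      then show "wnp_comp_morphism k n Ps (bas Q) = G (map bas Ps)"
        unfolding wnp_comp_morphism_eq[OF Q(2)] G_def .
    qed
    also have "\<dots> = G ?ps"
    proof (rule lin_ext_tensor_list)
      fix xs ys :: "(nat wnp \<Rightarrow>\<^sub>0 'k) list"
      assume l: "length xs + length ys + 1 = length ?ps"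
      show "lin (\<lambda>v. G (xs @ v # ys))"
        unfolding G_def
      proof (rule wnp_subst_multilinear[OF Q(1), where ?i0.0 = "Suc (length xs)"])
        show "count (labels k) (Suc (length xs)) = 1"
          using l by (simp del: upt_Suc add: count_mset_set)
        show "lin (\<lambda>v. shift (offset n (Suc (length xs))) ((xs @ v # ys) ! (Suc (length xs) - 1)))"
          by (simp add: lin_lin_map)
      next
        fix i v assume i: "i \<in># labels k" "i \<noteq> Suc (length xs)"
        then have "i - 1 \<noteq> length xs" by auto
        then show "shift (offset n i) ((xs @ v # ys) ! (i - 1)) =
            shift (offset n i) ((xs @ 0 # ys) ! (i - 1))"
          by (auto simp: nth_append nth_Cons' )
      qed
    qed
    also have "\<dots> = wnp_subst (\<lambda>i. shift (offset n i) (p i)) (bas Q)"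
      unfolding G_def by (rule wnp_subst_cong[OF Q(1)]) (auto simp del: upt_Suc)
    finally show "lin_ext (\<lambda>Ps. wnp_comp_morphism k n Ps (bas Q)) (tensor_list ?ps) =
        wnp_subst (\<lambda>i. shift (offset n i) (p i)) (bas Q)" .
  qed
  also have "\<dots> = wnp_subst (\<lambda>i. shift (offset n i) (p i)) q"
    by (rule lin_ext_eqI[symmetric, OF lin_wnp_subst]) simp
  finally show ?thesis .
qed

lemma offset_Suc: "1 \<le> i \<Longrightarrow> offset n (Suc i) = offset n i + n i"
  by (simp add: offset_def atLeastLessThanSuc)

lemma offset_total: "(\<Sum>i=1..k. n i) = offset n (Suc k)"
  by (simp add: offset_def atLeastLessThanSuc_atLeastAtMost)

lemma labels_shift: "image_mset (\<lambda>j. j + c) (labels m) = mset_set {c + 1..c + m}"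
  by (subst image_mset_mset_set) (auto simp: image_add_atLeastAtMost' add.commute)

lemma labels_total: "(\<Sum>i\<in>#labels k. image_mset (\<lambda>j. j + offset n i) (labels (n i))) = labels (\<Sum>i=1..k. n i)"
proof (induction k)
  case (Suc k)
  have "labels (Suc k) = labels k + {#Suc k#}"
    by (simp add: atLeastAtMostSuc_conv)
  then have "(\<Sum>i\<in>#labels (Suc k). image_mset (\<lambda>j. j + offset n i) (labels (n i))) =
      labels (offset n (Suc k)) + mset_set {offset n (Suc k) + 1..offset n (Suc k) + n (Suc k)}"
    using Suc by (simp add: labels_shift offset_total del: One_nat_def)
  also have "\<dots> = mset_set ({1..offset n (Suc k)} \<union> {offset n (Suc k) + 1..offset n (Suc k) + n (Suc k)})"
    by (rule mset_set_Union[symmetric]) auto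
  also have "{1..offset n (Suc k)} \<union> {offset n (Suc k) + 1..offset n (Suc k) + n (Suc k)} =
      {1..offset n (Suc (Suc k))}"
    by (auto simp: offset_Suc)
  finally show ?case by (simp only: offset_total)
qed simp

text \<open>The inputs of an iterated composition are numbered consecutively within the blocks of each \<open>p i\<close>; the
  offset of an input is the offset of its block plus its offset inside the block.\<close>

lemma offset_block:
  assumes "1 \<le> j"
  shows "offset m (a + j) = offset m (a + 1) + offset (\<lambda>j. m (a + j)) j"
  using assms
proof (induction j rule: dec_induct)
  case base
  show ?case by (simp add: offset_def)
next
  case (step j)
  then show ?case by (simp add: offset_Suc)
qed

lemma offset_offset:
  assumes "1 \<le> i"
  shows "offset m (offset n i + 1) = offset (\<lambda>i. \<Sum>j=1..n i. m (offset n i + j)) i"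
  using assms
proof (induction i rule: dec_induct)
  case base
  show ?case by (simp add: offset_def)
next
  case (step i)
  have "offset m (offset n (Suc i) + 1) = offset m (offset n i + Suc (n i))"
    using step by (simp add: offset_Suc)
  also have "\<dots> = offset m (offset n i + 1) + offset (\<lambda>j. m (offset n i + j)) (Suc (n i))"
    by (rule offset_block) simp
  also have "\<dots> = offset (\<lambda>i. \<Sum>j=1..n i. m (offset n i + j)) (Suc i)"
    using step.IH by (simp only: offset_Suc[OF step(1)] offset_total)
  finally show ?case .
qed

lemma inj_shift: "inj (\<lambda>j::nat. j + c)"
  by (simp add: inj_on_def)

lemma labels_permutes: "\<sigma> permutes {1..n} \<Longrightarrow> image_mset \<sigma> (labels n) = labels n"
  using permutes_image permutes_inj_on by (subst image_mset_mset_set) auto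

lemma relabel_permutes_piece:
  "\<sigma> permutes {1..n} \<Longrightarrow> x \<in> wnp_piece (labels n) \<Longrightarrow> relabel \<sigma> x \<in> wnp_piece (labels n)"
  using relabel_in_wnp_piece labels_permutes by metis

text \<open>With composition as substitution, associativity says that substitutions compose, the unit axioms that
  substituting points changes nothing, and equivariance that relabelling is itself a substitution. What
  remains is to compare the numberings of the inputs.\<close>

lemma WNP_operad_is_operad: "is_operad (WNP_operad :: ('k::field, nat wnp \<Rightarrow>\<^sub>0 'k) operad)"
proof -
  let ?P = "WNP_operad :: ('k, nat wnp \<Rightarrow>\<^sub>0 'k) operad"
  let ?g = "\<lambda>n p i. shift (offset n i) (p i) :: nat wnp \<Rightarrow>\<^sub>0 'k"
  have comp: "q \<in> wnp_piece (labels k)" "\<And>i. i \<in># labels k \<Longrightarrow> p i \<in> wnp_piece (labels (n i))"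
    if "composable (ocar ?P) k n q p" for k n q p
    using that by (auto simp: composable_def)
  have op: "opcomp ?P k n q p = wnp_subst (?g n p) q" if "q \<in> wnp_piece (labels k)" for k n q p
    by (rule opcomp_WNP[OF that])
  have closed: "opcomp ?P k n q p \<in> wnp_piece (labels (\<Sum>i=1..k. n i))"
    if "composable (ocar ?P) k n q p" for k n q p
    unfolding op[OF comp(1)[OF that]] labels_total[symmetric]
    by (rule wnp_subst_piece[OF comp(1)[OF that]]) (rule relabel_in_wnp_piece, rule comp(2)[OF that])
  have "operad_spaces ?P"
    by (simp add: operad_spaces_def vector_space_scal subspace_wnp_piece)
  moreover have "operad_composition ?P"
    unfolding operad_composition_def
  proof (intro allI impI conjI ballI)
    fix k n q p assume c: "composable (ocar ?P) k n q p"
    note q = comp(1)[OF c]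
    show "opcomp ?P k n q p \<in> ocar ?P (\<Sum>i=1..k. n i)" using closed[OF c] by simp
    show "linear_on (oscal ?P) (oscal ?P) (ocar ?P k) (\<lambda>x. opcomp ?P k n x p)"
      by (simp add: linear_on_def op pm.subspace_add[OF subspace_wnp_piece]
          pm.subspace_scale[OF subspace_wnp_piece] lin_plus[OF lin_wnp_subst] lin_scale[OF lin_wnp_subst])
    show "linear_on (oscal ?P) (oscal ?P) (ocar ?P (n i)) (\<lambda>x. opcomp ?P k n q (p(i := x)))"
      if "i \<in> {1..k}" for i
    proof -
      have "lin (\<lambda>x. wnp_subst (?g n (p(i := x))) q)"
        by (rule wnp_subst_multilinear[OF q, where ?i0.0 = i]) (use that in \<open>auto intro: lin_lin_map\<close>)
      then show ?thesis by (simp add: op[OF q] linear_on_def)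
    qed
    show "opcomp ?P k n' q p' = opcomp ?P k n q p"
      if "\<forall>i\<in>{1..k}. n' i = n i \<and> p' i = p i" for n' p'
    proof -
      have "offset n' i = offset n i" if "i \<in> {1..k}" for i
        unfolding offset_def using \<open>\<forall>i\<in>{1..k}. _ i\<close> that by (intro sum.cong) auto
      then show ?thesis unfolding op[OF q] using that by (intro wnp_subst_cong[OF q]) auto
    qed
  qed
  moreover have "operad_assoc ?P"
    unfolding operad_assoc_def
  proof (intro allI impI, elim conjE)
    fix k n q p m r
    assume c: "composable (ocar ?P) k n q p"
      and r: "\<forall>l\<in>{1..\<Sum>i=1..k. n i}. 1 \<le> m l \<and> r l \<in> ocar ?P (m l)"
    note q = comp(1)[OF c]
    have "opcomp ?P (\<Sum>i=1..k. n i) m (opcomp ?P k n q p) r =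
        wnp_subst (\<lambda>i. wnp_subst (?g m r) (?g n p i)) q"
      unfolding op[OF closed[OF c]] unfolding op[OF q] by (rule wnp_subst_wnp_subst)
    also have "\<dots> = wnp_subst (?g (\<lambda>i. \<Sum>j=1..n i. m (offset n i + j))
        (\<lambda>i. opcomp ?P (n i) (\<lambda>j. m (offset n i + j)) (p i) (\<lambda>j. r (offset n i + j)))) q"
    proof (rule wnp_subst_cong[OF q])
      fix i assume i: "i \<in># labels k"
      note pi = comp(2)[OF c i]
      let ?m = "\<lambda>i. \<Sum>j=1..n i. m (offset n i + j)"
      have "wnp_subst (?g m r) (?g n p i) = wnp_subst (\<lambda>j. ?g m r (j + offset n i)) (p i)"
        by (rule wnp_subst_relabel[OF inj_shift])
      also have "\<dots> = wnp_subst (\<lambda>j. shift (offset ?m i)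
          (?g (\<lambda>j. m (offset n i + j)) (\<lambda>j. r (offset n i + j)) j)) (p i)"
      proof (rule wnp_subst_cong[OF pi])
        fix j assume j: "j \<in># labels (n i)"
        have "offset m (offset n i + j) = offset ?m i + offset (\<lambda>j. m (offset n i + j)) j"
          using offset_block[of j m "offset n i"] offset_offset[of i m n] i j by simp
        then show "?g m r (j + offset n i) = shift (offset ?m i)
            (?g (\<lambda>j. m (offset n i + j)) (\<lambda>j. r (offset n i + j)) j)"
          by (simp add: lin_map_lin_map wnp_map_dec_comp ac_simps)
      qed
      also have "\<dots> = shift (offset ?m i) (wnp_subst (?g (\<lambda>j. m (offset n i + j)) (\<lambda>j. r (offset n i + j))) (p i))"
        by (rule relabel_wnp_subst[symmetric, OF inj_shift])
      finally show "wnp_subst (?g m r) (?g n p i) = shift (offset ?m i)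
          (opcomp ?P (n i) (\<lambda>j. m (offset n i + j)) (p i) (\<lambda>j. r (offset n i + j)))"
        by (simp only: op[OF pi])
    qed
    finally show "opcomp ?P (\<Sum>i=1..k. n i) m (opcomp ?P k n q p) r =
        opcomp ?P k (\<lambda>i. \<Sum>j=1..n i. m (offset n i + j)) q
          (\<lambda>i. opcomp ?P (n i) (\<lambda>j. m (offset n i + j)) (p i) (\<lambda>j. r (offset n i + j)))"
      by (simp only: op[OF q])
  qed
  moreover have "operad_unit ?P"
    unfolding operad_unit_def
  proof (intro conjI allI impI)
    show "ounit ?P \<in> ocar ?P 1" by simp
    show "opcomp ?P 1 n (ounit ?P) p = p 1" for n p
      by (subst op) (simp_all add: offset_def)
    fix k q assume "1 \<le> k \<and> q \<in> ocar ?P k"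
    then have q: "q \<in> wnp_piece (labels k)" by simp
    have "wnp_subst (?g (\<lambda>_. 1) (\<lambda>_. ounit ?P)) q = wnp_subst (\<lambda>i. bas (wnp_point i)) q"
      by (rule wnp_subst_cong[OF q]) (auto simp: offset_def)
    then show "opcomp ?P k (\<lambda>_. 1) q (\<lambda>_. ounit ?P) = q" by (simp only: op[OF q] wnp_subst_id)
  qed
  moreover have "operad_action ?P"
    unfolding operad_action_def
  proof (intro allI impI conjI ballI)
    show "opact ?P n id x = x" for n :: nat and x by (simp add: id_def)
  next
    fix n :: nat and \<sigma> assume "\<sigma> permutes {1..n}"
    then show "opact ?P n \<sigma> ` ocar ?P n \<subseteq> ocar ?P n"
      unfolding WNP_operad_simps using relabel_permutes_piece by blast
    show "linear_on (oscal ?P) (oscal ?P) (ocar ?P n) (opact ?P n \<sigma>)"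
      by (simp add: linear_on_def lin_plus[OF lin_lin_map] lin_scale[OF lin_lin_map])
    show "opact ?P n (\<sigma> \<circ> \<tau>) x = opact ?P n \<sigma> (opact ?P n \<tau> x)" for \<tau> x
      by (simp add: lin_map_lin_map wnp_map_dec_comp comp_def)
  qed
  moreover have "operad_equivariant ?P"
    unfolding operad_equivariant_def
  proof (intro allI impI conjI; elim conjE)
    fix k :: nat and n q p \<beta> \<sigma>
    assume c: "composable (ocar ?P) k n q p" and \<beta>: "\<beta> permutes {1..\<Sum>i=1..k. n i}"
      and \<sigma>: "\<sigma> permutes {1..k}"
      and b: "\<forall>i\<in>{1..k}. \<forall>j\<in>{1..n (\<sigma> i)}. \<beta> (offset (\<lambda>l. n (\<sigma> l)) i + j) = offset n (\<sigma> i) + j"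
    note q = comp(1)[OF c]
    have q': "relabel \<sigma> q \<in> wnp_piece (labels k)"
      by (rule relabel_permutes_piece[OF \<sigma> q])
    have "wnp_subst (?g n p) (relabel \<sigma> q) = wnp_subst (\<lambda>i. ?g n p (\<sigma> i)) q"
      by (rule wnp_subst_relabel[OF permutes_inj[OF \<sigma>]])
    also have "\<dots> = wnp_subst (\<lambda>i. relabel \<beta> (?g (\<lambda>i. n (\<sigma> i)) (\<lambda>i. p (\<sigma> i)) i)) q"
    proof (rule wnp_subst_cong[OF q])
      fix i assume "i \<in># labels k"
      then have i: "i \<in> {1..k}" by simp
      then have "\<sigma> i \<in># labels k" using permutes_in_image[OF \<sigma>, of i] by simp
      note pi = comp(2)[OF c this]
      show "?g n p (\<sigma> i) = relabel \<beta> (?g (\<lambda>i. n (\<sigma> i)) (\<lambda>i. p (\<sigma> i)) i)"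
        unfolding lin_map_lin_map wnp_map_dec_comp
        by (rule relabel_cong[OF pi]) (use b i in \<open>auto simp: add.commute\<close>)
    qed
    also have "\<dots> = relabel \<beta> (wnp_subst (?g (\<lambda>i. n (\<sigma> i)) (\<lambda>i. p (\<sigma> i))) q)"
      by (rule relabel_wnp_subst[symmetric, OF permutes_inj[OF \<beta>]])
    finally show "opcomp ?P k n (opact ?P k \<sigma> q) p =
        opact ?P (\<Sum>i=1..k. n i) \<beta> (opcomp ?P k (\<lambda>i. n (\<sigma> i)) q (\<lambda>i. p (\<sigma> i)))"
      by (simp only: WNP_operad_simps op[OF q] op[OF q'])
  next
    fix k :: nat and n q p \<beta> \<tau>
    assume c: "composable (ocar ?P) k n q p" and \<beta>: "\<beta> permutes {1..\<Sum>i=1..k. n i}"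
      and b: "\<forall>i\<in>{1..k}. \<forall>j\<in>{1..n i}. \<beta> (offset n i + j) = offset n i + \<tau> i j"
    note q = comp(1)[OF c]
    have "wnp_subst (?g n (\<lambda>i. relabel (\<tau> i) (p i))) q = wnp_subst (\<lambda>i. relabel \<beta> (?g n p i)) q"
    proof (rule wnp_subst_cong[OF q])
      fix i assume i: "i \<in># labels k"
      show "?g n (\<lambda>i. relabel (\<tau> i) (p i)) i = relabel \<beta> (?g n p i)"
        unfolding lin_map_lin_map wnp_map_dec_comp
        by (rule relabel_cong[OF comp(2)[OF c i]]) (use b i in \<open>auto simp: add.commute\<close>)
    qed
    also have "\<dots> = relabel \<beta> (wnp_subst (?g n p) q)"
      by (rule relabel_wnp_subst[symmetric, OF permutes_inj[OF \<beta>]])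
    finally show "opcomp ?P k n q (\<lambda>i. opact ?P (n i) (\<tau> i) (p i)) =
        opact ?P (\<Sum>i=1..k. n i) \<beta> (opcomp ?P k n q p)"
      by (simp only: WNP_operad_simps op[OF q])
  qed
  ultimately show ?thesis by (simp add: is_operad_def)
qed

section \<open>Products on the tensor algebra\<close>

definition tcat :: "('b list \<Rightarrow>\<^sub>0 'k::field) \<Rightarrow> ('b list \<Rightarrow>\<^sub>0 'k) \<Rightarrow> ('b list \<Rightarrow>\<^sub>0 'k)" where
  "tcat x y = lin_ext (\<lambda>u. lin_ext (\<lambda>v. bas (u @ v)) y) x"

lemma bilinear_tcat: "bilinear tcat"
  using bilinear_lin_ext[of "\<lambda>u v. bas (u @ v)"] by (simp add: tcat_def[abs_def])

lemma tcat_bas [simp]: "tcat (bas u) (bas v) = bas (u @ v)"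
  by (simp add: tcat_def)

lemmas [lin_intros] = bilinear_arg[OF bilinear_tcat]

lemma tcat_Nil [simp]: "tcat (bas []) x = x" "tcat x (bas []) = x"
  by (rule lin_eqI[OF bilinearD(2)[OF bilinear_tcat] lin_id], simp)
    (rule lin_eqI[OF bilinearD(1)[OF bilinear_tcat] lin_id], simp)

lemma tcat_zero [simp]: "tcat 0 x = 0" "tcat x 0 = 0"
  by (simp_all add: lin_zero[OF bilinearD(1)[OF bilinear_tcat]] lin_zero[OF bilinearD(2)[OF bilinear_tcat]])

lemma tcat_assoc: "tcat (tcat x y) z = tcat x (tcat y z)"
proof (rule lin_eqI[where x = x])
  fix a
  show "tcat (tcat (bas a) y) z = tcat (bas a) (tcat y z)"
  proof (rule lin_eqI[where x = y])
    fix b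
    show "tcat (tcat (bas a) (bas b)) z = tcat (bas a) (tcat (bas b) z)"
      by (rule lin_eqI[where x = z]) (auto intro!: lin_intros)
  qed (intro lin_intros)+
qed (intro lin_intros)+

abbreviation letter :: "('b \<Rightarrow>\<^sub>0 'k::field) \<Rightarrow> ('b list \<Rightarrow>\<^sub>0 'k)" where
  "letter \<equiv> lin_map (\<lambda>b. [b])"

lemma lookup_letter_tcat:
  "lk (tcat (letter v) x) [] = 0" "lk (tcat (letter v) x) (b # w) = lk v b * lk x w"
proof -
  have e: "lk (tcat (letter v) x) s = (\<Sum>c\<in>Poly_Mapping.keys v. \<Sum>u\<in>Poly_Mapping.keys x.
      if c # u = s then lk v c * lk x u else 0)" for s
    by (simp add: tcat_def lin_ext_lin_map lookup_lin_ext lookup_bas sum_distrib_left if_distrib cong: if_cong)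
  show "lk (tcat (letter v) x) [] = 0" by (simp add: e)
  have "lk (tcat (letter v) x) (b # w) = (\<Sum>c\<in>Poly_Mapping.keys v. if c = b then
      (\<Sum>u\<in>Poly_Mapping.keys x. if u = w then lk v b * lk x w else 0) else 0)"
    unfolding e by (intro sum.cong refl) (auto intro: sum.cong)
  also have "\<dots> = lk v b * lk x w" by (simp add: in_keys_iff)
  finally show "lk (tcat (letter v) x) (b # w) = lk v b * lk x w" .
qed

lemma split_sum_Nil_left: "split_sum u (\<lambda>a b. if a = [] then F b else 0) = F u"
  by (cases u) simp_all

lemma split_sum_Nil_right: "split_sum u (\<lambda>a b. if b = [] then F a else 0) = F u"
proof (induction u arbitrary: F)
  case (Cons x u)
  then show ?case using Cons.IH[of "\<lambda>a. F (x # a)"] by simp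
qed simp

lemma split_sum_append:
  "split_sum (u @ x # v) F = split_sum u (\<lambda>a c. F a (c @ x # v)) + split_sum v (\<lambda>a c. F (u @ x # a) c)"
  by (induction u arbitrary: F) (simp_all add: add.assoc)

lemma split_sum_fundef_cong [fundef_cong]:
  "u = u' \<Longrightarrow> (\<And>a b. u' = a @ b \<Longrightarrow> F a b = G a b) \<Longrightarrow> split_sum u F = split_sum u' G"
  by (hypsubst, rule split_sum_cong)

text \<open>The brackets \<open>[u; v]\<close> extended to the case that one of the words is empty, in which the coalgebra
  morphism with unit \<open>1\<close> forces the value: \<open>[b; 1] = [1; b] = b\<close>, and \<open>0\<close> otherwise.\<close>

definition block :: "('b list \<Rightarrow> 'b list \<Rightarrow> ('b \<Rightarrow>\<^sub>0 'k::field)) \<Rightarrow> 'b list \<Rightarrow> 'b list \<Rightarrow> ('b \<Rightarrow>\<^sub>0 'k)" where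
  "block br u v = (if u = [] then (case v of [b] \<Rightarrow> bas b | _ \<Rightarrow> 0)
     else if v = [] then (case u of [b] \<Rightarrow> bas b | _ \<Rightarrow> 0) else br u v)"

lemma block_Nil [simp]: "block br [] [] = 0"
  by (simp add: block_def)

lemma block_nonempty [simp]: "u \<noteq> [] \<Longrightarrow> v \<noteq> [] \<Longrightarrow> block br u v = br u v"
  by (simp add: block_def)

lemma block_singleton [simp]: "block br [] [b] = bas b" "block br [b] [] = bas b"
  by (simp_all add: block_def)

lemma block_long [simp]: "length u \<noteq> 1 \<Longrightarrow> block br [] u = 0" "length u \<noteq> 1 \<Longrightarrow> block br u [] = 0"
  by (auto simp: block_def split: list.split)

text \<open>The product on words given by brackets. The term with \<open>u1 = v1 = []\<close>, in which the product to be
  defined would occur, carries the bracket \<open>0\<close> and is omitted for termination.\<close>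

function wstar :: "('b list \<Rightarrow> 'b list \<Rightarrow> ('b \<Rightarrow>\<^sub>0 'k::field)) \<Rightarrow> 'b list \<Rightarrow> 'b list \<Rightarrow> ('b list \<Rightarrow>\<^sub>0 'k)" where
  "wstar br u v = (if u = [] \<and> v = [] then bas [] else 0) +
     split_sum u (\<lambda>u1 u2. split_sum v (\<lambda>v1 v2. if u1 = [] \<and> v1 = [] then 0
       else tcat (letter (block br u1 v1)) (wstar br u2 v2)))"
  by pat_completeness auto
termination
  by (relation "measure (\<lambda>(br, u, v). length u + length v)") auto

declare wstar.simps [simp del]

lemma wstar_rec:
  "wstar br u v = (if u = [] \<and> v = [] then bas [] else 0) +
     split_sum u (\<lambda>u1 u2. split_sum v (\<lambda>v1 v2. tcat (letter (block br u1 v1)) (wstar br u2 v2)))"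
proof -
  have z: "letter 0 = 0" by (rule lin_zero[OF lin_lin_map])
  show ?thesis
    by (subst wstar.simps, rule arg_cong2[where f = "(+)", OF refl], (rule split_sum_cong)+) (auto simp: z)
qed

lemma lookup_wstar:
  "lk (wstar br u v) [] = (if u = [] \<and> v = [] then 1 else 0)"
  "lk (wstar br u v) (b # w) =
     split_sum u (\<lambda>u1 u2. split_sum v (\<lambda>v1 v2. lk (block br u1 v1) b * lk (wstar br u2 v2) w))"
  by (subst wstar_rec, simp add: lookup_add lookup_split_sum lookup_letter_tcat lookup_bas)+

text \<open>This says that the product is a morphism of coalgebras; the sum over the splittings of the factors is
  regrouped by coassociativity.\<close>

lemma lookup_wstar_append:
  "lk (wstar br u v) (a @ c) =
     split_sum u (\<lambda>u1 u2. split_sum v (\<lambda>v1 v2. lk (wstar br u1 v1) a * lk (wstar br u2 v2) c))"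
proof (induction a arbitrary: u v)
  case Nil
  have "split_sum u (\<lambda>u1 u2. split_sum v (\<lambda>v1 v2. lk (wstar br u1 v1) [] * lk (wstar br u2 v2) c)) =
      split_sum u (\<lambda>u1 u2. if u1 = [] then split_sum v (\<lambda>v1 v2. if v1 = [] then lk (wstar br u2 v2) c else 0) else 0)"
    by (rule split_sum_cong) (auto simp: lookup_wstar(1) intro!: split_sum_cong)
  then show ?case by (simp add: split_sum_Nil_left)
next
  case (Cons x a)
  let ?B = "\<lambda>u v. lk (block br u v) x" and ?S = "\<lambda>u v. lk (wstar br u v)"
  have "lk (wstar br u v) ((x # a) @ c) =
      split_sum u (\<lambda>u1 U. split_sum v (\<lambda>v1 V. split_sum U (\<lambda>u2 u3. split_sum V (\<lambda>v2 v3.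
        ?B u1 v1 * (?S u2 v2 a * ?S u3 v3 c)))))"
    by (simp only: append_Cons lookup_wstar Cons.IH split_sum_times)
  also have "\<dots> = split_sum u (\<lambda>u1 U. split_sum U (\<lambda>u2 u3. split_sum v (\<lambda>v1 V. split_sum V (\<lambda>v2 v3.
        ?B u1 v1 * (?S u2 v2 a * ?S u3 v3 c)))))"
    by (intro split_sum_cong split_sum_swap)
  also have "\<dots> = split_sum u (\<lambda>U u3. split_sum U (\<lambda>u1 u2. split_sum v (\<lambda>V v3. split_sum V (\<lambda>v1 v2.
        ?B u1 v1 * (?S u2 v2 a * ?S u3 v3 c)))))"
    by (simp only: split_sum_coassoc[symmetric])
  also have "\<dots> = split_sum u (\<lambda>U u3. split_sum v (\<lambda>V v3. split_sum U (\<lambda>u1 u2. split_sum V (\<lambda>v1 v2.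
        ?B u1 v1 * (?S u2 v2 a * ?S u3 v3 c)))))"
    by (intro split_sum_cong split_sum_swap)
  also have "\<dots> = split_sum u (\<lambda>U u3. split_sum v (\<lambda>V v3. ?S U V (x # a) * ?S u3 v3 c))"
    by (simp only: lookup_wstar split_sum_times mult.assoc)
  finally show ?case .
qed

lemma lookup_deconcatenation:
  fixes x :: "'a list \<Rightarrow>\<^sub>0 'k::field"
  shows "lk (deconcatenation x) (a, c) = lk x (a @ c)"
proof -
  have d: "lk (\<Sum>i\<le>length w. bas (take i w, drop i w)) (a, c) = (lk (bas w) (a @ c) :: 'k)" for w :: "'a list"
  proof (cases "w = a @ c")
    case True
    have "(take i w = a \<and> drop i w = c) \<longleftrightarrow> i = length a" if "i \<le> length w" for i
      using True that by (metis append_eq_conv_conj length_take min.absorb2)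
    then have "lk (\<Sum>i\<le>length w. bas (take i w, drop i w) :: _ \<Rightarrow>\<^sub>0 'k) (a, c) =
        (\<Sum>i\<le>length w. if i = length a then 1 else 0)"
      unfolding lookup_sum by (intro sum.cong) (auto simp: lookup_bas)
    then show ?thesis using True by (simp add: lookup_bas)
  next
    case False
    then show ?thesis by (auto simp: lookup_sum lookup_bas intro!: sum.neutral)
  qed
  have "lin_ext bas x = x" by (rule lin_ext_basis)
  then have "lk x (a @ c) = (\<Sum>w\<in>Poly_Mapping.keys x. lk x w * lk (bas w) (a @ c))"
    using lookup_lin_ext[of bas x "a @ c"] by simp
  then show ?thesis unfolding deconcatenation_def lookup_lin_ext by (simp add: d)
qed

lemma lookup_tensor2: "lk (tensor2 x y) (a, c) = lk x a * lk y c"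
proof -
  have "lk (tensor2 x y) (a, c) = (\<Sum>p\<in>Poly_Mapping.keys x. \<Sum>q\<in>Poly_Mapping.keys y.
      if p = a \<and> q = c then lk x p * lk y q else 0)"
    by (simp add: tensor2_def lin_map_def lookup_lin_ext sum_distrib_left lookup_bas if_distrib cong: if_cong)
  also have "\<dots> = (\<Sum>p\<in>Poly_Mapping.keys x. if p = a then
      (\<Sum>q\<in>Poly_Mapping.keys y. if q = c then lk x a * lk y c else 0) else 0)"
    by (intro sum.cong refl) (auto intro: sum.cong)
  also have "\<dots> = lk x a * lk y c" by (simp add: in_keys_iff)
  finally show ?thesis .
qed

lemma lookup_tensor_proj:
  fixes x :: "'a list \<Rightarrow>\<^sub>0 'k::field"
  shows "lk (tensor_proj x) b = lk x [b]"
proof -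
  have "lk (case w of [b] \<Rightarrow> bas b | _ \<Rightarrow> 0) b = (lk (bas w) [b] :: 'k)" for w :: "'a list"
    by (auto simp: lookup_bas split: list.split)
  then have "lk (tensor_proj x) b = lk (lin_ext bas x) [b]"
    unfolding tensor_proj_def lookup_lin_ext by simp
  then show ?thesis by (simp add: lin_ext_basis)
qed

lemma lin_tensor_proj: "lin tensor_proj"
  unfolding tensor_proj_def by (rule lin_lin_ext)

lemma coalgebra_product_iff:
  "coalgebra_product s \<longleftrightarrow>
     (\<forall>u v a c. lk (s u v) (a @ c) =
        split_sum u (\<lambda>u1 u2. split_sum v (\<lambda>v1 v2. lk (s u1 v1) a * lk (s u2 v2) c))) \<and>
     (\<forall>u v. lk (s u v) [] = (if u = [] \<and> v = [] then 1 else 0))"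
proof -
  have "(deconcatenation (s u v) = (\<Sum>i\<le>length u. \<Sum>j\<le>length v.
           tensor2 (s (take i u) (take j v)) (s (drop i u) (drop j v)))) \<longleftrightarrow>
      (\<forall>a c. lk (s u v) (a @ c) =
        split_sum u (\<lambda>u1 u2. split_sum v (\<lambda>v1 v2. lk (s u1 v1) a * lk (s u2 v2) c)))" for u v
    by (auto simp: poly_mapping_eq_iff fun_eq_iff lookup_deconcatenation lookup_sum lookup_tensor2 split_sum_eq)
  moreover have "tensor_counit (s u v) = word_counit u * word_counit v \<longleftrightarrow>
      lk (s u v) [] = (if u = [] \<and> v = [] then 1 else 0)" for u v
    by (auto simp: tensor_counit_def word_counit_def)
  ultimately show ?thesis unfolding coalgebra_product_def by auto
qed

lemma wstar_Nil_left: "wstar br [] w = bas w"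
proof (induction w)
  case Nil
  show ?case by (subst wstar_rec) (simp add: lin_zero[OF lin_lin_map])
next
  case (Cons b w)
  have "split_sum w (\<lambda>v1 v2. tcat (letter (block br [] (b # v1))) (wstar br [] v2)) =
      split_sum w (\<lambda>v1 v2. if v1 = [] then tcat (bas [b]) (wstar br [] v2) else 0)"
    by (rule split_sum_cong) (auto simp: lin_zero[OF lin_lin_map])
  then show ?case
    by (subst wstar_rec) (simp add: lin_zero[OF lin_lin_map] split_sum_Nil_left Cons.IH)
qed

lemma block_flip: "block br u v = block (\<lambda>a b. br b a) v u"
  by (auto simp: block_def split: list.split)

text \<open>The definition is symmetric, so results on the left argument carry over to the right one.\<close>

lemma wstar_flip: "wstar br u v = wstar (\<lambda>a b. br b a) v u"
proof (rule poly_mapping_eqI)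
  fix w
  show "lk (wstar br u v) w = lk (wstar (\<lambda>a b. br b a) v u) w"
  proof (induction w arbitrary: u v)
    case (Cons b w)
    show ?case
      unfolding lookup_wstar
      by (subst split_sum_swap) (simp add: Cons.IH block_flip[of br])
  qed (auto simp: lookup_wstar)
qed

lemma wstar_Nil_right: "wstar br w [] = bas w"
  by (subst wstar_flip) (rule wstar_Nil_left)

lemma lookup_wstar_singleton: "lk (wstar br u v) [b] = lk (block br u v) b"
proof -
  have "lk (wstar br u v) [b] = split_sum u (\<lambda>u1 u2. if u2 = [] then
      split_sum v (\<lambda>v1 v2. if v2 = [] then lk (block br u1 v1) b else 0) else 0)"
    unfolding lookup_wstar
    by (rule split_sum_cong) (auto simp: lookup_wstar(1) intro!: split_sum_cong)
  then show ?thesis by (simp add: split_sum_Nil_right)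
qed

text \<open>A coalgebra morphism to a cofree coalgebra is determined by its projection to the letters.\<close>

lemma binf_star_eq: "binf_star br = wstar br"
  unfolding binf_star_def
proof (rule the_equality)
  show "coalgebra_product (wstar br) \<and> (\<forall>w. wstar br [] w = bas w \<and> wstar br w [] = bas w) \<and>
      (\<forall>u v. u \<noteq> [] \<and> v \<noteq> [] \<longrightarrow> tensor_proj (wstar br u v) = br u v)"
    by (auto simp: coalgebra_product_iff lookup_wstar_append lookup_wstar(1) wstar_Nil_left
        wstar_Nil_right lookup_tensor_proj lookup_wstar_singleton intro!: poly_mapping_eqI)
next
  fix s
  assume s: "coalgebra_product s \<and> (\<forall>w. s [] w = bas w \<and> s w [] = bas w) \<and>
      (\<forall>u v. u \<noteq> [] \<and> v \<noteq> [] \<longrightarrow> tensor_proj (s u v) = br u v)"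
  then have c: "lk (s u v) (a @ c) =
      split_sum u (\<lambda>u1 u2. split_sum v (\<lambda>v1 v2. lk (s u1 v1) a * lk (s u2 v2) c))"
    and e: "lk (s u v) [] = (if u = [] \<and> v = [] then 1 else 0)" for u v a c
    unfolding coalgebra_product_iff by blast+
  have b: "lk (s u v) [b] = lk (block br u v) b" for u v b
  proof (cases "u = [] \<or> v = []")
    case True
    then show ?thesis using s by (auto simp: block_def lookup_bas split: list.split)
  next
    case False
    then have "lk (s u v) [b] = lk (br u v) b" using s lookup_tensor_proj by metis
    then show ?thesis using False by simp
  qed
  have "lk (s u v) w = lk (wstar br u v) w" for u v w
  proof (induction w arbitrary: u v)
    case (Cons x w)
    have "lk (s u v) ([x] @ w) = split_sum u (\<lambda>u1 u2. split_sum v (\<lambda>v1 v2. lk (block br u1 v1) x * lk (wstar br u2 v2) w))"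
      unfolding c b Cons.IH ..
    then show ?case by (simp add: lookup_wstar)
  qed (simp add: e lookup_wstar)
  then show "s = wstar br" by (intro ext poly_mapping_eqI)
qed

definition tstar :: "('b list \<Rightarrow> 'b list \<Rightarrow> ('b \<Rightarrow>\<^sub>0 'k::field)) \<Rightarrow>
    ('b list \<Rightarrow>\<^sub>0 'k) \<Rightarrow> ('b list \<Rightarrow>\<^sub>0 'k) \<Rightarrow> ('b list \<Rightarrow>\<^sub>0 'k)" where
  "tstar br x y = lin_ext (\<lambda>u. lin_ext (wstar br u) y) x"

lemma bilinear_tstar: "bilinear (tstar br)"
  using bilinear_lin_ext[of "wstar br"] by (simp add: tstar_def[abs_def])

lemma tstar_bas [simp]: "tstar br (bas u) (bas v) = wstar br u v"
  by (simp add: tstar_def)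

lemmas [lin_intros] = bilinear_arg[OF bilinear_tstar]

lemma tstar_bas_left: "tstar br (bas u) y = lin_ext (wstar br u) y"
  and tstar_bas_right: "tstar br x (bas v) = lin_ext (\<lambda>u. wstar br u v) x"
  by (simp_all add: tstar_def)

lemma tstar_Nil [simp]: "tstar br (bas []) x = x" "tstar br x (bas []) = x"
  by (rule lin_eqI[OF bilinearD(2)[OF bilinear_tstar] lin_id], simp add: wstar_Nil_left)
    (rule lin_eqI[OF bilinearD(1)[OF bilinear_tstar] lin_id], simp add: wstar_Nil_right)

subsection \<open>Ideals of the tensor algebra\<close>

lemma subspace_tensor_ideal: "pm.subspace (tensor_ideal J)"
  unfolding tensor_ideal_def by (rule pm.subspace_span)

lemma tensor_ideal_base: "x \<in> J \<Longrightarrow> lin_map (\<lambda>b. u @ b # v) x \<in> tensor_ideal J"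
  unfolding tensor_ideal_def by (rule pm.span_base) auto

lemma tensor_ideal_induct:
  assumes "lin f" "pm.subspace S" "\<And>u v x. x \<in> J \<Longrightarrow> f (lin_map (\<lambda>b. u @ b # v) x) \<in> S"
  shows "x \<in> tensor_ideal J \<Longrightarrow> f x \<in> S"
proof -
  assume x: "x \<in> tensor_ideal J"
  have "tensor_ideal J \<subseteq> {x. f x \<in> S}"
    unfolding tensor_ideal_def
    by (rule pm.span_minimal) (use assms in \<open>auto intro: subspace_vimage\<close>)
  then show ?thesis using x by blast
qed

lemma tcat_in_tensor_ideal:
  fixes J :: "('a \<Rightarrow>\<^sub>0 'b::field) set"
  assumes "x \<in> tensor_ideal J"
  shows "tcat x y \<in> tensor_ideal J" "tcat y x \<in> tensor_ideal J"
proof -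
  note I = subspace_tensor_ideal[of J]
  have 1: "tcat x (bas w) \<in> tensor_ideal J" for w
  proof (rule tensor_ideal_induct[OF _ I _ assms, where f = "\<lambda>x. tcat x (bas w)"])
    fix u v and x :: "'a \<Rightarrow>\<^sub>0 'b" assume x: "x \<in> J"
    have "tcat (lin_map (\<lambda>b. u @ b # v) x) (bas w) = lin_map (\<lambda>b. u @ b # (v @ w)) x"
      by (rule lin_eqI[where x = x]) (auto intro!: lin_intros)
    then show "tcat (lin_map (\<lambda>b. u @ b # v) x) (bas w) \<in> tensor_ideal J"
      using tensor_ideal_base[OF x, of u "v @ w"] by simp
  qed (intro lin_intros)
  have 2: "tcat (bas w) x \<in> tensor_ideal J" for w
  proof (rule tensor_ideal_induct[OF _ I _ assms, where f = "\<lambda>x. tcat (bas w) x"])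
    fix u v and x :: "'a \<Rightarrow>\<^sub>0 'b" assume x: "x \<in> J"
    have "tcat (bas w) (lin_map (\<lambda>b. u @ b # v) x) = lin_map (\<lambda>b. (w @ u) @ b # v) x"
      by (rule lin_eqI[where x = x]) (auto intro!: lin_intros)
    then show "tcat (bas w) (lin_map (\<lambda>b. u @ b # v) x) \<in> tensor_ideal J"
      using tensor_ideal_base[OF x, of "w @ u" v] by simp
  qed (intro lin_intros)
  show "tcat x y \<in> tensor_ideal J"
    by (rule lin_in_subspace[OF bilinearD(2)[OF bilinear_tcat] I]) (rule 1)
  show "tcat y x \<in> tensor_ideal J"
    by (rule lin_in_subspace[OF bilinearD(1)[OF bilinear_tcat] I]) (rule 2)
qed

lemma tensor_proj_tensor_ideal:
  fixes J :: "('a \<Rightarrow>\<^sub>0 'b::field) set"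
  assumes J: "pm.subspace J" and x: "x \<in> tensor_ideal J"
  shows "tensor_proj x \<in> J"
proof (rule tensor_ideal_induct[OF lin_tensor_proj J _ x])
  fix u v and x :: "'a \<Rightarrow>\<^sub>0 'b" assume x: "x \<in> J"
  have "tensor_proj (lin_map (\<lambda>b. u @ b # v) x) = (if u = [] \<and> v = [] then x else 0)"
  proof (cases "u = [] \<and> v = []")
    case True
    then show ?thesis by (simp add: tensor_proj_def lin_ext_lin_map lin_ext_basis)
  next
    case False
    then have "(case u @ b # v of [b] \<Rightarrow> bas b | _ \<Rightarrow> (0 :: 'a \<Rightarrow>\<^sub>0 'b)) = 0" for b
      by (auto split: list.split simp: append_eq_Cons_conv)
    then show ?thesis using False
      by (auto simp: tensor_proj_def lin_ext_lin_map) (simp_all add: lin_ext_def)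
  qed
  then show "tensor_proj (lin_map (\<lambda>b. u @ b # v) x) \<in> J"
    using x pm.subspace_0[OF J] by auto
qed

text \<open>The part of \<^const>\<open>binf_quotient\<close> that says that the brackets descend to the quotient by \<open>J\<close>.\<close>

definition bracket_ideal :: "('b list \<Rightarrow> 'b list \<Rightarrow> ('b \<Rightarrow>\<^sub>0 'k::field)) \<Rightarrow> ('b \<Rightarrow>\<^sub>0 'k) set \<Rightarrow> bool" where
  "bracket_ideal br J \<longleftrightarrow> pm.subspace J \<and> (\<forall>x\<in>J. \<forall>u v w. w \<noteq> [] \<longrightarrow>
     lin_ext (\<lambda>b. br (u @ [b] @ v) w) x \<in> J \<and> lin_ext (\<lambda>b. br w (u @ [b] @ v)) x \<in> J)"

text \<open>In each term of the product, the distinguished letter is either inside the first bracket, which then lies in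
  \<open>J\<close>, or in the remaining word, which is shorter.\<close>

lemma wstar_in_tensor_ideal_left:
  fixes J :: "('a \<Rightarrow>\<^sub>0 'b::field) set"
  assumes J: "bracket_ideal br J" and x: "x \<in> J"
  shows "lin_ext (\<lambda>b. wstar br (u @ b # v) w) x \<in> tensor_ideal J"
proof (induction "length u + length w" arbitrary: u w rule: less_induct)
  case less
  note I = subspace_tensor_ideal[of J]
  have SJ: "pm.subspace J" using J by (simp add: bracket_ideal_def)
  have sum: "split_sum a F \<in> tensor_ideal J"
    if "\<And>c d. a = c @ d \<Longrightarrow> F c d \<in> tensor_ideal J" for a :: "'a list" and F
    unfolding split_sum_eq by (rule pm.subspace_sum[OF I]) (simp add: that)
  have blk: "lin_ext (\<lambda>b. block br (u @ b # a) w1) x \<in> J" for a w1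
  proof (cases "w1 = []")
    case True
    show ?thesis
    proof (cases "u = [] \<and> a = []")
      case True
      then show ?thesis using \<open>w1 = []\<close> x by (simp add: lin_ext_basis)
    next
      case False
      then have "block br (u @ b # a) w1 = 0" for b using True by (cases u) simp_all
      then show ?thesis using pm.subspace_0[OF SJ] by (simp add: lin_ext_def)
    qed
  next
    case False
    then show ?thesis using J x by (simp add: bracket_ideal_def)
  qed
  have "lin_ext (\<lambda>b. wstar br (u @ b # v) w) x =
      split_sum u (\<lambda>a c. split_sum w (\<lambda>w1 w2.
        tcat (letter (block br a w1)) (lin_ext (\<lambda>b. wstar br (c @ b # v) w2) x))) +
      split_sum v (\<lambda>a c. split_sum w (\<lambda>w1 w2.
        tcat (letter (lin_ext (\<lambda>b. block br (u @ b # a) w1) x)) (wstar br c w2)))"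
    (is "_ = ?r x")
  proof (rule lin_eqI[where x = x])
    show "lin (\<lambda>x. ?r x)" by (intro lin_intros lin_split_sum_fun)
    fix b
    show "lin_ext (\<lambda>b. wstar br (u @ b # v) w) (bas b) = ?r (bas b)"
      by (simp, subst wstar_rec) (simp add: split_sum_append)
  qed (intro lin_intros)
  moreover have "split_sum u (\<lambda>a c. split_sum w (\<lambda>w1 w2.
        tcat (letter (block br a w1)) (lin_ext (\<lambda>b. wstar br (c @ b # v) w2) x))) \<in> tensor_ideal J"
  proof (intro sum)
    fix a c w1 w2 assume e: "u = a @ c" "w = w1 @ w2"
    show "tcat (letter (block br a w1)) (lin_ext (\<lambda>b. wstar br (c @ b # v) w2) x) \<in> tensor_ideal J"
    proof (cases "a = [] \<and> w1 = []")
      case True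
      then show ?thesis by (simp add: lin_zero[OF lin_lin_map] pm.subspace_0[OF I])
    next
      case False
      then have "length c + length w2 < length u + length w" using e by auto
      then show ?thesis by (intro tcat_in_tensor_ideal(2) less)
    qed
  qed
  moreover have "split_sum v (\<lambda>a c. split_sum w (\<lambda>w1 w2.
        tcat (letter (lin_ext (\<lambda>b. block br (u @ b # a) w1) x)) (wstar br c w2))) \<in> tensor_ideal J"
  proof (intro sum tcat_in_tensor_ideal(1))
    show "letter (lin_ext (\<lambda>b. block br (u @ b # a) w1) x) \<in> tensor_ideal J" for a w1
      using tensor_ideal_base[OF blk, of "[]" "[]"] by simp
  qed
  ultimately show ?case using pm.subspace_add[OF I] by simp
qed

lemma wstar_in_tensor_ideal_right:
  assumes J: "bracket_ideal br J" and x: "x \<in> J"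
  shows "lin_ext (\<lambda>b. wstar br w (u @ b # v)) x \<in> tensor_ideal J"
proof -
  have "bracket_ideal (\<lambda>a b. br b a) J" using J by (auto simp: bracket_ideal_def)
  from wstar_in_tensor_ideal_left[OF this x] show ?thesis by (subst wstar_flip)
qed

lemma tstar_in_tensor_ideal:
  assumes J: "bracket_ideal br J" and x: "x \<in> tensor_ideal J"
  shows "tstar br x y \<in> tensor_ideal J" "tstar br y x \<in> tensor_ideal J"
proof -
  note I = subspace_tensor_ideal[of J]
  have 1: "tstar br x (bas w) \<in> tensor_ideal J" for w
    by (rule tensor_ideal_induct[OF _ I _ x, where f = "\<lambda>x. tstar br x (bas w)"])
      (auto intro!: lin_intros wstar_in_tensor_ideal_left[OF J] simp: tstar_bas_right lin_ext_lin_map)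
  have 2: "tstar br (bas w) x \<in> tensor_ideal J" for w
    by (rule tensor_ideal_induct[OF _ I _ x, where f = "\<lambda>x. tstar br (bas w) x"])
      (auto intro!: lin_intros wstar_in_tensor_ideal_right[OF J] simp: tstar_bas_left lin_ext_lin_map)
  show "tstar br x y \<in> tensor_ideal J"
    by (rule lin_in_subspace[OF bilinearD(2)[OF bilinear_tstar] I]) (rule 1)
  show "tstar br y x \<in> tensor_ideal J"
    by (rule lin_in_subspace[OF bilinearD(1)[OF bilinear_tstar] I]) (rule 2)
qed

text \<open>The conditions of \<^const>\<open>binf_quotient\<close> without the antipode, which exists automatically.\<close>

locale binf_mod =
  fixes br :: "'b list \<Rightarrow> 'b list \<Rightarrow> ('b \<Rightarrow>\<^sub>0 'k::field)" and J :: "('b \<Rightarrow>\<^sub>0 'k) set"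
  assumes bracket: "bracket_ideal br J"
    and assoc_words: "\<And>u v w. tstar br (wstar br u v) (bas w) - tstar br (bas u) (wstar br v w) \<in> tensor_ideal J"
begin

sublocale two_as_mod tcat "tstar br" "bas []" "tensor_ideal J"
proof
  show "pm.subspace (tensor_ideal J)" by (rule subspace_tensor_ideal)
  show "tstar br (tstar br x y) z - tstar br x (tstar br y z) \<in> tensor_ideal J" for x y z
  proof (rule lin_in_subspace[where x = x, OF _ subspace_tensor_ideal])
    fix u
    show "tstar br (tstar br (bas u) y) z - tstar br (bas u) (tstar br y z) \<in> tensor_ideal J"
    proof (rule lin_in_subspace[where x = y, OF _ subspace_tensor_ideal])
      fix v
      show "tstar br (tstar br (bas u) (bas v)) z - tstar br (bas u) (tstar br (bas v) z) \<in> tensor_ideal J"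
        by (rule lin_in_subspace[where x = z, OF _ subspace_tensor_ideal])
          (intro lin_intros, simp add: assoc_words)
    qed (intro lin_intros)
  qed (intro lin_intros)
qed (simp_all add: bilinear_tcat bilinear_tstar tcat_in_tensor_ideal tcat_assoc
    tstar_in_tensor_ideal[OF bracket] pm.subspace_0[OF subspace_tensor_ideal])

text \<open>The antipode: the left and the right convolution inverse of the identity, which exist because the
  coalgebra is graded and connected, agree modulo the ideal because the product is associative
  modulo the ideal.\<close>

function antipode :: "'b list \<Rightarrow> ('b list \<Rightarrow>\<^sub>0 'k)" where
  "antipode w = (if w = [] then bas []
     else - split_sum w (\<lambda>a c. if c = [] then 0 else tstar br (antipode a) (bas c)))"
  by pat_completeness auto
termination
  by (relation "measure length") auto

function antipode_r :: "'b list \<Rightarrow> ('b list \<Rightarrow>\<^sub>0 'k)" where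
  "antipode_r w = (if w = [] then bas []
     else - split_sum w (\<lambda>a c. if a = [] then 0 else tstar br (bas a) (antipode_r c)))"
  by pat_completeness auto
termination
  by (relation "measure length") auto

declare antipode.simps [simp del] antipode_r.simps [simp del]

lemma antipode_left:
  "split_sum w (\<lambda>a c. tstar br (antipode a) (bas c)) = (if w = [] then bas [] else 0)"
proof (cases "w = []")
  case False
  have "split_sum w (\<lambda>a c. tstar br (antipode a) (bas c)) =
      split_sum w (\<lambda>a c. (if c = [] then antipode a else 0) +
        (if c = [] then 0 else tstar br (antipode a) (bas c)))"
    by (rule split_sum_cong) auto
  also have "\<dots> = antipode w + split_sum w (\<lambda>a c. if c = [] then 0 else tstar br (antipode a) (bas c))"
    by (simp only: split_sum_add split_sum_Nil_right)
  also have "\<dots> = 0" using False by (subst antipode.simps) simp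
  finally show ?thesis using False by simp
qed (simp add: antipode.simps wstar_Nil_left)

lemma antipode_r_right:
  "split_sum w (\<lambda>a c. tstar br (bas a) (antipode_r c)) = (if w = [] then bas [] else 0)"
proof (cases "w = []")
  case False
  have "split_sum w (\<lambda>a c. tstar br (bas a) (antipode_r c)) =
      split_sum w (\<lambda>a c. (if a = [] then antipode_r c else 0) +
        (if a = [] then 0 else tstar br (bas a) (antipode_r c)))"
    by (rule split_sum_cong) auto
  also have "\<dots> = antipode_r w + split_sum w (\<lambda>a c. if a = [] then 0 else tstar br (bas a) (antipode_r c))"
    by (simp only: split_sum_add split_sum_Nil_left)
  also have "\<dots> = 0" using False by (subst antipode_r.simps) simp
  finally show ?thesis using False by simp
qed (simp add: antipode_r.simps wstar_Nil_left)

lemma eqv_split_sum: "(\<And>a c. eqv (F a c) (G a c)) \<Longrightarrow> eqv (split_sum w F) (split_sum w G)"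
  unfolding split_sum_eq by (rule eqv_sum) blast

lemma antipode_eqv: "eqv (antipode w) (antipode_r w)"
proof -
  let ?t = "tstar br" and ?e = "\<lambda>w. if w = [] then bas [] else (0 :: 'b list \<Rightarrow>\<^sub>0 'k)"
  note z = lin_zero[OF bilinearD(1)[OF bilinear_tstar]] lin_zero[OF bilinearD(2)[OF bilinear_tstar]]
  have "antipode w = split_sum w (\<lambda>a c. if c = [] then antipode a else 0)"
    by (simp only: split_sum_Nil_right)
  also have "\<dots> = split_sum w (\<lambda>a c. ?t (antipode a) (?e c))"
    by (rule split_sum_cong) (simp add: z)
  also have "\<dots> = split_sum w (\<lambda>a c. split_sum c (\<lambda>c1 c2. ?t (antipode a) (?t (bas c1) (antipode_r c2))))"
    by (simp only: antipode_r_right[symmetric] lin_split_sum[OF bilinearD(2)[OF bilinear_tstar]])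
  finally have 1: "antipode w =
      split_sum w (\<lambda>a c. split_sum c (\<lambda>c1 c2. ?t (antipode a) (?t (bas c1) (antipode_r c2))))" .
  have "antipode_r w = split_sum w (\<lambda>a c. if a = [] then antipode_r c else 0)"
    by (simp only: split_sum_Nil_left)
  also have "\<dots> = split_sum w (\<lambda>a c. ?t (?e a) (antipode_r c))"
    by (rule split_sum_cong) (simp add: z)
  also have "\<dots> = split_sum w (\<lambda>a c. split_sum a (\<lambda>a1 a2. ?t (?t (antipode a1) (bas a2)) (antipode_r c)))"
    by (simp only: antipode_left[symmetric] lin_split_sum[OF bilinearD(1)[OF bilinear_tstar]])
  also have "\<dots> = split_sum w (\<lambda>a c. split_sum c (\<lambda>c1 c2. ?t (?t (antipode a) (bas c1)) (antipode_r c2)))"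
    by (rule split_sum_coassoc)
  finally have 2: "antipode_r w =
      split_sum w (\<lambda>a c. split_sum c (\<lambda>c1 c2. ?t (?t (antipode a) (bas c1)) (antipode_r c2)))" .
  show ?thesis unfolding 1 2 by (intro eqv_split_sum eqv_sym[OF eqv_assoc(2)])
qed

lemma antipode_right:
  "eqv (split_sum w (\<lambda>a c. tstar br (bas a) (antipode c))) (if w = [] then bas [] else 0)"
proof -
  have "eqv (split_sum w (\<lambda>a c. tstar br (bas a) (antipode c)))
      (split_sum w (\<lambda>a c. tstar br (bas a) (antipode_r c)))"
    by (rule eqv_split_sum) (rule eqv_mult(2)[OF eqv_refl antipode_eqv])
  then show ?thesis by (simp only: antipode_r_right)
qed

lemma antipode_ideal:
  assumes x: "x \<in> J"
  shows "lin_ext (\<lambda>b. antipode (u @ b # v)) x \<in> tensor_ideal J"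
proof (induction "length v" arbitrary: v rule: less_induct)
  case less
  note I = subspace_tensor_ideal[of J]
  have sum: "split_sum a F \<in> tensor_ideal J"
    if "\<And>c d. a = c @ d \<Longrightarrow> F c d \<in> tensor_ideal J" for a :: "'b list" and F
    unfolding split_sum_eq by (rule pm.subspace_sum[OF I]) (simp add: that)
  have "lin_ext (\<lambda>b. antipode (u @ b # v)) x =
      scal (-1) (split_sum u (\<lambda>a c. tstar br (antipode a) (lin_map (\<lambda>b. c @ b # v) x)) +
      split_sum v (\<lambda>a c. if c = [] then 0 else tstar br (lin_ext (\<lambda>b. antipode (u @ b # a)) x) (bas c)))"
    (is "_ = ?r x")
  proof (rule lin_eqI[where x = x])
    have "lin (\<lambda>x. if c = [] then 0 else tstar br (lin_ext (\<lambda>b. antipode (u @ b # a)) x) (bas c))" for a c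
      by (cases "c = []") (auto intro!: lin_intros)
    then show "lin ?r" by (intro lin_intros lin_split_sum_fun)
    fix b
    show "lin_ext (\<lambda>b. antipode (u @ b # v)) (bas b) = ?r (bas b)"
      by (simp, subst antipode.simps) (simp add: split_sum_append pm.scale_minus_left cong: if_cong)
  qed (intro lin_intros)
  moreover have "split_sum u (\<lambda>a c. tstar br (antipode a) (lin_map (\<lambda>b. c @ b # v) x)) \<in> tensor_ideal J"
    by (intro sum tstar_in_tensor_ideal(2)[OF bracket] tensor_ideal_base x)
  moreover have "split_sum v (\<lambda>a c. if c = [] then 0
      else tstar br (lin_ext (\<lambda>b. antipode (u @ b # a)) x) (bas c)) \<in> tensor_ideal J"
  proof (rule sum)
    fix a c assume "v = a @ c"
    then show "(if c = [] then 0 else tstar br (lin_ext (\<lambda>b. antipode (u @ b # a)) x) (bas c)) \<in> tensor_ideal J"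
      using pm.subspace_0[OF I] by (auto intro!: tstar_in_tensor_ideal(1)[OF bracket] less)
  qed
  ultimately show ?case
    by (simp only: pm.subspace_scale[OF I] pm.subspace_add[OF I])
qed

lemma binf_quotient: "binf_quotient br J"
  unfolding binf_quotient_def binf_star_eq
proof (intro conjI exI[of _ antipode] allI)
  show "pm.subspace J" "\<forall>x\<in>J. \<forall>u v w. w \<noteq> [] \<longrightarrow>
        lin_ext (\<lambda>b. br (u @ [b] @ v) w) x \<in> J \<and> lin_ext (\<lambda>b. br w (u @ [b] @ v)) x \<in> J"
    using bracket by (simp_all add: bracket_ideal_def)
  show "lin_ext (\<lambda>z. wstar br z w) (wstar br u v) - lin_ext (wstar br u) (wstar br v w) \<in> tensor_ideal J" for u v w
    using assoc_words[of u v w] by (simp add: tstar_bas_left tstar_bas_right)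
  show "lin_ext antipode ` tensor_ideal J \<subseteq> tensor_ideal J"
    using tensor_ideal_induct[OF lin_lin_ext subspace_tensor_ideal, of J antipode J] antipode_ideal
    by (auto simp: lin_ext_lin_map)
  have e: "scal (word_counit w) (bas []) = (if w = [] then bas [] else (0 :: 'b list \<Rightarrow>\<^sub>0 'k))" for w :: "'b list"
    by (simp add: word_counit_def)
  show "(\<Sum>i\<le>length w. lin_ext (\<lambda>z. wstar br z (drop i w)) (antipode (take i w)))
      - scal (word_counit w) (bas []) \<in> tensor_ideal J" for w
    using antipode_left[of w] pm.subspace_0[OF subspace_tensor_ideal]
    by (simp add: e split_sum_eq tstar_bas_right)
  show "(\<Sum>i\<le>length w. lin_ext (wstar br (take i w)) (antipode (drop i w)))
      - scal (word_counit w) (bas []) \<in> tensor_ideal J" for w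
    using antipode_right[of w] by (simp add: e split_sum_eq tstar_bas_left eqv_def)
qed

end

lemma binf_quotient_iff: "binf_quotient br J \<longleftrightarrow> binf_mod br J"
proof
  assume q: "binf_quotient br J"
  show "binf_mod br J"
    by unfold_locales
      (use q in \<open>auto simp: binf_quotient_def bracket_ideal_def binf_star_eq tstar_bas_left tstar_bas_right\<close>)
qed (rule binf_mod.binf_quotient)

section \<open>Evaluation of bracket monomials\<close>

text \<open>The interpretation of bracket monomials in the \<open>B\<^sub>\<infinity>\<close> algebra of connected posets.\<close>

fun bterm_eval :: "('x \<Rightarrow> ('d wnp \<Rightarrow>\<^sub>0 'k::field)) \<Rightarrow> 'x bterm \<Rightarrow> ('d wnp \<Rightarrow>\<^sub>0 'k)" where
  "bterm_eval g (Gen i) = g i"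
| "bterm_eval g (Br s ss t ts) =
     proj_prim (hstar (hprod (map (bterm_eval g) (s # ss))) (hprod (map (bterm_eval g) (t # ts))))"

abbreviation pt :: "'d \<Rightarrow> ('d wnp \<Rightarrow>\<^sub>0 'k::field)" where
  "pt d \<equiv> bas (wnp_point d)"

abbreviation word_eval :: "('x \<Rightarrow> ('d wnp \<Rightarrow>\<^sub>0 'k::field)) \<Rightarrow> 'x bterm list \<Rightarrow> ('d wnp \<Rightarrow>\<^sub>0 'k)" where
  "word_eval g u \<equiv> hprod (map (bterm_eval g) u)"

lemma pt_primitive: "pt d \<in> primitives"
  by (simp add: sum_irreducible_point)

lemma bterm_eval_primitive: "(\<And>i. g i \<in> primitives) \<Longrightarrow> bterm_eval g t \<in> primitives"
  by (cases t) (simp_all add: proj_prim_primitive)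

lemma bterm_eval_primitives: "(\<And>i. g i \<in> primitives) \<Longrightarrow> set (map (bterm_eval g) u) \<subseteq> primitives"
  using bterm_eval_primitive by auto

lemma hprod_append: "hprod (xs @ ys) = hsum (hprod xs) (hprod ys)"
  by (induction xs) (simp_all add: hsum_assoc)

lemma hsum_zero [simp]: "hsum 0 x = 0" "hsum x 0 = 0"
  by (simp_all add: lin_zero[OF bilinearD(1)[OF bilinear_hsum]] lin_zero[OF bilinearD(2)[OF bilinear_hsum]])

lemma word_eval_tcat: "lin_ext (word_eval g) (tcat x y) = hsum (lin_ext (word_eval g) x) (lin_ext (word_eval g) y)"
proof (rule lin_eqI[where x = x])
  fix u
  show "lin_ext (word_eval g) (tcat (bas u) y) = hsum (lin_ext (word_eval g) (bas u)) (lin_ext (word_eval g) y)"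
    by (rule lin_eqI[where x = y]) (auto intro!: lin_intros simp: hprod_append)
qed (intro lin_intros)+

lemma word_eval_letter: "lin_ext (word_eval g) (letter v) = lin_ext (bterm_eval g) v"
  by (simp add: lin_ext_lin_map)

lemma proj_prim_hsum:
  assumes "x \<in> primitives" "lk y wnp_empty = 0" shows "proj_prim (hsum x y) = 0"
proof (rule poly_mapping_eqI)
  fix R
  show "lk (proj_prim (hsum x y)) R = lk 0 R"
    using lookup_hsum_primitive(1)[OF assms(1), of R y wnp_empty] assms(2)
    by (simp add: lookup_proj_prim)
qed

lemma proj_prim_hprod:
  assumes "set us \<subseteq> primitives"
  shows "proj_prim (hprod us) = (case us of [x] \<Rightarrow> x | _ \<Rightarrow> 0)"
proof (cases us)
  case Nil
  then show ?thesis by (simp add: proj_prim_def)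
next
  case (Cons x xs)
  then show ?thesis
    using assms proj_prim_hsum[of x "hprod xs"] lookup_hprod_empty[of xs] proj_prim_id[of x]
    by (cases xs) simp_all
qed

text \<open>The brackets with an empty word fit in, because the connected part of a word is the word itself if it has
  length one and \<open>0\<close> otherwise.\<close>

lemma bterm_eval_block:
  assumes g: "\<And>i. g i \<in> primitives"
  shows "lin_ext (bterm_eval g) (block term_bracket u v) = proj_prim (hstar (word_eval g u) (word_eval g v))"
proof -
  have l: "lin_ext (bterm_eval g) 0 = (0 :: 'b wnp \<Rightarrow>\<^sub>0 'c)" by (rule lin_zero[OF lin_lin_ext])
  have p: "proj_prim (word_eval g w) = (case w of [t] \<Rightarrow> bterm_eval g t | _ \<Rightarrow> 0)" for w
    by (subst proj_prim_hprod[OF bterm_eval_primitives[of g, OF g]]) (simp split: list.split)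
  consider "u = []" | "v = []" | s ss t ts where "u = s # ss" "v = t # ts"
    by (cases u; cases v) auto
  then show ?thesis
  proof cases
    case 1
    then show ?thesis by (simp add: p block_def l split: list.split)
  next
    case 2
    then show ?thesis by (simp add: p block_def l split: list.split)
  next
    case 3
    then show ?thesis by (simp add: block_def term_bracket_def)
  qed
qed

lemma split_sum_map: "split_sum (map f u) F = split_sum u (\<lambda>a b. F (map f a) (map f b))"
  by (simp add: split_sum_eq take_map drop_map)

lemma hstar_word_eval:
  assumes g: "\<And>i. g i \<in> primitives"
  shows "hstar (word_eval g u) (word_eval g v) = (if u = [] \<and> v = [] then bas wnp_empty else 0) +
    split_sum u (\<lambda>u1 u2. split_sum v (\<lambda>v1 v2.
      hsum (proj_prim (hstar (word_eval g u1) (word_eval g v1))) (hstar (word_eval g u2) (word_eval g v2))))"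
proof -
  have "set (map (bterm_eval g) u) \<subseteq> primitives" "set (map (bterm_eval g) v) \<subseteq> primitives"
    using bterm_eval_primitives[of g] g by blast+
  from hstar_hprod[OF this] show ?thesis by (simp add: split_sum_map)
qed

lemma word_eval_wstar:
  assumes g: "\<And>i. g i \<in> primitives"
  shows "lin_ext (word_eval g) (wstar term_bracket u v) = hstar (word_eval g u) (word_eval g v)"
proof (induction "length u + length v" arbitrary: u v rule: less_induct)
  case less
  let ?E = "lin_ext (word_eval g)" and ?b = "block term_bracket"
  have "?E (wstar term_bracket u v) = (if u = [] \<and> v = [] then bas wnp_empty else 0) +
     split_sum u (\<lambda>u1 u2. split_sum v (\<lambda>v1 v2.
       hsum (?E (letter (?b u1 v1))) (?E (wstar term_bracket u2 v2))))"
    by (subst wstar_rec)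
      (simp add: lin_plus[OF lin_lin_ext] lin_zero[OF lin_lin_ext] lin_split_sum[OF lin_lin_ext] word_eval_tcat)
  also have "split_sum u (\<lambda>u1 u2. split_sum v (\<lambda>v1 v2.
       hsum (?E (letter (?b u1 v1))) (?E (wstar term_bracket u2 v2)))) =
     split_sum u (\<lambda>u1 u2. split_sum v (\<lambda>v1 v2.
       hsum (proj_prim (hstar (word_eval g u1) (word_eval g v1))) (hstar (word_eval g u2) (word_eval g v2))))"
  proof (rule split_sum_cong, rule split_sum_cong)
    fix u1 u2 v1 v2 assume e: "u = u1 @ u2" "v = v1 @ v2"
    show "hsum (?E (letter (?b u1 v1))) (?E (wstar term_bracket u2 v2)) =
        hsum (proj_prim (hstar (word_eval g u1) (word_eval g v1))) (hstar (word_eval g u2) (word_eval g v2))"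
    proof (cases "u1 = [] \<and> v1 = []")
      case True
      then show ?thesis
        by (simp add: lin_zero[OF lin_lin_ext] lin_zero[OF lin_lin_map] proj_prim_def)
    next
      case False
      then have "length u2 + length v2 < length u + length v" using e by auto
      from less[OF this] show ?thesis by (simp only: word_eval_letter bterm_eval_block[of g, OF g])
    qed
  qed
  also have "(if u = [] \<and> v = [] then bas wnp_empty else 0) + \<dots> = hstar (word_eval g u) (word_eval g v)"
    by (rule hstar_word_eval[of g, OF g, symmetric])
  finally show ?case .
qed

lemma word_eval_tstar:
  assumes g: "\<And>i. g i \<in> primitives"
  shows "lin_ext (word_eval g) (tstar term_bracket x y) =
    hstar (lin_ext (word_eval g) x) (lin_ext (word_eval g) y)"
proof (rule lin_eqI[where x = x])
  fix u
  show "lin_ext (word_eval g) (tstar term_bracket (bas u) y) =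
      hstar (lin_ext (word_eval g) (bas u)) (lin_ext (word_eval g) y)"
    by (rule lin_eqI[where x = y]) (auto intro!: lin_intros simp: word_eval_wstar[of g, OF g])
qed (intro lin_intros)+

lemma proj_prim_word_eval:
  assumes g: "\<And>i. g i \<in> primitives"
  shows "proj_prim (lin_ext (word_eval g) x) = lin_ext (bterm_eval g) (tensor_proj x)"
proof (rule lin_eqI[where x = x])
  fix w
  show "proj_prim (lin_ext (word_eval g) (bas w)) = lin_ext (bterm_eval g) (tensor_proj (bas w))"
    by (simp add: proj_prim_hprod[OF bterm_eval_primitives[of g, OF g]] tensor_proj_def
        lin_zero[OF lin_lin_ext] split: list.split)
qed (auto intro!: lin_intros lin_compose[OF lin_proj_prim] lin_compose[OF lin_lin_ext] lin_tensor_proj)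

lemma split_sum_top:
  "split_sum u (\<lambda>u1 u2. split_sum v (\<lambda>v1 v2. F u1 u2 v1 v2)) = F u [] v [] +
     split_sum u (\<lambda>u1 u2. split_sum v (\<lambda>v1 v2. if u2 = [] \<and> v2 = [] then 0 else F u1 u2 v1 v2))"
proof -
  have "split_sum u (\<lambda>u1 u2. split_sum v (\<lambda>v1 v2. F u1 u2 v1 v2)) =
      split_sum u (\<lambda>u1 u2. split_sum v (\<lambda>v1 v2.
        (if u2 = [] then if v2 = [] then F u1 [] v1 [] else 0 else 0) +
        (if u2 = [] \<and> v2 = [] then 0 else F u1 u2 v1 v2)))"
    by (intro split_sum_cong) auto
  also have "\<dots> = split_sum u (\<lambda>u1 u2. if u2 = [] then split_sum v (\<lambda>v1 v2. if v2 = [] then F u1 [] v1 [] else 0) else 0) +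
     split_sum u (\<lambda>u1 u2. split_sum v (\<lambda>v1 v2. if u2 = [] \<and> v2 = [] then 0 else F u1 u2 v1 v2))"
    unfolding split_sum_add by (rule arg_cong2[where f = "(+)"], rule split_sum_cong) auto
  finally show ?thesis by (simp only: split_sum_Nil_right)
qed

lemma (in two_as_mod) eqv_split_sum:
  "(\<And>a b. w = a @ b \<Longrightarrow> F a b \<approx> G a b) \<Longrightarrow> split_sum w F \<approx> split_sum w G"
  unfolding split_sum_eq by (rule eqv_sum) simp

text \<open>A morphism of \<open>2\<close>-\<open>As\<close> algebras preserves the brackets, because the brackets are polynomials in the
  two products: the recursion for \<open>u \<star> v\<close> can be solved for the term \<open>[u; v]\<close>, all others being
  products of brackets of shorter words. In the target, \<open>\<tau>\<close> gives the values of monomials and \<open>T\<close> those of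
  words.\<close>

lemma (in two_as_mod) Xi_bterm_eval:
  fixes \<tau> :: "'x bterm \<Rightarrow> ('b \<Rightarrow>\<^sub>0 'k)" and T :: "'x bterm list \<Rightarrow> ('b \<Rightarrow>\<^sub>0 'k)"
  defines "\<beta> \<equiv> \<lambda>u v. lin_ext \<tau> (block term_bracket u v)"
  assumes T: "T [] = e" "\<And>t u. T (t # u) = c1 (\<tau> t) (T u)"
    and star: "\<And>u v. c2 (T u) (T v) \<approx> (if u = [] \<and> v = [] then e else 0) +
      split_sum u (\<lambda>u1 u2. split_sum v (\<lambda>v1 v2. c1 (\<beta> u1 v1) (c2 (T u2) (T v2))))"
  shows "Xi (\<lambda>i. \<tau> (Gen i)) (bterm_eval pt t) \<approx> \<tau> t"
proof -
  let ?X = "Xi (\<lambda>i. \<tau> (Gen i)) :: ('x wnp \<Rightarrow>\<^sub>0 'k) \<Rightarrow> _"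
  let ?w = "word_eval pt :: _ \<Rightarrow> 'x wnp \<Rightarrow>\<^sub>0 'k"
  let ?br = "\<lambda>u v. proj_prim (hstar (?w u) (?w v))"
  define good where "good t \<longleftrightarrow> ?X (bterm_eval pt t) \<approx> \<tau> t" for t
  have word: "?X (?w u) \<approx> T u" if "\<forall>t\<in>set u. good t" for u
    using that
  proof (induction u)
    case (Cons t u)
    have "?X (?w (t # u)) \<approx> c1 (?X (bterm_eval pt t)) (?X (?w u))" using Xi_hsum by simp
    also have "\<dots> \<approx> T (t # u)"
      unfolding T(2) by (rule eqv_mult) (use Cons in \<open>auto simp: good_def\<close>)
    finally show ?case .
  qed (simp add: T)
  have blk: "lin_ext (bterm_eval pt) (block term_bracket u v) = ?br u v" for u v
    by (rule bterm_eval_block) (rule pt_primitive)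
  have br: "?X (?br u v) \<approx> \<beta> u v" if "\<forall>t\<in>set u \<union> set v. good t" for u v
    using that
  proof (induction "length u + length v" arbitrary: u v rule: less_induct)
    case less
    have z: "?X (lin_ext (bterm_eval pt) 0) \<approx> lin_ext \<tau> 0" by (simp add: lin_zero[OF lin_lin_ext])
    consider "u = [] \<or> v = []" | "u \<noteq> []" "v \<noteq> []" by blast
    then show ?case
    proof cases
      case 1
      have "block term_bracket u v = (0 :: 'x bterm \<Rightarrow>\<^sub>0 'k) \<or>
          (\<exists>t. good t \<and> block term_bracket u v = (bas t :: 'x bterm \<Rightarrow>\<^sub>0 'k))"
        using 1 less.prems by (auto simp: block_def split: list.split)
      then show ?thesis
        unfolding blk[symmetric] \<beta>_def using z by (auto simp: good_def)
    next
      case 2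
      let ?F = "\<lambda>u1 u2 v1 v2. hsum (?br u1 v1) (hstar (?w u2) (?w v2))"
      let ?G = "\<lambda>u1 u2 v1 v2. c1 (\<beta> u1 v1) (c2 (T u2) (T v2))"
      let ?SF = "split_sum u (\<lambda>u1 u2. split_sum v (\<lambda>v1 v2. if u2 = [] \<and> v2 = [] then 0 else ?F u1 u2 v1 v2))"
      let ?SG = "split_sum u (\<lambda>u1 u2. split_sum v (\<lambda>v1 v2. if u2 = [] \<and> v2 = [] then 0 else ?G u1 u2 v1 v2))"
      \<comment> \<open>The full bracket of \<open>u\<close> and \<open>v\<close> is the term in which nothing is split off.\<close>
      have "hstar (?w u) (?w v) = split_sum u (\<lambda>u1 u2. split_sum v (\<lambda>v1 v2. ?F u1 u2 v1 v2))"
        using 2 hstar_word_eval[of pt, OF pt_primitive, of u v] by simp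
      also have "\<dots> = ?br u v + ?SF" by (subst split_sum_top) simp
      finally have 1: "?br u v = hstar (?w u) (?w v) - ?SF"
        by (rule add_implies_diff[OF sym])
      have "?X ?SF = split_sum u (\<lambda>u1 u2. split_sum v (\<lambda>v1 v2. if u2 = [] \<and> v2 = [] then 0 else ?X (?F u1 u2 v1 v2)))"
        by (simp only: lin_split_sum[OF lin_lin_ext] if_distrib[of ?X] lin_zero[OF lin_lin_ext])
      also have "\<dots> \<approx> ?SG"
      proof (rule eqv_split_sum, rule eqv_split_sum)
        fix u1 u2 v1 v2 assume e: "u = u1 @ u2" "v = v1 @ v2"
        show "(if u2 = [] \<and> v2 = [] then 0 else ?X (?F u1 u2 v1 v2)) \<approx>
            (if u2 = [] \<and> v2 = [] then 0 else ?G u1 u2 v1 v2)"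
        proof (cases "u2 = [] \<and> v2 = []")
          case False
          then have "?X (?br u1 v1) \<approx> \<beta> u1 v1" using e less.prems by (intro less.hyps) auto
          moreover have "?X (?w u2) \<approx> T u2" "?X (?w v2) \<approx> T v2"
            using e less.prems by (auto intro!: word)
          ultimately have "c1 (?X (?br u1 v1)) (c2 (?X (?w u2)) (?X (?w v2))) \<approx> ?G u1 u2 v1 v2"
            by (intro eqv_mult)
          then have "c1 (?X (?br u1 v1)) (?X (hstar (?w u2) (?w v2))) \<approx> ?G u1 u2 v1 v2"
            by (rule eqv_trans[OF eqv_mult(1)[OF eqv_refl Xi_hstar]])
          then have "?X (?F u1 u2 v1 v2) \<approx> ?G u1 u2 v1 v2" by (rule eqv_trans[OF Xi_hsum])
          then show ?thesis by (simp only: False if_False)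
        qed (simp only: if_True simp_thms eqv_refl)
      qed
      finally have sf: "?X ?SF \<approx> ?SG" .
      have "?X (hstar (?w u) (?w v)) \<approx> c2 (?X (?w u)) (?X (?w v))" by (rule Xi_hstar)
      also have "\<dots> \<approx> c2 (T u) (T v)" using less.prems by (intro eqv_mult word) auto
      also have "\<dots> \<approx> 0 + split_sum u (\<lambda>u1 u2. split_sum v (\<lambda>v1 v2. ?G u1 u2 v1 v2))"
        using star[of u v] 2 by simp
      finally have st: "?X (hstar (?w u) (?w v)) \<approx> ?G u [] v [] + ?SG"
        by (subst (asm) split_sum_top) simp
      have "?G u [] v [] \<approx> c1 (\<beta> u v) e" unfolding T(1) by (rule eqv_mult(1)[OF eqv_refl eqv_unit(3)])
      also have "\<dots> \<approx> \<beta> u v" by (rule eqv_unit)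
      finally have top: "?G u [] v [] \<approx> \<beta> u v" .
      have "?X (hstar (?w u) (?w v) - ?SF) \<approx> (?G u [] v [] + ?SG) - ?SG"
        unfolding lin_minus[OF lin_lin_ext] by (rule eqv_diff[OF st sf])
      also have "(?G u [] v [] + ?SG) - ?SG = ?G u [] v []" by (rule add_diff_cancel_right')
      also note top
      finally show ?thesis by (subst 1)
    qed
  qed
  have "good t"
  proof (induction t)
    case (Gen i)
    then show ?case by (simp add: good_def)
  next
    case (Br s ss t ts)
    then have "?X (?br (s # ss) (t # ts)) \<approx> \<beta> (s # ss) (t # ts)" by (intro br) auto
    then show ?case by (simp add: good_def \<beta>_def block_def term_bracket_def)
  qed
  then show ?thesis by (simp add: good_def)
qed

lemma wnp_subst_bterm_eval:
  assumes g: "\<And>i. g i \<in> primitives"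
  shows "wnp_subst g (bterm_eval pt t) = bterm_eval g t"
proof -
  have "wnp_target.eqv (wnp_target.Xi (\<lambda>i. bterm_eval g (Gen i)) (bterm_eval pt t)) (bterm_eval g t)"
  proof (rule wnp_target.Xi_bterm_eval[where T = "word_eval g"])
    fix u v
    show "wnp_target.eqv (hstar (word_eval g u) (word_eval g v)) ((if u = [] \<and> v = [] then bas wnp_empty else 0) +
      split_sum u (\<lambda>u1 u2. split_sum v (\<lambda>v1 v2. hsum (lin_ext (bterm_eval g) (block term_bracket u1 v1))
        (hstar (word_eval g u2) (word_eval g v2)))))"
      unfolding bterm_eval_block[of g, OF g]
      by (simp only: hstar_word_eval[of g, OF g, of u v] wnp_target.eqv_refl)
  qed simp_all
  then show ?thesis by (simp add: wnp_target.eqv_def wnp_subst_def)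
qed

section \<open>The relations of free \<open>B\<^sub>\<infinity>\<close> algebras\<close>

definition eval_kernel :: "('x bterm \<Rightarrow>\<^sub>0 'k::field) set" where
  "eval_kernel = {x. lin_ext (bterm_eval pt) x = 0}"

text \<open>The tensor algebra modulo the ideal of \<open>J\<close> is a \<open>2\<close>-\<open>As\<close> algebra, so by freeness there is a morphism to it from
  the algebra of WN posets that sends each point to its generator. It sends the value of a monomial to the class of
  the monomial, so whatever has value \<open>0\<close> is already \<open>0\<close> modulo \<open>J\<close>.\<close>

lemma binf_quotient_eval_kernel:
  fixes J :: "('x bterm \<Rightarrow>\<^sub>0 'k::field) set"
  assumes "binf_quotient term_bracket J" shows "eval_kernel \<subseteq> J"
proof
  interpret binf_mod term_bracket J using assms by (simp add: binf_quotient_iff)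
  have SJ: "pm.subspace J" using bracket by (simp add: bracket_ideal_def)
  fix x :: "'x bterm \<Rightarrow>\<^sub>0 'k" assume x: "x \<in> eval_kernel"
  have t: "eqv (Xi (\<lambda>i. letter (bas (Gen i))) (bterm_eval pt t)) (letter (bas t))" for t
  proof (rule Xi_bterm_eval[where T = bas and \<tau> = "\<lambda>t. letter (bas t)"])
    fix u v
    have l: "lin_ext (\<lambda>t. letter (bas t)) y = letter y" for y :: "'x bterm \<Rightarrow>\<^sub>0 'k"
      by (simp add: lin_map_def)
    show "eqv (tstar term_bracket (bas u) (bas v)) ((if u = [] \<and> v = [] then bas [] else 0) +
      split_sum u (\<lambda>u1 u2. split_sum v (\<lambda>v1 v2. tcat (lin_ext (\<lambda>t. letter (bas t)) (block term_bracket u1 v1))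
        (tstar term_bracket (bas u2) (bas v2)))))"
      unfolding l tstar_bas wstar_rec[of term_bracket u v, symmetric] by (rule eqv_refl)
  qed simp_all
  have "eqv (Xi (\<lambda>i. letter (bas (Gen i))) (lin_ext (bterm_eval pt) x)) (letter x)"
    by (rule eqv_lin[where x = x]) (auto intro!: lin_intros t[simplified])
  then have "- letter x \<in> tensor_ideal J"
    using x by (simp add: eval_kernel_def eqv_def lin_zero[OF lin_lin_ext])
  then have "letter x \<in> tensor_ideal J" using pm.subspace_neg[OF sub] by fastforce
  then have "tensor_proj (letter x) \<in> J" by (rule tensor_proj_tensor_ideal[OF SJ])
  moreover have "tensor_proj (letter x) = x"
    by (simp add: tensor_proj_def lin_ext_lin_map lin_ext_basis)
  ultimately show "x \<in> J" by simp
qed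

subsection \<open>Surjectivity\<close>

abbreviation word_gens :: "'x bterm list \<Rightarrow> 'x multiset" where
  "word_gens w \<equiv> mset (concat (map bterm_gens w))"

definition word_piece :: "'x multiset \<Rightarrow> ('x bterm list \<Rightarrow>\<^sub>0 'k::field) set" where
  "word_piece M = {x. Poly_Mapping.keys x \<subseteq> {w. word_gens w = M}}"

definition term_piece :: "'x multiset \<Rightarrow> ('x bterm \<Rightarrow>\<^sub>0 'k::field) set" where
  "term_piece M = {x. Poly_Mapping.keys x \<subseteq> {t. mset (bterm_gens t) = M}}"

lemma subspace_word_piece: "pm.subspace (word_piece M :: ('a bterm list \<Rightarrow>\<^sub>0 'b::field) set)"
  unfolding word_piece_def by (rule subspace_keys)

lemma subspace_term_piece: "pm.subspace (term_piece M)"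
  unfolding term_piece_def by (rule subspace_keys)

lemma bas_in_word_piece [simp]: "bas w \<in> word_piece M \<longleftrightarrow> word_gens w = M"
  by (simp add: word_piece_def)

lemma bas_in_term_piece [simp]: "bas t \<in> term_piece M \<longleftrightarrow> mset (bterm_gens t) = M"
  by (simp add: term_piece_def)

lemma word_pieceD: "x \<in> word_piece M \<Longrightarrow> w \<in> Poly_Mapping.keys x \<Longrightarrow> word_gens w = M"
  by (auto simp: word_piece_def)

lemma term_pieceD: "x \<in> term_piece M \<Longrightarrow> t \<in> Poly_Mapping.keys x \<Longrightarrow> mset (bterm_gens t) = M"
  by (auto simp: term_piece_def)

lemma tcat_word_piece:
  assumes "x \<in> word_piece M" "y \<in> word_piece N" shows "tcat x y \<in> word_piece (M + N)"
proof (rule bilinear_in_subspace[OF bilinear_tcat subspace_word_piece])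
  fix a b assume "a \<in> Poly_Mapping.keys x" "b \<in> Poly_Mapping.keys y"
  then show "tcat (bas a) (bas b) \<in> word_piece (M + N)"
    using word_pieceD[OF assms(1)] word_pieceD[OF assms(2)] by simp
qed

lemma letter_word_piece:
  assumes "x \<in> term_piece M" shows "letter x \<in> word_piece M"
proof (rule lin_in_subspace[OF lin_lin_map subspace_word_piece])
  fix t assume "t \<in> Poly_Mapping.keys x"
  then show "letter (bas t) \<in> word_piece M" using term_pieceD[OF assms] by simp
qed

lemma block_term_piece: "block term_bracket u v \<in> term_piece (word_gens u + word_gens v)"
proof -
  note z = pm.subspace_0[OF subspace_term_piece]
  show ?thesis
    by (cases u; cases v) (auto simp: block_def term_bracket_def z split: list.split)
qed

lemma wstar_word_piece:
  "(wstar term_bracket u v :: 'x bterm list \<Rightarrow>\<^sub>0 'k::field) \<in> word_piece (word_gens u + word_gens v)"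
proof (induction "length u + length v" arbitrary: u v rule: less_induct)
  case less
  let ?M = "word_gens u + word_gens v"
  note S = subspace_word_piece[of ?M, where ?'b = 'k]
  let ?tb = "term_bracket :: _ \<Rightarrow> _ \<Rightarrow> 'x bterm \<Rightarrow>\<^sub>0 'k"
  have sum: "split_sum a F \<in> word_piece ?M"
    if "\<And>c d. a = c @ d \<Longrightarrow> F c d \<in> word_piece ?M" for a :: "'x bterm list" and F :: "_ \<Rightarrow> _ \<Rightarrow> 'x bterm list \<Rightarrow>\<^sub>0 'k"
    unfolding split_sum_eq by (rule pm.subspace_sum[OF S]) (simp add: that)
  have "(if u1 = [] \<and> v1 = [] then 0 else tcat (letter (block ?tb u1 v1)) (wstar ?tb u2 v2))
      \<in> word_piece ?M" if e: "u = u1 @ u2" "v = v1 @ v2" for u1 u2 v1 v2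
  proof (cases "u1 = [] \<and> v1 = []")
    case True
    then show ?thesis by (simp only: if_True simp_thms pm.subspace_0[OF S])
  next
    case False
    then have "length u2 + length v2 < length u + length v" using e by auto
    note tcat_word_piece[OF letter_word_piece[OF block_term_piece[of u1 v1]] less[OF this]]
    moreover have "(word_gens u1 + word_gens v1) + (word_gens u2 + word_gens v2) = ?M"
      using e by (simp add: ac_simps)
    ultimately show ?thesis using False by (simp only: if_False)
  qed
  then have "split_sum u (\<lambda>u1 u2. split_sum v (\<lambda>v1 v2. if u1 = [] \<and> v1 = [] then 0
       else tcat (letter (block ?tb u1 v1)) (wstar ?tb u2 v2))) \<in> word_piece ?M"
    by (intro sum)
  moreover have "(if u = [] \<and> v = [] then bas [] else 0 :: 'x bterm list \<Rightarrow>\<^sub>0 'k) \<in> word_piece ?M"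
    using pm.subspace_0[OF S] by simp
  ultimately show ?case
    by (subst wstar.simps) (rule pm.subspace_add[OF S])
qed

lemma tstar_word_piece:
  assumes "x \<in> word_piece M" "y \<in> word_piece N" shows "tstar term_bracket x y \<in> word_piece (M + N)"
proof (rule bilinear_in_subspace[OF bilinear_tstar subspace_word_piece])
  fix a b assume "a \<in> Poly_Mapping.keys x" "b \<in> Poly_Mapping.keys y"
  then show "tstar term_bracket (bas a) (bas b) \<in> word_piece (M + N)"
    using word_pieceD[OF assms(1)] word_pieceD[OF assms(2)] wstar_word_piece[of a b] by simp
qed

lemma subspace_lin_image: "lin f \<Longrightarrow> pm.subspace S \<Longrightarrow> pm.subspace (f ` S)"
  by (rule module_hom.subspace_image[OF lin_hom])

text \<open>The values of words contain the points and are stable under both products.\<close>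

lemma word_eval_surj:
  fixes x :: "'x wnp \<Rightarrow>\<^sub>0 'k::field"
  assumes "x \<in> wnp_piece M"
  shows "x \<in> lin_ext (word_eval pt) ` word_piece M"
  using _ _ _ _ _ assms
proof (rule wnp_generated)
  show "pm.subspace (lin_ext (word_eval pt) ` word_piece M :: ('x wnp \<Rightarrow>\<^sub>0 'k) set)" for M
    by (intro subspace_lin_image lin_lin_ext subspace_word_piece)
  show "(bas wnp_empty :: 'x wnp \<Rightarrow>\<^sub>0 'k) \<in> lin_ext (word_eval pt) ` word_piece {#}"
    by (rule image_eqI[where x = "bas []"]) simp_all
  show "(pt d :: 'x wnp \<Rightarrow>\<^sub>0 'k) \<in> lin_ext (word_eval pt) ` word_piece {#d#}" for d
    by (rule image_eqI[where x = "bas [Gen d]"]) simp_all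
next
  fix M N and x y :: "'x wnp \<Rightarrow>\<^sub>0 'k"
  assume "x \<in> lin_ext (word_eval pt) ` word_piece M" "y \<in> lin_ext (word_eval pt) ` word_piece N"
  then obtain x' y' where e: "x' \<in> word_piece M" "y' \<in> word_piece N"
    "x = lin_ext (word_eval pt) x'" "y = lin_ext (word_eval pt) y'" by blast
  show "hsum x y \<in> lin_ext (word_eval pt) ` word_piece (M + N)"
    by (rule image_eqI[where x = "tcat x' y'"]) (simp_all add: e word_eval_tcat tcat_word_piece)
  show "hstar x y \<in> lin_ext (word_eval pt) ` word_piece (M + N)"
    by (rule image_eqI[where x = "tstar term_bracket x' y'"])
      (simp_all add: e word_eval_tstar[of pt, OF pt_primitive] tstar_word_piece)
qed

lemma bterm_eval_surj:
  assumes "sum_irreducible P"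
  shows "\<exists>y\<in>term_piece (wnp_mdec P). lin_ext (bterm_eval pt) y = (bas P :: 'x wnp \<Rightarrow>\<^sub>0 'k::field)"
proof -
  have "(bas P :: 'x wnp \<Rightarrow>\<^sub>0 'k) \<in> wnp_piece (wnp_mdec P)" by simp
  from word_eval_surj[OF this] obtain x
    where e: "(bas P :: 'x wnp \<Rightarrow>\<^sub>0 'k) = lin_ext (word_eval pt) x" and x: "x \<in> word_piece (wnp_mdec P)"
    by (rule imageE)
  have "lin_ext (bterm_eval pt) (tensor_proj x) = proj_prim (bas P :: 'x wnp \<Rightarrow>\<^sub>0 'k)"
    unfolding e by (rule proj_prim_word_eval[of pt, OF pt_primitive, symmetric])
  also have "\<dots> = bas P" using assms by (simp add: proj_prim_def)
  finally have "lin_ext (bterm_eval pt) (tensor_proj x) = (bas P :: 'x wnp \<Rightarrow>\<^sub>0 'k)" .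
  moreover have "tensor_proj x \<in> term_piece (wnp_mdec P)"
  proof (rule lin_in_subspace[OF lin_tensor_proj subspace_term_piece])
    fix w assume "w \<in> Poly_Mapping.keys x"
    then have "word_gens w = wnp_mdec P" by (rule word_pieceD[OF x])
    then show "tensor_proj (bas w) \<in> term_piece (wnp_mdec P)"
      using pm.subspace_0[OF subspace_term_piece]
      by (auto simp: tensor_proj_def split: list.split)
  qed
  ultimately show ?thesis by blast
qed

definition term_section :: "'x wnp \<Rightarrow> ('x bterm \<Rightarrow>\<^sub>0 'k::field)" where
  "term_section P = (SOME y. y \<in> term_piece (wnp_mdec P) \<and> lin_ext (bterm_eval pt) y = (bas P :: 'x wnp \<Rightarrow>\<^sub>0 'k))"

lemma term_section:
  assumes "sum_irreducible P"
  shows "(term_section P :: _ \<Rightarrow>\<^sub>0 'k::field) \<in> term_piece (wnp_mdec P)"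
    "lin_ext (bterm_eval pt) (term_section P) = (bas P :: 'x wnp \<Rightarrow>\<^sub>0 'k)"
  using someI_ex[OF bterm_eval_surj[OF assms, unfolded Bex_def], folded term_section_def] by blast+

lemma term_section_lin:
  assumes "x \<in> primitives"
  shows "lin_ext (bterm_eval pt) (lin_ext term_section x) = (x :: 'x wnp \<Rightarrow>\<^sub>0 'k::field)"
proof (rule lin_eqI[where x = x])
  fix P assume "P \<in> Poly_Mapping.keys x"
  then have "sum_irreducible P" using assms by (simp add: primitives_def)
  then show "lin_ext (bterm_eval pt) (lin_ext term_section (bas P)) = (bas P :: 'x wnp \<Rightarrow>\<^sub>0 'k)"
    by (simp add: term_section)
qed (intro lin_intros)+

subsection \<open>Words of connected components\<close>

text \<open>The unique factorisation of a WN poset into connected ones. It turns a section on connected posets into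
  one on all posets that is compatible with concatenation.\<close>

definition components :: "'d wnp \<Rightarrow> 'd wnp list" where
  "components P = (SOME l. (\<forall>C\<in>set l. sum_irreducible C) \<and> foldr wnp_sum l wnp_empty = P)"

lemma components_eqI:
  assumes "\<forall>C\<in>set l. sum_irreducible C" "foldr wnp_sum l wnp_empty = P"
  shows "components P = l"
proof -
  have "l' = l" if "\<forall>C\<in>set l'. sum_irreducible C" "foldr wnp_sum l' wnp_empty = foldr wnp_sum l wnp_empty" for l'
    using that assms(1)
  proof (induction l' arbitrary: l)
    case Nil
    then have "foldr wnp_sum l wnp_empty = wnp_empty" by simp
    then show ?case using Nil.prems(3) by (cases l) auto
  next
    case (Cons C l')
    then obtain D m where l: "l = D # m" by (cases l) auto
    then have "wnp_sum C (foldr wnp_sum l' wnp_empty) = wnp_sum D (foldr wnp_sum m wnp_empty)"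
      "sum_irreducible C" "sum_irreducible D" using Cons.prems by auto
    note u = wnp_sum_irreducible_unique[OF this]
    then show ?case using Cons l by auto
  qed
  note unique = this
  show ?thesis
    unfolding components_def
  proof (rule some_equality)
    show "(\<forall>C\<in>set l. sum_irreducible C) \<and> foldr wnp_sum l wnp_empty = P" using assms by blast
    show "l' = l" if "(\<forall>C\<in>set l'. sum_irreducible C) \<and> foldr wnp_sum l' wnp_empty = P" for l'
      by (rule unique) (simp_all add: that assms(2))
  qed
qed

lemma components_empty [simp]: "components wnp_empty = []"
  by (rule components_eqI) simp_all

lemma components_irreducible: "\<forall>C\<in>set (components P). sum_irreducible C"
  and components_sum: "foldr wnp_sum (components P) wnp_empty = P"
proof -
  have "\<exists>l. (\<forall>C\<in>set l. sum_irreducible C) \<and> foldr wnp_sum l wnp_empty = P"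
  proof (induction P rule: measure_induct_rule[where f = wnp_size])
    case (less P)
    show ?case
    proof (cases rule: wnp_word_cases[of P])
      case 1
      then show ?thesis by (intro exI[of _ "[]"]) simp
    next
      case (2 C R)
      have "C \<noteq> wnp_empty" using 2(1) by auto
      then have "wnp_size R < wnp_size P" using 2(2) by simp
      from less[OF this] obtain l where "\<forall>C\<in>set l. sum_irreducible C" "foldr wnp_sum l wnp_empty = R" by blast
      then show ?thesis using 2 by (intro exI[of _ "C # l"]) auto
    qed
  qed
  from someI_ex[OF this, folded components_def]
  show "\<forall>C\<in>set (components P). sum_irreducible C" "foldr wnp_sum (components P) wnp_empty = P" by blast+
qed

lemma components_Cons: "sum_irreducible C \<Longrightarrow> components (wnp_sum C R) = C # components R"
  by (rule components_eqI) (simp_all add: components_irreducible components_sum)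

primrec word_section :: "'x wnp list \<Rightarrow> ('x bterm list \<Rightarrow>\<^sub>0 'k::field)" where
  "word_section [] = bas []"
| "word_section (C # l) = tcat (letter (term_section C)) (word_section l)"

lemma word_section_hsum:
  assumes "x \<in> primitives"
  shows "lin_ext (\<lambda>P. word_section (components P)) (hsum x y) =
    tcat (letter (lin_ext term_section x)) (lin_ext (\<lambda>P. word_section (components P)) y)"
proof (rule lin_eqI[where x = x])
  fix C assume "C \<in> Poly_Mapping.keys x"
  then have C: "sum_irreducible C" using assms by (simp add: primitives_def)
  show "lin_ext (\<lambda>P. word_section (components P)) (hsum (bas C) y) =
      tcat (letter (lin_ext term_section (bas C))) (lin_ext (\<lambda>P. word_section (components P)) y)"
    by (rule lin_eqI[where x = y]) (auto intro!: lin_intros simp: components_Cons[OF C])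
qed (intro lin_intros)+

text \<open>Replacing each letter of a word by the chosen preimage of its value changes the word by an element of
  the ideal, so a word combination of value \<open>0\<close> lies in the ideal.\<close>

lemma word_eval_kernel:
  assumes "lin_ext (word_eval pt) x = (0 :: 'x wnp \<Rightarrow>\<^sub>0 'k::field)"
  shows "x \<in> tensor_ideal eval_kernel"
proof -
  let ?s = "lin_ext (\<lambda>P. word_section (components P)) :: ('x wnp \<Rightarrow>\<^sub>0 'k) \<Rightarrow> _"
  let ?w = "word_eval pt :: _ \<Rightarrow> 'x wnp \<Rightarrow>\<^sub>0 'k"
  note I = subspace_tensor_ideal[of "eval_kernel :: ('x bterm \<Rightarrow>\<^sub>0 'k) set"]
  have words: "?s (?w u) - bas u \<in> tensor_ideal eval_kernel" for u
  proof (induction u)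
    case Nil
    then show ?case by (simp add: pm.subspace_0[OF I])
  next
    case (Cons t u)
    let ?v = "bterm_eval pt t :: 'x wnp \<Rightarrow>\<^sub>0 'k"
    let ?d = "lin_ext term_section ?v - bas t"
    have v: "?v \<in> primitives" by (rule bterm_eval_primitive) (rule pt_primitive)
    have "?d \<in> eval_kernel"
      by (simp add: eval_kernel_def lin_minus[OF lin_lin_ext] term_section_lin[OF v])
    then have "letter ?d \<in> tensor_ideal eval_kernel"
      using tensor_ideal_base[of ?d eval_kernel "[]" "[]"] by simp
    then have "tcat (letter ?d) (?s (?w u)) \<in> tensor_ideal eval_kernel" by (rule tcat_in_tensor_ideal)
    moreover have "tcat (bas [t]) (?s (?w u) - bas u) \<in> tensor_ideal eval_kernel"
      by (rule tcat_in_tensor_ideal(2)[OF Cons.IH])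
    moreover have "?s (?w (t # u)) - bas (t # u) =
        tcat (letter ?d) (?s (?w u)) + tcat (bas [t]) (?s (?w u) - bas u)"
      by (simp add: word_section_hsum[OF v] lin_minus[OF lin_lin_map] lin_minus[OF bilinearD(1)[OF bilinear_tcat]]
          lin_minus[OF bilinearD(2)[OF bilinear_tcat]])
    ultimately show ?case using pm.subspace_add[OF I] by simp
  qed
  have "?s (lin_ext ?w x) - x \<in> tensor_ideal eval_kernel"
  proof (rule lin_in_subspace[OF _ I, where f = "\<lambda>x. ?s (lin_ext ?w x) - x"])
    show "lin (\<lambda>x. ?s (lin_ext ?w x) - x)" by (intro lin_intros)
    show "?s (lin_ext ?w (bas u)) - bas u \<in> tensor_ideal eval_kernel" for u
      using words[of u] by simp
  qed
  then have "- x \<in> tensor_ideal eval_kernel" using assms by (simp add: lin_zero[OF lin_lin_ext])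
  then show ?thesis using pm.subspace_neg[OF I] by fastforce
qed

text \<open>The values of words form an associative algebra, so the associators of words have value \<open>0\<close>, which puts them
  into the ideal.\<close>

lemma binf_mod_eval_kernel: "binf_mod term_bracket (eval_kernel :: ('x bterm \<Rightarrow>\<^sub>0 'k::field) set)"
proof
  let ?E = "lin_ext (bterm_eval pt) :: _ \<Rightarrow> 'x wnp \<Rightarrow>\<^sub>0 'k"
  let ?w = "word_eval pt :: _ \<Rightarrow> 'x wnp \<Rightarrow>\<^sub>0 'k"
  have "pm.subspace (eval_kernel :: ('x bterm \<Rightarrow>\<^sub>0 'k) set)"
    using subspace_vimage[OF lin_lin_ext subspace_zero_only] by (simp add: eval_kernel_def)
  moreover have "lin_ext (\<lambda>b. term_bracket (u @ [b] @ v) w) x \<in> eval_kernel \<and>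
      lin_ext (\<lambda>b. term_bracket w (u @ [b] @ v)) x \<in> eval_kernel"
    if x: "x \<in> eval_kernel" and w: "w \<noteq> []" for u v w and x :: "'x bterm \<Rightarrow>\<^sub>0 'k"
  proof -
    have t: "?E (term_bracket a b) = proj_prim (hstar (?w a) (?w b))" if "a \<noteq> []" "b \<noteq> []" for a b
      using bterm_eval_block[of pt, OF pt_primitive, of a b] that by simp
    have "lin_ext (\<lambda>b. ?w (u @ [b] @ v)) x = hsum (?w u) (hsum (?E x) (?w v))"
      by (rule lin_eqI[where x = x]) (auto intro!: lin_intros simp: hprod_append)
    then have z: "lin_ext (\<lambda>b. ?w (u @ [b] @ v)) x = 0" using x by (simp add: eval_kernel_def)
    have "?E (lin_ext (\<lambda>b. term_bracket (u @ [b] @ v) w) x) =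
        proj_prim (hstar (lin_ext (\<lambda>b. ?w (u @ [b] @ v)) x) (?w w))"
      by (rule lin_eqI[where x = x])
        (use w in \<open>auto intro!: lin_intros lin_compose[OF lin_proj_prim] simp: t\<close>)
    moreover have "?E (lin_ext (\<lambda>b. term_bracket w (u @ [b] @ v)) x) =
        proj_prim (hstar (?w w) (lin_ext (\<lambda>b. ?w (u @ [b] @ v)) x))"
      by (rule lin_eqI[where x = x])
        (use w in \<open>auto intro!: lin_intros lin_compose[OF lin_proj_prim] simp: t\<close>)
    ultimately show ?thesis
      unfolding z eval_kernel_def
      by (simp add: lin_zero[OF bilinearD(1)[OF bilinear_hstar]] lin_zero[OF bilinearD(2)[OF bilinear_hstar]]
          lin_zero[OF lin_proj_prim])
  qed
  ultimately show "bracket_ideal term_bracket (eval_kernel :: ('x bterm \<Rightarrow>\<^sub>0 'k) set)"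
    unfolding bracket_ideal_def by blast
  show "tstar term_bracket (wstar term_bracket u v) (bas w) - tstar term_bracket (bas u) (wstar term_bracket v w)
      \<in> tensor_ideal (eval_kernel :: ('x bterm \<Rightarrow>\<^sub>0 'k) set)" for u v w
    by (rule word_eval_kernel)
      (simp add: lin_minus[OF lin_lin_ext] word_eval_tstar[of pt, OF pt_primitive] word_eval_wstar[of pt, OF pt_primitive] hstar_assoc)
qed

text \<open>The intersection in \<^const>\<open>binf_relations\<close> is attained: the kernel of the evaluation is the least
  of the subspaces that are intersected.\<close>

lemma binf_relations_eq: "binf_relations = eval_kernel"
proof
  show "binf_relations \<subseteq> eval_kernel"
    using binf_mod_eval_kernel unfolding binf_relations_def by (auto simp: binf_quotient_iff)
  show "eval_kernel \<subseteq> binf_relations"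
    unfolding binf_relations_def using binf_quotient_eval_kernel by blast
qed

section \<open>The free \<open>B\<^sub>\<infinity>\<close> algebra as a space of connected posets\<close>

text \<open>Evaluation is injective on the free \<open>B\<^sub>\<infinity>\<close> algebra, and its image is the space of primitive elements. All
  statements on the free algebra are proved by evaluating both sides.\<close>

definition free_eval :: "('x, 'k::field) free_binf \<Rightarrow> ('x wnp \<Rightarrow>\<^sub>0 'k)" where
  "free_eval X = lin_ext (bterm_eval pt) (rep_free_binf X)"

lemma binf_eq_iff:
  "binf_eq x y \<longleftrightarrow> lin_ext (bterm_eval pt) x = (lin_ext (bterm_eval pt) y :: 'x wnp \<Rightarrow>\<^sub>0 'k::field)"
  by (simp add: binf_eq_def binf_relations_eq eval_kernel_def lin_minus[OF lin_lin_ext])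

lemma abs_rep_free: "abs_free_binf (rep_free_binf X) = X"
  by (rule Quotient_abs_rep[OF Quotient_free_binf])

lemma abs_free_eq_iff: "abs_free_binf x = abs_free_binf y \<longleftrightarrow> binf_eq x y"
  using Quotient_rel[OF Quotient_free_binf, of x y] by (simp add: binf_eq_def binf_relations_closed)

lemma free_eval_abs: "free_eval (abs_free_binf x) = lin_ext (bterm_eval pt) x"
  unfolding free_eval_def binf_eq_iff[symmetric] abs_free_eq_iff[symmetric] by (rule abs_rep_free)

lemma free_eval_inject: "free_eval X = free_eval Y \<longleftrightarrow> X = Y"
  unfolding free_eval_def binf_eq_iff[symmetric] abs_free_eq_iff[symmetric] by (simp only: abs_rep_free)

lemma free_eval_add: "free_eval (X + Y) = free_eval X + free_eval Y"
proof -
  have "X + Y = abs_free_binf (rep_free_binf X + rep_free_binf Y)"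
    by (metis plus_free_binf.abs_eq abs_rep_free)
  then have "free_eval (X + Y) = lin_ext (bterm_eval pt) (rep_free_binf X + rep_free_binf Y)"
    by (simp only: free_eval_abs)
  then show ?thesis by (simp only: free_eval_def lin_plus[OF lin_lin_ext])
qed

lemma free_eval_scal: "free_eval (binf_scal c X) = scal c (free_eval X)"
proof -
  have "binf_scal c X = abs_free_binf (scal c (rep_free_binf X))"
    by (metis binf_scal.abs_eq abs_rep_free)
  then have "free_eval (binf_scal c X) = lin_ext (bterm_eval pt) (scal c (rep_free_binf X))"
    by (simp only: free_eval_abs)
  then show ?thesis by (simp only: free_eval_def lin_scale[OF lin_lin_ext])
qed

lemma vector_space_binf_scal: "vector_space (binf_scal :: 'k::field \<Rightarrow> ('x, 'k) free_binf \<Rightarrow> _)"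
  by unfold_locales
    (simp_all add: free_eval_inject[symmetric] free_eval_add free_eval_scal pm.scale_right_distrib
      pm.scale_left_distrib)

interpretation fb: vector_space "binf_scal :: 'k::field \<Rightarrow> ('x, 'k) free_binf \<Rightarrow> _"
  by (rule vector_space_binf_scal)

lemma free_eval_zero: "free_eval 0 = 0"
  using free_eval_add[of 0 0] by simp

lemma bterm_eval_ext_primitive: "(\<And>i. g i \<in> primitives) \<Longrightarrow> lin_ext (bterm_eval g) x \<in> primitives"
  by (rule lin_ext_in_subspace[OF subspace_primitives]) (rule bterm_eval_primitive)

lemma free_eval_primitive: "free_eval X \<in> primitives"
  unfolding free_eval_def by (rule bterm_eval_ext_primitive) (rule pt_primitive)

definition free_section :: "('x wnp \<Rightarrow>\<^sub>0 'k::field) \<Rightarrow> ('x, 'k) free_binf" where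
  "free_section x = abs_free_binf (lin_ext term_section x)"

lemma free_eval_section: "x \<in> primitives \<Longrightarrow> free_eval (free_section x) = x"
  by (simp add: free_section_def free_eval_abs term_section_lin)

lemma free_section_eval: "free_section (free_eval X) = X"
  by (simp add: free_eval_inject[symmetric] free_eval_section free_eval_primitive)

subsection \<open>Arities\<close>

lemma hprod_in_wnp_piece:
  assumes "\<And>t. t \<in> set u \<Longrightarrow> f t \<in> wnp_piece (M t)"
  shows "hprod (map f u) \<in> wnp_piece (\<Sum>t\<leftarrow>u. M t)"
  using assms by (induction u) (auto intro: hsum_in_wnp_piece)

lemma proj_prim_in_wnp_piece: "x \<in> wnp_piece M \<Longrightarrow> proj_prim x \<in> wnp_piece M"
  by (auto simp: wnp_piece_def in_keys_iff lookup_proj_prim split: if_splits)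

lemma sum_list_gens: "(\<Sum>t\<leftarrow>u. mset (bterm_gens t)) = word_gens u"
  by (induction u) simp_all

lemma bterm_eval_piece: "(bterm_eval pt t :: 'x wnp \<Rightarrow>\<^sub>0 'k::field) \<in> wnp_piece (mset (bterm_gens t))"
proof (induction t)
  case (Br s ss t ts)
  let ?w = "word_eval pt :: _ \<Rightarrow> 'x wnp \<Rightarrow>\<^sub>0 'k"
  have "?w (s # ss) \<in> wnp_piece (word_gens (s # ss))" "?w (t # ts) \<in> wnp_piece (word_gens (t # ts))"
    unfolding sum_list_gens[symmetric] using Br by (auto intro!: hprod_in_wnp_piece simp del: list.map)
  from proj_prim_in_wnp_piece[OF hstar_in_wnp_piece[OF this]] show ?case
    by (simp add: ac_simps)
qed simp

lemma mset_eq_labels: "mset xs = labels n \<longleftrightarrow> distinct xs \<and> set xs = {1..n}"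
proof
  assume e: "mset xs = labels n"
  then have "set_mset (mset xs) = set_mset (labels n)" by (rule arg_cong)
  then have s: "set xs = {1..n}" by simp
  have "count (mset xs) a = (if a \<in> set xs then 1 else 0)" for a
    unfolding e s by (simp add: count_mset_set')
  then show "distinct xs \<and> set xs = {1..n}" using s by (simp add: distinct_count_atmost_1)
next
  assume "distinct xs \<and> set xs = {1..n}"
  then show "mset xs = labels n" using mset_set_set[of xs] by simp
qed

lemma B_infinity_operad_simps [simp]:
  "oscal B_infinity_operad = binf_scal"
  "ounit B_infinity_operad = abs_free_binf (bas (Gen 1))"
  by (simp_all add: B_infinity_operad_def)

text \<open>Evaluation preserves the multiset of generators, and the section can be chosen to preserve it as well.\<close>

lemma ocar_B_infinity: "X \<in> ocar B_infinity_operad n \<longleftrightarrow> free_eval X \<in> (WNP_h n :: (nat wnp \<Rightarrow>\<^sub>0 'k::field) set)"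
proof -
  let ?G = "{abs_free_binf (bas t) | t. distinct (bterm_gens t) \<and> set (bterm_gens t) = {1..n}} :: (nat, 'k) free_binf set"
  have car: "ocar B_infinity_operad n = fb.span ?G" by (simp add: B_infinity_operad_def)
  have sub: "pm.subspace (WNP_h n :: (nat wnp \<Rightarrow>\<^sub>0 'k) set)"
    unfolding WNP_h_def by (rule pm.subspace_span)
  show ?thesis
  proof
    assume "X \<in> ocar B_infinity_operad n"
    then have X: "X \<in> fb.span ?G" by (simp only: car)
    have "fb.span ?G \<subseteq> {X :: (nat, 'k) free_binf. free_eval X \<in> WNP_h n}"
    proof (rule fb.span_minimal)
      show "?G \<subseteq> {X :: (nat, 'k) free_binf. free_eval X \<in> WNP_h n}"
      proof
        fix Y assume "Y \<in> ?G"
        then obtain t where t: "Y = abs_free_binf (bas t)" "mset (bterm_gens t) = labels n"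
          using mset_eq_labels by blast
        have "free_eval Y = bterm_eval pt t" by (simp add: t free_eval_abs)
        then show "Y \<in> {X :: (nat, 'k) free_binf. free_eval X \<in> WNP_h n}"
          using bterm_eval_piece[of t, where 'k = 'k] t(2) free_eval_primitive[of Y] by (simp add: WNP_h_eq)
      qed
      show "fb.subspace {X :: (nat, 'k) free_binf. free_eval X \<in> WNP_h n}"
        by (rule fb.subspaceI) (simp_all add: free_eval_zero free_eval_add free_eval_scal
            pm.subspace_0[OF sub] pm.subspace_add[OF sub] pm.subspace_scale[OF sub])
    qed
    then show "free_eval X \<in> WNP_h n" using X by blast
  next
    assume x: "free_eval X \<in> WNP_h n"
    let ?y = "lin_ext term_section (free_eval X)"
    have "?y \<in> term_piece (labels n)"
    proof (rule lin_ext_in_subspace[OF subspace_term_piece])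
      fix P assume "P \<in> Poly_Mapping.keys (free_eval X)"
      then have "wnp_mdec P = labels n" "sum_irreducible P"
        using x by (auto simp: WNP_h_eq wnp_piece_def primitives_def)
      then show "(term_section P :: _ \<Rightarrow>\<^sub>0 'k) \<in> term_piece (labels n)" using term_section(1)[of P] by simp
    qed
    then have k: "abs_free_binf (bas t) \<in> ?G" if "t \<in> Poly_Mapping.keys ?y" for t
      using term_pieceD[OF _ that] mset_eq_labels by blast
    have "free_eval (\<Sum>t\<in>A. binf_scal (c t) (abs_free_binf (bas t))) =
        lin_ext (bterm_eval pt) (\<Sum>t\<in>A. scal (c t) (bas t))" for A and c :: "nat bterm \<Rightarrow> 'k"
      by (induction A rule: infinite_finite_induct)
        (simp_all add: free_eval_zero free_eval_add free_eval_scal free_eval_abs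
          lin_zero[OF lin_lin_ext] lin_plus[OF lin_lin_ext] lin_scale[OF lin_lin_ext])
    then have "free_eval (\<Sum>t\<in>Poly_Mapping.keys ?y. binf_scal (lk ?y t) (abs_free_binf (bas t))) =
        lin_ext (bterm_eval pt) ?y" using bas_expand[of ?y] by simp
    also have "\<dots> = free_eval X" using term_section_lin[OF free_eval_primitive[of X]] .
    finally have "X = (\<Sum>t\<in>Poly_Mapping.keys ?y. binf_scal (lk ?y t) (abs_free_binf (bas t)))"
      by (simp add: free_eval_inject)
    also have "\<dots> \<in> fb.span ?G" by (intro fb.span_sum fb.span_scale fb.span_base k)
    finally show "X \<in> ocar B_infinity_operad n" by (simp only: car)
  qed
qed

subsection \<open>Operations\<close>

lemma bterm_eval_map: "bterm_eval g (map_bterm f t) = bterm_eval (\<lambda>i. g (f i)) t"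
proof (induction t)
  case (Br s ss t ts)
  then show ?case by (simp cong: map_cong)
qed simp

lemma bterm_eval_relabel:
  fixes x :: "'x bterm \<Rightarrow>\<^sub>0 'k::field" and f :: "'x \<Rightarrow> 'y"
  assumes f: "inj f"
  shows "lin_ext (bterm_eval pt) (lin_map (map_bterm f) x) = relabel f (lin_ext (bterm_eval pt) x)"
proof (rule lin_eqI[where x = x])
  fix t
  let ?p = "\<lambda>i. pt (f i) :: 'y wnp \<Rightarrow>\<^sub>0 'k"
  have "wnp_subst ?p (bterm_eval pt t) = relabel f (bterm_eval pt t)"
    by (rule two_as_hom_eqI[OF wnp_subst_hom relabel_hom[OF f]]) simp
  moreover have "wnp_subst ?p (bterm_eval pt t) = bterm_eval ?p t"
    by (rule wnp_subst_bterm_eval) (rule pt_primitive)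
  ultimately show "lin_ext (bterm_eval pt) (lin_map (map_bterm f) (bas t)) =
      relabel f (lin_ext (bterm_eval pt) (bas t :: _ \<Rightarrow>\<^sub>0 'k))" by (simp add: bterm_eval_map)
qed (intro lin_intros)+

lemma lin_hprod_slot: "lin (\<lambda>v. hprod (xs @ v # ys))"
  unfolding hprod_append hprod.simps by (intro lin_intros)

text \<open>Substitution is defined on monomials by multilinear extension over tuples of monomials; the value of a bracket
  is multilinear in the values of its entries.\<close>

lemma bterm_eval_subst:
  fixes \<rho> :: "'x \<Rightarrow> ('y bterm \<Rightarrow>\<^sub>0 'k::field)"
  shows "lin_ext (bterm_eval pt) (bterm_subst \<rho> t) = bterm_eval (\<lambda>i. lin_ext (bterm_eval pt) (\<rho> i)) t"
proof (induction t)
  case (Br s ss t ts)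
  let ?E = "lin_ext (bterm_eval pt) :: _ \<Rightarrow> 'y wnp \<Rightarrow>\<^sub>0 'k"
  let ?s = "map (bterm_subst \<rho>)" and ?g = "\<lambda>i. ?E (\<rho> i)"
  let ?L = "\<lambda>f u. lin_ext f (tensor_list (?s u))"
  have w: "lin_ext (\<lambda>v. hprod (map (bterm_eval pt) v)) (tensor_list vs) = hprod (map ?E vs)" for vs
  proof -
    have "lin_ext (\<lambda>v. hprod (map ?E (map bas v))) (tensor_list vs) = hprod (map ?E vs)"
    proof (rule lin_ext_tensor_list[where G = "\<lambda>vs. hprod (map ?E vs)"])
      show "lin (\<lambda>v. hprod (map ?E (xs @ v # ys)))" for xs ys
        using lin_compose[OF lin_hprod_slot[of "map ?E xs" "map ?E ys"] lin_lin_ext[of "bterm_eval pt"]]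
        by simp
    qed
    then show ?thesis by (simp add: comp_def)
  qed
  have IH: "map ?E (?s (s # ss)) = map (bterm_eval ?g) (s # ss)"
    "map ?E (?s (t # ts)) = map (bterm_eval ?g) (t # ts)" using Br by auto
  have ne: "u \<noteq> []" if "u \<in> Poly_Mapping.keys (tensor_list (?s (a # as)))" for u a as
    using subsetD[OF keys_tensor_list that] by auto
  have b: "?E (term_bracket u v) = proj_prim (hstar (hprod (map (bterm_eval pt) u)) (hprod (map (bterm_eval pt) v)))"
    if "u \<noteq> []" "v \<noteq> []" for u v
    using bterm_eval_block[of pt, OF pt_primitive, of u v] that by simp
  have "?E (bterm_subst \<rho> (Br s ss t ts)) =
      ?L (\<lambda>u. ?L (\<lambda>v. ?E (term_bracket u v)) (t # ts)) (s # ss)"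
    by (simp add: lin_ext_lin[OF lin_lin_ext])
  also have "\<dots> = ?L (\<lambda>u. ?L (\<lambda>v. proj_prim (hstar (hprod (map (bterm_eval pt) u))
      (hprod (map (bterm_eval pt) v)))) (t # ts)) (s # ss)"
    by (intro lin_ext_cong b ne)
  also have "\<dots> = ?L (\<lambda>u. proj_prim (hstar (hprod (map (bterm_eval pt) u)) (hprod (map ?E (?s (t # ts)))))) (s # ss)"
    unfolding w[symmetric]
    by (rule lin_ext_cong, rule lin_ext_lin[symmetric])
      (intro lin_compose[OF lin_proj_prim] lin_intros)
  also have "\<dots> = proj_prim (hstar (hprod (map ?E (?s (s # ss)))) (hprod (map ?E (?s (t # ts)))))"
    unfolding w[symmetric, of "?s (s # ss)"]
    by (rule lin_ext_lin[symmetric, where f = "\<lambda>x. proj_prim (hstar x _)"])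
      (intro lin_compose[OF lin_proj_prim] lin_intros)
  finally show ?case unfolding IH by simp
qed simp

text \<open>Evaluation turns substitution into monomials into evaluation at the substituted values, and this is
  substitution into the value.\<close>

lemma free_eval_opcomp:
  "free_eval (opcomp B_infinity_operad k n X p) =
     wnp_subst (\<lambda>i. shift (offset n i) (free_eval (p i))) (free_eval X)"
proof -
  let ?E = "lin_ext (bterm_eval pt)"
  let ?r = "\<lambda>i. lin_map (map_bterm (\<lambda>j. j + offset n i)) (rep_free_binf (p i))"
  have g: "?E (?r i) = shift (offset n i) (free_eval (p i))" for i
    by (simp add: bterm_eval_relabel[OF inj_shift] free_eval_def)
  have prim: "?E (?r i) \<in> primitives" for i by (rule bterm_eval_ext_primitive) (rule pt_primitive)
  have "free_eval (opcomp B_infinity_operad k n X p) = ?E (lin_ext (bterm_subst ?r) (rep_free_binf X))"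
    by (simp add: B_infinity_operad_def free_eval_abs)
  also have "\<dots> = lin_ext (bterm_eval (\<lambda>i. ?E (?r i))) (rep_free_binf X)"
    by (simp add: lin_ext_lin[OF lin_lin_ext] bterm_eval_subst)
  also have "\<dots> = lin_ext (\<lambda>t. wnp_subst (\<lambda>i. ?E (?r i)) (bterm_eval pt t)) (rep_free_binf X)"
    by (simp only: wnp_subst_bterm_eval[of "\<lambda>i. ?E (?r i)", OF prim])
  also have "\<dots> = wnp_subst (\<lambda>i. ?E (?r i)) (free_eval X)"
    by (simp add: free_eval_def lin_ext_lin[OF lin_wnp_subst])
  finally show ?thesis by (simp only: g)
qed

lemma free_eval_opact: "\<sigma> permutes {1..n} \<Longrightarrow> free_eval (opact B_infinity_operad n \<sigma> X) = relabel \<sigma> (free_eval X)"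
proof -
  assume "\<sigma> permutes {1..n}"
  from bterm_eval_relabel[OF permutes_inj[OF this], of "rep_free_binf X"] show ?thesis
    unfolding free_eval_def[of X] by (simp add: B_infinity_operad_def free_eval_abs)
qed

section \<open>Suboperads and transport of structure\<close>

lemma suboperad_is_operad:
  assumes s: "is_suboperad S P" shows "is_operad (restrict_operad P S)"
proof -
  have sub: "S n \<subseteq> ocar P n" if "n \<ge> 1" for n using s that by (simp add: is_suboperad_def)
  have lo: "linear_on f g A h" if "linear_on f g B h" "A \<subseteq> B" for f g A B h
    using that unfolding linear_on_def by blast
  have c: "composable (ocar P) k n q p" if "composable S k n q p" for k n q p
    using that sub unfolding composable_def by blast
  have r: "ocar (restrict_operad P S) = S" "oscal (restrict_operad P S) = oscal P"
    "ounit (restrict_operad P S) = ounit P" "opcomp (restrict_operad P S) = opcomp P"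
    "opact (restrict_operad P S) = opact P"
    by (simp_all add: restrict_operad_def)
  from s have P: "operad_spaces P" "operad_composition P" "operad_assoc P" "operad_unit P"
    "operad_action P" "operad_equivariant P" by (simp_all add: is_suboperad_def is_operad_def)
  have cl: "opcomp P k n q p \<in> S (\<Sum>i=1..k. n i)" if "composable S k n q p" for k n q p
    using s that by (simp add: is_suboperad_def)
  have "operad_spaces (restrict_operad P S)"
    using s P(1) by (simp add: operad_spaces_def is_suboperad_def r)
  moreover have "operad_composition (restrict_operad P S)"
    unfolding operad_composition_def r
  proof (intro allI impI)
    fix k n q p assume co: "composable S k n q p"
    note o = P(2)[unfolded operad_composition_def, rule_format, OF c[OF co]]
    have k: "k \<ge> 1" "\<And>i. i \<in> {1..k} \<Longrightarrow> n i \<ge> 1" using co by (auto simp: composable_def)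
    show "opcomp P k n q p \<in> S (\<Sum>i=1..k. n i) \<and>
        linear_on (oscal P) (oscal P) (S k) (\<lambda>x. opcomp P k n x p) \<and>
        (\<forall>i\<in>{1..k}. linear_on (oscal P) (oscal P) (S (n i)) (\<lambda>x. opcomp P k n q (p(i := x)))) \<and>
        (\<forall>n' p'. (\<forall>i\<in>{1..k}. n' i = n i \<and> p' i = p i) \<longrightarrow> opcomp P k n' q p' = opcomp P k n q p)"
      using cl[OF co] o k sub lo by meson
  qed
  moreover have "operad_assoc (restrict_operad P S)"
    unfolding operad_assoc_def r
  proof (intro allI impI, elim conjE)
    fix k n q p m t
    assume co: "composable S k n q p" and t: "\<forall>l\<in>{1..\<Sum>i=1..k. n i}. 1 \<le> m l \<and> t l \<in> S (m l)"
    then have "\<forall>l\<in>{1..\<Sum>i=1..k. n i}. 1 \<le> m l \<and> t l \<in> ocar P (m l)" using sub by blast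
    then show "opcomp P (\<Sum>i=1..k. n i) m (opcomp P k n q p) t =
        opcomp P k (\<lambda>i. \<Sum>j=1..n i. m (offset n i + j)) q
          (\<lambda>i. opcomp P (n i) (\<lambda>j. m (offset n i + j)) (p i) (\<lambda>j. t (offset n i + j)))"
      using P(3)[unfolded operad_assoc_def, rule_format] c[OF co] by blast
  qed
  moreover have "operad_unit (restrict_operad P S)"
    using P(4) s sub unfolding operad_unit_def r is_suboperad_def by blast
  moreover have "operad_action (restrict_operad P S)"
    unfolding operad_action_def r
  proof (intro allI impI conjI ballI)
    fix n :: nat and x assume n: "n \<ge> 1" and x: "x \<in> S n"
    then show "opact P n id x = x" using P(5) sub unfolding operad_action_def by blast
  next
    fix n :: nat and \<sigma> assume n: "n \<ge> 1" and \<sigma>: "\<sigma> permutes {1..n}"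
    note a = P(5)[unfolded operad_action_def, rule_format, OF n, THEN conjunct2, rule_format, OF \<sigma>]
    show "opact P n \<sigma> ` S n \<subseteq> S n" using s n \<sigma> by (simp add: is_suboperad_def)
    show "linear_on (oscal P) (oscal P) (S n) (opact P n \<sigma>)" using a lo sub[OF n] by blast
    fix \<tau> x assume "\<tau> permutes {1..n}" "x \<in> S n"
    then show "opact P n (\<sigma> \<circ> \<tau>) x = opact P n \<sigma> (opact P n \<tau> x)" using a sub[OF n] by blast
  qed
  moreover have "operad_equivariant (restrict_operad P S)"
    using P(6) c unfolding operad_equivariant_def r by blast
  ultimately show ?thesis by (simp add: is_operad_def)
qed

text \<open>Each axiom is an equation or a membership, and \<open>\<theta>\<close> reflects both. The associativity axiom requires some care:
  the inner compositions correspond to each other at the indices \<open>1, \<dots>, k\<close>, and the outer composition depends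
  only on these.\<close>

lemma operad_pullback:
  fixes P :: "('k::field, 'a::ab_group_add) operad" and Q :: "('k, 'b::ab_group_add) operad"
  assumes P: "is_operad P" and V: "vector_space (oscal Q)"
    and inj: "\<And>X Y. \<theta> X = \<theta> Y \<longleftrightarrow> X = Y"
    and add: "\<And>X Y. \<theta> (X + Y) = \<theta> X + \<theta> Y" and scal: "\<And>c X. \<theta> (oscal Q c X) = oscal P c (\<theta> X)"
    and car: "\<And>n X. X \<in> ocar Q n \<longleftrightarrow> \<theta> X \<in> ocar P n"
    and unit: "\<theta> (ounit Q) = ounit P"
    and comp: "\<And>k n q p. \<theta> q \<in> ocar P k \<Longrightarrow> \<theta> (opcomp Q k n q p) = opcomp P k n (\<theta> q) (\<lambda>i. \<theta> (p i))"
    and act: "\<And>n \<sigma> X. \<sigma> permutes {1..n} \<Longrightarrow> \<theta> (opact Q n \<sigma> X) = opact P n \<sigma> (\<theta> X)"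
  shows "is_operad Q"
proof -
  from P have A: "operad_spaces P" "operad_composition P" "operad_assoc P" "operad_unit P"
    "operad_action P" "operad_equivariant P" by (simp_all add: is_operad_def)
  interpret Q: vector_space "oscal Q" by (rule V)
  interpret P: vector_space "oscal P" using A(1) by (simp add: operad_spaces_def)
  have z: "\<theta> 0 = 0" using add[of 0 0] by simp
  have c: "composable (ocar P) k n (\<theta> q) (\<lambda>i. \<theta> (p i))" "\<theta> q \<in> ocar P k"
    if "composable (ocar Q) k n q p" for k n q p
    using that by (auto simp: composable_def car)
  note o = A(2)[unfolded operad_composition_def, rule_format, OF c(1)]
  have cg: "opcomp P k n' q p' = opcomp P k n q p"
    if "composable (ocar P) k n q p" "\<And>i. i \<in> {1..k} \<Longrightarrow> n' i = n i \<and> p' i = p i" for k n q p n' p'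
  proof -
    have "\<forall>i\<in>{1..k}. n' i = n i \<and> p' i = p i" using that(2) by blast
    then show ?thesis
      using A(2)[unfolded operad_composition_def, rule_format, OF that(1), THEN conjunct2, THEN conjunct2,
          THEN conjunct2] by blast
  qed
  have "operad_spaces Q"
    unfolding operad_spaces_def
  proof (intro conjI V allI impI)
    fix n :: nat assume "1 \<le> n"
    then have s: "P.subspace (ocar P n)" using A(1) by (simp add: operad_spaces_def)
    show "Q.subspace (ocar Q n)"
      by (rule Q.subspaceI) (simp_all add: car z add scal P.subspace_0[OF s] P.subspace_add[OF s] P.subspace_scale[OF s])
  qed
  moreover have "operad_composition Q"
    unfolding operad_composition_def
  proof (intro allI impI conjI ballI)
    fix k n q p assume co: "composable (ocar Q) k n q p"
    note o1 = o[OF co, THEN conjunct1] and o2 = o[OF co, THEN conjunct2, THEN conjunct1]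
      and o3 = o[OF co, THEN conjunct2, THEN conjunct2, THEN conjunct1, rule_format]
      and o4 = o[OF co, THEN conjunct2, THEN conjunct2, THEN conjunct2, rule_format]
    note cp = comp[OF c(2)[OF co]]
    show "opcomp Q k n q p \<in> ocar Q (\<Sum>i=1..k. n i)" using o1 by (simp only: car cp)
    have kk: "\<theta> x + \<theta> y \<in> ocar P k \<and> oscal P d (\<theta> x) \<in> ocar P k" if "\<theta> x \<in> ocar P k" "\<theta> y \<in> ocar P k" for x y d
    proof -
      have "P.subspace (ocar P k)" using A(1) co by (simp add: operad_spaces_def composable_def)
      then show ?thesis using that P.subspace_add P.subspace_scale by blast
    qed
    show "linear_on (oscal Q) (oscal Q) (ocar Q k) (\<lambda>x. opcomp Q k n x p)"
      using o2 kk unfolding linear_on_def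
      by (simp add: car inj[symmetric] add scal comp)
    show "linear_on (oscal Q) (oscal Q) (ocar Q (n i)) (\<lambda>x. opcomp Q k n q (p(i := x)))" if "i \<in> {1..k}" for i
    proof -
      have u: "(\<lambda>j. \<theta> ((p(i := x)) j)) = (\<lambda>j. \<theta> (p j))(i := \<theta> x)" for x by auto
      have l: "linear_on (oscal P) (oscal P) (ocar P (n i)) (\<lambda>x. opcomp P k n (\<theta> q) ((\<lambda>j. \<theta> (p j))(i := x)))"
        using o3[OF that] .
      show ?thesis using l unfolding linear_on_def by (simp add: car inj[symmetric] add scal cp u del: fun_upd_apply)
    qed
    show "opcomp Q k n' q p' = opcomp Q k n q p" if "\<forall>i\<in>{1..k}. n' i = n i \<and> p' i = p i" for n' p'
      unfolding inj[symmetric] cp by (rule o4) (use that in simp)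
  qed
  moreover have "operad_assoc Q"
    unfolding operad_assoc_def
  proof (intro allI impI, elim conjE)
    fix k n q p m t
    assume co: "composable (ocar Q) k n q p" and t: "\<forall>l\<in>{1..\<Sum>i=1..k. n i}. 1 \<le> m l \<and> t l \<in> ocar Q (m l)"
    have "\<forall>l\<in>{1..\<Sum>i=1..k. n i}. 1 \<le> m l \<and> \<theta> (t l) \<in> ocar P (m l)" using t by (simp add: car)
    note as = A(3)[unfolded operad_assoc_def, rule_format, OF conjI[OF c(1)[OF co] this]]
    note cp = comp[OF c(2)[OF co]]
    have "opcomp P k n (\<theta> q) (\<lambda>i. \<theta> (p i)) \<in> ocar P (\<Sum>i=1..k. n i)" using o[OF co] by blast
    then have 1: "\<theta> (opcomp Q (\<Sum>i=1..k. n i) m (opcomp Q k n q p) t) =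
        opcomp P (\<Sum>i=1..k. n i) m (opcomp P k n (\<theta> q) (\<lambda>i. \<theta> (p i))) (\<lambda>i. \<theta> (t i))"
      by (simp add: comp cp)
    let ?N = "\<lambda>i. \<Sum>j=1..n i. m (offset n i + j)"
    have 2: "opcomp P k ?N (\<theta> q)
          (\<lambda>i. \<theta> (opcomp Q (n i) (\<lambda>j. m (offset n i + j)) (p i) (\<lambda>j. t (offset n i + j)))) =
        opcomp P k ?N (\<theta> q)
          (\<lambda>i. opcomp P (n i) (\<lambda>j. m (offset n i + j)) (\<theta> (p i)) (\<lambda>j. \<theta> (t (offset n i + j))))"
      (is "opcomp P k ?N _ ?f = opcomp P k ?N _ ?h")
    proof -
      have pi: "n i \<ge> 1" "\<theta> (p i) \<in> ocar P (n i)" if "i \<in> {1..k}" for i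
        using co that by (auto simp: composable_def car)
      have e: "?f i = ?h i" if "i \<in> {1..k}" for i by (rule comp[OF pi(2)[OF that]])
      have ml: "m (offset n i + j) \<ge> 1 \<and> \<theta> (t (offset n i + j)) \<in> ocar P (m (offset n i + j))"
        if "i \<in> {1..k}" "j \<in> {1..n i}" for i j
      proof -
        have "offset n i + n i \<le> (\<Sum>l\<in>{1..k}. n l)"
        proof -
          have "offset n i + n i = (\<Sum>l\<in>insert i {1..<i}. n l)" by (simp add: offset_def)
          also have "\<dots> \<le> (\<Sum>l\<in>{1..k}. n l)" using that(1) by (intro sum_mono2) auto
          finally show ?thesis .
        qed
        then have "offset n i + j \<in> {1..\<Sum>i=1..k. n i}" using that by auto
        then show ?thesis using t car by blast
      qed
      have "composable (ocar P) (n i) (\<lambda>j. m (offset n i + j)) (\<theta> (p i)) (\<lambda>j. \<theta> (t (offset n i + j)))"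
        if "i \<in> {1..k}" for i using pi[OF that] ml[OF that] by (simp add: composable_def)
      then have h: "?h i \<in> ocar P (?N i)" if "i \<in> {1..k}" for i
        using A(2)[unfolded operad_composition_def] that by blast
      have N: "?N i \<ge> 1" if "i \<in> {1..k}" for i
      proof -
        have "m (offset n i + 1) \<le> ?N i" using pi(1)[OF that] by (intro member_le_sum) auto
        then show ?thesis using ml[OF that, of 1] pi(1)[OF that] by auto
      qed
      have "composable (ocar P) k ?N (\<theta> q) ?h"
        using h N c(1)[OF co] by (auto simp: composable_def)
      then show ?thesis by (rule cg) (use e in blast)
    qed
    show "opcomp Q (\<Sum>i=1..k. n i) m (opcomp Q k n q p) t =
        opcomp Q k ?N q (\<lambda>i. opcomp Q (n i) (\<lambda>j. m (offset n i + j)) (p i) (\<lambda>j. t (offset n i + j)))"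
      by (simp only: inj[symmetric] 1 cp 2 as)
  qed
  moreover have "operad_unit Q"
    unfolding operad_unit_def
  proof (intro conjI allI impI)
    have u: "ounit P \<in> ocar P 1" using A(4) by (simp add: operad_unit_def)
    then show "ounit Q \<in> ocar Q 1" by (simp add: car unit)
    fix n :: "nat \<Rightarrow> nat" and p :: "nat \<Rightarrow> 'b" assume "n 1 \<ge> 1 \<and> p 1 \<in> ocar Q (n 1)"
    then have "opcomp P 1 n (ounit P) (\<lambda>i. \<theta> (p i)) = \<theta> (p 1)"
      using A(4) by (simp add: operad_unit_def car)
    then show "opcomp Q 1 n (ounit Q) p = p 1" using u by (simp add: inj[symmetric] comp unit)
  next
    fix k q assume k: "k \<ge> 1 \<and> q \<in> ocar Q k"
    then have "opcomp P k (\<lambda>_. 1) (\<theta> q) (\<lambda>_. ounit P) = \<theta> q"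
      using A(4) by (simp add: operad_unit_def car)
    then show "opcomp Q k (\<lambda>_. 1) q (\<lambda>_. ounit Q) = q" using k by (simp add: inj[symmetric] comp unit car)
  qed
  moreover have "operad_action Q"
    unfolding operad_action_def
  proof (intro allI impI conjI ballI)
    fix n :: nat and x assume "1 \<le> n" "x \<in> ocar Q n"
    then show "opact Q n id x = x"
      using A(5) by (simp add: inj[symmetric] act permutes_id operad_action_def car)
  next
    fix n :: nat and \<sigma> assume n: "1 \<le> n" and \<sigma>: "\<sigma> permutes {1..n}"
    note a = A(5)[unfolded operad_action_def, rule_format, OF n, THEN conjunct2, rule_format, OF \<sigma>]
    show "opact Q n \<sigma> ` ocar Q n \<subseteq> ocar Q n" using a by (auto simp: car act[OF \<sigma>] image_subset_iff)
    have "linear_on (oscal P) (oscal P) (ocar P n) (opact P n \<sigma>)" using a by blast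
    then show "linear_on (oscal Q) (oscal Q) (ocar Q n) (opact Q n \<sigma>)"
      unfolding linear_on_def by (simp add: car inj[symmetric] act[OF \<sigma>] add scal)
    fix \<tau> x assume \<tau>: "\<tau> permutes {1..n}" and "x \<in> ocar Q n"
    then show "opact Q n (\<sigma> \<circ> \<tau>) x = opact Q n \<sigma> (opact Q n \<tau> x)"
      using a by (simp add: car inj[symmetric] act[OF \<sigma>] act[OF \<tau>] act[OF permutes_compose[OF \<tau> \<sigma>]])
  qed
  moreover have "operad_equivariant Q"
    unfolding operad_equivariant_def
  proof (intro allI impI conjI; elim conjE)
    fix k n q p \<beta> \<sigma>
    assume co: "composable (ocar Q) k n q p" and \<beta>: "\<beta> permutes {1..\<Sum>i=1..k. n i}"
      and \<sigma>: "\<sigma> permutes {1..k}"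
      and b: "\<forall>i\<in>{1..k}. \<forall>j\<in>{1..n (\<sigma> i)}. \<beta> (offset (\<lambda>l. n (\<sigma> l)) i + j) = offset n (\<sigma> i) + j"
    have k: "k \<ge> 1" using co by (simp add: composable_def)
    have "opact P k \<sigma> (\<theta> q) \<in> ocar P k"
      using A(5) k \<sigma> c(2)[OF co] unfolding operad_action_def by blast
    moreover have "opcomp P k n (opact P k \<sigma> (\<theta> q)) (\<lambda>i. \<theta> (p i)) =
        opact P (\<Sum>i=1..k. n i) \<beta> (opcomp P k (\<lambda>i. n (\<sigma> i)) (\<theta> q) (\<lambda>i. \<theta> (p (\<sigma> i))))"
      using A(6) c(1)[OF co] \<beta> \<sigma> b unfolding operad_equivariant_def by blast
    ultimately show "opcomp Q k n (opact Q k \<sigma> q) p =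
        opact Q (\<Sum>i=1..k. n i) \<beta> (opcomp Q k (\<lambda>i. n (\<sigma> i)) q (\<lambda>i. p (\<sigma> i)))"
      by (simp only: inj[symmetric] act[OF \<beta>] act[OF \<sigma>] comp c(2)[OF co])
  next
    fix k n q p \<beta> \<tau>
    assume co: "composable (ocar Q) k n q p" and \<beta>: "\<beta> permutes {1..\<Sum>i=1..k. n i}"
      and \<tau>: "\<forall>i\<in>{1..k}. \<tau> i permutes {1..n i}"
      and b: "\<forall>i\<in>{1..k}. \<forall>j\<in>{1..n i}. \<beta> (offset n i + j) = offset n i + \<tau> i j"
    have eq: "opcomp P k n (\<theta> q) (\<lambda>i. opact P (n i) (\<tau> i) (\<theta> (p i))) =
        opact P (\<Sum>i=1..k. n i) \<beta> (opcomp P k n (\<theta> q) (\<lambda>i. \<theta> (p i)))"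
      using A(6) c(1)[OF co] \<beta> \<tau> b unfolding operad_equivariant_def by blast
    have "composable (ocar P) k n (\<theta> q) (\<lambda>i. opact P (n i) (\<tau> i) (\<theta> (p i)))"
      using c(1)[OF co] \<tau> A(5) unfolding composable_def operad_action_def by blast
    then have "opcomp P k n (\<theta> q) (\<lambda>i. \<theta> (opact Q (n i) (\<tau> i) (p i))) =
        opcomp P k n (\<theta> q) (\<lambda>i. opact P (n i) (\<tau> i) (\<theta> (p i)))"
      by (rule cg) (use \<tau> act in blast)
    then show "opcomp Q k n q (\<lambda>i. opact Q (n i) (\<tau> i) (p i)) =
        opact Q (\<Sum>i=1..k. n i) \<beta> (opcomp Q k n q p)"
      by (simp only: inj[symmetric] act[OF \<beta>] comp c(2)[OF co] eq)
  qed
  ultimately show ?thesis by (simp add: is_operad_def)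
qed

section \<open>The operad of connected WN posets\<close>

text \<open>A primitive element is the value of a combination of bracket monomials, and substitution of primitive
  elements preserves brackets. Without the brackets this is not visible, since substitution does not respect the
  vertical concatenation.\<close>

lemma wnp_subst_primitive:
  assumes "x \<in> primitives" "\<And>i. g i \<in> primitives"
  shows "wnp_subst g x \<in> primitives"
proof -
  have "wnp_subst g x = wnp_subst g (lin_ext (bterm_eval pt) (lin_ext term_section x))"
    by (simp only: term_section_lin[OF assms(1)])
  also have "\<dots> = lin_ext (bterm_eval g) (lin_ext term_section x)"
    by (simp add: lin_ext_lin[OF lin_wnp_subst] wnp_subst_bterm_eval[of g, OF assms(2)])
  also have "\<dots> \<in> primitives" by (rule bterm_eval_ext_primitive) (rule assms(2))
  finally show ?thesis .
qed

lemma WNP_h_suboperad: "is_suboperad WNP_h (WNP_operad :: ('k::field, nat wnp \<Rightarrow>\<^sub>0 'k) operad)"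
proof -
  let ?P = "WNP_operad :: ('k, nat wnp \<Rightarrow>\<^sub>0 'k) operad"
  have "opcomp ?P k n q p \<in> WNP_h (\<Sum>i=1..k. n i)" if co: "composable WNP_h k n q p" for k n q p
  proof -
    have q: "q \<in> wnp_piece (labels k)" "q \<in> primitives"
      and p: "\<And>i. i \<in> {1..k} \<Longrightarrow> p i \<in> primitives"
      and "composable (ocar ?P) k n q p"
      using co by (auto simp: composable_def WNP_h_eq)
    then have "opcomp ?P k n q p \<in> ocar ?P (\<Sum>i=1..k. n i)"
      using WNP_operad_is_operad unfolding is_operad_def operad_composition_def by blast
    moreover have "opcomp ?P k n q p \<in> primitives"
    proof -
      \<comment> \<open>Outside of \<open>{1..k}\<close> the family \<open>p\<close> is arbitrary and may fail to be primitive.\<close>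
      let ?g = "\<lambda>i. if i \<in> {1..k} then shift (offset n i) (p i) else 0"
      have "opcomp ?P k n q p = wnp_subst (\<lambda>i. shift (offset n i) (p i)) q" by (rule opcomp_WNP[OF q(1)])
      also have "\<dots> = wnp_subst ?g q" by (rule wnp_subst_cong[OF q(1)]) simp
      also have "\<dots> \<in> primitives"
        by (rule wnp_subst_primitive[OF q(2)])
          (use p relabel_primitives pm.subspace_0[OF subspace_primitives] in auto)
      finally show ?thesis .
    qed
    ultimately show ?thesis by (simp add: WNP_h_eq)
  qed
  moreover have "opact ?P n \<sigma> ` WNP_h n \<subseteq> WNP_h n" if "\<sigma> permutes {1..n}" for n \<sigma>
    unfolding WNP_operad_simps WNP_h_eq
    using relabel_permutes_piece[OF that] relabel_primitives by blast
  moreover have "pm.subspace (WNP_h n :: (nat wnp \<Rightarrow>\<^sub>0 'k) set)" for n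
    unfolding WNP_h_def by (rule pm.subspace_span)
  moreover have "ounit ?P \<in> WNP_h 1" by (simp add: WNP_h_eq sum_irreducible_point)
  ultimately show ?thesis
    using WNP_operad_is_operad by (auto simp: is_suboperad_def WNP_h_eq)
qed

text \<open>Evaluation of bracket monomials identifies the multilinear part of the free \<open>B\<^sub>\<infinity>\<close> algebra with the span of the
  connected indexed posets and turns its operations into those of WN posets.\<close>

theorem corollary44:
  shows "is_suboperad WNP_h (WNP_operad :: ('k::field, nat wnp \<Rightarrow>\<^sub>0 'k) operad) \<and>
    operads_isomorphic
      (restrict_operad (WNP_operad :: ('k, nat wnp \<Rightarrow>\<^sub>0 'k) operad) WNP_h)
      (B_infinity_operad :: ('k, (nat, 'k) free_binf) operad)"
proof (intro conjI)
  let ?W = "WNP_operad :: ('k, nat wnp \<Rightarrow>\<^sub>0 'k) operad"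
  let ?P = "restrict_operad ?W WNP_h" and ?Q = "B_infinity_operad :: ('k, (nat, 'k) free_binf) operad"
  show s: "is_suboperad WNP_h ?W" by (rule WNP_h_suboperad)
  have r: "ocar ?P = WNP_h" "oscal ?P = scal" "ounit ?P = pt 1" "opcomp ?P = opcomp ?W"
    "opact ?P n \<sigma> = relabel \<sigma>" for n \<sigma>
    by (simp_all add: restrict_operad_def)
  have P: "is_operad ?P" by (rule suboperad_is_operad[OF s])
  have comp: "free_eval (opcomp ?Q k n q p) = opcomp ?W k n (free_eval q) (\<lambda>i. free_eval (p i))"
    if "free_eval q \<in> WNP_h k" for k n q p
    using that by (simp add: free_eval_opcomp opcomp_WNP WNP_h_eq)
  have Q: "is_operad ?Q"
    by (rule operad_pullback[OF P, where \<theta> = free_eval])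
      (simp_all add: vector_space_binf_scal free_eval_inject free_eval_add free_eval_scal
        ocar_B_infinity comp free_eval_opact free_eval_abs r)
  have prim: "x \<in> primitives" if "x \<in> WNP_h n" for x :: "nat wnp \<Rightarrow>\<^sub>0 'k" and n
    using that by (simp add: WNP_h_eq)
  have ev: "free_eval (free_section x) = x" if "x \<in> WNP_h n" for x :: "nat wnp \<Rightarrow>\<^sub>0 'k" and n
    by (rule free_eval_section[OF prim[OF that]])
  have sub: "pm.subspace (WNP_h n :: (nat wnp \<Rightarrow>\<^sub>0 'k) set)" for n
    unfolding WNP_h_def by (rule pm.subspace_span)
  have "operad_isomorphism (\<lambda>n. free_section) ?P ?Q"
    unfolding operad_isomorphism_def r
  proof (intro conjI allI impI ballI)
    fix n :: nat assume "n \<ge> 1"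
    show "bij_betw free_section (WNP_h n) (ocar ?Q n)"
      by (rule bij_betw_byWitness[where f' = free_eval])
        (auto simp: ev free_section_eval ocar_B_infinity)
    show "linear_on scal (oscal ?Q) (WNP_h n) free_section"
      unfolding linear_on_def
      by (simp add: free_eval_inject[symmetric] free_eval_add free_eval_scal ev
          ev[OF pm.subspace_add[OF sub]] ev[OF pm.subspace_scale[OF sub]])
    fix \<sigma> and x :: "nat wnp \<Rightarrow>\<^sub>0 'k" assume \<sigma>: "\<sigma> permutes {1..n}" and x: "x \<in> WNP_h n"
    have "relabel \<sigma> x \<in> WNP_h n"
      using relabel_permutes_piece[OF \<sigma>] relabel_primitives x unfolding WNP_h_eq by blast
    then show "free_section (relabel \<sigma> x) = opact ?Q n \<sigma> (free_section x)"
      by (simp add: free_eval_inject[symmetric] free_eval_opact[OF \<sigma>] ev[OF x] ev)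
  next
    show "free_section (pt 1) = ounit ?Q"
      by (simp add: free_eval_inject[symmetric] free_eval_abs free_eval_section sum_irreducible_point)
  next
    fix k n and q :: "nat wnp \<Rightarrow>\<^sub>0 'k" and p
    assume co: "composable WNP_h k n q p"
    then have q: "q \<in> WNP_h k" and p: "\<And>i. i \<in> {1..k} \<Longrightarrow> p i \<in> WNP_h (n i)" by (auto simp: composable_def)
    have c: "opcomp ?W k n q p \<in> WNP_h (\<Sum>i=1..k. n i)"
      using s co by (simp add: is_suboperad_def)
    have "operad_composition ?P" using P by (simp only: is_operad_def)
    note cong = this[unfolded operad_composition_def r, rule_format, OF co,
      THEN conjunct2, THEN conjunct2, THEN conjunct2]
    have "opcomp ?W k n q (\<lambda>i. free_eval (free_section (p i))) = opcomp ?W k n q p"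
      by (rule cong[rule_format]) (simp add: ev[OF p])
    then show "free_section (opcomp ?W k n q p) = opcomp ?Q k n (free_section q) (\<lambda>i. free_section (p i))"
      by (simp add: free_eval_inject[symmetric] comp ev[OF q] q ev[OF c])
  qed
  then show "operads_isomorphic ?P ?Q" using P Q unfolding operads_isomorphic_def by blast
qed

end
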